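(* Let $q$ be a power of a prime and let $K/\mathbb{F}_q(T)$ and $L/\mathbb{F}_q(T)$ be finite separable extensions (inside a fixed algebraic closure of $\mathbb{F}_q(T)$) which are arithmetically equivalent over $\mathbb{F}_q(T)$. Then: - $K$ and $L$ have the same Galois closure over $\mathbb{F}_q(T)$, the same Galois core over $\mathbb{F}_q(T)$ and the same field of constants. - If $K/\mathbb{F}_q(T)$ is Galois, then $K=L$. - If $[K:\mathbb{F}_q(T)]\leq 6$, then $K$ and $L$ are isomorphic over $\mathbb{F}_q(T)$.
   Context: For a finite separable extension $K$ of $\mathbb{F}_q(T)$, let $\mathcal{O}_K$ be the integral closure of $\mathbb{F}_q[T]$ in $K$; the splitting type $f_K(\mathfrak{p})$ of a non-zero prime $\mathfrak{p}$ of $\mathbb{F}_q[T]$ is the non-decreasing tuple of inertia degrees over $\mathfrak{p}$ of the primes of $\mathcal{O}_K$ above $\mathfrak{p}$. $K$ and $L$ are arithmetically equivalent over $\mathbb{F}_q(T)$ if $f_K(\mathfrak{p})=f_L(\mathfrak{p})$ for all non-zero primes $\mathfrak{p}$ of $\mathbb{F}_q[T]$ outside a set of Dirichlet density zero. The Galois core of $K$ over $\mathbb{F}_q(T)$ is the biggest Galois extension of $\mathbb{F}_q(T)$ contained in $K$. *)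

theory Defs
  imports
    "HOL-Algebra.Algebra"
    "HOL-Number_Theory.Number_Theory"
    "HOL-Analysis.Infinite_Sum"
begin

text \<open>
  All fields are subfields, given by their carrier sets, of one ambient field \<open>R\<close>, which plays
  the role of the fixed algebraic closure. The notions of separability and normality below
  inspect the roots of minimal polynomials in \<open>R\<close>; they are the usual ones when \<open>R\<close> is an
  algebraic closure of the base field \<open>F\<close>, so that these polynomials split in \<open>R\<close>.
\<close>

subsection \<open>Separable and Galois extensions\<close>

definition (in ring) separable_over :: "'a set \<Rightarrow> 'a \<Rightarrow> bool"
  where "separable_over F x \<longleftrightarrow>
    (algebraic over F) x \<and> (\<forall>y \<in> carrier R. alg_mult (Irr F x) y \<le> 1)"

definition (in ring) finite_separable_extension :: "'a set \<Rightarrow> 'a set \<Rightarrow> bool"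
  where "finite_separable_extension F K \<longleftrightarrow>
    subfield K R \<and> F \<subseteq> K \<and> (finite_dimension over F) K \<and> (\<forall>x \<in> K. separable_over F x)"

definition (in ring) galois_extension :: "'a set \<Rightarrow> 'a set \<Rightarrow> bool"
  where "galois_extension F K \<longleftrightarrow>
    subfield K R \<and> F \<subseteq> K \<and>
    (\<forall>x \<in> K. separable_over F x) \<and>
    (\<forall>x \<in> K. \<forall>y. is_root (Irr F x) y \<longrightarrow> y \<in> K)"

definition (in ring) galois_closure :: "'a set \<Rightarrow> 'a set \<Rightarrow> 'a set"
  where "galois_closure F K = (LEAST M. galois_extension F M \<and> K \<subseteq> M)"

definition (in ring) galois_core :: "'a set \<Rightarrow> 'a set \<Rightarrow> 'a set"
  where "galois_core F K = (GREATEST M. galois_extension F M \<and> M \<subseteq> K)"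

definition (in ring) field_of_constants :: "'a set \<Rightarrow> 'a set \<Rightarrow> 'a set"
  where "field_of_constants k K = {x \<in> K. (algebraic over k) x}"

definition (in ring) isomorphic_over :: "'a set \<Rightarrow> 'a set \<Rightarrow> 'a set \<Rightarrow> bool"
  where "isomorphic_over F K L \<longleftrightarrow>
    (\<exists>\<phi> \<in> ring_iso (R\<lparr>carrier := K\<rparr>) (R\<lparr>carrier := L\<rparr>). \<forall>x \<in> F. \<phi> x = x)"


subsection \<open>Primes and splitting types\<close>

text \<open>The list \<open>[]\<close> is the zero polynomial, and its leading coefficient is unspecified.\<close>

definition (in ring) integral_closure :: "'a set \<Rightarrow> 'a set \<Rightarrow> 'a set"
  where "integral_closure A K =
    {x \<in> K. \<exists>p \<in> carrier (A[X]). p \<noteq> [] \<and> lead_coeff p = \<one> \<and> eval p x = \<zero>}"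

definition (in ring) nonzero_primes :: "'a set \<Rightarrow> 'a set set"
  where "nonzero_primes A = {p. primeideal p (R\<lparr>carrier := A\<rparr>) \<and> p \<noteq> {\<zero>}}"

definition (in ring) primes_above :: "'a set \<Rightarrow> 'a set \<Rightarrow> 'a set \<Rightarrow> 'a set set"
  where "primes_above A K p =
    {P. primeideal P (R\<lparr>carrier := integral_closure A K\<rparr>) \<and> P \<inter> A = p}"

text \<open>
  For a prime \<open>P\<close> of \<open>\<O>\<close>, the integral closure of \<open>A\<close> in \<open>K\<close>, the residue ring of \<open>A\<close> at
  \<open>P \<inter> A\<close> is identified with its isomorphic image in \<open>\<O> Quot P\<close>, namely the set of classes
  of elements of \<open>A\<close>.
\<close>

definition (in ring) inertia_degree :: "'a set \<Rightarrow> 'a set \<Rightarrow> 'a set \<Rightarrow> nat"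
  where "inertia_degree A K P =
    (let \<O> = R\<lparr>carrier := integral_closure A K\<rparr>
     in ring.dim (\<O> Quot P) ((\<lambda>a. P +>\<^bsub>\<O>\<^esub> a) ` A) (carrier (\<O> Quot P)))"

definition (in ring) splitting_type :: "'a set \<Rightarrow> 'a set \<Rightarrow> 'a set \<Rightarrow> nat list"
  where "splitting_type A K p =
    sorted_list_of_multiset (image_mset (inertia_degree A K) (mset_set (primes_above A K p)))"


subsection \<open>Dirichlet density and arithmetic equivalence\<close>

definition (in ring) prime_norm :: "'a set \<Rightarrow> 'a set \<Rightarrow> nat"
  where "prime_norm A p = card (carrier (R\<lparr>carrier := A\<rparr> Quot p))"

definition (in ring) has_dirichlet_density :: "'a set \<Rightarrow> 'a set set \<Rightarrow> real \<Rightarrow> bool"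
  where "has_dirichlet_density A S d \<longleftrightarrow>
    ((\<lambda>s. (\<Sum>\<^sub>\<infinity>p\<in>S. real (prime_norm A p) powr (-s)) /
          (\<Sum>\<^sub>\<infinity>p\<in>nonzero_primes A. real (prime_norm A p) powr (-s))) \<longlongrightarrow> d) (at_right 1)"

definition (in ring) arithmetically_equivalent :: "'a set \<Rightarrow> 'a set \<Rightarrow> 'a set \<Rightarrow> bool"
  where "arithmetically_equivalent A K L \<longleftrightarrow>
    (\<exists>S \<subseteq> nonzero_primes A. has_dirichlet_density A S 0 \<and>
       (\<forall>p \<in> nonzero_primes A - S. splitting_type A K p = splitting_type A L p))"

end

(* For K = F(g) with g integral and almost every prime p of A = Fq[T], the number of entries 1 in
  the splitting type of p is the number of conjugates of g whose residue at a prime P above p, in a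
  normal extension M, lies in A/p. The product of two such counts, for e and a in M, is the sum of
  the counts for representatives of the conjugacy classes among all e' + c a', where e' and a' run
  through the conjugates of e and a. A Mertens-type estimate for the orders A[g], obtained by
  counting elements of bounded size in ideals, shows that a single count has average 1 in the sense
  of Dirichlet density. So the product has as average the number of orbits of the stabilizer of e on
  the conjugates of a, and arithmetic equivalence of F(a) and F(b) makes this number the same for a
  and b, for every e. Suitable choices of e compare Galois closures and cores; in degree at most 6,
  comparing the orbits of pointwise stabilizers on the two sets of conjugates produces a point
  stabilizer common to both. Neither Chebotarev's theorem nor ideal factorization is needed. *)
theory Submission
 imports Defs "HOL-Analysis.Summation_Tests"
begin

text \<open>The orders A[g] need not be maximal, so ideals need not be products of primes. Size
  replaces factorization: an element whose coordinates have degree below m generates an ideal of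
  index at most q^(n(m + c0)), where \<open>c0\<close> is the loss in a product, and by the Chinese
  remainder theorem this bounds the degrees of the primes containing it. The lower half of the
  Mertens estimate needs elements for which this bound is nearly attained. They are taken of the
  form 1 + Q(T^e + y), hence prime to Q, which excludes the bad primes and all primes of small
  degree; most of these elements lie only in unramified primes of degree one, and only once. What
  excludes ramification is not a discriminant but Frobenius: the powers of g^p are again a basis of
  F(g), so A[g]/p is reduced for almost all p. Integral closures enter at the end, where they agree
  with A[g] away from finitely many primes. The limit 6 on the degree belongs to the group theory:
  the points and lines of the projective plane of order 2 have equal orbit numbers for every group
  of collineations, but different stabilizers.\<close>

abbreviation (in ring) CR where "CR \<equiv> carrier R"
abbreviation (in ring) sub where "sub B \<equiv> R\<lparr>carrier := B\<rparr>"
abbreviation (in ring) "ext \<equiv> simple_extension"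
no_notation matrix_matrix_mult (infixl "**" 70)
abbreviation (in ring) mlt (infixl "**" 70) where "x ** y \<equiv> x \<otimes> y"

section \<open>Finite additive subgroups and boxes\<close>

definition (in ring) asub :: "'a set => bool"
 where "asub V \<longleftrightarrow> V \<subseteq> CR \<and> \<zero> \<in> V \<and> (\<forall>x\<in>V. \<forall>y\<in>V. x \<ominus> y \<in> V)"

text \<open>Coefficient lists of the fixed length \<open>n\<close>, leading zeros included, so that
  the set is an additive group whenever \<open>S\<close> is one. With \<open>S\<close> equal to
  \<open>k\<close>, \<open>A\<close>, \<open>At m\<close> or \<open>F\<close> it yields bounded
  polynomials, orders, boxes and simple extensions.\<close>

definition (in ring) Bx :: "'a set => 'a => nat => 'a set"
 where "Bx S x n = (%p. eval p x) ` {p. set p \<subseteq> S \<and> length p = n}"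

context ring
begin

lemma eval_scale:
 "a \<in> CR ==> x \<in> CR ==> set p \<subseteq> CR ==> eval (map ((\<otimes>) a) p) x = a ** eval p x"
 by (induct p) (auto simp: eval_in_carrier r_distr m_assoc)

lemma asubD:
 assumes "asub V"
 shows "V \<subseteq> CR" "\<zero> \<in> V" "!!x y. x \<in> V ==> y \<in> V ==> x \<ominus> y \<in> V"
  "!!x. x \<in> V ==> x \<in> CR"
  "!!x. x \<in> V ==> \<ominus> x \<in> V" "!!x y. x \<in> V ==> y \<in> V ==> x \<oplus> y \<in> V"
proof -
 show a: "V \<subseteq> CR" "\<zero> \<in> V" "!!x y. x \<in> V ==> y \<in> V ==> x \<ominus> y \<in> V"
  "!!x. x \<in> V ==> x \<in> CR"
  using assms unfolding asub_def by auto
 show n: "\<ominus> x \<in> V" if "x \<in> V" for x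
 proof -
  have "\<zero> \<ominus> x \<in> V" using a that by blast
  then show ?thesis using a(4)[OF that] by (simp add: minus_eq)
 qed
 show "x \<oplus> y \<in> V" if "x \<in> V" "y \<in> V" for x y
 proof -
  have "x \<ominus> (\<ominus> y) \<in> V" using a(3)[OF that(1) n[OF that(2)]] .
  then show ?thesis using a(4) that by (simp add: minus_eq)
 qed
qed

lemma asubI:
 assumes "V \<subseteq> CR" "\<zero> \<in> V" "!!x. x \<in> V ==> \<ominus> x \<in> V" "!!x y. x \<in> V ==> y \<in> V ==> x \<oplus> y \<in> V"
 shows "asub V"
 using assms unfolding asub_def by (simp add: minus_eq)

lemma asub_Int: "asub V ==> asub W ==> asub (V \<inter> W)"
 unfolding asub_def by auto

lemma subring_asub: "subring V R ==> asub V"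
 by (rule asubI) (auto dest: subringE)

lemma minus_zero_iff: "x \<in> CR ==> y \<in> CR ==> x \<ominus> y = \<zero> \<longleftrightarrow> x = y"
 by (metis add.inv_closed minus_eq minus_minus minus_equality r_neg)

text \<open>Subtracting a fixed element of a fibre embeds the fibre into
  \<open>V \<inter> W\<close>. So \<open>f\<close> bounds the index without having to be a
  homomorphism, and chosen representatives can serve as \<open>f\<close>.\<close>

lemma card_fibres:
 assumes V: "asub V" and fV: "finite V" and W: "asub W" and fY: "finite Y"
  and f: "!!x. x \<in> V ==> f x \<in> Y"
  and fib: "!!x y. x \<in> V ==> y \<in> V ==> f x = f y ==> x \<ominus> y \<in> W"
 shows "card V \<le> card (V \<inter> W) * card Y"
proof -
 have "card (V \<inter> f -` {y}) \<le> card (V \<inter> W)" if "y \<in> Y" for y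
 proof (cases "V \<inter> f -` {y} = {}")
  case False
  then obtain x where x: "x \<in> V" "f x = y" by auto
  show ?thesis
  proof (rule card_inj_on_le[where f = "%z. z \<ominus> x"])
   show "inj_on (%z. z \<ominus> x) (V \<inter> f -` {y})"
   proof (rule inj_onI)
    fix a b assume "a \<in> V \<inter> f -` {y}" "b \<in> V \<inter> f -` {y}" and e: "a \<ominus> x = b \<ominus> x"
    then show "a = b" using asubD(4)[OF V] x e by (simp add: minus_eq)
   qed
   show "(%z. z \<ominus> x) ` (V \<inter> f -` {y}) \<subseteq> V \<inter> W"
    using x fib asubD(3)[OF V] by auto
   show "finite (V \<inter> W)" using fV by auto
  qed
 qed simp
 moreover have "card V \<le> (\<Sum>y\<in>Y. card (V \<inter> f -` {y}))"
 proof -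
  have "V = (\<Union>y\<in>Y. V \<inter> f -` {y})" using f by auto
  then show ?thesis by (metis card_UN_le fY)
 qed
 ultimately show ?thesis
  by (smt (verit, best) mult.commute of_nat_id order.trans sum_bounded_above)
qed

lemma card_direct:
 assumes V: "asub V" and U: "asub U" and fW: "finite W" and 0: "U \<inter> V \<subseteq> {\<zero>}"
  and sub: "!!u v. u \<in> U ==> v \<in> V ==> u \<oplus> v \<in> W"
 shows "card U * card V \<le> card W"
proof -
 have "inj_on (%(u,v). u \<oplus> v) (U \<times> V)"
 proof (rule inj_onI, clarify)
  fix u v u' v' assume a: "u \<in> U" "v \<in> V" "u' \<in> U" "v' \<in> V" and e: "u \<oplus> v = u' \<oplus> v'"
  then have c: "u \<in> CR" "u' \<in> CR" "v \<in> CR" "v' \<in> CR"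
   using asubD(4) V U by auto
  have "u \<ominus> u' = v' \<ominus> v"
  proof -
   have "u \<ominus> u' = (u \<oplus> v) \<ominus> v \<ominus> u'" using c by algebra
   also have "\<dots> = v' \<ominus> v" unfolding e using c by algebra
   finally show ?thesis .
  qed
  moreover have "u \<ominus> u' \<in> U" "v' \<ominus> v \<in> V" using a asubD(3) V U by auto
  ultimately show "u = u' \<and> v = v'" using 0 c by auto
 qed
 then have "card (U \<times> V) \<le> card W"
  by (rule card_inj_on_le) (use sub fW in auto)
 then show ?thesis by (simp add: card_cartesian_product)
qed

lemma Bx_0 [simp]: "Bx S x 0 = {\<zero>}"
 unfolding Bx_def by auto

lemma Bx_Suc: "Bx S x (Suc n) = {s ** x [^] n \<oplus> u | s u. s \<in> S \<and> u \<in> Bx S x n}"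
proof -
 have "{p. set p \<subseteq> S \<and> length p = Suc n} = {s # p | s p. s \<in> S \<and> set p \<subseteq> S \<and> length p = n}"
  by (auto simp: length_Suc_conv)
 then show ?thesis unfolding Bx_def by (simp only: image_def) force
qed

text \<open>The Horner form: the constant coefficient is split off instead of the leading one, as
  needed in inductions that multiply by \<open>x\<close>.\<close>

lemma Bx_Suc':
 assumes "S \<subseteq> CR" "x \<in> CR"
 shows "Bx S x (Suc n) = {u ** x \<oplus> s | s u. s \<in> S \<and> u \<in> Bx S x n}" (is "?L = ?R")
proof -
 have e: "{p. set p \<subseteq> S \<and> length p = Suc n} = {p @ [s] | s p. s \<in> S \<and> set p \<subseteq> S \<and> length p = n}" (is "?A = ?B")
 proof
  show "?A \<subseteq> ?B"
  proof
   fix p assume a: "p \<in> ?A"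
   then have "p ~= []" by auto
   then have "p = butlast p @ [last p]" "last p \<in> set p" "set (butlast p) \<subseteq> set p" "length (butlast p) = n"
    using a by (auto dest: in_set_butlastD)
   then show "p \<in> ?B" using a by blast
  qed
  show "?B \<subseteq> ?A" by auto
 qed
 have "eval (p @ [s]) x = eval p x ** x \<oplus> s" if "set p \<subseteq> S" "s \<in> S" for p s
  using eval_append_aux[of p s x] that assms by auto
 then show ?thesis unfolding Bx_def e by (auto simp: image_def) metis+
qed

lemma Bx_carrier: "S \<subseteq> CR ==> x \<in> CR ==> Bx S x n \<subseteq> CR"
 unfolding Bx_def using eval_in_carrier by auto

lemma Bx_asub:
 assumes "asub S" "x \<in> CR" shows "asub (Bx S x n)"
proof (induction n)
 case 0
 then show ?case by (simp add: asub_def)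
next
 case (Suc n)
 note S = asubD[OF assms(1)] and B = asubD[OF Suc]
 have x: "x [^] n \<in> CR" using assms by simp
 show ?case unfolding asub_def
 proof (intro conjI ballI)
  show "Bx S x (Suc n) \<subseteq> CR" using Bx_carrier S(1) assms by blast
  show "\<zero> \<in> Bx S x (Suc n)" using S(2) B(2) x unfolding Bx_Suc by force
  fix y z assume "y \<in> Bx S x (Suc n)" "z \<in> Bx S x (Suc n)"
  then obtain s u s' u' where y: "y = s ** x [^] n \<oplus> u" "s \<in> S" "u \<in> Bx S x n"
   "z = s' ** x [^] n \<oplus> u'" "s' \<in> S" "u' \<in> Bx S x n" unfolding Bx_Suc by auto
  have "y \<ominus> z = (s \<ominus> s') ** x [^] n \<oplus> (u \<ominus> u')" unfolding y(1,4)
   using x S(4)[OF y(2)] B(4)[OF y(3)] S(4)[OF y(5)] B(4)[OF y(6)] by algebra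
  then show "y \<ominus> z \<in> Bx S x (Suc n)" unfolding Bx_Suc using S(3)[OF y(2,5)] B(3)[OF y(3,6)] by blast
 qed
qed

lemma Bx_mono: "S \<subseteq> S' ==> Bx S x n \<subseteq> Bx S' x n"
 unfolding Bx_def by auto

lemma Bx_incr:
 assumes "\<zero> \<in> S" "S \<subseteq> CR" "x \<in> CR" "m \<le> n"
 shows "Bx S x m \<subseteq> Bx S x n"
 using assms(4)
proof (induction n rule: dec_induct)
 case (step n)
 have "Bx S x n \<subseteq> Bx S x (Suc n)"
 proof
  fix u assume u: "u \<in> Bx S x n"
  then have "\<zero> ** x [^] n \<oplus> u \<in> Bx S x (Suc n)" unfolding Bx_Suc using assms by blast
  moreover have "u \<in> CR" using u Bx_carrier[OF assms(2,3)] by blast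
  ultimately show "u \<in> Bx S x (Suc n)" using assms by simp
 qed
 then show ?case using step by auto
qed simp

lemma Bx_finite: "finite S ==> finite (Bx S x n)"
 unfolding Bx_def by (rule finite_imageI) (use finite_lists_length_eq[of S n] in auto)

lemma Bx_scale:
 assumes "S \<subseteq> CR" "x \<in> CR" "c \<in> CR" and sub: "!!s. s \<in> S ==> c ** s \<in> S'"
  and u: "u \<in> Bx S x n"
 shows "c ** u \<in> Bx S' x n"
 using u
proof (induction n arbitrary: u)
 case 0
 then show ?case using assms by simp
next
 case (Suc n)
 then obtain s v where y: "u = s ** x [^] n \<oplus> v" "s \<in> S" "v \<in> Bx S x n" unfolding Bx_Suc by auto
 have v: "v \<in> CR" "s \<in> CR" using Bx_carrier[OF assms(1,2)] y assms by auto
 have "c ** u = (c ** s) ** x [^] n \<oplus> (c ** v)" unfolding y using v assms(2,3)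
  by (simp add: r_distr m_assoc)
 then show ?case unfolding Bx_Suc using Suc.IH[OF y(3)] sub[OF y(2)] by blast
qed

text \<open>Linear independence of the first \<open>n\<close> powers of \<open>x\<close>, for lists
  as in \<open>Bx\<close>. For an additive group \<open>S\<close> it amounts to uniqueness of
  coordinates.\<close>

definition indep :: "'a set => 'a => nat => bool"
 where "indep S x n \<longleftrightarrow> (\<forall>p. set p \<subseteq> S \<and> length p = n \<and> eval p x = \<zero> --> set p \<subseteq> {\<zero>})"

lemma indep_pred:
 assumes "\<zero> \<in> S" "S \<subseteq> CR" "x \<in> CR" "indep S x (Suc n)" shows "indep S x n"
 unfolding indep_def
proof (intro allI impI)
 fix p assume a: "set p \<subseteq> S \<and> length p = n \<and> eval p x = \<zero>"
 then have "set (\<zero> # p) \<subseteq> S \<and> length (\<zero> # p) = Suc n \<and> eval (\<zero> # p) x = \<zero>"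
  using assms by simp
 then have "set (\<zero> # p) \<subseteq> {\<zero>}" using assms(4) unfolding indep_def by blast
 then show "set p \<subseteq> {\<zero>}" by simp
qed

lemma indep_Suc:
 assumes S: "asub S" "x \<in> CR" and i: "indep S x (Suc n)"
  and s: "s \<in> S" "s' \<in> S" "u \<in> Bx S x n" "u' \<in> Bx S x n"
  and e: "s ** x [^] n \<oplus> u = s' ** x [^] n \<oplus> u'"
 shows "s = s' \<and> u = u'"
proof -
 note S' = asubD[OF S(1)] and B = asubD[OF Bx_asub[OF S]]
 have c: "s \<in> CR" "s' \<in> CR" "u \<in> CR" "u' \<in> CR" "x [^] n \<in> CR"
  using S' B s S(2) by auto
 have "u \<ominus> u' \<in> Bx S x n" using B s by blast
 then obtain p where p: "set p \<subseteq> S" "length p = n" "eval p x = u \<ominus> u'"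
  unfolding Bx_def by auto
 have "eval ((s \<ominus> s') # p) x = (s ** x [^] n \<oplus> u) \<ominus> (s' ** x [^] n \<oplus> u')"
  using c p by simp algebra
 also have "\<dots> = \<zero>" unfolding e using c by algebra
 finally have "set ((s \<ominus> s') # p) \<subseteq> {\<zero>}"
  using i p S'(3)[OF s(1,2)] unfolding indep_def by (metis insert_subset length_Cons list.simps(15))
 then have ss: "s = s'" using c by auto
 then show ?thesis using e c ss by simp
qed

lemma card_Bx:
 assumes S: "asub S" "x \<in> CR" and i: "indep S x n"
 shows "card (Bx S x n) = card S ^ n"
 using i
proof (induction n)
 case (Suc n)
 have "Bx S x (Suc n) = (%(s,u). s ** x [^] n \<oplus> u) ` (S \<times> Bx S x n)"
  unfolding Bx_Suc by auto
 moreover have "inj_on (%(s,u). s ** x [^] n \<oplus> u) (S \<times> Bx S x n)"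
  by (rule inj_onI, clarify) (use indep_Suc[OF S Suc.prems] in auto)
 ultimately show ?case using indep_pred Suc.prems asubD[OF S(1)] S(2) Suc.IH by (simp add: card_image card_cartesian_product)
qed simp

lemma Bx_x_mult:
 assumes S: "\<zero> \<in> S" "S \<subseteq> CR" "x \<in> CR" "u \<in> Bx S x n"
 shows "u ** x \<in> Bx S x (Suc n)"
using S(4) Bx_carrier[OF S(2,3)] assms S unfolding Bx_Suc'[OF S(2,3)] by force

lemma Bx_coords_unique:
 assumes S: "asub S" "x \<in> CR" and i: "indep S x n"
  and p: "set p \<subseteq> S" "length p = n" "set p' \<subseteq> S" "length p' = n" and e: "eval p x = eval p' x"
 shows "p = p'"
 using p e i
proof (induction n arbitrary: p p')
 case (Suc n)
 then obtain s t s' t' where st: "p = s # t" "p' = s' # t'" by (metis length_Suc_conv)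
 have "indep S x n" using indep_pred Suc.prems asubD[OF S(1)] S(2) by blast
 then show ?case using st Suc.prems indep_Suc[OF S Suc.prems(6), of s s' "eval t x" "eval t' x"] Suc.IH[of t t'] unfolding Bx_def by auto
qed simp

end

subsection \<open>Ideals of subrings\<close>

text \<open>Ideals and primes of a subring are plain sets of elements of the ambient ring, so that
  contraction to a smaller subring is an intersection; \<open>idl_iff\<close> and
  \<open>prm_iff\<close> give the link to the library notions.\<close>

definition (in ring) idl :: "'a set => 'a set => bool"
 where "idl B I \<longleftrightarrow> asub I \<and> I \<subseteq> B \<and> (\<forall>x\<in>B. \<forall>y\<in>I. x ** y \<in> I)"

definition (in ring) prm :: "'a set => 'a set => bool"
 where "prm B P \<longleftrightarrow> idl B P \<and> \<one> \<notin> P \<and> (\<forall>x\<in>B. \<forall>y\<in>B. x ** y \<in> P --> x \<in> P \<or> y \<in> P)"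

context domain
begin

lemma idlD:
 assumes "idl B I"
 shows "asub I" "I \<subseteq> B" "!!x y. x \<in> B ==> y \<in> I ==> x ** y \<in> I"
  "\<zero> \<in> I" "!!x. x \<in> I ==> x \<in> B" "!!x. x \<in> I ==> x \<in> CR"
  "!!x y. x \<in> I ==> y \<in> I ==> x \<oplus> y \<in> I" "!!x y. x \<in> I ==> y \<in> I ==> x \<ominus> y \<in> I"
  "!!x. x \<in> I ==> \<ominus> x \<in> I"
proof -
 show I: "asub I" "I \<subseteq> B" "!!x y. x \<in> B ==> y \<in> I ==> x ** y \<in> I"
  using assms unfolding idl_def by auto
 show "!!x. x \<in> I ==> x \<in> B" using I(2) by blast
qed (rule asubD[OF conjunct1[OF assms[unfolded idl_def]]]; assumption)+

lemma prmD:
 assumes "prm B P"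
 shows "idl B P" "\<one> \<notin> P" "!!x y. x \<in> B ==> y \<in> B ==> x ** y \<in> P ==> x \<in> P \<or> y \<in> P"
 using assms unfolding prm_def by blast+

lemma prm_pow:
 assumes "prm B P" "subring B R" "x \<in> B" "x [^] (n::nat) \<in> P" shows "x \<in> P"
 using assms(4)
proof (induction n)
 case 0
 then show ?case using prmD(2)[OF assms(1)] by simp
next
 case (Suc n)
 have "x [^] n \<in> B" by (induction n) (use assms subringE[OF assms(2)] in auto)
 then show ?case using Suc prmD(3)[OF assms(1), of "x [^] n" x] assms(3) by auto
qed

lemma subring_pow: "subring B R ==> x \<in> B ==> x [^] (n::nat) \<in> B"
 by (induction n) (auto dest: subringE)

lemma subring_minus: "subring B R ==> x \<in> B ==> y \<in> B ==> x \<ominus> y \<in> B"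
 using subringE(5,7)[of B R] by (simp add: minus_eq)

lemma idl_restrict:
 assumes "idl B I" "C \<subseteq> B" "subring C R" shows "idl C (I \<inter> C)"
 unfolding idl_def using asub_Int[OF idlD(1)[OF assms(1)] subring_asub[OF assms(3)]]
 using assms(2) idlD(3)[OF assms(1)] subringE(6)[OF assms(3)] by auto

lemma prm_restrict:
 assumes "prm B P" "C \<subseteq> B" "subring C R" shows "prm C (P \<inter> C)"
 unfolding prm_def using idl_restrict[OF prmD(1)[OF assms(1)] assms(2,3)] prmD[OF assms(1)] assms(2) by blast

lemma cring_sub:
 assumes "subring B R" shows "cring (sub B)"
proof -
 have "subcring B R" using assms subringE(1)[OF assms] m_comm
  by (intro subcringI) auto
 then show ?thesis using subcring_iff[OF subringE(1)[OF assms]] by blast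
qed

lemma a_minus_sub:
 assumes "subring B R" "x \<in> B" shows "\<ominus>\<^bsub>sub B\<^esub> x = \<ominus> x"
proof -
 interpret B: cring "sub B" using cring_sub[OF assms(1)] .
 have x: "x \<in> CR" "\<ominus> x \<in> B" using subringE[OF assms(1)] assms(2) by auto
 show ?thesis using B.minus_equality[of "\<ominus> x" x] assms(2) x l_neg by auto
qed

lemma idl_iff:
 assumes "subring B R" shows "ideal I (sub B) \<longleftrightarrow> idl B I"
proof
 interpret B: cring "sub B" using cring_sub[OF assms] .
 assume "ideal I (sub B)"
 then interpret I: ideal I "sub B" .
 have sub: "I \<subseteq> B" using I.a_subset by simp
 have "asub I"
 proof (rule asubI)
  show "I \<subseteq> CR" using sub subringE(1)[OF assms] by blast
  show "\<zero> \<in> I" using I.zero_closed by simp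
  show "\<ominus> x \<in> I" if "x \<in> I" for x
   using I.a_inv_closed[OF that] a_minus_sub[OF assms, of x] sub that by (metis subsetD)
  show "x \<oplus> y \<in> I" if "x \<in> I" "y \<in> I" for x y using I.a_closed[OF that] by simp
 qed
 then show "idl B I" unfolding idl_def using sub I.I_l_closed by auto
next
 interpret B: cring "sub B" using cring_sub[OF assms] .
 assume I: "idl B I"
 note i = idlD[OF I]
 show "ideal I (sub B)"
 proof (rule idealI)
  show "ring (sub B)" by (rule B.ring_axioms)
  show "subgroup I (add_monoid (sub B))"
  proof (rule B.add.subgroupI)
   show "I \<subseteq> carrier (sub B)" using i by simp
   show "I ~= {}" using i by auto
   show "\<ominus>\<^bsub>sub B\<^esub> a \<in> I" if "a \<in> I" for a
    using a_minus_sub[OF assms, of a] i(5,9)[OF that] by simp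
   show "a \<oplus>\<^bsub>sub B\<^esub> b \<in> I" if "a \<in> I" "b \<in> I" for a b
    using i that by simp
  qed
  show "x \<otimes>\<^bsub>sub B\<^esub> a \<in> I" if "a \<in> I" "x \<in> carrier (sub B)" for a x
   using i that by simp
  show "a \<otimes>\<^bsub>sub B\<^esub> x \<in> I" if "a \<in> I" "x \<in> carrier (sub B)" for a x
   using i(3)[of x a] i(6)[of a] that m_comm[of a x] subringE(1)[OF assms] by auto
 qed
qed

lemma prm_iff:
 assumes "subring B R" shows "primeideal P (sub B) \<longleftrightarrow> prm B P"
proof
 interpret B: cring "sub B" using cring_sub[OF assms] .
 assume p: "primeideal P (sub B)"
 then interpret P: primeideal P "sub B" .
 have i: "idl B P" using idl_iff[OF assms] P.ideal_axioms by blast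
 have "\<one> \<notin> P"
 proof
  assume "\<one> \<in> P"
  then have "x \<in> P" if "x \<in> B" for x
   using idlD(3)[OF i that, of \<one>] that subringE(1)[OF assms] by auto
  then show False using P.I_notcarr idlD(2)[OF i] by auto
 qed
 then show "prm B P" unfolding prm_def using i P.I_prime by simp
next
 interpret B: cring "sub B" using cring_sub[OF assms] .
 assume p: "prm B P"
 show "primeideal P (sub B)"
 proof (rule primeidealI)
  show "ideal P (sub B)" using idl_iff[OF assms] prmD(1)[OF p] by blast
  show "cring (sub B)" by (rule B.is_cring)
  show "carrier (sub B) ~= P" using prmD(2)[OF p] subringE(3)[OF assms] by auto
  show "a \<in> P \<or> b \<in> P" if "a \<in> carrier (sub B)" "b \<in> carrier (sub B)"
   "a \<otimes>\<^bsub>sub B\<^esub> b \<in> P" for a b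
   using prmD(3)[OF p] that by simp
 qed
qed

text \<open>A domain with finitely many elements is a field; here by the pigeonhole principle on the powers
  of an element.\<close>

lemma prm_finite_index_inv:
 assumes B: "subring B R" and P: "prm B P" and S: "finite S" "!!y. y \<in> B ==> \<exists>s\<in>S. y \<ominus> s \<in> P" "S \<subseteq> CR"
  and y: "y \<in> B" "y \<notin> P"
 shows "\<exists>z\<in>B. z ** y \<ominus> \<one> \<in> P"
proof -
 note i = idlD[OF prmD(1)[OF P]]
 have yc: "y \<in> CR" using y subringE(1)[OF B] by auto
 have "\<exists>s\<in>S. y [^] n \<ominus> s \<in> P" for n :: nat using S(2) subring_pow[OF B y(1)] by blast
 then obtain f where f: "!!n::nat. f n \<in> S \<and> y [^] n \<ominus> f n \<in> P" by metis
 have "\<not> inj_on f (UNIV :: nat set)"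
 proof
  assume "inj_on f (UNIV :: nat set)"
  moreover have "f ` UNIV \<subseteq> S" using f by auto
  ultimately show False using S(1) finite_subset[of "f ` UNIV" S] finite_imageD by blast
 qed
 then obtain a b where ab: "f a = f b" "a < b" unfolding inj_on_def by (metis linorder_neqE_nat)
 define c where "c = b - a - 1"
 have b: "b = a + Suc c" using ab unfolding c_def by auto
 have fc: "f b \<in> CR" using f S(3) by blast
 have "(y [^] b \<ominus> f b) \<ominus> (y [^] a \<ominus> f a) \<in> P" using i(8) f by blast
 also have "(y [^] b \<ominus> f b) \<ominus> (y [^] a \<ominus> f a) = y [^] b \<ominus> y [^] a"
  unfolding ab using yc fc nat_pow_closed[of y b] nat_pow_closed[of y a] by algebra
 also have "\<dots> = y [^] a ** (y [^] c ** y \<ominus> \<one>)"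
 proof -
  have "y [^] b = y [^] a ** (y [^] c ** y)" unfolding b using yc by (simp add: m_assoc flip: nat_pow_mult)
  then show ?thesis using yc by (simp add: minus_eq r_distr r_minus)
 qed
 finally have "y [^] a ** (y [^] c ** y \<ominus> \<one>) \<in> P" .
 moreover have "y [^] c ** y \<ominus> \<one> \<in> B"
  using subring_minus[OF B] subringE[OF B] subring_pow[OF B y(1), of c] y(1) by auto
 ultimately show ?thesis using prmD(3)[OF P] subring_pow[OF B y(1)] prm_pow[OF P B y(1)] y(2) by blast
qed

end

section \<open>The polynomial ring\<close>

locale fq_poly = field R for R (structure) +
 fixes k :: "'a set" and T :: 'a and q :: nat
 assumes k: "subfield k R" and fin_k: "finite k" and card_k: "card k = q"
  and T: "T \<in> CR" and trT: "(transcendental over k) T"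
begin

definition A where "A = ext k T"
definition At :: "nat => 'a set" where "At m = Bx k T m"

lemma subring_k: "subring k R" using subfieldE(1)[OF k] .
lemma asub_k: "asub k" using subring_asub[OF subring_k] .
lemma k_carrier: "k \<subseteq> CR" using subfieldE(3)[OF k] .
lemma A_subring: "subring A R" unfolding A_def by (rule simple_extension_is_subring[OF subring_k T])
lemma A_carrier: "A \<subseteq> CR" using subringE(1)[OF A_subring] .
lemma A_asub: "asub A" using subring_asub[OF A_subring] .
lemma k_A: "k \<subseteq> A" unfolding A_def by (rule simple_extension_incl[OF k_carrier T])
lemma T_A: "T \<in> A" unfolding A_def by (rule simple_extension_mem[OF subring_k T])

lemma q_gt: "q > 1"
proof -
 have "{\<zero>, \<one>} \<subseteq> k" using subringE[OF subring_k] by auto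
 moreover have "card {\<zero>, \<one>} = 2" by simp
 ultimately show ?thesis using card_mono[OF fin_k] card_k by (metis Suc_1 less_eq_Suc_le)
qed

lemma At_0 [simp]: "At 0 = {\<zero>}" by (simp add: At_def)

lemma At_asub: "asub (At m)" unfolding At_def by (rule Bx_asub[OF asub_k T])
lemmas AtD = asubD[OF At_asub]

lemma At_finite: "finite (At m)" unfolding At_def by (rule Bx_finite[OF fin_k])

lemma At_mono: "m \<le> n ==> At m \<subseteq> At n"
 unfolding At_def by (rule Bx_incr[OF _ k_carrier T]) (use subringE(2)[OF subring_k] in auto)

lemma indep_k: "indep k T n"
 unfolding indep_def
proof (intro allI impI)
 fix p assume p: "set p \<subseteq> k \<and> length p = n \<and> eval p T = \<zero>"
 have "eval (normalize p) T = \<zero>" using eval_normalize[of p T] p k_carrier T by auto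
 then have "normalize p = []" using normalize_gives_polynomial p univ_poly_carrier eval_transcendental[OF trT] by blast
 then show "set p \<subseteq> {\<zero>}"
  by (induct p) (auto, meson list.discI, metis all_not_in_conv list.discI list.sel(3) singletonD subset_singletonD)
qed

lemma card_At: "card (At m) = q ^ m"
 unfolding At_def using card_Bx[OF asub_k T indep_k] card_k by simp

lemma At_Suc: "At (Suc m) = {s ** T [^] m \<oplus> u | s u. s \<in> k \<and> u \<in> At m}"
 unfolding At_def by (rule Bx_Suc)

lemma At_Suc': "At (Suc m) = {u ** T \<oplus> s | s u. s \<in> k \<and> u \<in> At m}"
 unfolding At_def by (rule Bx_Suc'[OF k_carrier T])

lemma At_1: "At (Suc 0) = k"
 unfolding At_Suc using k_carrier by force

lemma A_eq: "A = (\<Union>m. At m)"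
proof
 show "A \<subseteq> (\<Union>m. At m)"
 proof
  fix a assume "a \<in> A"
  then obtain p where p: "p \<in> carrier (k[X])" "a = eval p T"
   unfolding A_def simple_extension_as_eval_img[OF k_carrier T] by auto
  then have "set p \<subseteq> k" by (simp add: polynomial_incl univ_poly_carrier)
  then show "a \<in> (\<Union>m. At m)" using p unfolding At_def Bx_def by blast
 qed
next
 have "At m \<subseteq> A" for m
 proof (induction m)
  case 0
  then show ?case using subringE(2)[OF A_subring] by simp
 next
  case (Suc m)
  then show ?case unfolding At_Suc' using k_A T_A subringE(6,7)[OF A_subring] by blast
 qed
 then show "(\<Union>m. At m) \<subseteq> A" by blast
qed

lemma At_A: "At m \<subseteq> A" using A_eq by blast

text \<open>Degree at most \<open>i\<close> times degree below \<open>m\<close>, hence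
  \<open>Suc\<close> on one side only.\<close>

lemma At_mult: "a \<in> At (Suc i) ==> b \<in> At m ==> a ** b \<in> At (i + m)"
proof (induction i arbitrary: a)
 case 0
 then have a: "a \<in> k" by (simp add: At_1)
 show ?case unfolding At_def add_0
  by (rule Bx_scale[OF k_carrier T]) (use a k_carrier subringE(6)[OF subring_k] 0 in \<open>auto simp: At_def\<close>)
next
 case (Suc i)
 then obtain s u where a: "a = u ** T \<oplus> s" "s \<in> k" "u \<in> At (Suc i)" unfolding At_Suc'[of "Suc i"] by auto
 have ub: "u ** b \<in> At (i + m)" using Suc a by blast
 have 1: "(u ** b) ** T \<in> At (Suc (i + m))" using ub subringE(2)[OF subring_k] AtD(4)[OF ub] T unfolding At_Suc'[of "i+m"] by force
 have "s ** b \<in> At m" unfolding At_def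
  by (rule Bx_scale[OF k_carrier T]) (use a k_carrier subringE(6)[OF subring_k] Suc in \<open>auto simp: At_def\<close>)
 then have 2: "s ** b \<in> At (Suc (i + m))" using At_mono[of m "Suc (i+m)"] by auto
 show ?case using AtD(4) a Suc.prems k_carrier T AtD(6)[OF 1 2] unfolding a by (auto simp: r_distr m_ac)
qed

text \<open>\<open>dege d a\<close>: the polynomial \<open>a\<close> has degree exactly \<open>d\<close>.\<close>

definition dege :: "nat => 'a => bool" where "dege d a \<longleftrightarrow> a \<in> At (Suc d) \<and> a \<notin> At d"

lemma dege_lead:
 assumes "s \<in> k" "u \<in> At m"
 shows "s ** T [^] m \<oplus> u \<in> At m \<longleftrightarrow> s = \<zero>"
proof
 assume "s = \<zero>"
 then show "s ** T [^] m \<oplus> u \<in> At m" using assms T AtD by auto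
next
 assume a: "s ** T [^] m \<oplus> u \<in> At m"
 show "s = \<zero>" using a AtD(4) T indep_Suc[OF asub_k T indep_k assms(1) subringE(2)[OF subring_k]] assms unfolding At_def by simp
qed

lemma degeE:
 assumes "dege d a"
 obtains s u where "s \<in> k" "s ~= \<zero>" "u \<in> At d" "a = s ** T [^] d \<oplus> u"
proof -
 from assms obtain s u where a: "s \<in> k" "u \<in> At d" "a = s ** T [^] d \<oplus> u"
  unfolding dege_def At_Suc by auto
 then show ?thesis using that dege_lead[OF a(1,2)] assms unfolding dege_def by auto
qed

lemma T_pow_At: "s \<in> k ==> s ** T [^] d \<in> At (Suc d)"
proof -
 assume s: "s \<in> k"
 show ?thesis using s AtD(2) k_carrier T unfolding At_Suc by force
qed

lemma dege_mult:
 assumes "dege i a" "dege j b" shows "dege (i + j) (a ** b)"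
proof -
 obtain s u where a: "s \<in> k" "s ~= \<zero>" "u \<in> At i" "a = s ** T [^] i \<oplus> u" using degeE[OF assms(1)] .
 obtain t v where b: "t \<in> k" "t ~= \<zero>" "v \<in> At j" "b = t ** T [^] j \<oplus> v" using degeE[OF assms(2)] .
 have c: "s \<in> CR" "t \<in> CR" "u \<in> CR" "v \<in> CR" "T [^] i \<in> CR" "T [^] j \<in> CR"
  using a b k_carrier AtD(4) T by auto
 have 1: "(s ** T [^] i) ** v \<in> At (i + j)" using At_mult[OF T_pow_At[OF a(1)] b(3)] .
 have bA: "b \<in> At (Suc j)" using assms(2) unfolding dege_def by blast
 have 2: "b ** u \<in> At (i + j)" using At_mult[OF bA a(3)] by (simp add: add.commute)
 have e: "a ** b = (s ** t) ** T [^] (i + j) \<oplus> ((s ** T [^] i) ** v \<oplus> b ** u)"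
  unfolding a(4) b(4) nat_pow_mult[OF T, symmetric] using c by (simp add: r_distr m_ac a_ac)
 have st: "s ** t \<in> k" "s ** t ~= \<zero>" using a b subringE(6)[OF subring_k] integral c by auto
 note low = AtD(6)[OF 1 2]
 have "a ** b \<notin> At (i + j)" unfolding e using dege_lead[OF st(1) low] st(2) by blast
 then show ?thesis using st low unfolding e At_Suc dege_def by blast
qed

lemma dege_exists:
 assumes "a \<in> A" "a ~= \<zero>" obtains d where "dege d a"
proof -
 obtain m where m: "a \<in> At m" using assms A_eq by auto
 define l where "l = (LEAST m. a \<in> At m)"
 have l: "a \<in> At l" unfolding l_def using LeastI m by metis
 then obtain d where d: "l = Suc d" using assms not0_implies_Suc by (metis At_0 singletonD)
 then show ?thesis using not_less_Least[of d "%m. a \<in> At m"] that l d unfolding l_def dege_def by auto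
qed

lemma dege_At: "dege d a ==> a \<in> At m ==> d < m"
 unfolding dege_def using At_mono[of m d] by (metis linorder_not_le subsetD)

lemma dege_A: "dege d a ==> a \<in> A" unfolding dege_def using At_A by blast

lemma dege_nonzero: "dege d a ==> a ~= \<zero>" unfolding dege_def using AtD(2) by blast

lemma A_div:
 assumes p: "dege d p" and a: "a \<in> A"
 shows "\<exists>b\<in>A. \<exists>r\<in>At d. a = p ** b \<oplus> r"
proof -
 obtain t v where t: "t \<in> k" "t ~= \<zero>" "v \<in> At d" "p = t ** T [^] d \<oplus> v" using degeE[OF p] .
 have pc: "p \<in> CR" using dege_A[OF p] A_carrier by blast
 have "\<exists>b\<in>A. \<exists>r\<in>At d. a = p ** b \<oplus> r" if "a \<in> At m" for m a
  using that
 proof (induction m arbitrary: a)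
  case 0
  then show ?case using subringE(2)[OF A_subring] AtD(2) pc by (intro bexI[of _ \<zero>]) auto
 next
  case (Suc m)
  show ?case
  proof (cases "m < d")
   case True
   then have "a \<in> At d" using Suc At_mono[of "Suc m" d] by auto
   then show ?thesis using subringE(2)[OF A_subring] pc AtD(4) by (intro bexI[of _ \<zero>] bexI[of _ a]) auto
  next
   case False
   then obtain e where e: "m = d + e" using le_Suc_ex not_less by blast
   obtain s u where a: "s \<in> k" "u \<in> At m" "a = s ** T [^] m \<oplus> u" using Suc.prems unfolding At_Suc by auto
   \<comment> \<open>\<open>c T^e\<close> times the divisor has the leading term of
     \<open>a\<close>; what remains lies in \<open>At m\<close>, where the induction hypothesis
     applies.\<close>
   define c where "c = s ** inv t"
   have it: "inv t \<in> k" "inv t ** t = \<one>" using subfield_m_inv[OF k, of t] t by auto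
   have ck: "c \<in> k" unfolding c_def using a it subringE(6)[OF subring_k] by blast
   have cT: "c ** T [^] e \<in> At (Suc e)" using T_pow_At[OF ck] .
   have cc: "s \<in> CR" "t \<in> CR" "u \<in> CR" "v \<in> CR" "T [^] d \<in> CR" "T [^] e \<in> CR" "c \<in> CR" "inv t \<in> CR"
    using a t it ck k_carrier AtD(4) T by auto
   have "p ** (c ** T [^] e) = s ** T [^] m \<oplus> (c ** T [^] e) ** v"
   proof -
    have "p ** (c ** T [^] e) = (c ** t) ** (T [^] d ** T [^] e) \<oplus> (c ** T [^] e) ** v"
     unfolding t(4) using cc by (simp add: r_distr m_ac)
    then show ?thesis using cc it nat_pow_mult[OF T] unfolding c_def e by (simp add: m_assoc)
   qed
   then have "a = p ** (c ** T [^] e) \<oplus> (u \<ominus> (c ** T [^] e) ** v)"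
   proof -
    have 1: "s ** T [^] m \<in> CR" "(c ** T [^] e) ** v \<in> CR" using cc T by auto
    show ?thesis using 1 cc(3) \<open>p ** (c ** T [^] e) = _\<close> unfolding a by algebra
   qed
   moreover have "(c ** T [^] e) ** v \<in> At m" using At_mult[OF cT t(3)] e by (simp add: add.commute)
   then obtain b r where br: "b \<in> A" "r \<in> At d" "u \<ominus> (c ** T [^] e) ** v = p ** b \<oplus> r" using AtD(3) a Suc.IH by blast
   ultimately have "a = p ** (c ** T [^] e) \<oplus> (p ** b \<oplus> r)" by simp
   moreover have "b \<in> CR" "r \<in> CR" using br A_carrier AtD(4) by auto
   ultimately have "a = p ** (c ** T [^] e \<oplus> b) \<oplus> r" using cc pc by (simp add: r_distr a_assoc)
   moreover have "c ** T [^] e \<oplus> b \<in> A" using cT At_A br subringE(7)[OF A_subring] by blast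
   ultimately show ?thesis using br by blast
  qed
 qed
 then show ?thesis using a A_eq by auto
qed

text \<open>For a nonzero ideal this is the degree of a generator, so that the residue ring has
  \<open>q ^ dgi p\<close> elements.\<close>

definition dgi :: "'a set => nat"
 where "dgi p = (LEAST d. \<exists>a\<in>p. dege d a)"

text \<open>Division by an element of least degree. The last two clauses make
  \<open>At (dgi p)\<close> a full system of representatives modulo \<open>p\<close>: one gives
  uniqueness, the other existence.\<close>

lemma idl_gen:
 assumes p: "idl A p" "p ~= {\<zero>}"
 obtains \<pi> where "\<pi> \<in> p" "dege (dgi p) \<pi>" "p = {\<pi> ** b | b. b \<in> A}"
  "p \<inter> At (dgi p) = {\<zero>}" "!!a. a \<in> A ==> \<exists>r\<in>At (dgi p). a \<ominus> r \<in> p"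
proof -
 note i = idlD[OF p(1)]
 obtain a where a: "a \<in> p" "a ~= \<zero>" using p i by auto
 then obtain d where "dege d a" using dege_exists i(5) by blast
 then obtain \<pi> where pi: "\<pi> \<in> p" "dege (dgi p) \<pi>" using a LeastI[of "%d. \<exists>a\<in>p. dege d a"] unfolding dgi_def by blast
 have pic: "\<pi> \<in> CR" using i(6) pi by blast
 have z: "p \<inter> At (dgi p) = {\<zero>}"
 proof -
  have "x = \<zero>" if x: "x \<in> p" "x \<in> At (dgi p)" for x
  proof (rule ccontr)
   assume "x ~= \<zero>"
   then obtain e where e: "dege e x" using dege_exists i(5) x(1) by blast
   then have "dgi p \<le> e" unfolding dgi_def using x by (intro Least_le) auto
   then show False using dege_At[OF e x(2)] by simp
  qed
  then show ?thesis using i(4) AtD(2)[of "dgi p"] by blast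
 qed
 have dv: "\<exists>r\<in>At (dgi p). \<exists>b\<in>A. a = \<pi> ** b \<oplus> r" if "a \<in> A" for a using A_div[OF pi(2) that] by blast
 have mi: "a \<ominus> r = \<pi> ** b" if "a = \<pi> ** b \<oplus> r" "b \<in> A" "r \<in> At (dgi p)" for a b r
 proof -
  have "\<pi> ** b \<in> CR" "r \<in> CR" using that pic A_carrier AtD(4) by auto
  then show ?thesis unfolding that(1) by algebra
 qed
 have mp: "\<pi> ** b \<in> p" if "b \<in> A" for b using i(3)[OF that pi(1)] m_comm pic that A_carrier by auto
 have "p = {\<pi> ** b | b. b \<in> A}"
 proof
  show "p \<subseteq> {\<pi> ** b | b. b \<in> A}"
  proof
   fix a assume a: "a \<in> p"
   obtain r b where rb: "r \<in> At (dgi p)" "b \<in> A" "a = \<pi> ** b \<oplus> r" using dv[OF i(5)[OF a]] by blast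
   have "r = a \<ominus> \<pi> ** b"
   proof -
    have "\<pi> ** b \<in> CR" "r \<in> CR" using rb pic A_carrier AtD(4) by auto
    then show ?thesis unfolding rb(3) by algebra
   qed
   then have "r = \<zero>" using i(8)[OF a mp[OF rb(2)]] rb z by blast
   moreover have "\<pi> ** b \<in> CR" using rb(2) pic A_carrier by blast
   ultimately show "a \<in> {\<pi> ** b | b. b \<in> A}" using rb(3) rb(2) by auto
  qed
  show "{\<pi> ** b | b. b \<in> A} \<subseteq> p" using mp by auto
 qed
 moreover have "\<exists>r\<in>At (dgi p). a \<ominus> r \<in> p" if "a \<in> A" for a
  using dv[OF that] mi mp by metis
 ultimately show ?thesis using that pi z by blast
qed

lemma At_reps_unique:
 assumes p: "idl A p" "p ~= {\<zero>}" and r: "r \<in> At (dgi p)" "r' \<in> At (dgi p)" "r \<ominus> r' \<in> p"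
 shows "r = r'"
proof -
 obtain \<pi> where z: "p \<inter> At (dgi p) = {\<zero>}" using idl_gen[OF p] by metis
 have "r \<ominus> r' = \<zero>" using AtD(3) r z by blast
 then show ?thesis using minus_zero_iff r AtD(4) by blast
qed

lemma prm_A_inv:
 assumes p: "prm A p" "p ~= {\<zero>}" and y: "y \<in> A" "y \<notin> p"
 shows "\<exists>z\<in>A. z ** y \<ominus> \<one> \<in> p"
proof -
 obtain \<pi> where "!!a. a \<in> A ==> \<exists>r\<in>At (dgi p). a \<ominus> r \<in> p" using idl_gen[OF prmD(1)[OF p(1)] p(2)] by metis
 then show ?thesis
  by (intro prm_finite_index_inv[OF A_subring p(1) At_finite _ _ y]) (use AtD(1) in auto)
qed

lemma dgi_pos:
 assumes p: "prm A p" "p ~= {\<zero>}" shows "dgi p > 0"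
proof (rule ccontr)
 assume a: "\<not> dgi p > 0"
 obtain \<pi> where "!!a. a \<in> A ==> \<exists>r\<in>At (dgi p). a \<ominus> r \<in> p" using idl_gen[OF prmD(1)[OF p(1)] p(2)] by metis
 then have "\<exists>r\<in>At 0. \<one> \<ominus> r \<in> p" using a subringE(3)[OF A_subring] by fastforce
 then show False using prmD(2)[OF p(1)] by (simp add: minus_eq)
qed

text \<open>A prime is determined by a generator, chosen in \<open>At (Suc d)\<close>. The bound is
  crude but yields convergence of the Dirichlet series for \<open>s > 1\<close>.\<close>

lemma card_primes_le:
 "finite {p. prm A p \<and> p ~= {\<zero>} \<and> dgi p = d}" "card {p. prm A p \<and> p ~= {\<zero>} \<and> dgi p = d} \<le> q ^ Suc d"
proof -
 let ?S = "{p. prm A p \<and> p ~= {\<zero>} \<and> dgi p = d}"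
 have "\<forall>p\<in>?S. \<exists>\<pi>. \<pi> \<in> At (Suc d) \<and> p = {\<pi> ** b | b. b \<in> A}"
 proof
  fix p assume "p \<in> ?S"
  then have p: "prm A p" "p ~= {\<zero>}" "dgi p = d" by auto
  obtain \<pi> where "dege (dgi p) \<pi>" "p = {\<pi> ** b | b. b \<in> A}" by (rule idl_gen[OF prmD(1)[OF p(1)] p(2)])
  then show "\<exists>\<pi>. \<pi> \<in> At (Suc d) \<and> p = {\<pi> ** b | b. b \<in> A}" using p(3) unfolding dege_def by blast
 qed
 from bchoice[OF this] obtain g where g: "\<forall>p\<in>?S. g p \<in> At (Suc d) \<and> p = {g p ** b | b. b \<in> A}" by (elim exE)
 define h where "h \<pi> = {\<pi> ** b | b. b \<in> A}" for \<pi>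
 have g1: "g p \<in> At (Suc d)" and g2: "p = h (g p)" if "p \<in> ?S" for p
  unfolding h_def by (rule conjunct1[OF bspec[OF g that]], rule conjunct2[OF bspec[OF g that]])
 have inj: "inj_on g ?S"
  by (rule inj_on_inverseI[where g = h]) (use g2 in simp)
 have im: "g ` ?S \<subseteq> At (Suc d)" by (intro image_subsetI g1)
 show "finite ?S" using finite_imageD[OF finite_subset[OF im At_finite] inj] .
 show "card ?S \<le> q ^ Suc d" using card_inj_on_le[OF inj im At_finite] card_At by simp
qed

end

section \<open>Orders generated by one element\<close>

text \<open>The ring \<open>A[\<gamma>]\<close> as a free module of rank \<open>n\<close> over
  \<open>A\<close>: \<open>indep_A\<close> gives the basis of powers, \<open>pw\<close> the closure
  under multiplication. It is not assumed to be integrally closed.\<close>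

locale fq_order = fq_poly R k T q for R (structure) and k T q +
 fixes \<gamma> :: 'a and n :: nat
 assumes \<gamma>: "\<gamma> \<in> CR" and n_pos: "n > 0"
  and indep_A: "indep A \<gamma> n" and pw: "\<gamma> [^] n \<in> Bx A \<gamma> n"
begin

definition Od where "Od = Bx A \<gamma> n"
definition Box where "Box m = Bx (At m) \<gamma> n"

lemma Od_asub: "asub Od" unfolding Od_def by (rule Bx_asub[OF A_asub \<gamma>])
lemmas OdD = asubD[OF Od_asub]

lemma Bx_mem_carrier: "S \<subseteq> CR ==> x \<in> CR ==> u \<in> Bx S x l ==> u \<in> CR"
 using Bx_carrier by blast

lemma A_Bx1: "s \<in> A ==> s \<in> Bx A \<gamma> (Suc 0)"
 unfolding Bx_Suc using A_carrier by force

lemma A_Od: "A \<subseteq> Od"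
proof
 fix s assume "s \<in> A"
 then have "s \<in> Bx A \<gamma> (Suc 0)" by (rule A_Bx1)
 moreover have "Bx A \<gamma> (Suc 0) \<subseteq> Bx A \<gamma> n"
  by (rule Bx_incr) (use subringE(2)[OF A_subring] A_carrier \<gamma> n_pos in auto)
 ultimately show "s \<in> Od" unfolding Od_def by blast
qed

lemma Od_gamma_mult: assumes "u \<in> Od" shows "u ** \<gamma> \<in> Od"
proof -
 have "u ** \<gamma> \<in> Bx A \<gamma> (Suc n)"
  using assms Bx_x_mult[OF subringE(2)[OF A_subring] A_carrier \<gamma>] unfolding Od_def by blast
 then obtain s v where sv: "s \<in> A" "v \<in> Bx A \<gamma> n" "u ** \<gamma> = s ** \<gamma> [^] n \<oplus> v" unfolding Bx_Suc by auto
 have "s ** \<gamma> [^] n \<in> Bx A \<gamma> n"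
  by (rule Bx_scale[OF A_carrier \<gamma> _ _ pw]) (use sv A_carrier subringE(6)[OF A_subring] in auto)
 then show ?thesis using sv OdD(6) unfolding Od_def by simp
qed

lemma A_Od_mult: assumes "s \<in> A" "u \<in> Od" shows "s ** u \<in> Od"
 unfolding Od_def
 by (rule Bx_scale[OF A_carrier \<gamma>]) (use assms A_carrier subringE(6)[OF A_subring] in \<open>auto simp: Od_def\<close>)

lemma Od_mult: assumes "u \<in> Od" "w \<in> Od" shows "u ** w \<in> Od"
proof -
 have "u ** w \<in> Od" if "u \<in> Bx A \<gamma> m" for u m
  using that
 proof (induction m arbitrary: u)
  case 0
  then show ?case using OdD assms by simp
 next
  case (Suc m)
  then obtain s v where v: "s \<in> A" "v \<in> Bx A \<gamma> m" "u = v ** \<gamma> \<oplus> s" unfolding Bx_Suc'[OF A_carrier \<gamma>] by auto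
  show ?case using v A_carrier Bx_mem_carrier[OF A_carrier \<gamma>] OdD(4) assms \<gamma> OdD(6)[OF Od_gamma_mult[OF Suc.IH[OF v(2)]] A_Od_mult[OF v(1) assms(2)]] unfolding v by (auto simp: r_distr m_ac)
 qed
 then show ?thesis using assms(1) unfolding Od_def by blast
qed

lemma Od_subring: "subring Od R"
 by (rule subringI) (use OdD Od_mult A_Od subringE(3)[OF A_subring] in auto)

lemma Od_carrier: "Od \<subseteq> CR" using subringE(1)[OF Od_subring] .

lemma gamma_Od: "\<gamma> \<in> Od"
proof -
 have "\<one> ** \<gamma> \<in> Od" using Od_gamma_mult[OF subringE(3)[OF Od_subring]] .
 then show ?thesis using \<gamma> by simp
qed

lemma Box_asub: "asub (Box m)" unfolding Box_def by (rule Bx_asub[OF At_asub \<gamma>])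
lemmas BoxD = asubD[OF Box_asub]
lemma Box_finite: "finite (Box m)" unfolding Box_def by (rule Bx_finite[OF At_finite])
lemma Box_mono: "m \<le> m' ==> Box m \<subseteq> Box m'" unfolding Box_def by (rule Bx_mono[OF At_mono])
lemma Box_Od: "Box m \<subseteq> Od" unfolding Box_def Od_def by (rule Bx_mono[OF At_A])

lemma indep_At: "indep (At m) \<gamma> n"
 using indep_A At_A[of m] unfolding indep_def by blast

lemma card_Box: "card (Box m) = q ^ (m * n)"
 unfolding Box_def using card_Bx[OF At_asub \<gamma> indep_At] by (simp add: card_At power_mult)

lemma finite_A_At: "finite S ==> S \<subseteq> A ==> \<exists>m. S \<subseteq> At m"
proof (induction S rule: finite_induct)
 case (insert s S)
 then obtain m m' where "S \<subseteq> At m" "s \<in> At m'" using A_eq by auto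
 then show ?case using At_mono[of m "max m m'"] At_mono[of m' "max m m'"] by auto
qed simp

lemma Od_Box: assumes "u \<in> Od" obtains m where "u \<in> Box m"
proof -
 obtain p where p: "set p \<subseteq> A" "length p = n" "u = eval p \<gamma>" using assms unfolding Od_def Bx_def by auto
 obtain m where "set p \<subseteq> At m" using finite_A_At[of "set p"] p by auto
 then show ?thesis using p that unfolding Box_def Bx_def by blast
qed

lemma finite_Od_Box: "finite S ==> S \<subseteq> Od ==> \<exists>m. S \<subseteq> Box m"
proof (induction S rule: finite_induct)
 case (insert s S)
 then obtain m m' where "S \<subseteq> Box m" "s \<in> Box m'" using Od_Box by (metis insert_subset)
 then show ?case using Box_mono[of m "max m m'"] Box_mono[of m' "max m m'"] by auto
qed simp

definition c1 where "c1 = (SOME m. \<gamma> [^] n \<in> Box m)"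
text \<open>The loss in a product of two boxes: each Horner step multiplies by
  \<open>\<gamma>\<close> and costs \<open>c1\<close>, and there are \<open>n\<close> steps, see
  \<open>Box_mult\<close>.\<close>

definition c0 where "c0 = n * c1"

lemma c1: "\<gamma> [^] n \<in> Box c1"
proof -
 obtain m where "\<gamma> [^] n \<in> Box m" using Od_Box pw unfolding Od_def by blast
 then show ?thesis unfolding c1_def by (rule someI)
qed

lemma At_Box_mult: assumes "s \<in> At (Suc a)" "u \<in> Box b" shows "s ** u \<in> Box (a + b)"
 unfolding Box_def
 by (rule Bx_scale[OF AtD(1) \<gamma> AtD(4)[OF assms(1)] _ assms(2)[unfolded Box_def]]) (use At_mult assms in auto)

lemma Box_gamma_mult: assumes "u \<in> Box b" shows "u ** \<gamma> \<in> Box (b + c1)"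
proof -
 have "u ** \<gamma> \<in> Bx (At b) \<gamma> (Suc n)"
  using assms Bx_x_mult[OF AtD(2,1) \<gamma>] unfolding Box_def by blast
 then obtain s v where sv: "s \<in> At b" "v \<in> Box b" "u ** \<gamma> = s ** \<gamma> [^] n \<oplus> v" unfolding Bx_Suc Box_def by auto
 have 1: "s ** \<gamma> [^] n \<in> Box (b + c1)" using sv At_mono[of b "Suc b"] At_Box_mult c1 by auto
 have 2: "v \<in> Box (b + c1)" using sv Box_mono[of b "b + c1"] by auto
 show ?thesis using sv BoxD(6)[OF 1 2] by simp
qed

lemma Box_mult: assumes "u \<in> Box a" "w \<in> Box b" shows "u ** w \<in> Box (a + b + c0)"
proof -
 have "u ** w \<in> Box (a + b + m * c1)" if "u \<in> Bx (At a) \<gamma> m" for u m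
  using that
 proof (induction m arbitrary: u)
  case 0
  then show ?case using BoxD assms by simp
 next
  case (Suc m)
  then obtain s v where v: "s \<in> At a" "v \<in> Bx (At a) \<gamma> m" "u = v ** \<gamma> \<oplus> s" unfolding Bx_Suc'[OF AtD(1) \<gamma>] by auto
  have 1: "(v ** w) ** \<gamma> \<in> Box (a + b + Suc m * c1)"
   using Box_gamma_mult[OF Suc.IH[OF v(2)]] by (simp add: ac_simps)
  have 2: "s ** w \<in> Box (a + b + Suc m * c1)" using v At_mono[of a "Suc a"] At_Box_mult assms Box_mono[of "a+b" "a + b + Suc m * c1"] by force
  show ?case using v AtD(4) Bx_mem_carrier[OF AtD(1) \<gamma>] BoxD(4) assms \<gamma> BoxD(6)[OF 1 2] unfolding v by (simp add: r_distr m_ac)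
 qed
 then show ?thesis using assms(1) unfolding Box_def c0_def by blast
qed

lemma Box_Suc_T: assumes "w \<in> Box (Suc m)" shows "\<exists>u\<in>Box m. \<exists>v\<in>Box (Suc 0). w = u ** T \<oplus> v"
proof -
 have "\<exists>u\<in>Bx (At m) \<gamma> l. \<exists>v\<in>Bx (At (Suc 0)) \<gamma> l. w = u ** T \<oplus> v" if "w \<in> Bx (At (Suc m)) \<gamma> l" for w l
  using that
 proof (induction l arbitrary: w)
  case 0
  then show ?case using T by simp
 next
  case (Suc l)
  then obtain s x where sx: "s \<in> At (Suc m)" "x \<in> Bx (At (Suc m)) \<gamma> l" "w = s ** \<gamma> [^] l \<oplus> x" unfolding Bx_Suc by auto
  obtain u v where uv: "u \<in> Bx (At m) \<gamma> l" "v \<in> Bx (At (Suc 0)) \<gamma> l" "x = u ** T \<oplus> v" using Suc.IH[OF sx(2)] by blast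
  obtain s1 s2 where s: "s1 \<in> At m" "s2 \<in> k" "s = s1 ** T \<oplus> s2" using sx(1) unfolding At_Suc' by auto
  have "w = (s1 ** \<gamma> [^] l \<oplus> u) ** T \<oplus> (s2 ** \<gamma> [^] l \<oplus> v)"
   using uv s Bx_mem_carrier[OF AtD(1) \<gamma>] AtD(4) k_carrier \<gamma> T unfolding sx(3) uv(3) s(3) by (auto simp: r_distr m_ac a_ac)
  moreover have "s1 ** \<gamma> [^] l \<oplus> u \<in> Bx (At m) \<gamma> (Suc l)" unfolding Bx_Suc using s uv by blast
  ultimately show ?case using s uv At_1 unfolding Bx_Suc by blast
 qed
 then show ?thesis using assms unfolding Box_def by blast
qed

text \<open>An element of \<open>A\<close> multiplies every coordinate separately, so degrees add up
  exactly and no \<open>c0\<close> appears, in contrast to \<open>Box_mult\<close>.\<close>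

lemma Box_div:
 assumes a: "dege d a" and w: "w \<in> Od" and aw: "a ** w \<in> Box (d + m)"
 shows "w \<in> Box m"
proof -
 obtain p where p: "set p \<subseteq> A" "length p = n" "w = eval p \<gamma>" using w unfolding Od_def Bx_def by auto
 obtain p' where p': "set p' \<subseteq> At (d + m)" "length p' = n" "a ** w = eval p' \<gamma>" using aw unfolding Box_def Bx_def by auto
 have aA: "a \<in> A" using dege_A[OF a] .
 have pc: "set p \<subseteq> CR" "a \<in> CR" using p A_carrier aA by auto
 have "map ((\<otimes>) a) p = p'"
 proof (rule Bx_coords_unique[OF A_asub \<gamma> indep_A])
  show "set (map ((\<otimes>) a) p) \<subseteq> A" using p aA subringE(6)[OF A_subring] by auto
  show "length (map ((\<otimes>) a) p) = n" "length p' = n" using p p' by auto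
  show "set p' \<subseteq> A" using p' At_A by blast
  show "eval (map ((\<otimes>) a) p) \<gamma> = eval p' \<gamma>" using eval_scale[OF pc(2) \<gamma> pc(1)] p p' by simp
 qed
 then have s: "a ** s \<in> At (d + m)" if "s \<in> set p" for s using p'(1) that by auto
 have "s \<in> At m" if sp: "s \<in> set p" for s
 proof (cases "s = \<zero>")
  case False
  then obtain e where e: "dege e s" using dege_exists p(1) sp by blast
  have "d + e < d + m" using dege_At[OF dege_mult[OF a e] s[OF sp]] .
  then show ?thesis using e At_mono[of "Suc e" m] unfolding dege_def by auto
 qed (use AtD(2) in simp)
 then show ?thesis unfolding Box_def Bx_def using p by auto
qed

lemma Od_div:
 assumes a: "dege d a" and w: "w \<in> Od"
 shows "\<exists>u\<in>Od. \<exists>v\<in>Box d. w = a ** u \<oplus> v"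
proof -
 have ac: "a \<in> CR" using dege_A[OF a] A_carrier by auto
 have "\<exists>u\<in>Bx A \<gamma> l. \<exists>v\<in>Bx (At d) \<gamma> l. w = a ** u \<oplus> v" if "w \<in> Bx A \<gamma> l" for w l
  using that
 proof (induction l arbitrary: w)
  case 0
  then show ?case using ac by simp
 next
  case (Suc l)
  then obtain s x where sx: "s \<in> A" "x \<in> Bx A \<gamma> l" "w = s ** \<gamma> [^] l \<oplus> x" unfolding Bx_Suc by auto
  obtain u v where uv: "u \<in> Bx A \<gamma> l" "v \<in> Bx (At d) \<gamma> l" "x = a ** u \<oplus> v" using Suc.IH[OF sx(2)] by blast
  obtain s1 s2 where s: "s1 \<in> A" "s2 \<in> At d" "s = a ** s1 \<oplus> s2" using A_div[OF a sx(1)] by blast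
  have c: "u \<in> CR" "v \<in> CR" "s1 \<in> CR" "s2 \<in> CR" "\<gamma> [^] l \<in> CR"
   using uv s Bx_mem_carrier[OF AtD(1) \<gamma>] Bx_mem_carrier[OF A_carrier \<gamma>] AtD(4) A_carrier \<gamma> by auto
  have "w = a ** (s1 ** \<gamma> [^] l \<oplus> u) \<oplus> (s2 ** \<gamma> [^] l \<oplus> v)"
   unfolding sx(3) uv(3) s(3) using c ac by (simp add: r_distr m_ac a_ac)
  then show ?case using s uv unfolding Bx_Suc by blast
 qed
 then show ?thesis using w unfolding Box_def Od_def by blast
qed

lemma asub_mult: assumes "asub V" "x \<in> CR" shows "asub ((\<otimes>) x ` V)"
unfolding asub_def
proof (intro conjI ballI)
 note v = asubD[OF assms(1)]
 show "(\<otimes>) x ` V \<subseteq> CR" using v assms by auto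
 show "\<zero> \<in> (\<otimes>) x ` V" using v(2) assms by force
 fix y z assume "y \<in> (\<otimes>) x ` V" "z \<in> (\<otimes>) x ` V"
 then obtain y' z' where y: "y' \<in> V" "z' \<in> V" "y = x ** y'" "z = x ** z'" by auto
 have "y \<ominus> z = x ** (y' \<ominus> z')" using v(4) assms(2) y by algebra
 then show "y \<ominus> z \<in> (\<otimes>) x ` V" using v(3)[OF y(1,2)] by blast
qed

lemma mult_cancel: "x \<in> CR ==> y \<in> CR ==> z \<in> CR ==> x ~= \<zero> ==> x ** y = x ** z ==> y = z"
 using m_lcancel by blast

text \<open>The index of \<open>x \<O>\<close> in \<open>\<O>\<close> is bounded in terms of the size of \<open>x\<close>.\<close>

lemma index_le:
 assumes x: "x \<in> Box m" "x ~= \<zero>" and W: "finite W" "W \<subseteq> Od"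
  and sep: "!!w w' u. w \<in> W ==> w' \<in> W ==> u \<in> Od ==> w \<ominus> w' = x ** u ==> w = w'"
 shows "card W \<le> q ^ (n * (m + c0))"
proof -
 obtain J where J: "W \<subseteq> Box J" using finite_Od_Box[OF W] by blast
 have xc: "x \<in> CR" using BoxD(4) x by blast
 \<comment> \<open>The sums \<open>w + x v\<close> are distinct elements of
   \<open>Box (m + J + c0)\<close>. The factor \<open>q ^ (J * n)\<close> occurs on both sides and
   cancels, so the choice of \<open>J\<close> is immaterial.\<close>
 have "inj_on (%(w,v). w \<oplus> x ** v) (W \<times> Box J)"
 proof (rule inj_onI, clarify)
  fix w v w' v' assume a: "w \<in> W" "v \<in> Box J" "w' \<in> W" "v' \<in> Box J" and e: "w \<oplus> x ** v = w' \<oplus> x ** v'"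
  have c: "w \<in> CR" "w' \<in> CR" "v \<in> CR" "v' \<in> CR" using a W Od_carrier BoxD(4) by auto
  have "w \<ominus> w' = (w \<oplus> x ** v) \<ominus> x ** v \<ominus> w'" using c xc by algebra
  also have "\<dots> = x ** (v' \<ominus> v)" unfolding e using c xc by algebra
  finally have e1: "w \<ominus> w' = x ** (v' \<ominus> v)" .
  then have "w = w'" using sep[OF a(1,3)] BoxD(3)[OF a(4,2)] Box_Od by blast
  moreover have "v = v'"
  proof -
   have "x ** v = x ** v'" using e \<open>w = w'\<close> c xc by simp
   then show ?thesis using mult_cancel[OF xc] c x(2) by blast
  qed
  ultimately show "w = w' \<and> v = v'" by simp
 qed
 moreover have "(%(w,v). w \<oplus> x ** v) ` (W \<times> Box J) \<subseteq> Box (m + J + c0)"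
 proof clarify
  fix w v assume "w \<in> W" "v \<in> Box J"
  then have "w \<in> Box (m + J + c0)" "x ** v \<in> Box (m + J + c0)"
   using J Box_mono[of J "m + J + c0"] Box_mult[OF x(1)] by auto
  then show "w \<oplus> x ** v \<in> Box (m + J + c0)" by (rule BoxD(6))
 qed
 ultimately have "card (W \<times> Box J) \<le> card (Box (m + J + c0))"
  by (rule card_inj_on_le) (rule Box_finite)
 then have "card W * q ^ (J * n) \<le> q ^ (n * (m + c0)) * q ^ (J * n)"
  by (simp add: card_cartesian_product card_Box algebra_simps flip: power_add)
 then show ?thesis using q_gt by simp
qed

text \<open>Pigeonhole in place of a norm: \<open>At M\<close> has more elements than there can be
  classes modulo \<open>x\<close>, so two of them differ by a multiple of \<open>x\<close>.\<close>

lemma A_inter_multiples: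
 assumes x: "x \<in> Od" "x ~= \<zero>"
 obtains \<delta> u where "\<delta> \<in> A" "\<delta> ~= \<zero>" "u \<in> Od" "\<delta> = x ** u"
proof -
 obtain m where m: "x \<in> Box m" using Od_Box x by blast
 define M where "M = n * (m + c0) + 1"
 have "\<not> (\<forall>w\<in>At M. \<forall>w'\<in>At M. \<forall>u\<in>Od. w \<ominus> w' = x ** u --> w = w')"
 proof
  assume "\<forall>w\<in>At M. \<forall>w'\<in>At M. \<forall>u\<in>Od. w \<ominus> w' = x ** u --> w = w'"
  then have "card (At M) \<le> q ^ (n * (m + c0))"
   by (intro index_le[OF m x(2) At_finite]) (use At_A A_Od in blast)+
  then show False unfolding card_At M_def using q_gt by simp
 qed
 then obtain w w' u where w: "w \<in> At M" "w' \<in> At M" "u \<in> Od" "w \<ominus> w' = x ** u" "w ~= w'" by blast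
 have "w \<ominus> w' \<in> A" using AtD(3)[OF w(1,2)] At_A by blast
 then show ?thesis using w minus_zero_iff AtD(4) that by blast
qed

end

subsection \<open>Residue rings and the norm of a prime\<close>

context domain
begin

lemma coset_sub:
 assumes B: "subring B R" and I: "idl B I" and x: "x \<in> B"
 shows "I +>\<^bsub>sub B\<^esub> x = {y \<in> B. y \<ominus> x \<in> I}"
proof
 note i = idlD[OF I] and b = subringE[OF B]
 have xc: "x \<in> CR" using x b(1) by blast
 show "I +>\<^bsub>sub B\<^esub> x \<subseteq> {y \<in> B. y \<ominus> x \<in> I}"
 proof
  fix y assume "y \<in> I +>\<^bsub>sub B\<^esub> x"
  then obtain h where h: "h \<in> I" "y = h \<oplus> x" unfolding a_r_coset_def' by auto
  have "h \<oplus> x \<ominus> x = h" using i(6)[OF h(1)] xc by algebra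
  then show "y \<in> {y \<in> B. y \<ominus> x \<in> I}" using h b(7) i(5) x by auto
 qed
 show "{y \<in> B. y \<ominus> x \<in> I} \<subseteq> I +>\<^bsub>sub B\<^esub> x"
 proof
  fix y assume y: "y \<in> {y \<in> B. y \<ominus> x \<in> I}"
  then have "y \<in> CR" using b(1) by auto
  then have "y = (y \<ominus> x) \<oplus> x" using xc by algebra
  then show "y \<in> I +>\<^bsub>sub B\<^esub> x" unfolding a_r_coset_def' using y by auto
 qed
qed

lemma coset_sub_eq_iff:
 assumes B: "subring B R" and I: "idl B I" and x: "x \<in> B" "y \<in> B"
 shows "I +>\<^bsub>sub B\<^esub> x = I +>\<^bsub>sub B\<^esub> y \<longleftrightarrow> x \<ominus> y \<in> I"
proof
 note i = idlD[OF I] and b = subringE[OF B]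
 have c: "x \<in> CR" "y \<in> CR" using x b(1) by auto
 show "x \<ominus> y \<in> I" if "I +>\<^bsub>sub B\<^esub> x = I +>\<^bsub>sub B\<^esub> y"
 proof -
  have "x \<ominus> x = \<zero>" using c by algebra
  then have "x \<in> I +>\<^bsub>sub B\<^esub> x" unfolding coset_sub[OF B I x(1)] using x i(4) by simp
  then show ?thesis unfolding that unfolding coset_sub[OF B I x(2)] by simp
 qed
 assume xy: "x \<ominus> y \<in> I"
 show "I +>\<^bsub>sub B\<^esub> x = I +>\<^bsub>sub B\<^esub> y"
  unfolding coset_sub[OF B I x(1)] coset_sub[OF B I x(2)]
 proof (rule Collect_cong, rule conj_cong[OF refl])
  fix z assume "z \<in> B"
  then have z: "z \<in> CR" using b(1) by auto
  have 1: "z \<ominus> y = (z \<ominus> x) \<oplus> (x \<ominus> y)" and 2: "z \<ominus> x = (z \<ominus> y) \<ominus> (x \<ominus> y)" using z c by algebra+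
  show "z \<ominus> x \<in> I \<longleftrightarrow> z \<ominus> y \<in> I"
   using i(7)[OF _ xy, of "z \<ominus> x"] i(8)[OF _ xy, of "z \<ominus> y"] 1 2 by metis
 qed
qed

lemma carrier_Quot_sub: "carrier (sub B Quot I) = (%x. I +>\<^bsub>sub B\<^esub> x) ` B"
 unfolding FactRing_def A_RCOSETS_def' by auto

lemma Quot_field:
 assumes B: "subring B R" and P: "prm B P" and inv: "!!y. y \<in> B ==> y \<notin> P ==> \<exists>z\<in>B. z ** y \<ominus> \<one> \<in> P"
 shows "field (sub B Quot P)"
proof -
 interpret P: primeideal P "sub B" using prm_iff[OF B] P by blast
 interpret Q: domain "sub B Quot P" by (rule P.quotient_is_domain)
 show ?thesis
 proof (rule Q.cring_fieldI2)
  fix a assume a: "a \<in> carrier (sub B Quot P)" "a ~= \<zero>\<^bsub>sub B Quot P\<^esub>"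
  then obtain y where y: "y \<in> B" "a = P +>\<^bsub>sub B\<^esub> y" unfolding carrier_Quot_sub by auto
  have "y \<notin> P"
  proof
   assume "y \<in> P"
   then have "a = P" unfolding y(2) using P.a_rcos_zero[OF P.ideal_axioms] by simp
   then show False using a(2) by (simp add: FactRing_def)
  qed
  then obtain z where z: "z \<in> B" "z ** y \<ominus> \<one> \<in> P" using inv y by blast
  have zy: "z ** y = y ** z" using z y subringE(1)[OF B] m_comm by blast
  show "\<exists>b\<in>carrier (sub B Quot P). a \<otimes>\<^bsub>sub B Quot P\<^esub> b = \<one>\<^bsub>sub B Quot P\<^esub>"
   using P.rcoset_mult_add[of y z] y z coset_sub_eq_iff[OF B prmD(1)[OF P], of "y ** z" \<one>] subringE(3,6)[OF B] zy z(1) unfolding carrier_Quot_sub by (auto simp: FactRing_def)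
 qed simp
qed

end

context fq_poly
begin

lemma card_Quot_A:
 assumes p: "idl A p" "p ~= {\<zero>}"
 shows "finite (carrier (sub A Quot p))" "card (carrier (sub A Quot p)) = q ^ dgi p"
proof -
 let ?c = "%x. p +>\<^bsub>sub A\<^esub> x"
 obtain \<pi> where r: "!!a. a \<in> A ==> \<exists>r\<in>At (dgi p). a \<ominus> r \<in> p" using idl_gen[OF p] by metis
 have e: "carrier (sub A Quot p) = ?c ` At (dgi p)"
  unfolding carrier_Quot_sub
 proof
  show "?c ` A \<subseteq> ?c ` At (dgi p)"
  proof (rule image_subsetI)
   fix a assume a: "a \<in> A"
   obtain s where s: "s \<in> At (dgi p)" "a \<ominus> s \<in> p" using r[OF a] by blast
   then show "?c a \<in> ?c ` At (dgi p)" using At_A coset_sub_eq_iff[OF A_subring p(1) a] s(2) s(1) by blast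
  qed
  show "?c ` At (dgi p) \<subseteq> ?c ` A" using At_A by blast
 qed
 moreover have "inj_on ?c (At (dgi p))"
 proof (rule inj_onI)
  fix x y assume a: "x \<in> At (dgi p)" "y \<in> At (dgi p)" "?c x = ?c y"
  show "x = y" using a At_A At_reps_unique[OF p a(1,2)] coset_sub_eq_iff[OF A_subring p(1)] a(3) by force
 qed
 ultimately show "finite (carrier (sub A Quot p))" "card (carrier (sub A Quot p)) = q ^ dgi p"
  by (auto simp: At_finite card_image card_At)
qed

text \<open>Lagrange's theorem for the unit group of the residue field, of order
  \<open>q ^ dgi p - 1\<close>.\<close>

lemma fermat:
 assumes p: "prm A p" "p ~= {\<zero>}" and a: "a \<in> A"
 shows "a [^] (q ^ dgi p) \<ominus> a \<in> p"
proof (cases "a \<in> p")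
 case True
 have "q ^ dgi p = Suc (q ^ dgi p - 1)" using q_gt by simp
 then obtain m where m: "q ^ dgi p = Suc m" by blast
 show ?thesis using idlD(3)[OF prmD(1)[OF p(1)] _ True] subring_pow[OF A_subring a] idlD(8)[OF prmD(1)[OF p(1)]] True unfolding m by simp
next
 case False
 interpret P: primeideal p "sub A" using prm_iff[OF A_subring] p by blast
 let ?Q = "sub A Quot p"
 interpret Q: field ?Q by (rule Quot_field[OF A_subring p(1) prm_A_inv[OF p]])
 interpret G: group "Multiplicative_Group.mult_of ?Q" by (rule Q.field_mult_group)
 interpret h: ring_hom_ring "sub A" ?Q "(+>\<^bsub>sub A\<^esub>) p" by (rule P.rcos_ring_hom_ring)
 let ?c = "%x. p +>\<^bsub>sub A\<^esub> x"
 note eq = coset_sub_eq_iff[OF A_subring prmD(1)[OF p(1)]]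
 have z: "\<zero>\<^bsub>?Q\<^esub> = ?c \<zero>" using h.hom_zero by simp
 have "?c a ~= \<zero>\<^bsub>?Q\<^esub>" unfolding z using eq[OF a subringE(2)[OF A_subring]] False a A_carrier by (auto simp: minus_eq)
 then have ca: "?c a \<in> carrier (Multiplicative_Group.mult_of ?Q)" using a by simp
 have fQ: "finite (carrier ?Q)" using card_Quot_A[OF prmD(1)[OF p(1)] p(2)] by blast
 have o: "order (Multiplicative_Group.mult_of ?Q) = q ^ dgi p - 1"
  unfolding order_def using card_Quot_A[OF prmD(1)[OF p(1)] p(2)] by simp
 have "?c a [^]\<^bsub>?Q\<^esub> (q ^ dgi p) = ?c a [^]\<^bsub>?Q\<^esub> (q ^ dgi p - 1) \<otimes>\<^bsub>?Q\<^esub> ?c a"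
 proof -
  have "q ^ dgi p = Suc (q ^ dgi p - 1)" using q_gt by simp
  then show ?thesis by (metis Q.nat_pow_Suc)
 qed
 then show ?thesis using G.pow_order_eq_1[OF ca] ca h.hom_nat_pow[of a "q ^ dgi p"] a eq[OF subring_pow[OF A_subring a] a] unfolding o by (simp add: nat_pow_def)
qed

lemma T_pow_minus_T: "i > 1 ==> dege i (T [^] i \<ominus> T)"
proof -
 assume i: "i > 1"
 have "\<one> ** T [^] (1::nat) \<in> At (Suc 1)" by (rule T_pow_At) (use subringE(3)[OF subring_k] in auto)
 then have 1: "\<ominus> T \<in> At i" using T AtD(5) At_mono[of "Suc 1" i] i by auto
 have e: "T [^] i \<ominus> T = \<one> ** T [^] i \<oplus> (\<ominus> T)" using T by (simp add: minus_eq)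
 have o: "\<one> \<in> k" using subringE(3)[OF subring_k] .
 show ?thesis unfolding e dege_def using dege_lead[OF o 1] o 1 At_Suc[of i] by auto
qed

end

subsection \<open>Primes of an order\<close>

context fq_order
begin

text \<open>\<open>np P\<close>: \<open>P\<close> is a nonzero prime; \<open>H1 P\<close>: moreover \<open>P\<close> has residue degree one over \<open>A\<close>.\<close>

definition np where "np P \<longleftrightarrow> prm Od P \<and> P \<inter> A ~= {\<zero>}"
definition H1 where "H1 P \<longleftrightarrow> np P \<and> (\<forall>y\<in>Od. \<exists>a\<in>A. y \<ominus> a \<in> P)"
text \<open>The degree of the prime of \<open>A\<close> below \<open>P\<close>, not the degree of
  \<open>P\<close> itself; for nonzero primes the two agree exactly when
  \<open>H1 P\<close>.\<close>

definition dP where "dP P = dgi (P \<inter> A)"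

lemma npD:
 assumes "np P"
 shows "prm Od P" "idl Od P" "prm A (P \<inter> A)" "idl A (P \<inter> A)" "P \<inter> A ~= {\<zero>}"
 using assms prm_restrict[OF _ A_Od A_subring] prmD(1) unfolding np_def by blast+

text \<open>A generator of the prime below lies in \<open>P\<close>, so \<open>Box (dP P)\<close>
  meets every class modulo \<open>P\<close>, and the residue ring is a finite domain.\<close>

lemma np_inv:
 assumes P: "np P" and y: "y \<in> Od" "y \<notin> P"
 shows "\<exists>z\<in>Od. z ** y \<ominus> \<one> \<in> P"
proof -
 obtain \<pi> where pi: "\<pi> \<in> P \<inter> A" "dege (dP P) \<pi>" using idl_gen[OF npD(4,5)[OF P]] unfolding dP_def by metis
 have pc: "\<pi> \<in> CR" using pi A_carrier by blast
 show ?thesis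
 proof (rule prm_finite_index_inv[OF Od_subring npD(1)[OF P] Box_finite _ _ y])
  show "Box (dP P) \<subseteq> CR" using BoxD(1) .
  fix w assume "w \<in> Od"
  then obtain u v where uv: "u \<in> Od" "v \<in> Box (dP P)" "w = \<pi> ** u \<oplus> v" using Od_div[OF pi(2)] by blast
  have "w \<ominus> v = u ** \<pi>" using uv OdD(4) BoxD(4) pc unfolding uv(3) by algebra
  then show "\<exists>v\<in>Box (dP P). w \<ominus> v \<in> P" using idlD(3)[OF npD(2)[OF P] uv(1)] pi uv(2) by force
 qed
qed

lemma np_maximal:
 assumes P: "np P" "np P'" "P \<subseteq> P'" shows "P = P'"
proof (rule ccontr)
 assume "P ~= P'"
 then obtain y where y: "y \<in> P'" "y \<notin> P" using P by blast
 have yO: "y \<in> Od" using y idlD(5)[OF npD(2)[OF P(2)]] by blast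
 obtain z where z: "z \<in> Od" "z ** y \<ominus> \<one> \<in> P" using np_inv[OF P(1) yO y(2)] by blast
 have zy: "z ** y \<in> P'" using idlD(3)[OF npD(2)[OF P(2)] z(1) y(1)] .
 have "z ** y \<ominus> (z ** y \<ominus> \<one>) \<in> P'" using idlD(8)[OF npD(2)[OF P(2)] zy] z P(3) by blast
 moreover have "z ** y \<ominus> (z ** y \<ominus> \<one>) = \<one>"
 proof -
  have "z \<in> CR" "y \<in> CR" using z yO Od_carrier by auto
  then show ?thesis by algebra
 qed
 ultimately show False using prmD(2)[OF npD(1)[OF P(2)]] by simp
qed

text \<open>The Chinese remainder theorem in the form of an element that is 1 at one prime and 0 at
  the others. A product of elements outside \<open>P0\<close> is found first and then inverted
  modulo \<open>P0\<close>.\<close>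

lemma comaximal:
 assumes "finite \<P>" "np P0" "!!P. P \<in> \<P> ==> np P" "P0 \<notin> \<P>"
 shows "\<exists>e\<in>Od. e \<ominus> \<one> \<in> P0 \<and> (\<forall>P\<in>\<P>. e \<in> P)"
proof -
 have "\<exists>y\<in>Od. y \<notin> P0 \<and> (\<forall>P\<in>\<P>. y \<in> P)"
  using assms
 proof (induction \<P> rule: finite_induct)
  case empty
  then show ?case using prmD(2)[OF npD(1)] subringE(3)[OF Od_subring] by blast
 next
  case (insert P \<P>)
  then obtain y where y: "y \<in> Od" "y \<notin> P0" "\<forall>P\<in>\<P>. y \<in> P" by blast
  have nP: "np P" using insert by blast
  obtain z where z: "z \<in> P" "z \<notin> P0" using np_maximal[OF nP insert.prems(1)] insert by blast
  have zO: "z \<in> Od" using z idlD(5)[OF npD(2)[OF nP]] by blast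
  have c: "y \<in> CR" "z \<in> CR" using y zO Od_carrier by auto
  have "z ** y \<notin> P0" using prmD(3)[OF npD(1)[OF insert.prems(1)] zO y(1)] y z by blast
  moreover have "y ** z \<in> P" using idlD(3)[OF npD(2)[OF nP] y(1) z(1)] .
  then have "z ** y \<in> P" using m_comm c by simp
  moreover have "z ** y \<in> P'" if "P' \<in> \<P>" for P'
   using idlD(3)[OF npD(2) zO] insert.prems(2) that y(3) by blast
  ultimately show ?case using Od_mult[OF zO y(1)] by blast
 qed
 then obtain y where y: "y \<in> Od" "y \<notin> P0" "\<forall>P\<in>\<P>. y \<in> P" by blast
 obtain z where z: "z \<in> Od" "z ** y \<ominus> \<one> \<in> P0" using np_inv[OF assms(2) y(1,2)] by blast
 have "z ** y \<in> P" if "P \<in> \<P>" for P using idlD(3)[OF npD(2) z(1)] assms(3) that y(3) by blast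
 then show ?thesis using z Od_mult[OF z(1) y(1)] by blast
qed

text \<open>The Chinese remainder theorem as a lower bound for an index: choices of incongruent
  representatives at the single primes combine to elements that the family of primes still tells
  apart.\<close>

lemma separated_set:
 assumes "finite \<P>" "!!P. P \<in> \<P> ==> np P"
  and S: "!!P. P \<in> \<P> ==> finite (S P) \<and> S P \<subseteq> Od"
   "!!P s s'. P \<in> \<P> ==> s \<in> S P ==> s' \<in> S P ==> s \<ominus> s' \<in> P ==> s = s'"
 shows "\<exists>W. finite W \<and> W \<subseteq> Od \<and> card W = (\<Prod>P\<in>\<P>. card (S P)) \<and>
  (\<forall>w\<in>W. \<forall>w'\<in>W. (\<forall>P\<in>\<P>. w \<ominus> w' \<in> P) --> w = w')"
 using assms
proof (induction \<P> rule: finite_induct)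
 case empty
 then show ?case using subringE(2)[OF Od_subring] by (intro exI[of _ "{\<zero>}"]) auto
next
 case (insert P \<P>)
 have "\<exists>W. finite W \<and> W \<subseteq> Od \<and> card W = (\<Prod>P\<in>\<P>. card (S P)) \<and>
  (\<forall>w\<in>W. \<forall>w'\<in>W. (\<forall>P\<in>\<P>. w \<ominus> w' \<in> P) --> w = w')"
  by (rule insert.IH; rule insert.prems; assumption?) (rule insertI2, assumption)+
 then obtain W where W: "finite W" "W \<subseteq> Od" "card W = (\<Prod>P\<in>\<P>. card (S P))"
  "\<forall>w\<in>W. \<forall>w'\<in>W. (\<forall>P\<in>\<P>. w \<ominus> w' \<in> P) --> w = w'" by blast
 have nP: "np P" using insert by blast
 obtain e where e: "e \<in> Od" "e \<ominus> \<one> \<in> P" "\<forall>P\<in>\<P>. e \<in> P"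
  using comaximal[OF insert.hyps(1) nP insert.prems(1)[OF insertI2] insert.hyps(2)] by blast
 have SP: "finite (S P)" "S P \<subseteq> Od" using insert.prems(2)[of P] by auto
 have ec: "e \<in> CR" using e Od_carrier by blast
 \<comment> \<open>As \<open>e\<close> is 1 modulo \<open>P\<close> and 0 modulo the other primes,
   this is \<open>s\<close> modulo \<open>P\<close> and \<open>w\<close> modulo the others.\<close>
 define g where "g = (%(w,s). w \<oplus> e ** (s \<ominus> w))"
 have key: "w = w' \<and> s = s'" if a: "w \<in> W" "w' \<in> W" "s \<in> S P" "s' \<in> S P"
  and m: "\<forall>P'\<in>insert P \<P>. g (w,s) \<ominus> g (w',s') \<in> P'" for w w' s s'
 proof
  have O: "w \<in> Od" "w' \<in> Od" "s \<in> Od" "s' \<in> Od" using a W SP by auto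
  then have c: "w \<in> CR" "w' \<in> CR" "s \<in> CR" "s' \<in> CR" using Od_carrier by auto
  define f where "f = (s \<ominus> w) \<ominus> (s' \<ominus> w')"
  have fO: "f \<in> Od" unfolding f_def by (intro subring_minus[OF Od_subring] O)
  have ge: "g (w,s) \<ominus> g (w',s') = (w \<ominus> w') \<oplus> e ** f" unfolding g_def f_def using c ec by simp algebra
  have gc: "(w \<ominus> w') \<in> CR" "f \<in> CR" using c fO Od_carrier by auto
  have "w \<ominus> w' \<in> P'" if P': "P' \<in> \<P>" for P'
  proof -
   have i: "idl Od P'" using npD(2) insert.prems(1) P' by blast
   have "(w \<ominus> w') = (g (w,s) \<ominus> g (w',s')) \<ominus> f ** e" unfolding ge using gc ec by algebra
   then show ?thesis using idlD(3)[OF i fO] e P' idlD(8)[OF i] m by simp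
  qed
  then show w: "w = w'" using W(4) a by blast
  have i: "idl Od P" using npD(2)[OF nP] .
  have "f ** (e \<ominus> \<one>) \<in> P" using idlD(3)[OF i fO e(2)] .
  moreover have "s \<ominus> s' = (g (w,s) \<ominus> g (w',s')) \<ominus> f ** (e \<ominus> \<one>)"
   unfolding ge unfolding f_def w using c ec by algebra
  ultimately show "s = s'" using idlD(8)[OF i] m insert.prems(3)[of P s s'] a by simp
 qed
 have inj: "inj_on g (W \<times> S P)"
 proof (rule inj_onI)
  fix x y assume a: "x \<in> W \<times> S P" "y \<in> W \<times> S P" "g x = g y"
  obtain w s w' s' where xy: "x = (w,s)" "y = (w',s')" by (cases x, cases y) auto
  have O: "w' \<in> Od" "s' \<in> Od" using a W SP xy by auto
  then have "g y \<in> CR" unfolding xy g_def using Od_carrier ec by auto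
  then have "g x \<ominus> g y = \<zero>" using a(3) by (simp add: r_neg)
  moreover have "\<forall>P'\<in>insert P \<P>. \<zero> \<in> P'" using idlD(4) npD(2) insert.prems(1) by blast
  ultimately show "x = y" using key[of w w' s s'] a xy by auto
 qed
 have sub: "g ` (W \<times> S P) \<subseteq> Od"
 proof clarify
  fix w s assume "w \<in> W" "s \<in> S P"
  then have "w \<in> Od" "s \<in> Od" using W SP by auto
  then show "g (w,s) \<in> Od" unfolding g_def using subring_minus[OF Od_subring] OdD(6) Od_mult e(1) by auto
 qed
 have "card (g ` (W \<times> S P)) = (\<Prod>P\<in>insert P \<P>. card (S P))"
  unfolding card_image[OF inj] using insert W by simp
 moreover have "finite (g ` (W \<times> S P))" using W SP by auto
 moreover have "\<forall>x\<in>g ` (W \<times> S P). \<forall>y\<in>g ` (W \<times> S P). (\<forall>P\<in>insert P \<P>. x \<ominus> y \<in> P) --> x = y"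
  using key by (auto; metis)
 ultimately show ?case using sub by (intro exI[of _ "g ` (W \<times> S P)"]) auto
qed

text \<open>Stands in for the factorization of the ideal generated by \<open>x\<close>: elements
  congruent modulo \<open>x\<close> are congruent modulo every prime containing \<open>x\<close>, so
  the set from \<open>separated_set\<close> is also separated modulo \<open>x\<close>, and
  \<open>index_le\<close> bounds its size.\<close>

lemma sum_dP_le:
 assumes x: "x \<in> Box m" "x ~= \<zero>" and P: "finite \<P>" "!!P. P \<in> \<P> ==> np P \<and> x \<in> P"
 shows "(\<Sum>P\<in>\<P>. dP P) \<le> n * (m + c0)"
proof -
 obtain W where W: "finite W" "W \<subseteq> Od" "card W = (\<Prod>P\<in>\<P>. card (At (dP P)))"
  "\<forall>w\<in>W. \<forall>w'\<in>W. (\<forall>P\<in>\<P>. w \<ominus> w' \<in> P) --> w = w'"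
 proof -
  have "\<exists>W. finite W \<and> W \<subseteq> Od \<and> card W = (\<Prod>P\<in>\<P>. card (At (dP P))) \<and>
   (\<forall>w\<in>W. \<forall>w'\<in>W. (\<forall>P\<in>\<P>. w \<ominus> w' \<in> P) --> w = w')"
  proof (rule separated_set[OF P(1)])
   show "np P" if "P \<in> \<P>" for P using P(2) that by blast
   show "finite (At (dP P)) \<and> At (dP P) \<subseteq> Od" for P using At_finite At_A A_Od by blast
   fix P s s' assume a: "P \<in> \<P>" "s \<in> At (dP P)" "s' \<in> At (dP P)" "s \<ominus> s' \<in> P"
   then show "s = s'" using AtD(3) At_A At_reps_unique[OF npD(4,5)] P(2) a unfolding dP_def by blast
  qed
  then show ?thesis using that by blast
 qed
 have "card W \<le> q ^ (n * (m + c0))"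
 proof (rule index_le[OF x W(1,2)])
  fix w w' u assume a: "w \<in> W" "w' \<in> W" "u \<in> Od" "w \<ominus> w' = x ** u"
  have "u ** x \<in> P" if "P \<in> \<P>" for P using idlD(3)[OF npD(2) a(3)] P(2) that by blast
  then show "w = w'" using m_comm a(3) x Od_carrier BoxD(4) W(4) a by auto
 qed
 then have "q ^ (\<Sum>P\<in>\<P>. dP P) \<le> q ^ (n * (m + c0))" unfolding W(3) card_At power_sum .
 then show ?thesis using power_le_imp_le_exp[OF q_gt] by blast
qed

lemma dP_pos: "np P ==> dP P > 0"
 unfolding dP_def using dgi_pos[OF npD(3,5)] .

lemma H1_np: "H1 P ==> np P" unfolding H1_def by blast

lemma H1_residue:
 assumes "H1 P" "y \<in> Od" shows "\<exists>r\<in>At (dP P). y \<ominus> r \<in> P"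
proof -
 obtain a where a: "a \<in> A" "y \<ominus> a \<in> P" using assms unfolding H1_def by blast
 note nP = H1_np[OF assms(1)]
 obtain r where r: "r \<in> At (dP P)" "a \<ominus> r \<in> P \<inter> A" using idl_gen[OF npD(4,5)[OF nP]] a unfolding dP_def by metis
 have c: "y \<in> CR" "a \<in> CR" "r \<in> CR" using assms a r Od_carrier A_carrier AtD(4) by auto
 have "y \<ominus> r = (y \<ominus> a) \<oplus> (a \<ominus> r)" using c by algebra
 then show ?thesis using idlD(7)[OF npD(2)[OF nP] a(2)] r by force
qed

lemma At_Box: "a \<in> At m ==> a \<in> Box m"
proof -
 assume a: "a \<in> At m"
 show ?thesis using a AtD(4) Bx_incr[OF AtD(2,1) \<gamma>, of "Suc 0" n m] n_pos unfolding Bx_Suc Box_def by auto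
qed

text \<open>Because the residue degree is one, a box meets at most \<open>q ^ dP P\<close> classes
  modulo \<open>P\<close>.\<close>

lemma card_Box_inter:
 assumes "H1 P" shows "q ^ (m * n) \<le> card (Box m \<inter> P) * q ^ dP P"
proof -
 define f where "f y = (SOME r. r \<in> At (dP P) \<and> y \<ominus> r \<in> P)" for y
 have f: "f y \<in> At (dP P) \<and> y \<ominus> f y \<in> P" if "y \<in> Box m" for y
 proof -
  have "\<exists>r. r \<in> At (dP P) \<and> y \<ominus> r \<in> P" using that Box_Od H1_residue[OF assms] by blast
  then show ?thesis unfolding f_def by (rule someI_ex)
 qed
 have i: "idl Od P" using npD(2)[OF H1_np[OF assms]] .
 have "card (Box m) \<le> card (Box m \<inter> P) * card (At (dP P))"
 proof (rule card_fibres[OF Box_asub Box_finite idlD(1)[OF i] At_finite])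
  show "f x \<in> At (dP P)" if "x \<in> Box m" for x using f that by blast
  fix x y assume a: "x \<in> Box m" "y \<in> Box m" "f x = f y"
  have "(x \<ominus> f x) \<ominus> (y \<ominus> f y) \<in> P" using idlD(8)[OF i] f a by blast
  then show "x \<ominus> y \<in> P" using a(1,2) conjunct1[OF f[OF a(2)]] BoxD(4) AtD(4) unfolding a(3) by algebra
 qed
 then show ?thesis unfolding card_Box card_At .
qed

text \<open>By \<open>fermat\<close> all these primes contain \<open>T^(q^d) - T\<close>, an element
  of known size, to which \<open>sum_dP_le\<close> applies.\<close>

lemma np_count:
 assumes "finite \<P>" "!!P. P \<in> \<P> ==> np P \<and> dP P = d"
 shows "d * card \<P> \<le> n * (q ^ d + 1 + c0)"
proof (cases "d = 0")
 case False
 define x where "x = T [^] (q ^ d) \<ominus> T"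
 have xd: "dege (q ^ d) x" using one_less_power[OF q_gt] False T_pow_minus_T unfolding x_def by blast
 have xB: "x \<in> Box (q ^ d + 1)" using At_Box xd unfolding dege_def by simp
 have "(\<Sum>P\<in>\<P>. dP P) \<le> n * (q ^ d + 1 + c0)"
 proof (rule sum_dP_le[OF xB dege_nonzero[OF xd] assms(1)])
  fix P assume P: "P \<in> \<P>"
  then show "np P \<and> x \<in> P" using fermat[OF npD(3,5) T_A] assms(2)[OF P] assms P unfolding x_def dP_def by blast
 qed
 then show ?thesis using assms(2) by (simp add: mult.commute)
qed simp

lemma np_finite: "d > 0 ==> finite {P. np P \<and> dP P = d}"
proof (rule ccontr)
 assume d: "d > 0" and "infinite {P. np P \<and> dP P = d}"
 then obtain \<P> where P: "finite \<P>" "card \<P> = n * (q ^ d + 1 + c0) + 1" "\<P> \<subseteq> {P. np P \<and> dP P = d}"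
  using infinite_arbitrarily_large[of "{P. np P \<and> dP P = d}" "n * (q ^ d + 1 + c0) + 1"] by blast
 then have "d * card \<P> \<le> n * (q ^ d + 1 + c0)" using np_count[of \<P> d] by blast
 moreover have "card \<P> \<le> d * card \<P>" using d by simp
 ultimately show False using P(2) by simp
qed

end

subsection \<open>Counting elements of boxes in an ideal\<close>

lemma sum_powers_le: "(2::real) \<le> x ==> (\<Sum>d=1..M. x ^ d) \<le> 2 * x ^ M"
proof (induction M)
 case (Suc M)
 have "(\<Sum>d=1..Suc M. x ^ d) \<le> 2 * x ^ M + x ^ Suc M" using Suc by simp
 moreover have "2 * x ^ M \<le> x * x ^ M" using Suc.prems by (intro mult_right_mono) auto
 ultimately show ?case by simp
qed simp

context fq_order
begin

definition HH where "HH d = {P. H1 P \<and> dP P = d}"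
definition h where "h d = card (HH d)"
text \<open>The sum of Mertens' theorem for the primes of residue degree one. Multiplying each term
  by \<open>u ^ d / d\<close> turns it into a Dirichlet series, see
  \<open>ZZ_series\<close>.\<close>

definition U :: "nat => real" where "U M = (\<Sum>d=1..M. real d * real (h d) / real q ^ d)"

lemma HH_finite: "d > 0 ==> finite (HH d)"
 unfolding HH_def by (rule finite_subset[OF _ np_finite[of d]]) (auto simp: H1_np)

lemma h_le: "d * h d \<le> n * (q ^ d + 1 + c0)"
proof (cases "d = 0")
 case False
 then show ?thesis unfolding h_def
  by (intro np_count HH_finite) (auto simp: HH_def H1_np)
qed simp

lemma sum_h_le: "(\<Sum>d=1..M. real d * real (h d)) \<le> real n * (3 + real c0) * real q ^ M"
proof -
 have q2: "(2::real) \<le> real q" using q_gt by simp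
 have "(\<Sum>d=1..M. real d * real (h d)) \<le> (\<Sum>d=1..M. real n * (real q ^ d + 1 + real c0))"
 proof (rule sum_mono)
  fix d
  have "real (d * h d) \<le> real (n * (q ^ d + 1 + c0))" using h_le[of d] of_nat_mono by blast
  then show "real d * real (h d) \<le> real n * (real q ^ d + 1 + real c0)" by (simp add: algebra_simps)
 qed
 also have "\<dots> = real n * ((\<Sum>d=1..M. real q ^ d) + real M * (1 + real c0))"
  by (simp add: sum_distrib_left[symmetric] sum.distrib algebra_simps)
 also have "\<dots> \<le> real n * (2 * real q ^ M + real q ^ M * (1 + real c0))"
 proof (intro mult_left_mono add_mono sum_powers_le q2 mult_right_mono)
  have "real M \<le> 2 ^ M" using less_exp[of M] by (metis less_imp_le of_nat_le_iff of_nat_numeral of_nat_power)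
  also have "\<dots> \<le> real q ^ M" using q2 by (intro power_mono) auto
  finally show "real M \<le> real q ^ M" .
 qed auto
 finally show ?thesis by (simp add: algebra_simps)
qed

text \<open>Double counting of pairs of a prime and a nonzero element of \<open>Box m\<close> in it,
  weighted by degree. An element accounts for at most \<open>n * (m + c0)\<close>, a prime for at
  least its expected share minus one, the one being due to the element zero.\<close>

lemma U_upper: "U (m * n) \<le> real (n * m) + real n * (3 + 2 * real c0)"
proof -
 \<comment> \<open>Up to degree \<open>m * n\<close> the ones subtracted for the element zero add up
   to a bounded multiple of the size of the box, by \<open>sum_h_le\<close>.\<close>
 define PP where "PP = (\<Union>d\<in>{1..m*n}. HH d)"
 have fP: "finite PP" unfolding PP_def using HH_finite by auto
 define N where "N = q ^ (m * n)"
 let ?B = "Box m - {\<zero>}"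
 have fB: "finite ?B" using Box_finite by blast
 have H: "H1 P" "dP P \<le> m * n" if "P \<in> PP" for P using that unfolding PP_def HH_def by auto
 have "(\<Sum>P\<in>PP. dP P * card (?B \<inter> P)) = (\<Sum>P\<in>PP. \<Sum>x\<in>?B. if x \<in> P then dP P else 0)"
  by (rule sum.cong[OF refl]) (simp add: sum.If_cases[OF fB] mult.commute Int_def)
 also have "\<dots> = (\<Sum>x\<in>?B. \<Sum>P\<in>PP. if x \<in> P then dP P else 0)" by (rule sum.swap)
 also have "\<dots> \<le> (\<Sum>x\<in>?B. n * (m + c0))"
 proof (rule sum_mono)
  fix x assume x: "x \<in> ?B"
  have "(\<Sum>P\<in>PP. if x \<in> P then dP P else 0) = (\<Sum>P\<in>{P\<in>PP. x \<in> P}. dP P)"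
   using fP by (simp add: sum.If_cases Int_def)
  also have "\<dots> \<le> n * (m + c0)" by (rule sum_dP_le) (use x fP H H1_np in auto)
  finally show "(\<Sum>P\<in>PP. if x \<in> P then dP P else 0) \<le> n * (m + c0)" .
 qed
 also have "\<dots> \<le> N * (n * (m + c0))"
  unfolding N_def card_Box[symmetric] using card_mono[OF Box_finite, of ?B m] by auto
 finally have le: "(\<Sum>P\<in>PP. dP P * card (?B \<inter> P)) \<le> N * (n * (m + c0))" .
 have contrib: "real (dP P) * (real N / real q ^ dP P - 1) \<le> real (dP P * card (?B \<inter> P))" if P: "P \<in> PP" for P
 proof -
  have i: "idl Od P" using npD(2) H1_np H(1) P by blast
  have "?B \<inter> P = (Box m \<inter> P) - {\<zero>}" by blast
  then have "card (?B \<inter> P) = card (Box m \<inter> P) - 1"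
   using BoxD(2) idlD(4)[OF i] by simp
  moreover have "card (Box m \<inter> P) > 0" using BoxD(2) idlD(4)[OF i] Box_finite by (auto simp: card_gt_0_iff)
  ultimately have c: "real (card (?B \<inter> P)) = real (card (Box m \<inter> P)) - 1" by simp
  have "N \<le> card (Box m \<inter> P) * q ^ dP P" unfolding N_def using card_Box_inter[OF H(1)[OF P]] .
  then have "real N \<le> real (card (Box m \<inter> P)) * real q ^ dP P" by (metis of_nat_le_iff of_nat_mult of_nat_power)
  then have "real N / real q ^ dP P \<le> real (card (Box m \<inter> P))" by (simp add: divide_le_eq)
  then have "real (dP P) * (real N / real q ^ dP P - 1) \<le> real (dP P) * (real (card (Box m \<inter> P)) - 1)"
   by (intro mult_left_mono) auto
  then show ?thesis using c by simp
 qed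
 have "(\<Sum>P\<in>PP. real (dP P) * (real N / real q ^ dP P - 1)) = (\<Sum>d=1..m*n. real (h d) * (real d * (real N / real q ^ d - 1)))"
 proof -
  have "(\<Sum>P\<in>PP. real (dP P) * (real N / real q ^ dP P - 1)) = (\<Sum>d\<in>{1..m*n}. \<Sum>P\<in>HH d. real (dP P) * (real N / real q ^ dP P - 1))"
   unfolding PP_def by (rule sum.UNION_disjoint) (auto simp: HH_finite, auto simp: HH_def)
  also have "\<dots> = (\<Sum>d\<in>{1..m*n}. \<Sum>P\<in>HH d. real d * (real N / real q ^ d - 1))"
   by (intro sum.cong refl) (auto simp: HH_def)
  finally show ?thesis by (simp add: h_def)
 qed
 also have "\<dots> = real N * U (m * n) - (\<Sum>d=1..m*n. real d * real (h d))"
  unfolding U_def sum_distrib_left sum_subtractf[symmetric] by (intro sum.cong refl) (simp add: algebra_simps)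
 finally have e: "(\<Sum>P\<in>PP. real (dP P) * (real N / real q ^ dP P - 1)) = real N * U (m * n) - (\<Sum>d=1..m*n. real d * real (h d))" .
 have "(\<Sum>P\<in>PP. real (dP P) * (real N / real q ^ dP P - 1)) \<le> (\<Sum>P\<in>PP. real (dP P * card (?B \<inter> P)))"
  by (rule sum_mono) (rule contrib)
 also have "\<dots> = real (\<Sum>P\<in>PP. dP P * card (?B \<inter> P))" by simp
 also have "\<dots> \<le> real (N * (n * (m + c0)))" using le of_nat_mono by blast
 finally have "real N * U (m * n) \<le> real N * real (n * (m + c0)) + (\<Sum>d=1..m*n. real d * real (h d))" using e by simp
 also have "\<dots> \<le> real N * real (n * (m + c0)) + real n * (3 + real c0) * real N"
  using sum_h_le[of "m * n"] unfolding N_def by simp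
 finally have "real N * U (m * n) \<le> real N * (real (n * (m + c0)) + real n * (3 + real c0))" by (simp add: algebra_simps)
 then have "U (m * n) \<le> real (n * (m + c0)) + real n * (3 + real c0)" using q_gt unfolding N_def by simp
 then show ?thesis by (simp add: algebra_simps)
qed

text \<open>\<open>sized D V\<close>: the nonzero elements of \<open>V\<close> are as large as those of an ideal of norm \<open>q ^ D\<close>.\<close>

definition sized where
 "sized D V \<longleftrightarrow> asub V \<and> (\<forall>m. \<forall>x\<in>V \<inter> Box m. x ~= \<zero> --> D \<le> n * (m + c0))"

lemma Box_0: "Box 0 = {\<zero>}"
proof -
 have "card (Box 0) = 1" by (simp add: card_Box)
 then show ?thesis using BoxD(2)[of 0] by (metis card_1_singletonE singletonD)
qed

lemma sized_small_box:
 assumes "sized D V" "D > 0"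
 obtains j where "V \<inter> Box j \<subseteq> {\<zero>}" "D \<le> n * j + n * (1 + c0)" "j \<le> (D - 1) div n"
proof -
 \<comment> \<open>The largest \<open>j\<close> with \<open>n * (j + c0) < D\<close>. If the
   subtraction is truncated to 0, \<open>Box 0\<close> is trivial anyway.\<close>
 define j where "j = (D - 1) div n - c0"
 have 2: "D \<le> n * j + n * (1 + c0)"
 using dividend_less_times_div[OF n_pos, of "D - 1"] unfolding j_def by (simp add: algebra_simps)
 have 1: "V \<inter> Box j \<subseteq> {\<zero>}"
 proof
  fix x assume x: "x \<in> V \<inter> Box j"
  show "x \<in> {\<zero>}"
  proof (rule ccontr)
   assume "x \<notin> {\<zero>}"
   then have x0: "x ~= \<zero>" by simp
   then have D: "D \<le> n * (j + c0)" using assms(1) x unfolding sized_def by blast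
   have "j ~= 0"
   proof
    assume "j = 0"
    then have "x \<in> {\<zero>}" using x Box_0 by blast
    then show False using x0 by simp
   qed
   then have "n * (j + c0) \<le> n * ((D - 1) div n)" unfolding j_def by simp
   also have "\<dots> \<le> D - 1" by simp
   finally show False using D assms(2) by linarith
  qed
 qed
 show ?thesis using that[OF 1 2] unfolding j_def by simp
qed

text \<open>\<open>V \<inter> Box m\<close> and \<open>Box j\<close> meet only in zero inside
  \<open>Box m\<close>, so the product of their sizes is bounded by that of \<open>Box m\<close>.
  The extra factor is the price for rounding \<open>D\<close> to the size of a box.\<close>

lemma sized_card_small:
 assumes "sized D V" "D > 0" "D \<le> n * m"
 shows "card (Box m \<inter> V) * q ^ D \<le> q ^ (m * n) * q ^ (n * (1 + c0))"
proof -
 obtain j where j: "V \<inter> Box j \<subseteq> {\<zero>}" "D \<le> n * j + n * (1 + c0)" "j \<le> (D - 1) div n"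
  using sized_small_box[OF assms(1,2)] .
 have "(D - 1) div n \<le> (n * m) div n" using assms by (intro div_le_mono) auto
 then have jm: "j \<le> m" using j(3) n_pos by simp
 have "card (Box m \<inter> V) * card (Box j) \<le> card (Box m)"
 proof (rule card_direct[OF Box_asub _ Box_finite])
  show "asub (Box m \<inter> V)" using assms(1) asub_Int Box_asub unfolding sized_def by blast
  show "Box m \<inter> V \<inter> Box j \<subseteq> {\<zero>}" using j by blast
  show "u \<oplus> v \<in> Box m" if "u \<in> Box m \<inter> V" "v \<in> Box j" for u v
   using that Box_mono[OF jm] BoxD(6) by blast
 qed
 then have "card (Box m \<inter> V) * q ^ (j * n) * q ^ (n * (1 + c0)) \<le> q ^ (m * n) * q ^ (n * (1 + c0))" unfolding card_Box
  by (intro mult_le_mono1)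
 moreover have "q ^ D \<le> q ^ (j * n) * q ^ (n * (1 + c0))"
  unfolding power_add[symmetric] using j(2) q_gt by (intro power_increasing) (auto simp: mult.commute)
 then have "card (Box m \<inter> V) * q ^ D \<le> card (Box m \<inter> V) * (q ^ (j * n) * q ^ (n * (1 + c0)))"
  by (rule mult_le_mono2)
 ultimately show ?thesis unfolding mult.assoc[symmetric] by (rule le_trans[rotated])
qed

text \<open>The same argument where the expected number of elements is at most \<open>q ^ r\<close>:
  the count is then bounded independently of \<open>m\<close>.\<close>

lemma sized_card_large:
 assumes "sized D V" "D > 0" "D + r \<ge> n * m"
 shows "card (Box m \<inter> V) \<le> q ^ (n * (1 + c0) + r)"
proof -
 obtain j where j: "V \<inter> Box j \<subseteq> {\<zero>}" "D \<le> n * j + n * (1 + c0)" "j \<le> (D - 1) div n"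
  using sized_small_box[OF assms(1,2)] .
 define j' where "j' = min j m"
 have "card (Box m \<inter> V) * card (Box j') \<le> card (Box m)"
 proof (rule card_direct[OF Box_asub _ Box_finite])
  show "asub (Box m \<inter> V)" using assms(1) asub_Int Box_asub unfolding sized_def by blast
  show "Box m \<inter> V \<inter> Box j' \<subseteq> {\<zero>}" using j Box_mono[of j' j] unfolding j'_def by auto
  show "u \<oplus> v \<in> Box m" if "u \<in> Box m \<inter> V" "v \<in> Box j'" for u v
   using that Box_mono[of j' m] BoxD(6) unfolding j'_def by auto
 qed
 then have a: "card (Box m \<inter> V) * q ^ (j' * n) \<le> q ^ (m * n)" unfolding card_Box .
 also have "q ^ (m * n) \<le> q ^ (n * (1 + c0) + r + j' * n)"
 proof (rule power_increasing)
  show "m * n \<le> n * (1 + c0) + r + j' * n"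
  proof (cases "j \<le> m")
   case True
   then show ?thesis unfolding j'_def using j(2) assms(3) by (simp add: mult.commute)
  qed (simp add: j'_def)
 qed (use q_gt in simp)
 finally show ?thesis unfolding power_add using q_gt by simp
qed

lemma asub_card_double:
 assumes "asub V" "asub W" "V \<subset> W" "finite W" shows "2 * card V \<le> card W"
proof -
 obtain w where w: "w \<in> W" "w \<notin> V" using assms by blast
 note v = asubD[OF assms(1)] and ww = asubD[OF assms(2)]
 have "inj_on (%x. w \<oplus> x) V" by (rule inj_onI) (use v(4) ww(4)[OF w(1)] in simp)
 then have c: "card ((%x. w \<oplus> x) ` V) = card V" by (rule card_image)
 have "V \<inter> (%x. w \<oplus> x) ` V = {}"
 proof (rule ccontr)
  assume "V \<inter> (%x. w \<oplus> x) ` V ~= {}"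
  then obtain x where x: "x \<in> V" "w \<oplus> x \<in> V" by blast
  have "w = (w \<oplus> x) \<ominus> x" using v(4)[OF x(1)] ww(4)[OF w(1)] by algebra
  then show False using v(3)[OF x(2,1)] w(2) by simp
 qed
 moreover have f: "finite V" using assms finite_subset by blast
 ultimately have "card (V \<union> (%x. w \<oplus> x) ` V) = 2 * card V" using c by (simp add: card_Un_disjoint)
 moreover have "V \<union> (%x. w \<oplus> x) ` V \<subseteq> W" using assms(3) ww(6)[OF w(1)] by blast
 ultimately show ?thesis using card_mono[OF assms(4)] by metis
qed

lemma np_sized: assumes "np P" shows "sized (dP P) P"
 unfolding sized_def
proof (intro conjI allI ballI impI)
 show "asub P" using idlD(1)[OF npD(2)[OF assms]] .
 fix m x assume "x \<in> P \<inter> Box m" "x ~= \<zero>"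
 then have "(\<Sum>P\<in>{P}. dP P) \<le> n * (m + c0)" by (intro sum_dP_le) (use assms in auto)
 then show "dP P \<le> n * (m + c0)" by simp
qed

text \<open>Bounds the length of a strictly increasing chain of subgroups whose first member has
  index at most \<open>t0\<close> in the last: each step at least doubles the size, and
  \<open>2 ^ t0\<close> exceeds \<open>t0\<close>.\<close>

definition t0 where "t0 = q ^ (n * (1 + c0))"

text \<open>The sets \<open>P + Box j\<close> strictly increase with \<open>j\<close> until they exhaust \<open>\<O>\<close>, and they start from a
  set whose size is within a bounded factor of the index of \<open>P\<close>.\<close>

lemma card_Box_inter_exact:
 assumes P: "H1 P" and le: "dP P + n * t0 \<le> n * m"
 shows "card (Box m \<inter> P) * q ^ dP P \<le> q ^ (m * n)"
proof -
 have nP: "np P" using H1_np[OF P] .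
 have i: "idl Od P" using npD(2)[OF nP] .
 define d where "d = dP P"
 obtain j where j: "P \<inter> Box j \<subseteq> {\<zero>}" "d \<le> n * j + n * (1 + c0)" "j \<le> (d - 1) div n"
  using sized_small_box[OF np_sized[OF nP] dP_pos[OF nP]] unfolding d_def .
 have "(d - 1) div n \<le> (n * (m - t0)) div n"
  using le unfolding d_def by (intro div_le_mono) (simp add: diff_mult_distrib2)
 then have jm': "j \<le> m - t0" using j(3) n_pos by simp
 have "dP P > 0" using dP_pos[OF nP] .
 then have "n * t0 \<le> n * m" using le by linarith
 then have jm: "j + t0 \<le> m" using n_pos jm' by simp
 \<comment> \<open>\<open>M t\<close> is \<open>P + Box (j + t)\<close>; its representatives
   \<open>S t\<close> form a subgroup of the finite group \<open>At d\<close>, so growth can be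
   measured there.\<close>
 define M where "M t = {y \<in> Od. \<exists>v\<in>Box (j + t). y \<ominus> v \<in> P}" for t
 define S where "S t = M t \<inter> At d" for t
 have M_asub: "asub (M t)" for t
  unfolding asub_def
 proof (intro conjI ballI)
  show "M t \<subseteq> CR" unfolding M_def using Od_carrier by blast
  show "\<zero> \<in> M t" unfolding M_def using OdD(2) BoxD(2) idlD(4,8)[OF i] by blast
  fix x y assume "x \<in> M t" "y \<in> M t"
  then obtain v w where x: "x \<in> Od" "v \<in> Box (j + t)" "x \<ominus> v \<in> P" "y \<in> Od" "w \<in> Box (j + t)" "y \<ominus> w \<in> P"
   unfolding M_def by blast
  have c: "x \<in> CR" "v \<in> CR" "y \<in> CR" "w \<in> CR" using x Od_carrier BoxD(4) by blast+
  have "(x \<ominus> y) \<ominus> (v \<ominus> w) \<in> P" using idlD(8)[OF i x(3,6)] c by algebra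
  then show "x \<ominus> y \<in> M t" unfolding M_def using OdD(3)[OF x(1,4)] BoxD(3)[OF x(2,5)] by blast
 qed
 have M_cong: "y \<in> M t" if "y \<in> Od" "r \<in> M t" "y \<ominus> r \<in> P" for y r t
 proof -
  from that(2) obtain v where v: "r \<in> Od" "v \<in> Box (j + t)" "r \<ominus> v \<in> P" unfolding M_def by blast
  have "y \<in> CR" "r \<in> CR" "v \<in> CR" using that v Od_carrier BoxD(4) by blast+
  then have "y \<ominus> v \<in> P" using idlD(7)[OF i that(3) v(3)] by algebra
  then show ?thesis unfolding M_def using that v by blast
 qed
 have Box_M: "Box (j + t) \<subseteq> M t" for t
 proof
  fix v assume v: "v \<in> Box (j + t)"
  then have "v \<ominus> v \<in> P" using BoxD(4) idlD(4)[OF i] by (simp add: minus_eq r_neg)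
  then show "v \<in> M t" unfolding M_def using v Box_Od by blast
 qed
 have M_mono: "M t \<subseteq> M (Suc t)" for t unfolding M_def using Box_mono[of "j + t" "j + Suc t"] by auto
 \<comment> \<open>If one step adds nothing, \<open>M t\<close> is closed under multiplication by
   \<open>T\<close> and contains \<open>Box 1\<close>, hence by \<open>Box_Suc_T\<close> every
   box.\<close>
 have stab: "Od \<subseteq> M t" if eq: "S t = S (Suc t)" for t
 proof -
  have sub: "M (Suc t) \<subseteq> M t"
  proof
   fix y assume y: "y \<in> M (Suc t)"
   then have yO: "y \<in> Od" unfolding M_def by blast
   obtain r where r: "r \<in> At d" "y \<ominus> r \<in> P" using H1_residue[OF P yO] unfolding d_def by blast
   have rO: "r \<in> Od" using r At_A A_Od by blast
   have "y \<in> CR" "r \<in> CR" using yO rO Od_carrier by auto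
   then have "r \<in> M (Suc t)" using idlD(9)[OF i r(2)] M_cong[OF rO y] by algebra
   then show "y \<in> M t" using r eq M_cong[OF yO _ r(2)] unfolding S_def by blast
  qed
  have "Box s \<subseteq> M t" for s
  proof (induction s)
   case 0
   then show ?case using Box_mono[of 0 "j + t"] Box_M[of t] by auto
  next
   case (Suc s)
   show ?case
   proof
    fix w assume "w \<in> Box (Suc s)"
    then obtain u v where uv: "u \<in> Box s" "v \<in> Box (Suc 0)" "w = u ** T \<oplus> v" using Box_Suc_T by blast
    have vM: "v \<in> M t" using uv(2) Box_mono[of "Suc 0" "j + Suc t"] Box_M[of "Suc t"] sub by auto
    have "u \<in> M t" using uv(1) Suc by blast
    then obtain u0 where u0: "u \<in> Od" "u0 \<in> Box (j + t)" "u \<ominus> u0 \<in> P" unfolding M_def by blast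
    have uc: "u \<in> CR" "u0 \<in> CR" using u0 Od_carrier BoxD(4) by blast+
    have TO: "T \<in> Od" using T_A A_Od by blast
    have "\<one> ** T [^] (1::nat) \<in> At (Suc 1)" by (rule T_pow_At) (use subringE(3)[OF subring_k] in auto)
    then have "T ** u0 \<in> M t" using T At_Box_mult[of T 1 u0 "j + t"] u0 Box_M[of "Suc t"] sub by auto
    moreover have "u ** T \<ominus> T ** u0 = T ** (u \<ominus> u0)" using uc T by algebra
    then have "u ** T \<ominus> T ** u0 \<in> P" using idlD(3)[OF i TO u0(3)] by simp
    ultimately show "w \<in> M t" using M_cong[OF Od_mult[OF u0(1) TO]] asubD(6)[OF M_asub _ vM] uv(3) by simp
   qed
  qed
  then show ?thesis using Od_Box by blast
 qed
 have S_asub: "asub (S t)" for t unfolding S_def using asub_Int[OF M_asub At_asub] .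
 have S_fin: "finite (S t)" for t unfolding S_def using At_finite by blast
 have full: "S t = At d" if "Od \<subseteq> M t" for t unfolding S_def using that At_A A_Od by blast
 have grow: "S t = At d \<or> 2 ^ t * q ^ (j * n) \<le> card (S t)" for t
 proof (induction t)
  case 0
  have "\<forall>y\<in>Box j. \<exists>r. r \<in> At d \<and> y \<ominus> r \<in> P" using H1_residue[OF P] Box_Od unfolding d_def by blast
  from bchoice[OF this] obtain f where f: "\<forall>y\<in>Box j. f y \<in> At d \<and> y \<ominus> f y \<in> P" by blast
  have "card (Box j) \<le> card (S 0)"
  proof (rule card_inj_on_le[OF _ _ S_fin])
   show "inj_on f (Box j)"
   proof (rule inj_onI)
    fix x y assume a: "x \<in> Box j" "y \<in> Box j" "f x = f y"
    have p: "x \<ominus> f x \<in> P" "y \<ominus> f y \<in> P" using f a by blast+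
    have c: "x \<in> CR" "y \<in> CR" "f y \<in> CR" using a f BoxD(4) AtD(4) by blast+
    have "x \<ominus> y = (x \<ominus> f x) \<ominus> (y \<ominus> f y)" unfolding a(3) using c by algebra
    then show "x = y" using idlD(8)[OF i p] BoxD(3)[OF a(1,2)] j(1) minus_zero_iff c by auto
   qed
   show "f ` Box j \<subseteq> S 0"
   proof (rule image_subsetI)
    fix y assume y: "y \<in> Box j"
    have fy: "f y \<in> At d" "y \<ominus> f y \<in> P" using f y by blast+
    have c: "y \<in> CR" "f y \<in> CR" using y fy BoxD(4) AtD(4) by blast+
    have "f y \<ominus> y \<in> P" using c idlD(9)[OF i fy(2)] by algebra
    then show "f y \<in> S 0" using Box_M[of 0] y fy At_A A_Od M_cong[of "f y" y 0] fy(1) unfolding S_def by auto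
   qed
  qed
  then show ?case unfolding card_Box by simp
 next
  case (Suc t)
  show ?case
  proof (cases "S t = S (Suc t)")
   case True
   then show ?thesis using full[OF stab] by metis
  next
   case False
   have sub: "S t \<subseteq> S (Suc t)" unfolding S_def using M_mono by blast
   have "2 * card (S t) \<le> card (S (Suc t))"
    by (rule asub_card_double[OF S_asub S_asub _ S_fin]) (use False sub in blast)
   then show ?thesis using False sub Suc unfolding S_def by auto
  qed
 qed
 have "S t0 = At d"
 proof (rule ccontr)
  assume ne: "S t0 ~= At d"
  then have "2 ^ t0 * q ^ (j * n) \<le> card (S t0)" using grow by blast
  also have "\<dots> \<le> card (At d)" unfolding S_def by (intro card_mono At_finite) auto
  also have "\<dots> \<le> q ^ (n * (1 + c0)) * q ^ (j * n)"
   unfolding card_At power_add[symmetric] using j(2) q_gt by (intro power_increasing) (auto simp: mult.commute)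
  finally have "2 ^ t0 \<le> q ^ (n * (1 + c0))" using q_gt by simp
  then show False using less_exp[of t0] unfolding t0_def[symmetric] by simp
 qed
 \<comment> \<open>Now \<open>Box m\<close> meets all \<open>q ^ d\<close> classes modulo
   \<open>P\<close>. The translates of \<open>Box m \<inter> P\<close> by representatives are
   disjoint in \<open>Box m\<close>, which gives the bound with constant 1.\<close>
 then have "\<forall>a\<in>At d. \<exists>v. v \<in> Box m \<and> a \<ominus> v \<in> P"
  using Box_mono[OF jm] unfolding S_def M_def by blast
 from bchoice[OF this] obtain g where g: "\<forall>a\<in>At d. g a \<in> Box m \<and> a \<ominus> g a \<in> P" by blast
 have "card ((Box m \<inter> P) \<times> At d) \<le> card (Box m)"
 proof (rule card_inj_on_le[OF _ _ Box_finite])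
  show "inj_on (%(z,a). z \<oplus> g a) ((Box m \<inter> P) \<times> At d)"
  proof (rule inj_onI, clarify)
   fix z a z' a' assume a: "z \<in> Box m" "z \<in> P" "z' \<in> Box m" "z' \<in> P" "a \<in> At d" "a' \<in> At d" and e: "z \<oplus> g a = z' \<oplus> g a'"
   have c: "z \<in> CR" "z' \<in> CR" "a \<in> CR" "a' \<in> CR" "g a \<in> CR" "g a' \<in> CR"
    using a g BoxD(4) AtD(4) by blast+
   have "a \<ominus> a' = ((a \<ominus> g a) \<oplus> (z \<oplus> g a)) \<ominus> ((a' \<ominus> g a') \<oplus> (z' \<oplus> g a')) \<oplus> (z' \<ominus> z)"
    using c by algebra
   also have "\<dots> = (a \<ominus> g a) \<ominus> (a' \<ominus> g a') \<oplus> (z' \<ominus> z)" unfolding e using c by algebra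
   also have "\<dots> \<in> P" using g a idlD(7,8)[OF i] by blast
   finally have aa: "a = a'" using AtD(3)[OF a(5,6)] At_A At_reps_unique[OF npD(4,5)[OF nP]] a unfolding d_def dP_def by blast
   then show "z = z' \<and> a = a'" using e c by simp
  qed
  show "(%(z,a). z \<oplus> g a) ` ((Box m \<inter> P) \<times> At d) \<subseteq> Box m"
   using g BoxD(6) by auto
 qed
 then show ?thesis unfolding card_cartesian_product card_At card_Box d_def .
qed

end

subsection \<open>Maximal ideals and ramification\<close>

context fq_order
begin

text \<open>The ideal contains some nonzero \<open>\<delta>\<close> of \<open>A\<close>, and an
  ideal containing \<open>\<delta>\<close> is determined by its part in \<open>Box e\<close>. So
  only finitely many ideals contain \<open>I\<close>; a maximal proper one among them is
  prime.\<close>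

lemma exists_np:
 assumes I: "idl Od I" "\<one> \<notin> I" and x: "x \<in> I" "x ~= \<zero>"
 shows "\<exists>P. np P \<and> I \<subseteq> P"
proof -
 have xO: "x \<in> Od" using idlD(5)[OF I(1) x(1)] .
 obtain \<delta> u where d: "\<delta> \<in> A" "\<delta> ~= \<zero>" "u \<in> Od" "\<delta> = x ** u" using A_inter_multiples[OF xO x(2)] .
 have "u \<in> CR" "x \<in> CR" using d(3) xO Od_carrier by auto
 then have dI: "\<delta> \<in> I" using idlD(3)[OF I(1) d(3) x(1)] d(4) m_comm by simp
 obtain e where e: "dege e \<delta>" using dege_exists[OF d(1,2)] .
 define JJ where "JJ = {J. idl Od J \<and> I \<subseteq> J \<and> \<one> \<notin> J}"
 have "inj_on (%J. J \<inter> Box e) JJ"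
 proof (rule inj_onI)
  have sub: "J \<subseteq> J'" if J: "J \<in> JJ" "J' \<in> JJ" "J \<inter> Box e = J' \<inter> Box e" for J J'
  proof
   fix w assume w: "w \<in> J"
   have i: "idl Od J" "idl Od J'" "\<delta> \<in> J" "\<delta> \<in> J'" using J dI unfolding JJ_def by auto
   obtain u v where uv: "u \<in> Od" "v \<in> Box e" "w = \<delta> ** u \<oplus> v" using Od_div[OF e] idlD(5)[OF i(1) w] by blast
   have c: "u \<in> CR" "v \<in> CR" "\<delta> \<in> CR" using uv BoxD(4) Od_carrier d A_carrier by auto
   have m: "u ** \<delta> \<in> J" "u ** \<delta> \<in> J'" using idlD(3)[OF i(1) uv(1) i(3)] idlD(3)[OF i(2) uv(1) i(4)] by auto
   have "v \<in> J" using c idlD(8)[OF i(1) w m(1)] unfolding uv(3) by algebra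
   then have "v \<in> J'" using J(3) uv(2) by blast
   moreover have "w = u ** \<delta> \<oplus> v" unfolding uv(3) using c m_comm by simp
   ultimately show "w \<in> J'" using idlD(7)[OF i(2) m(2)] by simp
  qed
  show "J = J'" if "J \<in> JJ" "J' \<in> JJ" "J \<inter> Box e = J' \<inter> Box e" for J J'
   using sub[OF that] sub[OF that(2,1) that(3)[symmetric]] by blast
 qed
 moreover have "finite ((%J. J \<inter> Box e) ` JJ)"
  by (rule finite_subset[of _ "Pow (Box e)"]) (use Box_finite in auto)
 ultimately have "finite JJ" using finite_imageD by blast
 moreover have "I \<in> JJ" unfolding JJ_def using I by blast
 ultimately obtain M where M: "M \<in> JJ" "!!J. J \<in> JJ ==> M \<subseteq> J ==> M = J"
  using finite_has_maximal[of JJ] by blast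
 have iM: "idl Od M" "\<one> \<notin> M" "I \<subseteq> M" using M(1) unfolding JJ_def by auto
 have "prm Od M"
  unfolding prm_def
 proof (intro conjI ballI impI iM)
  fix a b assume a: "a \<in> Od" "b \<in> Od" "a ** b \<in> M"
  have ac: "a \<in> CR" "b \<in> CR" using a Od_carrier by auto
  show "a \<in> M \<or> b \<in> M"
  proof (rule ccontr)
   assume n: "\<not> (a \<in> M \<or> b \<in> M)"
   define J where "J = {m \<oplus> a ** r | m r. m \<in> M \<and> r \<in> Od}"
   have "idl Od J"
    unfolding idl_def asub_def
   proof (intro conjI ballI)
    show "J \<subseteq> CR" unfolding J_def using idlD(6)[OF iM(1)] Od_carrier ac by auto
    show "\<zero> \<in> J" using idlD(4)[OF iM(1)] OdD(2) ac unfolding J_def by force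
    show "J \<subseteq> Od" unfolding J_def using idlD(5)[OF iM(1)] Od_mult[OF a(1)] OdD(6) by auto
    fix x assume "x \<in> J"
    then obtain m r where x: "x = m \<oplus> a ** r" "m \<in> M" "r \<in> Od" unfolding J_def by blast
    have xc: "m \<in> CR" "r \<in> CR" using x idlD(6)[OF iM(1)] Od_carrier by auto
    show "x \<ominus> y \<in> J" if "y \<in> J" for y
    proof -
     obtain m' r' where y: "y = m' \<oplus> a ** r'" "m' \<in> M" "r' \<in> Od" using \<open>y \<in> J\<close> unfolding J_def by blast
     have "m' \<in> CR" "r' \<in> CR" using y idlD(6)[OF iM(1)] Od_carrier by auto
     then have "x \<ominus> y = (m \<ominus> m') \<oplus> a ** (r \<ominus> r')" unfolding x(1) y(1) using xc ac by algebra
     then show ?thesis unfolding J_def using idlD(8)[OF iM(1) x(2) y(2)] OdD(3)[OF x(3) y(3)] by blast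
    qed
    fix s assume s: "s \<in> Od"
    have "s ** x = s ** m \<oplus> a ** (s ** r)" unfolding x(1) using xc ac subsetD[OF Od_carrier s] by algebra
    then show "s ** x \<in> J" unfolding J_def using idlD(3)[OF iM(1) s x(2)] Od_mult[OF s x(3)] by blast
   qed
   moreover have MJ: "M \<subseteq> J"
   proof
    fix m assume m: "m \<in> M"
    show "m \<in> J" using m OdD(2) ac idlD(6)[OF iM(1)] unfolding J_def by force
   qed
   moreover have "a \<in> J"
   using idlD(4)[OF iM(1)] subringE(3)[OF Od_subring] ac unfolding J_def by force
   ultimately have "\<one> \<in> J" using M(2)[of J] n iM(3) unfolding JJ_def by blast
   then obtain m r where 1: "\<one> = m \<oplus> a ** r" "m \<in> M" "r \<in> Od" unfolding J_def by blast
   have mc: "m \<in> CR" "r \<in> CR" using 1 idlD(6)[OF iM(1)] Od_carrier by auto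
   have "b = \<one> ** b" using ac by simp
   then have "b = (m \<oplus> a ** r) ** b" unfolding 1(1) .
   also have "\<dots> = b ** m \<oplus> r ** (a ** b)" using mc ac by algebra
   also have "\<dots> \<in> M" using idlD(3,7)[OF iM(1)] a 1 by blast
   finally show False using n by blast
  qed
 qed
 then show ?thesis using dI iM(3) d unfolding np_def by blast
qed

text \<open>The extension of the ideal \<open>p\<close> to the order. Single products form an ideal
  because \<open>p\<close> is principal.\<close>

definition pO where "pO p = {a ** u | a u. a \<in> p \<and> u \<in> Od}"

lemma pO_gen:
 assumes "p = {\<pi> ** b | b. b \<in> A}" "\<pi> \<in> p" "\<pi> \<in> A" shows "pO p = {\<pi> ** u | u. u \<in> Od}"
proof
 show "pO p \<subseteq> {\<pi> ** u | u. u \<in> Od}"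
 proof
  fix x assume "x \<in> pO p"
  then obtain a u where x: "x = a ** u" "a \<in> p" "u \<in> Od" unfolding pO_def by blast
  obtain b where b: "a = \<pi> ** b" "b \<in> A" using x(2) assms(1) by blast
  have "x = \<pi> ** (b ** u)" unfolding x(1) b(1) using b(2) assms(3) x(3) A_carrier Od_carrier by (intro m_assoc) auto
  then show "x \<in> {\<pi> ** u | u. u \<in> Od}" using A_Od_mult[OF b(2) x(3)] by blast
 qed
qed (use assms(2) in \<open>auto simp: pO_def\<close>)

lemma pO_idl: assumes "idl A p" "p ~= {\<zero>}" shows "idl Od (pO p)"
proof -
 obtain \<pi> where pi: "\<pi> \<in> p" "p = {\<pi> ** b | b. b \<in> A}" by (rule idl_gen[OF assms])
 have piA: "\<pi> \<in> A" using idlD(5)[OF assms(1) pi(1)] .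
 have pc: "\<pi> \<in> CR" using piA A_carrier by blast
 have e: "pO p = (\<otimes>) \<pi> ` Od" using pO_gen[OF pi(2,1) piA] by auto
 show ?thesis unfolding idl_def
 proof (intro conjI ballI)
  show "asub (pO p)" unfolding e by (rule asub_mult[OF Od_asub pc])
  show "pO p \<subseteq> Od" unfolding e using A_Od_mult[OF piA] by blast
  fix x y assume a: "x \<in> Od" "y \<in> pO p"
  then obtain u where u: "u \<in> Od" "y = \<pi> ** u" unfolding e by blast
  have "x ** y = \<pi> ** (x ** u)" unfolding u(2) using a u pc Od_carrier by (intro m_lcomm) auto
  then show "x ** y \<in> pO p" unfolding e using Od_mult[OF a(1) u(1)] by blast
 qed
qed

text \<open>The contraction to the order of the square of \<open>P \<inter> A\<close> extended to
  the localization at \<open>P\<close>. At an unramified prime it consists of the elements vanishing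
  there to second order.\<close>

definition P2 where "P2 P = {x \<in> Od. \<exists>g\<in>Od. g \<notin> P \<and> (\<exists>a\<in>P \<inter> A. \<exists>b\<in>P \<inter> A. \<exists>u\<in>Od. g ** x = a ** b ** u)}"

lemma P2_iff:
 assumes P: "np P" and pi: "\<pi> \<in> P \<inter> A" "P \<inter> A = {\<pi> ** b | b. b \<in> A}"
 shows "x \<in> P2 P \<longleftrightarrow> x \<in> Od \<and> (\<exists>g\<in>Od. g \<notin> P \<and> (\<exists>u\<in>Od. g ** x = \<pi> ** (\<pi> ** u)))"
proof
 have pc: "\<pi> \<in> CR" using pi A_carrier by blast
 show "x \<in> P2 P ==> x \<in> Od \<and> (\<exists>g\<in>Od. g \<notin> P \<and> (\<exists>u\<in>Od. g ** x = \<pi> ** (\<pi> ** u)))"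
 proof -
  assume "x \<in> P2 P"
  then obtain g a b u where g: "x \<in> Od" "g \<in> Od" "g \<notin> P" "a \<in> P \<inter> A" "b \<in> P \<inter> A" "u \<in> Od" "g ** x = a ** b ** u"
   unfolding P2_def by blast
  obtain a' where a': "a = \<pi> ** a'" "a' \<in> A" using g(4) pi(2) by blast
  obtain b' where b': "b = \<pi> ** b'" "b' \<in> A" using g(5) pi(2) by blast
  have c: "a' \<in> CR" "b' \<in> CR" "u \<in> CR" using a' b' g A_carrier Od_carrier by auto
  have "g ** x = \<pi> ** (\<pi> ** (a' ** (b' ** u)))" unfolding g(7) a' b' using c pc by (simp add: m_ac)
  then show ?thesis using g A_Od_mult[OF a'(2) A_Od_mult[OF b'(2) g(6)]] by blast
 qed
 assume "x \<in> Od \<and> (\<exists>g\<in>Od. g \<notin> P \<and> (\<exists>u\<in>Od. g ** x = \<pi> ** (\<pi> ** u)))"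
 then obtain g u where g: "x \<in> Od" "g \<in> Od" "g \<notin> P" "u \<in> Od" "g ** x = \<pi> ** (\<pi> ** u)" by blast
 have "g ** x = \<pi> ** \<pi> ** u" using g Od_carrier g(5) pc by (auto simp: m_assoc)
 then show "x \<in> P2 P" unfolding P2_def using g pi(1) by blast
qed

lemma np_gen:
 assumes "np P"
 obtains \<pi> where "\<pi> \<in> P \<inter> A" "dege (dP P) \<pi>" "P \<inter> A = {\<pi> ** b | b. b \<in> A}"
  "!!a. a \<in> A ==> \<exists>r\<in>At (dP P). a \<ominus> r \<in> P"
proof (rule idl_gen[OF npD(4,5)[OF assms]])
 fix \<pi> assume a: "\<pi> \<in> P \<inter> A" "dege (dgi (P \<inter> A)) \<pi>" "P \<inter> A = {\<pi> ** b | b. b \<in> A}"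
  "!!a. a \<in> A ==> \<exists>r\<in>At (dgi (P \<inter> A)). a \<ominus> r \<in> P \<inter> A"
 show ?thesis
 proof (rule that[OF a(1) a(2)[folded dP_def] a(3)])
  fix a' assume "a' \<in> A"
  then show "\<exists>r\<in>At (dP P). a' \<ominus> r \<in> P" using a(4)[folded dP_def] by blast
 qed
qed

lemma P2_asub: assumes P: "np P" shows "asub (P2 P)"
proof -
 obtain \<pi> where pi: "\<pi> \<in> P \<inter> A" "P \<inter> A = {\<pi> ** b | b. b \<in> A}" by (rule np_gen[OF P])
 note iff = P2_iff[OF P pi]
 have pc: "\<pi> \<in> CR" using pi A_carrier by blast
 show ?thesis unfolding asub_def
 proof (intro conjI ballI)
  show "P2 P \<subseteq> CR" unfolding P2_def using Od_carrier by blast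
  have "\<one> ** \<zero> = \<pi> ** (\<pi> ** \<zero>)" using pc by simp
  then show "\<zero> \<in> P2 P" unfolding iff using OdD(2) subringE(3)[OF Od_subring] prmD(2)[OF npD(1)[OF P]] by blast
  fix x y assume "x \<in> P2 P" "y \<in> P2 P"
  then obtain g u g' v where g: "x \<in> Od" "g \<in> Od" "g \<notin> P" "u \<in> Od" "g ** x = \<pi> ** (\<pi> ** u)"
   "y \<in> Od" "g' \<in> Od" "g' \<notin> P" "v \<in> Od" "g' ** y = \<pi> ** (\<pi> ** v)" unfolding iff by blast
  have c: "x \<in> CR" "g \<in> CR" "u \<in> CR" "y \<in> CR" "g' \<in> CR" "v \<in> CR"
   using g Od_carrier by auto
  have "(g ** g') ** (x \<ominus> y) = g' ** (g ** x) \<ominus> g ** (g' ** y)" using c by algebra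
  also have "\<dots> = \<pi> ** (\<pi> ** (g' ** u \<ominus> g ** v))" unfolding g(5,10) using c pc by algebra
  finally have "(g ** g') ** (x \<ominus> y) = \<pi> ** (\<pi> ** (g' ** u \<ominus> g ** v))" .
  moreover have "g ** g' \<notin> P" using prmD(3)[OF npD(1)[OF P] g(2,7)] g(3,8) by blast
  ultimately show "x \<ominus> y \<in> P2 P" unfolding iff
   using Od_mult[OF g(2,7)] OdD(3)[OF g(1,6)] OdD(3)[OF Od_mult[OF g(7,4)] Od_mult[OF g(2,9)]] by blast
 qed
qed

lemma P2_mult: assumes P: "np P" and x: "x \<in> P2 P" and u: "u \<in> Od" shows "x ** u \<in> P2 P"
proof -
 from x obtain g a b v where g: "x \<in> Od" "g \<in> Od" "g \<notin> P" "a \<in> P \<inter> A" "b \<in> P \<inter> A" "v \<in> Od" "g ** x = a ** b ** v"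
  unfolding P2_def by blast
 have c: "x \<in> CR" "g \<in> CR" "v \<in> CR" "u \<in> CR" "a \<in> CR" "b \<in> CR"
  using g u Od_carrier A_carrier by auto
 have "g ** (x ** u) = (g ** x) ** u" using c by (simp add: m_assoc)
 also have "\<dots> = a ** b ** (v ** u)" unfolding g(7) using c by (simp add: m_assoc)
 finally show ?thesis unfolding P2_def using g Od_mult[OF g(1) u] Od_mult[OF g(6) u] by blast
qed

lemma P2_sub: assumes P: "np P" shows "P2 P \<subseteq> P"
proof
 fix x assume "x \<in> P2 P"
 then obtain g a b v where g: "x \<in> Od" "g \<in> Od" "g \<notin> P" "a \<in> P \<inter> A" "b \<in> P \<inter> A" "v \<in> Od" "g ** x = a ** b ** v"
  unfolding P2_def by blast
 have c: "v \<in> CR" "a \<in> CR" "b \<in> CR" using g Od_carrier A_carrier by auto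
 have "(b ** v) ** a \<in> P" using A_Od_mult g idlD(3)[OF npD(2)[OF P]] by blast
 then show "x \<in> P" using c prmD(3)[OF npD(1)[OF P] g(2,1)] g(3) unfolding g(7) by algebra
qed

lemma P2_cancel:
 assumes P: "np P" and Q: "Q \<in> Od" "Q \<notin> P" and w: "w \<in> Od" "Q ** w \<in> P2 P" shows "w \<in> P2 P"
proof -
 from w obtain g a b v where g: "g \<in> Od" "g \<notin> P" "a \<in> P \<inter> A" "b \<in> P \<inter> A" "v \<in> Od" "g ** (Q ** w) = a ** b ** v"
  unfolding P2_def by blast
 have "(g ** Q) ** w = a ** b ** v" using g w Q Od_carrier by (simp add: m_assoc subset_iff)
 then show ?thesis using prmD(3)[OF npD(1)[OF P]] g Q w Od_mult[OF g(1) Q(1)] unfolding P2_def by blast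
qed

text \<open>The elements \<open>a + b t\<close> are incongruent modulo \<open>V\<close>, hence
  modulo any nonzero \<open>x\<close> in \<open>V\<close>, which \<open>index_le\<close> then forces
  to be large. As \<open>t\<close> serves an element without residue in that of \<open>A\<close> in
  \<open>not_H1_sized\<close>, and a generator of the prime below in
  \<open>P2_sized\<close>.\<close>

lemma sized_pairs:
 assumes V: "asub V" and P: "np P" and mult: "!!x u. x \<in> V ==> u \<in> Od ==> x ** u \<in> V" and t: "t \<in> Od"
  and sep: "!!a a' b b'. a \<in> At (dP P) ==> a' \<in> At (dP P) ==> b \<in> At (dP P) ==> b' \<in> At (dP P) ==>
   (a \<ominus> a') \<oplus> (b \<ominus> b') ** t \<in> V ==> a = a' \<and> b = b'"
 shows "sized (2 * dP P) V"
 unfolding sized_def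
proof (intro conjI allI ballI impI V)
 fix m x assume x: "x \<in> V \<inter> Box m" "x ~= \<zero>"
 define g where "g = (%(a,b). a \<oplus> b ** t)"
 let ?D = "At (dP P) \<times> At (dP P)"
 have tc: "t \<in> CR" using t Od_carrier by blast
 have diff: "g (a,b) \<ominus> g (a',b') = (a \<ominus> a') \<oplus> (b \<ominus> b') ** t"
  if "a \<in> At (dP P)" "a' \<in> At (dP P)" "b \<in> At (dP P)" "b' \<in> At (dP P)" for a a' b b'
 proof -
  have "a \<in> CR" "a' \<in> CR" "b \<in> CR" "b' \<in> CR" using that AtD(4) by blast+
  then show ?thesis unfolding g_def using tc by simp algebra
 qed
 have gO: "g ` ?D \<subseteq> Od" unfolding g_def using At_A A_Od_mult[OF _ t] OdD(6) A_Od by (auto simp: subset_iff)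
 have inj: "inj_on g ?D"
 proof (rule inj_onI, clarify)
  fix a b a' b' assume a: "a \<in> At (dP P)" "b \<in> At (dP P)" "a' \<in> At (dP P)" "b' \<in> At (dP P)" "g (a,b) = g (a',b')"
  have "g (a,b) \<in> CR" using gO a Od_carrier by blast
  then show "a = a' \<and> b = b'" using a(5) sep[OF a(1,3,2,4)] diff[OF a(1,3,2,4)] asubD(2)[OF V] by algebra
 qed
 have "card (g ` ?D) \<le> q ^ (n * (m + c0))"
 proof (rule index_le[of x m])
  show "x \<in> Box m" "x ~= \<zero>" using x by auto
  show "finite (g ` ?D)" using At_finite by blast
  show "g ` ?D \<subseteq> Od" by (rule gO)
  fix w w' u assume w: "w \<in> g ` ?D" "w' \<in> g ` ?D" "u \<in> Od" "w \<ominus> w' = x ** u"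
  obtain a b where ab: "a \<in> At (dP P)" "b \<in> At (dP P)" "w = g (a,b)" using w(1) by blast
  obtain a' b' where ab': "a' \<in> At (dP P)" "b' \<in> At (dP P)" "w' = g (a',b')" using w(2) by blast
  show "w = w'" using mult[of x u] x w(3,4) diff[OF ab(1) ab'(1) ab(2) ab'(2)] ab ab' sep[OF ab(1) ab'(1) ab(2) ab'(2)] by simp
 qed
 then show "2 * dP P \<le> n * (m + c0)" using power_le_imp_le_exp[OF q_gt] unfolding card_image[OF inj] card_cartesian_product card_At by (simp add: mult_2 power_add)
qed

lemma At_dP_unique:
 assumes "np P" "r \<in> At (dP P)" "r' \<in> At (dP P)" "r \<ominus> r' \<in> P" shows "r = r'"
 using At_reps_unique[OF npD(4,5)[OF assms(1)]] assms AtD(3) At_A unfolding dP_def by blast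

lemma not_H1_sized: assumes P: "np P" and n: "\<not> H1 P" shows "sized (2 * dP P) P"
proof -
 have i: "idl Od P" using npD(2)[OF P] .
 obtain t where t: "t \<in> Od" "!!a. a \<in> A ==> t \<ominus> a \<notin> P" using n P unfolding H1_def by blast
 have tc: "t \<in> CR" using t Od_carrier by blast
 show ?thesis
 proof (rule sized_pairs[OF idlD(1)[OF i] P _ t(1)])
  show "x ** u \<in> P" if "x \<in> P" "u \<in> Od" for x u
   using idlD(3)[OF i that(2,1)] m_comm[of x u] idlD(6)[OF i that(1)] that(2) Od_carrier by auto
  fix a a' b b' assume a: "a \<in> At (dP P)" "a' \<in> At (dP P)" "b \<in> At (dP P)" "b' \<in> At (dP P)"
   and m: "(a \<ominus> a') \<oplus> (b \<ominus> b') ** t \<in> P"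
  have c: "a \<in> CR" "a' \<in> CR" "b \<in> CR" "b' \<in> CR" using a AtD(4) by blast+
  have dA: "b \<ominus> b' \<in> A" "a \<ominus> a' \<in> A" using AtD(3) At_A a by blast+
  have bb: "b = b'"
  proof (rule ccontr)
   assume "b ~= b'"
   then obtain z where z: "z \<in> A" "z ** (b \<ominus> b') \<ominus> \<one> \<in> P" using At_dP_unique[OF P a(3,4)] prm_A_inv[OF npD(3,5)[OF P] dA(1)] by blast
   have zc: "z \<in> CR" using z A_carrier by blast
   have "z ** ((a \<ominus> a') \<oplus> (b \<ominus> b') ** t) \<ominus> t ** (z ** (b \<ominus> b') \<ominus> \<one>) \<in> P"
    using idlD(8)[OF i idlD(3)[OF i _ m] idlD(3)[OF i t(1) z(2)]] z(1) A_Od by blast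
   also have "z ** ((a \<ominus> a') \<oplus> (b \<ominus> b') ** t) \<ominus> t ** (z ** (b \<ominus> b') \<ominus> \<one>) = t \<ominus> (\<ominus> (z ** (a \<ominus> a')))"
    using zc c tc by algebra
   finally show False using t(2) subringE(5,6)[OF A_subring] z(1) dA by blast
  qed
  then show "a = a' \<and> b = b'" using m c tc At_dP_unique[OF P a(1,2)] bb by (simp add: minus_eq r_neg)
 qed
qed

lemma P2_sized: assumes P: "np P" shows "sized (2 * dP P) (P2 P)"
proof -
 have i: "idl Od P" using npD(2)[OF P] .
 obtain \<pi> where pi: "\<pi> \<in> P \<inter> A" "dege (dP P) \<pi>" "P \<inter> A = {\<pi> ** b | b. b \<in> A}" by (rule np_gen[OF P])
 have pc: "\<pi> \<in> CR" "\<pi> ~= \<zero>" using pi A_carrier dege_nonzero by auto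
 have piO: "\<pi> \<in> Od" using pi A_Od by blast
 show ?thesis
 proof (rule sized_pairs[OF P2_asub[OF P] P P2_mult[OF P] piO], assumption, assumption)
  fix a a' b b' assume a: "a \<in> At (dP P)" "a' \<in> At (dP P)" "b \<in> At (dP P)" "b' \<in> At (dP P)"
   and m: "(a \<ominus> a') \<oplus> (b \<ominus> b') ** \<pi> \<in> P2 P"
  have c: "a \<in> CR" "a' \<in> CR" "b \<in> CR" "b' \<in> CR" using a AtD(4) by blast+
  have bO: "b \<ominus> b' \<in> Od" using AtD(3) At_A A_Od a by blast
  have "(a \<ominus> a') \<oplus> (b \<ominus> b') ** \<pi> \<ominus> (b \<ominus> b') ** \<pi> \<in> P"
   using idlD(8)[OF i _ idlD(3)[OF i bO]] m P2_sub[OF P] pi by blast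
  then have aa: "a = a'" using c pc At_dP_unique[OF P a(1,2)] by algebra
  then have "(b \<ominus> b') ** \<pi> \<in> P2 P" using m c pc by (simp add: minus_eq r_neg)
  then obtain g u where g: "g \<in> Od" "g \<notin> P" "u \<in> Od" "g ** ((b \<ominus> b') ** \<pi>) = \<pi> ** (\<pi> ** u)"
   unfolding P2_iff[OF P pi(1,3)] by blast
  have gc: "g \<in> CR" "u \<in> CR" using g Od_carrier by auto
  have "\<pi> ** (g ** (b \<ominus> b')) = \<pi> ** (\<pi> ** u)" using g(4) gc c pc by (simp add: m_ac)
  then have "g ** (b \<ominus> b') = u ** \<pi>" using mult_cancel[OF pc(1) _ _ pc(2)] gc c pc m_comm by simp
  then show "a = a' \<and> b = b'" using idlD(3)[OF i g(3)] pi prmD(3)[OF npD(1)[OF P] g(1) bO] g(2) aa At_dP_unique[OF P a(3,4)] by auto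
 qed
qed

lemma pigeon_pO:
 assumes p: "idl A p" "p ~= {\<zero>}" and y: "y \<in> Od"
 obtains i j :: nat where "i < j" "y [^] i \<ominus> y [^] j \<in> pO p"
proof -
 obtain \<pi> where pi: "\<pi> \<in> p" "dege (dgi p) \<pi>" using idl_gen[OF p] by metis
 have I: "idl Od (pO p)" using pO_idl[OF p] .
 have pc: "\<pi> \<in> CR" using idlD(6)[OF p(1) pi(1)] .
 have "\<forall>l::nat. \<exists>v. v \<in> Box (dgi p) \<and> y [^] l \<ominus> v \<in> pO p"
 proof
  fix l :: nat
  obtain u v where uv: "u \<in> Od" "v \<in> Box (dgi p)" "y [^] l = \<pi> ** u \<oplus> v"
   using Od_div[OF pi(2)] subring_pow[OF Od_subring y] by blast
  have "u \<in> CR" "v \<in> CR" using uv Od_carrier BoxD(4) by auto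
  then have "y [^] l \<ominus> v = \<pi> ** u" unfolding uv(3) using pc by algebra
  then show "\<exists>v. v \<in> Box (dgi p) \<and> y [^] l \<ominus> v \<in> pO p" unfolding pO_def using uv pi by auto
 qed
 from choice[OF this] obtain f where f: "!!l::nat. f l \<in> Box (dgi p) \<and> y [^] l \<ominus> f l \<in> pO p" by blast
 have "\<not> inj_on f (UNIV :: nat set)"
 proof
  assume "inj_on f (UNIV :: nat set)"
  moreover have "f ` UNIV \<subseteq> Box (dgi p)" using f by auto
  ultimately show False using Box_finite[of "dgi p"] finite_subset[of "f ` UNIV"] finite_imageD by blast
 qed
 then obtain i j where ij: "f i = f j" "i < j" unfolding inj_on_def by (metis linorder_neqE_nat)
 have c: "y [^] i \<in> CR" "y [^] j \<in> CR" "f j \<in> CR" using y Od_carrier f BoxD(4) by auto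
 have "y [^] i \<ominus> y [^] j = (y [^] i \<ominus> f i) \<ominus> (y [^] j \<ominus> f j)" unfolding ij(1) using c by algebra
 then show ?thesis using idlD(8)[OF I] f that ij by metis
qed

end

text \<open>\<open>D1\<close> has the part of the discriminant: modulo a prime of \<open>A\<close>
  not containing it the order is a reduced ring. Such an element is constructed in
  \<open>order_red\<close>.\<close>

locale fq_order_red = fq_order R k T q \<gamma> n for R (structure) and k T q \<gamma> n +
 fixes D1 :: 'a
 assumes D1: "D1 \<in> A" "D1 ~= \<zero>"
  and red: "!!p w j. prm A p ==> p ~= {\<zero>} ==> D1 \<notin> p ==> w \<in> Od ==> w [^] (j::nat) \<in> pO p ==> w \<in> pO p"
begin

text \<open>As \<open>\<O> / p \<O>\<close> is finite and reduced, every element of \<open>P / p \<O>\<close> is killed by an element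
  outside \<open>P\<close>.\<close>

lemma unramified:
 assumes P: "np P" and D: "D1 \<notin> P" and y: "y \<in> P"
 shows "\<exists>g\<in>Od. g \<notin> P \<and> g ** y \<in> pO (P \<inter> A)"
proof -
 have i: "idl Od P" using npD(2)[OF P] .
 have yO: "y \<in> Od" using idlD(5)[OF i y] .
 have yc: "y \<in> CR" using idlD(6)[OF i y] .
 obtain a b :: nat where ab: "a < b" "y [^] a \<ominus> y [^] b \<in> pO (P \<inter> A)"
  using pigeon_pO[OF npD(4,5)[OF P] yO] .
 obtain c where c: "b = Suc (a + c)" using ab(1) less_imp_Suc_add by blast
 \<comment> \<open>The coincidence of two powers says that \<open>g y^a\<close> lies in
   \<open>p Od\<close>, with \<open>p\<close> the prime below; hence a power of \<open>g y\<close>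
   does, and reducedness applies. Modulo \<open>P\<close> the element \<open>g\<close> is 1.\<close>
 define g where "g = \<one> \<ominus> y [^] Suc c"
 have ycP: "y [^] Suc c \<in> P" using idlD(3)[OF i subring_pow[OF Od_subring yO] y] by simp
 have gO: "g \<in> Od" unfolding g_def by (intro subring_minus[OF Od_subring] subringE(3)[OF Od_subring] subring_pow[OF Od_subring yO])
 have gc: "g \<in> CR" using gO Od_carrier by blast
 have pc: "y [^] Suc c \<in> CR" "y [^] a \<in> CR" using yc by auto
 have gP: "g \<notin> P"
 proof
  assume "g \<in> P"
  then have "g \<oplus> y [^] Suc c \<in> P" using idlD(7)[OF i _ ycP] by blast
  moreover have "g \<oplus> y [^] Suc c = \<one>" unfolding g_def using pc by algebra
  ultimately show False using prmD(2)[OF npD(1)[OF P]] by simp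
 qed
 have "y [^] b = y [^] a ** y [^] Suc c" unfolding c using nat_pow_mult[OF yc, of a "Suc c"] by simp
 then have 1: "g ** y [^] a \<in> pO (P \<inter> A)" using pc ab(2) unfolding g_def by algebra
 have "(g ** y) [^] Suc a = (g [^] a ** y) ** (g ** y [^] a)"
 proof -
  have "(g ** y) [^] Suc a = g [^] Suc a ** y [^] Suc a" using nat_pow_distrib[OF gc yc] .
  then show ?thesis using gc yc by (simp add: m_ac)
 qed
 moreover have "g [^] a ** y \<in> Od" using Od_mult[OF subring_pow[OF Od_subring gO] yO] .
 ultimately have "(g ** y) [^] Suc a \<in> pO (P \<inter> A)" using idlD(3)[OF pO_idl[OF npD(4,5)[OF P]] _ 1] by simp
 moreover have "D1 \<notin> P \<inter> A" using D by blast
 ultimately show ?thesis using red[OF npD(3,5)[OF P] _ Od_mult[OF gO yO]] gO gP by blast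
qed

text \<open>The generated ideal is radical, by localization: the multipliers taking \<open>y\<close>
  to multiples of \<open>x\<close> form an ideal containing \<open>x\<close>. At a prime above it,
  \<open>x\<close> and \<open>y\<close> are multiples of \<open>\<pi>\<close> up to factors outside
  the prime, and the cofactor \<open>x'\<close> of \<open>x\<close> is itself outside as
  \<open>x\<close> is not in \<open>P2 P\<close>. So \<open>x' f\<close> is a multiplier outside the
  prime.\<close>

lemma radical_principal:
 assumes x: "x \<in> Od" "x ~= \<zero>"
  and good: "!!P. np P ==> x \<in> P ==> H1 P \<and> D1 \<notin> P \<and> x \<notin> P2 P"
  and y: "y \<in> Od" "!!P. H1 P ==> x \<in> P ==> y \<in> P"
 shows "\<exists>u\<in>Od. y = x ** u"
proof -
 have xc: "x \<in> CR" "y \<in> CR" using x y Od_carrier by auto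
 define I where "I = {a \<in> Od. \<exists>u\<in>Od. a ** y = x ** u}"
 have I: "idl Od I"
  unfolding idl_def asub_def
 proof (intro conjI ballI)
  show "I \<subseteq> CR" "I \<subseteq> Od" unfolding I_def using Od_carrier by auto
  have "\<zero> ** y = x ** \<zero>" using xc by simp
  then show "\<zero> \<in> I" unfolding I_def using OdD(2) by blast
  fix a assume "a \<in> I"
  then obtain u where a: "a \<in> Od" "u \<in> Od" "a ** y = x ** u" unfolding I_def by blast
  have ac: "a \<in> CR" "u \<in> CR" using a Od_carrier by auto
  show "a \<ominus> b \<in> I" if "b \<in> I" for b
  proof -
   obtain v where b: "b \<in> Od" "v \<in> Od" "b ** y = x ** v" using \<open>b \<in> I\<close> unfolding I_def by blast
   then have "(a \<ominus> b) ** y = x ** (u \<ominus> v)" using a(3) ac subsetD[OF Od_carrier] xc by algebra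
   then show ?thesis unfolding I_def using OdD(3)[OF a(1) b(1)] OdD(3)[OF a(2) b(2)] by blast
  qed
  fix s assume s: "s \<in> Od"
  then have "(s ** a) ** y = x ** (s ** u)" using a(3) ac xc subsetD[OF Od_carrier s] by (simp add: m_assoc m_lcomm)
  then show "s ** a \<in> I" unfolding I_def using Od_mult[OF s] a by blast
 qed
 have xI: "x \<in> I" using x y unfolding I_def by blast
 have "\<one> \<in> I"
 proof (rule ccontr)
  assume "\<one> \<notin> I"
  then obtain P where P: "np P" "I \<subseteq> P" using exists_np[OF I _ xI x(2)] by blast
  have xP: "x \<in> P" using xI P by blast
  have g: "H1 P" "D1 \<notin> P" "x \<notin> P2 P" using good[OF P(1) xP] by auto
  have yP: "y \<in> P" using y(2)[OF g(1) xP] .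
  obtain \<pi> where pi: "\<pi> \<in> P \<inter> A" "dege (dP P) \<pi>" "P \<inter> A = {\<pi> ** b | b. b \<in> A}" by (rule np_gen[OF P(1)])
  have pc: "\<pi> \<in> CR" "\<pi> ~= \<zero>" "\<pi> \<in> A" using pi A_carrier dege_nonzero by auto
  have pO: "pO (P \<inter> A) = {\<pi> ** u | u. u \<in> Od}" using pO_gen[OF pi(3,1) pc(3)] .
  have un: "\<exists>g u. g \<in> Od \<and> g \<notin> P \<and> u \<in> Od \<and> g ** z = \<pi> ** u" if "z \<in> P" for z
   using unramified[OF P(1) g(2) that] unfolding pO by blast
  obtain g x' where gx: "g \<in> Od" "g \<notin> P" "x' \<in> Od" "g ** x = \<pi> ** x'" using un[OF xP] by blast
  obtain f y' where fy: "f \<in> Od" "f \<notin> P" "y' \<in> Od" "f ** y = \<pi> ** y'" using un[OF yP] by blast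
  have c: "g \<in> CR" "x' \<in> CR" "f \<in> CR" "y' \<in> CR" using gx fy Od_carrier by auto
  have "x' \<notin> P"
  proof
   assume "x' \<in> P"
   then obtain g' x'' where g': "g' \<in> Od" "g' \<notin> P" "x'' \<in> Od" "g' ** x' = \<pi> ** x''" using un by blast
   have c': "g' \<in> CR" "x'' \<in> CR" using g' Od_carrier by auto
   have "(g' ** g) ** x = g' ** (\<pi> ** x')" unfolding gx(4)[symmetric] using c c' xc by (simp add: m_assoc)
   also have "\<dots> = \<pi> ** (\<pi> ** x'')" unfolding g'(4)[symmetric] using c c' pc by (simp add: m_lcomm)
   finally have "x \<in> P2 P" unfolding P2_iff[OF P(1) pi(1,3)]
    using x(1) Od_mult[OF g'(1) gx(1)] prmD(3)[OF npD(1)[OF P(1)] g'(1) gx(1)] g'(2,3) gx(2) by blast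
   then show False using g by blast
  qed
  then have n: "x' ** f \<notin> P" using prmD(3)[OF npD(1)[OF P(1)] gx(3) fy(1)] fy(2) by blast
  have "(x' ** f) ** y = x' ** (\<pi> ** y')" unfolding fy(4)[symmetric] using c xc by (simp add: m_assoc)
  also have "\<dots> = (\<pi> ** x') ** y'" using c pc by algebra
  also have "\<dots> = x ** (g ** y')" unfolding gx(4)[symmetric] using c xc by algebra
  finally have "x' ** f \<in> I" unfolding I_def using Od_mult gx fy by blast
  then show False using n P(2) by blast
 qed
 then show ?thesis unfolding I_def using xc by auto
qed

end

subsection \<open>The density of primes of degree one\<close>

lemma geometric_tail:
 fixes x :: real assumes "2 \<le> x" "D \<le> M"
 shows "(\<Sum>d=Suc D..M. 1 / x ^ d) \<le> 1 / x ^ D"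
proof -
 have "(\<Sum>d=Suc D..M. 1 / x ^ d) + 1 / x ^ M \<le> 1 / x ^ D"
  using assms(2)
 proof (induction M rule: dec_induct)
  case (step M)
  have "2 * (1 / x ^ Suc M) \<le> 1 / x ^ M"
   using assms(1) by (simp add: field_simps)
  then show ?case using step by simp
 qed simp
 moreover have "1 / x ^ M \<ge> 0" using assms by simp
 ultimately show ?thesis by linarith
qed

context fq_poly
begin

lemma common_multiple:
 assumes "finite S" "S \<subseteq> A"
 shows "\<exists>Q\<in>A. Q ~= \<zero> \<and> (\<forall>a\<in>S. a ~= \<zero> --> (\<exists>b\<in>A. Q = a ** b))"
 using assms
proof (induction S rule: finite_induct)
 case empty
 then show ?case using subringE(3)[OF A_subring] one_not_zero by (intro bexI[of _ \<one>]) auto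
next
 case (insert s S)
 then obtain Q where Q: "Q \<in> A" "Q ~= \<zero>" "!!a. a \<in> S ==> a ~= \<zero> ==> \<exists>b\<in>A. Q = a ** b" by auto
 have sA: "s \<in> A" using insert by blast
 have c: "s \<in> CR" "Q \<in> CR" using sA Q A_carrier by auto
 show ?case
 proof (cases "s = \<zero>")
  case True
  then show ?thesis using Q by blast
 next
  case False
  have "s ** Q \<in> A" using subringE(6)[OF A_subring sA Q(1)] .
  moreover have "\<exists>b\<in>A. s ** Q = a ** b" if a: "a \<in> insert s S" "a ~= \<zero>" for a
  proof (cases "a = s")
   case True
   then show ?thesis using Q by blast
  next
   case False
   then have aS: "a \<in> S" using a by blast
   then obtain b where b: "b \<in> A" "Q = a ** b" using Q(3) a by blast
   have "a \<in> CR" "b \<in> CR" using aS b insert.prems A_carrier by auto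
   then show ?thesis using c subringE(6)[OF A_subring sA b(1)] unfolding b(2) by (auto simp: m_lcomm)
  qed
  ultimately show ?thesis using False Q integral c by blast
 qed
qed

lemma dege_add_low: assumes "dege d a" "b \<in> At d" shows "dege d (b \<oplus> a)"
proof -
 have a: "a \<in> At (Suc d)" "a \<notin> At d" using assms(1) unfolding dege_def by auto
 have b: "b \<in> At (Suc d)" using assms(2) At_mono[of d "Suc d"] by auto
 have "b \<oplus> a \<notin> At d"
 proof
  assume n: "b \<oplus> a \<in> At d"
  have "a = (b \<oplus> a) \<ominus> b" using AtD(4)[OF a(1)] AtD(4)[OF b] by algebra
  then show False using AtD(3)[OF n assms(2)] a(2) by simp
 qed
 then show ?thesis unfolding dege_def using AtD(6)[OF b a(1)] by blast
qed

end

context fq_order_red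
begin

text \<open>The form \<open>1 + Q(...)\<close> keeps out all primes containing \<open>Q\<close>. The
  power of \<open>T\<close> exceeds the size of \<open>y\<close> by the loss \<open>c0\<close> of a
  product and one more, so that \<open>Q T^(m + c0 + 1)\<close> dominates and multiplication acts on
  sizes like an element of \<open>A\<close> of degree \<open>E\<close>.\<close>

definition shift where "shift Q m y = \<one> \<oplus> Q ** (T [^] (m + c0 + 1) \<oplus> y)"

lemma shift_props:
 assumes Q: "dege \<delta> Q" and y: "y \<in> Box m" and E: "E = \<delta> + m + c0 + 1"
 shows "shift Q m y \<in> Box (E + 1)" "!!u. u \<in> Od ==> shift Q m y ** u \<in> Box E ==> u = \<zero>" "shift Q m y ~= \<zero>"
proof -
 let ?e = "m + c0 + 1"
 have QA: "Q \<in> A" using dege_A[OF Q] .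
 have c: "Q \<in> CR" "y \<in> CR" "T [^] ?e \<in> CR" using QA A_carrier y BoxD(4) T by auto
 define z0 where "z0 = \<one> \<oplus> Q ** T [^] ?e"
 have Te: "dege ?e (T [^] ?e)"
 proof -
  have "\<one> ** T [^] ?e \<oplus> \<zero> \<notin> At ?e" using dege_lead[OF subringE(3)[OF subring_k] AtD(2)] one_not_zero by blast
  moreover have "\<one> ** T [^] ?e \<in> At (Suc ?e)" using T_pow_At[OF subringE(3)[OF subring_k]] .
  ultimately show ?thesis unfolding dege_def using c by simp
 qed
 have "\<one> \<in> At (Suc 0)" unfolding At_1 using subringE(3)[OF subring_k] .
 then have z0: "dege E z0" using At_mono[of "Suc 0" "\<delta> + ?e"] dege_add_low[OF dege_mult[OF Q Te]] E unfolding z0_def by (auto simp: ac_simps)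
 have Qy: "Q ** y \<in> Box (\<delta> + m)" using At_Box_mult y Q unfolding dege_def by blast
 have e: "shift Q m y = z0 \<oplus> Q ** y" unfolding shift_def z0_def using c by (simp add: r_distr a_assoc)
 have "z0 \<in> Box (E + 1)" using At_Box z0 unfolding dege_def by simp
 moreover have "Q ** y \<in> Box (E + 1)" using Qy Box_mono[of "\<delta> + m" "E + 1"] E by auto
 ultimately show 1: "shift Q m y \<in> Box (E + 1)" unfolding e by (rule BoxD(6))
 show 2: "u = \<zero>" if u: "u \<in> Od" "shift Q m y ** u \<in> Box E" for u
 proof (rule ccontr)
  assume u0: "u ~= \<zero>"
  \<comment> \<open>The smallest box around \<open>u\<close>. Multiplication by \<open>z0\<close>
    enlarges it by exactly \<open>E\<close>, while \<open>Q y\<close> stays one short of that; so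
    the product cannot lie in \<open>Box E\<close>.\<close>
  define l where "l = (LEAST m. u \<in> Box m)"
  obtain l0 where "u \<in> Box l0" using Od_Box[OF u(1)] .
  then have ul: "u \<in> Box l" unfolding l_def using LeastI[of "%m. u \<in> Box m" l0] by blast
  obtain l' where l': "l = Suc l'" using ul u0 Box_0 not0_implies_Suc by (metis singletonD)
  have uc: "u \<in> CR" "z0 \<in> CR" using u Od_carrier dege_A[OF z0] A_carrier by auto
  have "Q ** y ** u \<in> Box (\<delta> + m + Suc l' + c0)" using Box_mult[OF Qy] ul l' by blast
  then have a: "Q ** y ** u \<in> Box (E + l')" unfolding E by (simp add: ac_simps)
  have b: "shift Q m y ** u \<in> Box (E + l')" using u(2) Box_mono[of E "E + l'"] by auto
  have "z0 ** u \<in> Box (E + l')" using uc c BoxD(3)[OF b a] unfolding e by algebra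
  then show False using not_less_Least[of l' "%m. u \<in> Box m"] l' Box_div[OF z0 u(1)] unfolding l_def by auto
 qed
 show "shift Q m y ~= \<zero>"
 proof
  assume "shift Q m y = \<zero>"
  then have "shift Q m y ** \<one> \<in> Box E" using BoxD(2) by simp
  then show False using 2[OF subringE(3)[OF Od_subring]] one_not_zero by blast
 qed
qed

lemma shift_Q_notin:
 assumes "prm Od P" "Q \<in> A" "y \<in> Od" "shift Q m y \<in> P" shows "Q \<notin> P"
proof
 assume Q: "Q \<in> P"
 note i = prmD(1)[OF assms(1)]
 have Ty: "T [^] (m + c0 + 1) \<oplus> y \<in> Od" using OdD(6) subring_pow[OF Od_subring] T_A A_Od assms(3) by blast
 have c: "Q \<in> CR" "T [^] (m + c0 + 1) \<oplus> y \<in> CR" using assms(2) A_carrier Ty Od_carrier by auto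
 have "(T [^] (m + c0 + 1) \<oplus> y) ** Q \<in> P" using idlD(3)[OF i Ty Q] .
 then have "shift Q m y \<ominus> (T [^] (m + c0 + 1) \<oplus> y) ** Q \<in> P" using idlD(8)[OF i assms(4)] by blast
 moreover have "shift Q m y \<ominus> (T [^] (m + c0 + 1) \<oplus> y) ** Q = \<one>" unfolding shift_def using c by algebra
 ultimately show False using prmD(2)[OF assms(1)] by simp
qed

text \<open>The difference of two shifts is \<open>Q (y - y0)\<close>, and \<open>Q\<close> can be
  cancelled modulo \<open>V\<close>. So the \<open>y\<close> in question lie in one coset of
  \<open>V \<inter> Box m\<close>.\<close>

lemma card_shift_le:
 assumes V: "asub V" "!!w. w \<in> Od ==> Q ** w \<in> V ==> w \<in> V" and Q: "Q \<in> A"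
 shows "card {y \<in> Box m. shift Q m y \<in> V} \<le> card (Box m \<inter> V)"
proof (cases "{y \<in> Box m. shift Q m y \<in> V} = {}")
 case False
 then obtain y0 where y0: "y0 \<in> Box m" "shift Q m y0 \<in> V" by blast
 have Qc: "Q \<in> CR" "T [^] (m + c0 + 1) \<in> CR" using Q A_carrier T by auto
 show ?thesis
 proof (rule card_inj_on_le[where f = "%y. y \<ominus> y0"])
  show "inj_on (%y. y \<ominus> y0) {y \<in> Box m. shift Q m y \<in> V}"
  proof (rule inj_onI)
   fix a b assume "a \<in> {y \<in> Box m. shift Q m y \<in> V}" "b \<in> {y \<in> Box m. shift Q m y \<in> V}" and e: "a \<ominus> y0 = b \<ominus> y0"
   then show "a = b" using BoxD(4) y0 e by (auto simp: minus_eq)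
  qed
  show "(%y. y \<ominus> y0) ` {y \<in> Box m. shift Q m y \<in> V} \<subseteq> Box m \<inter> V"
  proof (rule image_subsetI)
   fix y assume y: "y \<in> {y \<in> Box m. shift Q m y \<in> V}"
   then have yB: "y \<ominus> y0 \<in> Box m" using BoxD(3) y0 by blast
   have c: "y \<in> CR" "y0 \<in> CR" using y y0 BoxD(4) by auto
   have "Q ** (y \<ominus> y0) = shift Q m y \<ominus> shift Q m y0" unfolding shift_def using c Qc by algebra
   then show "y \<ominus> y0 \<in> Box m \<inter> V" using asubD(3)[OF V(1)] y y0 V(2) yB Box_Od by force
  qed
  show "finite (Box m \<inter> V)" using Box_finite by blast
 qed
next
 case True
 show ?thesis unfolding True by simp
qed

text \<open>Reverses \<open>sum_dP_le\<close> for good elements: by \<open>shift_props\<close>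
  distinct elements of \<open>Box E\<close> are incongruent modulo the shift, hence, its ideal being
  radical, already modulo the family of primes containing it.\<close>

lemma sum_dP_ge:
 assumes Q: "dege \<delta> Q" and y: "y \<in> Box m" and E: "E = \<delta> + m + c0 + 1"
  and good: "!!P. np P ==> shift Q m y \<in> P ==> H1 P \<and> D1 \<notin> P \<and> shift Q m y \<notin> P2 P"
  and fin: "finite \<P>" "!!P. H1 P ==> shift Q m y \<in> P ==> P \<in> \<P>" "!!P. P \<in> \<P> ==> H1 P"
 shows "E * n \<le> (\<Sum>P\<in>\<P>. if shift Q m y \<in> P then dP P else 0)"
proof -
 note sh = shift_props[OF Q y E]
 define x where "x = shift Q m y"
 define \<P>' where "\<P>' = {P\<in>\<P>. x \<in> P}"
 have fP: "finite \<P>'" unfolding \<P>'_def using fin by simp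
 define f where "f w = (\<lambda>P\<in>\<P>'. SOME r. r \<in> At (dP P) \<and> w \<ominus> r \<in> P)" for w
 have f: "f w P \<in> At (dP P) \<and> w \<ominus> f w P \<in> P" if "w \<in> Box E" "P \<in> \<P>'" for w P
 proof -
  have "\<exists>r. r \<in> At (dP P) \<and> w \<ominus> r \<in> P" using that Box_Od H1_residue fin(3) that(2) unfolding \<P>'_def by blast
  then have "(SOME r. r \<in> At (dP P) \<and> w \<ominus> r \<in> P) \<in> At (dP P) \<and> w \<ominus> (SOME r. r \<in> At (dP P) \<and> w \<ominus> r \<in> P) \<in> P"
   by (rule someI_ex)
  then show ?thesis unfolding f_def using that(2) by simp
 qed
 have xO: "x \<in> Od" unfolding x_def using sh(1) Box_Od by blast
 have "card (Box E) \<le> card (PiE \<P>' (%P. At (dP P)))"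
 proof (rule card_inj_on_le[where f = f])
  show "inj_on f (Box E)"
  proof (rule inj_onI)
   fix a b assume ab: "a \<in> Box E" "b \<in> Box E" "f a = f b"
   have c: "a \<in> CR" "b \<in> CR" using ab BoxD(4) by auto
   have "a \<ominus> b \<in> P" if "H1 P" "x \<in> P" for P
   proof -
    have P: "P \<in> \<P>'" unfolding \<P>'_def using fin(2) that unfolding x_def by blast
    have i: "idl Od P" using npD(2)[OF H1_np[OF that(1)]] .
    have p: "a \<ominus> f a P \<in> P" "b \<ominus> f b P \<in> P" using f P ab by blast+
    have "f b P \<in> CR" using f[OF ab(2) P] AtD(4) by blast
    then show ?thesis using c idlD(8)[OF i p] unfolding ab(3) by algebra
   qed
   then obtain u where u: "u \<in> Od" "a \<ominus> b = x ** u" using BoxD(3)[OF ab(1,2)] Box_Od radical_principal[OF xO] sh(3) good unfolding x_def by blast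
   then have "u = \<zero>" using sh(2) BoxD(3)[OF ab(1,2)] unfolding x_def by simp
   then show "a = b" using u xO Od_carrier minus_zero_iff c by auto
  qed
  show "f ` Box E \<subseteq> PiE \<P>' (%P. At (dP P))"
  proof (rule image_subsetI)
   fix w assume w: "w \<in> Box E"
   show "f w \<in> PiE \<P>' (%P. At (dP P))"
    by (rule PiE_I) (use f[OF w] in \<open>auto simp: f_def\<close>)
  qed
  show "finite (PiE \<P>' (%P. At (dP P)))" using fP At_finite by (intro finite_PiE) auto
 qed
 then have "q ^ (E * n) \<le> q ^ (\<Sum>P\<in>\<P>'. dP P)" unfolding card_Box card_PiE[OF fP] card_At power_sum .
 then have "E * n \<le> (\<Sum>P\<in>\<P>'. dP P)" using power_le_imp_le_exp[OF q_gt] by blast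
 also have "\<dots> = (\<Sum>P\<in>\<P>. if shift Q m y \<in> P then dP P else 0)"
  unfolding \<P>'_def x_def using fin(1) by (simp add: sum.If_cases Int_def)
 finally show ?thesis .
qed

definition NP where "NP d = {P. np P \<and> dP P = d}"

lemma card_NP: assumes "d > 0" shows "finite (NP d)" "card (NP d) \<le> n * (2 + c0) * q ^ d"
proof -
 show f: "finite (NP d)" unfolding NP_def by (rule np_finite[OF assms])
 have "d * card (NP d) \<le> n * (q ^ d + 1 + c0)" by (rule np_count[OF f]) (simp add: NP_def)
 moreover have "card (NP d) \<le> d * card (NP d)" using assms by simp
 moreover have "n * (q ^ d + 1 + c0) \<le> n * (2 + c0) * q ^ d"
 proof -
  have "q ^ d \<ge> 1" using q_gt by simp
  then have "(1 + c0) * 1 \<le> (1 + c0) * q ^ d" by (rule mult_le_mono2)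
  then have "q ^ d + 1 + c0 \<le> (2 + c0) * q ^ d" by simp
  then have "n * (q ^ d + 1 + c0) \<le> n * ((2 + c0) * q ^ d)" by (rule mult_le_mono2)
  then show ?thesis by (simp only:)
 qed
 ultimately show "card (NP d) \<le> n * (2 + c0) * q ^ d" by linarith
qed

definition K1 where "K1 = q ^ (n * (1 + c0))"

lemma sized_card:
 assumes "sized D V" "D > 0"
 shows "real (card (Box m \<inter> V)) \<le> real K1 * (real q ^ (m * n) / real q ^ D + 1)"
proof (cases "D \<le> n * m")
 case True
 have "card (Box m \<inter> V) * q ^ D \<le> q ^ (m * n) * K1" using sized_card_small[OF assms True] unfolding K1_def .
 then have "real (card (Box m \<inter> V) * q ^ D) \<le> real (q ^ (m * n) * K1)" using of_nat_mono by blast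
 then have "real (card (Box m \<inter> V)) \<le> real q ^ (m * n) * real K1 / real q ^ D"
  using q_gt by (simp add: le_divide_eq)
 then show ?thesis by (simp add: algebra_simps)
next
 case False
 then have "real (card (Box m \<inter> V)) \<le> real K1" using sized_card_large[OF assms, of m 0] unfolding K1_def by simp
 moreover have "0 \<le> real K1 * (real q ^ (m * n) / real q ^ D)" by simp
 ultimately show ?thesis unfolding distrib_left by linarith
qed

text \<open>\<open>Q\<close> is a common multiple of \<open>D1\<close> and all nonzero polynomials
  of degree at most \<open>D\<close>; among the latter is a generator of each prime of degree at
  most \<open>D\<close>.\<close>

lemma exists_Q:
 obtains Q \<delta> where "dege \<delta> Q" "!!P. np P ==> Q \<notin> P ==> D1 \<notin> P \<and> D < dP P"
proof -
 have fin: "finite (insert D1 (At (Suc D)))" using At_finite by blast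
 have sub: "insert D1 (At (Suc D)) \<subseteq> A" using At_A D1 by blast
 obtain Q where Q: "Q \<in> A" "Q ~= \<zero>" "!!a. a \<in> insert D1 (At (Suc D)) ==> a ~= \<zero> ==> \<exists>b\<in>A. Q = a ** b"
  using common_multiple[OF fin sub] by auto
 obtain \<delta> where d: "dege \<delta> Q" using dege_exists[OF Q(1,2)] .
 have "D1 \<notin> P \<and> D < dP P" if P: "np P" "Q \<notin> P" for P
 proof (rule ccontr)
  assume n: "\<not> (D1 \<notin> P \<and> D < dP P)"
  obtain \<pi> where pi: "\<pi> \<in> P \<inter> A" "dege (dP P) \<pi>" "P \<inter> A = {\<pi> ** b | b. b \<in> A}" by (rule np_gen[OF P(1)])
  have "\<exists>a\<in>P. a \<in> insert D1 (At (Suc D)) \<and> a ~= \<zero>"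
  proof (cases "D1 \<in> P")
   case True
   then show ?thesis using D1 by blast
  next
   case False
   then have "dP P \<le> D" using n by simp
   then show ?thesis using pi(2) At_mono[of "Suc (dP P)" "Suc D"] pi dege_nonzero unfolding dege_def by blast
  qed
  then obtain a b where ab: "a \<in> P" "b \<in> A" "Q = a ** b" using Q(3) by blast
  have "b ** a \<in> P" using idlD(3)[OF npD(2)[OF P(1)]] ab A_Od by blast
  moreover have "b ** a = Q" using ab idlD(6)[OF npD(2)[OF P(1)]] A_carrier m_comm by (simp add: subset_iff)
  ultimately show False using P(2) by simp
 qed
 then show ?thesis using that d by blast
qed

text \<open>Double counting as in \<open>U_upper\<close>, with shifted elements. A good one accounts
  for at least \<open>E * n\<close>. Bad ones lie in a prime of higher residue degree or in some
  \<open>P2 P\<close>, conditions of index \<open>q ^ (2 * d)\<close> with \<open>d > D\<close>, so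
  their proportion is of order \<open>q ^ (- D)\<close>. It matters that \<open>C3\<close> does not
  depend on \<open>D\<close>; \<open>K5\<close> and \<open>m1\<close> do, through
  \<open>Q\<close>.\<close>

lemma U_lower:
 "\<exists>C3 \<ge> 0. \<forall>D. \<exists>K5 m1. \<forall>m\<ge>m1. U (m * n) \<ge> real (m * n) * (1 - C3 / real q ^ D) - K5"
proof -
 define C where "C = 2 * real (n * (2 + c0)) * real K1"
 have q2: "(2::real) \<le> real q" using q_gt by simp
 have C0: "C \<ge> 0" unfolding C_def by simp
 have "\<exists>K5 m1. \<forall>m\<ge>m1. U (m * n) \<ge> real (m * n) * (1 - 3 * C / real q ^ D) - K5" for D
 proof -
  obtain Q \<delta> where Q: "dege \<delta> Q" "!!P. np P ==> Q \<notin> P ==> D1 \<notin> P \<and> D < dP P" by (rule exists_Q[where D = D]) blast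
  have QA: "Q \<in> A" using dege_A[OF Q(1)] .
  have QO: "Q \<in> Od" using QA A_Od by blast
  define K4 where "K4 = q ^ (n * (1 + c0) + n * t0)"
  define K5 where "K5 = real K4 * (real n * (3 + real c0)) * real q ^ (n * (\<delta> + 2 * c0 + 2))"
  have "U (m * n) \<ge> real (m * n) * (1 - 3 * C / real q ^ D) - K5" if m: "m \<ge> \<delta> + 2 * c0 + 2 + 2 * D" for m
  proof -
   define E where "E = \<delta> + m + c0 + 1"
   define sh where "sh y = shift Q m y" for y
   define N where "N = real q ^ (m * n)"
   have N0: "N > 0" unfolding N_def using q_gt by simp
   \<comment> \<open>No prime of larger degree contains a shifted element. The conditions defining
     bad elements have size \<open>2 * d\<close>, so for them degrees stop at half of this.\<close>
   define M3 where "M3 = n * (E + 1 + c0)"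
   define M2 where "M2 = M3 div 2"
   have X1: "sh y \<in> Box (E + 1)" "sh y ~= \<zero>" if "y \<in> Box m" for y
    unfolding sh_def using shift_props[OF Q(1) that E_def] by auto
   have szX: "d \<le> M3" if "sized d V" "y \<in> Box m" "sh y \<in> V" for d V y
    using that X1[OF that(2)] unfolding sized_def M3_def by auto
   have QP: "Q \<notin> P" if "np P" "y \<in> Box m" "sh y \<in> P" for P y
    using shift_Q_notin[OF npD(1)[OF that(1)] QA] that Box_Od unfolding sh_def by blast
   define Bad where "Bad = {y \<in> Box m. \<exists>P. np P \<and> sh y \<in> P \<and> (\<not> H1 P \<or> sh y \<in> P2 P)}"
   define B1 where "B1 P = (if H1 P \<or> Q \<in> P then {} else {y \<in> Box m. sh y \<in> P})" for P
   define B2 where "B2 P = (if Q \<in> P then {} else {y \<in> Box m. sh y \<in> P2 P})" for P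
   have Bfin: "finite (B1 P)" "finite (B2 P)" for P unfolding B1_def B2_def using Box_finite by auto
   let ?g = "%d. N / real q ^ (2 * d) + 1"
   have b1: "real (card (B1 P)) \<le> real K1 * ?g d" if P: "P \<in> NP d" for P d
   proof (cases "H1 P \<or> Q \<in> P")
    case False
    have nP: "np P" "dP P = d" using P unfolding NP_def by auto
    have i: "idl Od P" using npD(2)[OF nP(1)] .
    have "real (card (B1 P)) \<le> real (card (Box m \<inter> P))" using card_shift_le[OF idlD(1)[OF i] _ QA] prmD(3)[OF npD(1)[OF nP(1)] QO] unfolding B1_def sh_def by auto
    also have "\<dots> \<le> real K1 * ?g d"
     unfolding N_def using sized_card[OF not_H1_sized[OF nP(1)]] False dP_pos[OF nP(1)] nP(2) by auto
    finally show ?thesis .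
   qed (use N0 q_gt in \<open>simp add: B1_def\<close>)
   have b2: "real (card (B2 P)) \<le> real K1 * ?g d" if P: "P \<in> NP d" for P d
   proof (cases "Q \<in> P")
    case False
    have nP: "np P" "dP P = d" using P unfolding NP_def by auto
    have "real (card (B2 P)) \<le> real (card (Box m \<inter> P2 P))" using card_shift_le[OF P2_asub[OF nP(1)] P2_cancel[OF nP(1) QO False] QA] unfolding B2_def sh_def by simp
    also have "\<dots> \<le> real K1 * ?g d"
     unfolding N_def using sized_card[OF P2_sized[OF nP(1)]] dP_pos[OF nP(1)] nP(2) by auto
    finally show ?thesis .
   qed (use N0 q_gt in \<open>simp add: B2_def\<close>)
   have sub: "Bad \<subseteq> (\<Union>d\<in>{Suc D..M2}. \<Union>P\<in>NP d. B1 P \<union> B2 P)"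
   proof
    fix y assume "y \<in> Bad"
    then obtain P where P: "y \<in> Box m" "np P" "sh y \<in> P" "\<not> H1 P \<or> sh y \<in> P2 P" unfolding Bad_def by blast
    have nQ: "Q \<notin> P" using QP[OF P(2,1,3)] .
    have "dP P \<in> {Suc D..M2}" using P(4) szX[OF not_H1_sized[OF P(2)] P(1,3)] szX[OF P2_sized[OF P(2)] P(1)] Q(2)[OF P(2) nQ] unfolding M2_def by auto
    then show "y \<in> (\<Union>d\<in>{Suc D..M2}. \<Union>P\<in>NP d. B1 P \<union> B2 P)" using P nQ P(2) unfolding B1_def B2_def NP_def by auto
   qed
   have NPf: "finite (NP d)" if "d \<in> {Suc D..M2}" for d using card_NP(1)[of d] that by auto
   have "real (card Bad) \<le> (\<Sum>d=Suc D..M2. C * (N / real q ^ d + real q ^ d))"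
   proof -
    have "card Bad \<le> card (\<Union>d\<in>{Suc D..M2}. \<Union>P\<in>NP d. B1 P \<union> B2 P)"
     by (rule card_mono[OF _ sub]) (use NPf Bfin in auto)
    also have "\<dots> \<le> (\<Sum>d=Suc D..M2. card (\<Union>P\<in>NP d. B1 P \<union> B2 P))" by (rule card_UN_le) simp
    also have "\<dots> \<le> (\<Sum>d=Suc D..M2. \<Sum>P\<in>NP d. card (B1 P) + card (B2 P))"
    proof (rule sum_mono)
     fix d assume "d \<in> {Suc D..M2}"
     then have "card (\<Union>P\<in>NP d. B1 P \<union> B2 P) \<le> (\<Sum>P\<in>NP d. card (B1 P \<union> B2 P))" by (intro card_UN_le NPf)
     also have "\<dots> \<le> (\<Sum>P\<in>NP d. card (B1 P) + card (B2 P))" by (intro sum_mono card_Un_le)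
     finally show "card (\<Union>P\<in>NP d. B1 P \<union> B2 P) \<le> (\<Sum>P\<in>NP d. card (B1 P) + card (B2 P))" .
    qed
    finally have "real (card Bad) \<le> real (\<Sum>d=Suc D..M2. \<Sum>P\<in>NP d. card (B1 P) + card (B2 P))" using of_nat_mono by blast
    also have "\<dots> = (\<Sum>d=Suc D..M2. \<Sum>P\<in>NP d. real (card (B1 P)) + real (card (B2 P)))" by simp
    also have "\<dots> \<le> (\<Sum>d=Suc D..M2. C * (N / real q ^ d + real q ^ d))"
    proof (rule sum_mono)
     fix d assume d: "d \<in> {Suc D..M2}"
     have "(\<Sum>P\<in>NP d. real (card (B1 P)) + real (card (B2 P))) \<le> (\<Sum>P\<in>NP d. 2 * (real K1 * ?g d))"
     proof (rule sum_mono)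
      fix P assume "P \<in> NP d"
      then show "real (card (B1 P)) + real (card (B2 P)) \<le> 2 * (real K1 * ?g d)"
       using add_mono[OF b1 b2, of P d P d] by simp
     qed
     also have "\<dots> = real (card (NP d)) * (2 * (real K1 * ?g d))" by simp
     also have "\<dots> \<le> real (n * (2 + c0) * q ^ d) * (2 * (real K1 * ?g d))"
      by (rule mult_right_mono) (use card_NP(2)[of d] d N0 in \<open>auto simp: of_nat_mono simp del: of_nat_mult of_nat_power\<close>)
     also have "\<dots> = C * (real q ^ d * ?g d)"
      by (simp only: C_def of_nat_mult of_nat_power mult.assoc mult.left_commute)
     also have "real q ^ d * ?g d = N / real q ^ d + real q ^ d"
      unfolding mult_2 power_add by (simp add: field_simps)
     finally show "(\<Sum>P\<in>NP d. real (card (B1 P)) + real (card (B2 P))) \<le> C * (N / real q ^ d + real q ^ d)" .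
    qed
    finally show ?thesis .
   qed
   also have "\<dots> = C * (N * (\<Sum>d=Suc D..M2. 1 / real q ^ d) + (\<Sum>d=Suc D..M2. real q ^ d))"
    by (simp add: sum_distrib_left sum.distrib distrib_left)
   also have "\<dots> \<le> C * (N * (1 / real q ^ D) + 2 * real q ^ M2)"
   proof (intro mult_left_mono add_mono C0)
    show "(\<Sum>d=Suc D..M2. 1 / real q ^ d) \<le> 1 / real q ^ D"
    proof (cases "D \<le> M2")
     case True
     then show ?thesis by (rule geometric_tail[OF q2])
    qed (use q_gt in simp)
    have "(\<Sum>d=Suc D..M2. real q ^ d) \<le> (\<Sum>d=1..M2. real q ^ d)" by (rule sum_mono2) auto
    also have "\<dots> \<le> 2 * real q ^ M2" by (rule sum_powers_le[OF q2])
    finally show "(\<Sum>d=Suc D..M2. real q ^ d) \<le> 2 * real q ^ M2" .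
   qed (use N0 in simp)
   \<comment> \<open>\<open>q ^ M2\<close> is of the order of the square root of \<open>N\<close>,
     hence below \<open>N / q ^ D\<close> once \<open>m\<close> is large compared with
     \<open>D\<close> and the degree of \<open>Q\<close>.\<close>
   also have "\<dots> \<le> C * (N * (1 / real q ^ D) + 2 * (N / real q ^ D))"
   proof (intro mult_left_mono add_mono C0 order_refl)
    have "2 * M2 \<le> n * (E + 1 + c0)" unfolding M2_def M3_def by simp
    also have "\<dots> = n * m + n * (\<delta> + 2 * c0 + 2)" unfolding E_def by (simp add: algebra_simps)
    finally have a: "2 * M2 \<le> n * m + n * (\<delta> + 2 * c0 + 2)" .
    have "n * (\<delta> + 2 * c0 + 2 + 2 * D) \<le> n * m" using m by (rule mult_le_mono2)
    then have "n * (\<delta> + 2 * c0 + 2) + n * (2 * D) \<le> n * m" by (simp add: algebra_simps)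
    moreover have "2 * D \<le> n * (2 * D)" using n_pos by simp
    ultimately have "M2 + D \<le> m * n" using a unfolding mult.commute[of m n] by linarith
    then have "real q ^ (M2 + D) \<le> N" unfolding N_def using q_gt by (intro power_increasing) auto
    then show "real q ^ M2 \<le> N / real q ^ D" using q_gt by (simp add: le_divide_eq power_add)
   qed (use N0 in auto)
   finally have bad: "real (card Bad) \<le> 3 * C * N / real q ^ D" by (simp add: algebra_simps)
   define PP where "PP = (\<Union>d\<in>{1..M3}. HH d)"
   let ?f = "%y. \<Sum>P\<in>PP. if sh y \<in> P then dP P else 0" let ?S = "%P. {y \<in> Box m. sh y \<in> P}"
   have PPf: "finite PP" unfolding PP_def using HH_finite by auto
   have PPH: "H1 P" if "P \<in> PP" for P using that unfolding PP_def HH_def by auto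
   have PPi: "P \<in> PP" if "H1 P" "y \<in> Box m" "sh y \<in> P" for P y
   proof -
    have "dP P \<le> M3" using szX[OF np_sized[OF H1_np[OF that(1)]] that(2,3)] .
    then show ?thesis unfolding PP_def HH_def using that(1) dP_pos[OF H1_np[OF that(1)]] by auto
   qed
   have lower: "(card (Box m) - card Bad) * (E * n) \<le> (\<Sum>y\<in>Box m. ?f y)"
   proof -
    have "(\<Sum>y\<in>Box m - Bad. E * n) \<le> (\<Sum>y\<in>Box m - Bad. ?f y)"
    proof (rule sum_mono)
     fix y assume y: "y \<in> Box m - Bad"
     then have yB: "y \<in> Box m" by blast
     show "E * n \<le> ?f y"
      unfolding sh_def
     proof (rule sum_dP_ge[OF Q(1) yB E_def _ PPf])
      fix P
      show "H1 P \<and> D1 \<notin> P \<and> shift Q m y \<notin> P2 P" if P: "np P" "shift Q m y \<in> P"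
      using Q(2)[OF P(1)] QP[OF P(1) yB] P(2) y P unfolding sh_def Bad_def by blast
      show "P \<in> PP" if "H1 P" "shift Q m y \<in> P" using PPi[OF that(1) yB] that(2) unfolding sh_def by blast
      show "H1 P" if "P \<in> PP" using PPH[OF that] .
     qed
    qed
    also have "\<dots> \<le> (\<Sum>y\<in>Box m. ?f y)" by (rule sum_mono2) (use Box_finite in auto)
    finally have "card (Box m - Bad) * (E * n) \<le> (\<Sum>y\<in>Box m. ?f y)" by simp
    moreover have "card (Box m - Bad) = card (Box m) - card Bad"
     by (rule card_Diff_subset) (use Box_finite finite_subset in \<open>auto simp: Bad_def\<close>)
    ultimately show ?thesis by simp
   qed
   have "(\<Sum>y\<in>Box m. ?f y) = (\<Sum>P\<in>PP. \<Sum>y\<in>Box m. if sh y \<in> P then dP P else 0)"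
    by (rule sum.swap)
   also have "\<dots> = (\<Sum>P\<in>PP. dP P * card (?S P))"
    by (rule sum.cong[OF refl]) (simp add: sum.If_cases[OF Box_finite] mult.commute Int_def)
   finally have swap: "real (\<Sum>y\<in>Box m. ?f y) = (\<Sum>P\<in>PP. real (dP P) * real (card (?S P)))"
    by simp
   \<comment> \<open>The main term needs constant 1, so \<open>card_Box_inter_exact\<close> is used
     wherever it applies. In degrees from \<open>m * n - n * t0\<close> on only boundedly many
     elements occur.\<close>
   have each: "real (card (?S P)) \<le> (if d \<le> m * n then N / real q ^ d else 0) + real K4"
    if P: "P \<in> HH d" for P d
   proof (cases "\<exists>y\<in>Box m. sh y \<in> P")
    case True
    have H: "H1 P" "dP P = d" using P unfolding HH_def by auto
    have nP: "np P" using H1_np[OF H(1)] .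
    have 1: "real (card (?S P)) \<le> real (card (Box m \<inter> P))" using True QP[OF nP] card_shift_le[OF idlD(1)[OF npD(2)[OF nP]] _ QA] prmD(3)[OF npD(1)[OF nP] QO] unfolding sh_def by auto
    show ?thesis
    proof (cases "d + n * t0 \<le> n * m")
     case True
     then have "real (card (Box m \<inter> P) * q ^ d) \<le> real (q ^ (m * n))" using card_Box_inter_exact[OF H(1)] H(2) of_nat_mono by blast
     then have "real (card (Box m \<inter> P)) \<le> N / real q ^ d" unfolding N_def using q_gt by (simp add: le_divide_eq)
     moreover have "d \<le> m * n" using True by (simp add: mult.commute)
     ultimately show ?thesis using 1 by simp
    next
     case False
     then have "card (Box m \<inter> P) \<le> K4" using sized_card_large[OF np_sized[OF nP], of m "n * t0"] dP_pos[OF nP] H(2)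
      unfolding K4_def by simp
     moreover have "N / real q ^ d \<ge> 0" using N0 by simp
     ultimately show ?thesis using 1 by auto
    qed
   next
    case False
    then have e: "?S P = {}" by blast
    show ?thesis unfolding e using N0 by simp
   qed
   have "(\<Sum>P\<in>PP. real (dP P) * real (card (?S P))) = (\<Sum>d=1..M3. \<Sum>P\<in>HH d. real (dP P) * real (card (?S P)))"
    unfolding PP_def by (rule sum.UNION_disjoint) (auto simp: HH_finite, auto simp: HH_def)
   also have "\<dots> \<le> (\<Sum>d=1..M3. \<Sum>P\<in>HH d. real d * ((if d \<le> m * n then N / real q ^ d else 0) + real K4))"
    by (intro sum_mono mult_mono each) (auto simp: HH_def)
   also have "\<dots> = (\<Sum>d=1..M3. (if d \<le> m * n then N * (real d * real (h d) / real q ^ d) else 0)) + real K4 * (\<Sum>d=1..M3. real d * real (h d))"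
    unfolding sum_distrib_left sum.distrib[symmetric]
    by (intro sum.cong refl) (simp add: h_def algebra_simps)
   also have "(\<Sum>d=1..M3. (if d \<le> m * n then N * (real d * real (h d) / real q ^ d) else 0)) = N * U (m * n)"
   proof -
    have "{1..M3} \<inter> {d. d \<le> m * n} = {1..m * n}" unfolding M3_def E_def by (auto simp: algebra_simps)
    then show ?thesis unfolding U_def sum_distrib_left by (simp add: sum.If_cases)
   qed
   also have "real K4 * (\<Sum>d=1..M3. real d * real (h d)) \<le> real K4 * (real n * (3 + real c0) * real q ^ M3)"
    by (rule mult_left_mono[OF sum_h_le]) simp
   also have "real K4 * (real n * (3 + real c0) * real q ^ M3) = N * K5"
   proof -
    have "M3 = m * n + n * (\<delta> + 2 * c0 + 2)" unfolding M3_def E_def by (simp add: algebra_simps)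
    then show ?thesis unfolding K5_def N_def by (simp add: power_add)
   qed
   finally have up: "(\<Sum>P\<in>PP. real (dP P) * real (card (?S P))) \<le> N * U (m * n) + N * K5" by simp
   have "real (card (Box m) - card Bad) \<ge> N - 3 * C * N / real q ^ D"
   proof -
    have "real (card (Box m)) \<le> real (card (Box m) - card Bad) + real (card Bad)" by (simp only:)
    moreover have "real (card (Box m)) = N" unfolding card_Box N_def by simp
    ultimately show ?thesis using bad by linarith
   qed
   then have g: "N * (1 - 3 * C / real q ^ D) \<le> real (card (Box m) - card Bad)" by (simp add: algebra_simps)
   have "N * (1 - 3 * C / real q ^ D) * real (m * n) \<le> real (card (Box m) - card Bad) * real (m * n)"
    by (rule mult_right_mono[OF g]) simp
   also have "\<dots> \<le> real (card (Box m) - card Bad) * real (E * n)"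
    by (intro mult_left_mono of_nat_mono mult_le_mono1) (auto simp: E_def)
   also have "\<dots> = real ((card (Box m) - card Bad) * (E * n))" by simp
   also have "\<dots> \<le> real (\<Sum>y\<in>Box m. ?f y)" using lower of_nat_mono by blast
   also have "\<dots> \<le> N * U (m * n) + N * K5" unfolding swap by (rule up)
   finally have "N * ((1 - 3 * C / real q ^ D) * real (m * n)) \<le> N * (U (m * n) + K5)" by (simp add: algebra_simps)
   then show ?thesis using N0 by (simp add: mult.commute)
  qed
  then show ?thesis by blast
 qed
 then show ?thesis using C0 by (intro exI[of _ "3 * C"]) auto
qed

lemma U_mono: "m \<le> m' ==> U m \<le> U m'"
 unfolding U_def by (rule sum_mono2) auto

text \<open>An analogue of Mertens' theorem.\<close>

theorem U_asymp: "(%M. U M / real M) \<longlonglongrightarrow> 1"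
proof (rule tendstoI)
 fix e :: real assume e: "e > 0"
 obtain C3 where C3: "C3 \<ge> 0" "!!D. \<exists>K5 m1. \<forall>m\<ge>m1. U (m * n) \<ge> real (m * n) * (1 - C3 / real q ^ D) - K5"
  using U_lower by blast
 have "(%D. (1 / real q) ^ D) \<longlonglongrightarrow> 0" by (rule LIMSEQ_power_zero) (use q_gt in simp)
 then have "(%D. C3 * (1 / real q) ^ D) \<longlonglongrightarrow> 0" by (rule tendsto_mult_right_zero)
 then have "\<forall>\<^sub>F D in sequentially. C3 * (1 / real q) ^ D < e / 2" by (rule order_tendstoD(2)) (use e in simp)
 then obtain D where "C3 * (1 / real q) ^ D < e / 2" by fastforce
 then have D: "C3 / real q ^ D < e / 2" by (simp add: power_divide)
 obtain K5 m1 where K5: "!!m. m \<ge> m1 ==> U (m * n) \<ge> real (m * n) * (1 - C3 / real q ^ D) - K5" using C3(2) by blast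
 define K6 where "K6 = \<bar>K5\<bar> + real n * (4 + 2 * real c0)"
 have K60: "K6 \<ge> 0" unfolding K6_def by simp
 define M0 where "M0 = n * (m1 + 1) + nat \<lceil>2 * (K6 + real n) / e\<rceil> + 1"
 have "dist (U M / real M) 1 < e" if M: "M \<ge> M0" for M
 proof -
  have M1: "real M > 0" using M unfolding M0_def by simp
  define m where "m = M div n"
  have mM: "m * n \<le> M" unfolding m_def by simp
  have Mm: "M < (m + 1) * n" unfolding m_def using dividend_less_div_times[OF n_pos, of M] by simp
  have "n * (m1 + 1) \<le> M" using M unfolding M0_def by simp
  then have "m1 + 1 \<le> m" unfolding m_def using n_pos by (metis div_le_mono nonzero_mult_div_cancel_left less_numeral_extra(3))
  then have m1: "m1 \<le> m" by simp
  have "2 * (K6 + real n) / e < real M" using M unfolding M0_def by linarith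
  then have K: "K6 + real n < e / 2 * real M" using e by (simp add: field_simps)
  have "U M \<le> U ((m + 1) * n)" using Mm by (intro U_mono) simp
  also have "\<dots> \<le> real (n * (m + 1)) + real n * (3 + 2 * real c0)" by (rule U_upper)
  also have "\<dots> \<le> real M + K6"
  proof -
   have "real (n * m) \<le> real M" using mM by (metis mult.commute of_nat_mono)
   then show ?thesis unfolding K6_def by (simp add: algebra_simps)
  qed
  finally have u: "U M \<le> real M + K6" .
  have "real (m * n) * (1 - C3 / real q ^ D) \<ge> real M - real n - e / 2 * real M"
  proof -
   have "real (m * n) * (C3 / real q ^ D) \<le> real M * (e / 2)"
    by (rule mult_mono) (use mM D C3(1) in \<open>auto simp del: of_nat_mult\<close>)
   moreover have "real M * (e / 2) = e / 2 * real M" by simp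
   moreover have "real M \<le> real (m * n) + real n" using Mm by (simp add: flip: of_nat_mult of_nat_add)
   ultimately show ?thesis unfolding right_diff_distrib by linarith
  qed
  then have l: "real M - real n - e / 2 * real M - K6 \<le> U M" using mult_nonneg_nonneg[of "real n" "4 + 2 * real c0"] K5[OF m1] U_mono[OF mM] unfolding K6_def by linarith
  have "1 - e < U M / real M"
  proof -
   have "real M - e * real M < U M" using l K by simp
   then show ?thesis using M1 by (simp add: less_divide_eq algebra_simps)
  qed
  then show ?thesis using K M1 K60 u unfolding dist_real_def by (simp add: field_simps)
 qed
 then show "\<forall>\<^sub>F M in sequentially. dist (U M / real M) 1 < e" unfolding eventually_sequentially by blast
qed

end

section \<open>Dirichlet series\<close>

text \<open>Summation by parts, once for \<open>c\<close> and once for the comparison sequence with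
  partial sums \<open>e * M + K\<close>; the differences of \<open>v\<close> are nonnegative, so the
  two can be compared term by term.\<close>

lemma abel_estimate:
 fixes c v :: "nat => real"
 assumes v: "!!d. v (Suc d) \<le> v d" "!!d. v d \<ge> 0"
  and C: "!!M. \<bar>\<Sum>d=1..M. c d\<bar> \<le> e * real M + K"
 shows "\<bar>\<Sum>d=1..M. c d * v d\<bar> \<le> e * (\<Sum>d=1..M. v d) + K * v 1"
proof (cases M)
 case 0
 show ?thesis using C[of 0] 0 v(2)[of 1] by simp
next
 case (Suc N)
 define S where "S m = (\<Sum>d=1..m. c d)" for m
 have 1: "(\<Sum>d=1..Suc m. c d * v d) = S (Suc m) * v (Suc m) + (\<Sum>d=1..m. S d * (v d - v (Suc d)))" for m
  by (induction m) (auto simp: S_def algebra_simps)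
 have 2: "(e * real (Suc m) + K) * v (Suc m) + (\<Sum>d=1..m. (e * real d + K) * (v d - v (Suc d))) = e * (\<Sum>d=1..Suc m. v d) + K * v 1" for m
  by (induction m) (auto simp: algebra_simps)
 have "\<bar>\<Sum>d=1..Suc N. c d * v d\<bar> \<le> \<bar>S (Suc N) * v (Suc N)\<bar> + \<bar>\<Sum>d=1..N. S d * (v d - v (Suc d))\<bar>"
  unfolding 1 by (rule abs_triangle_ineq)
 also have "\<bar>S (Suc N) * v (Suc N)\<bar> \<le> (e * real (Suc N) + K) * v (Suc N)"
  unfolding abs_mult S_def using C[of "Suc N"] v(2)[of "Suc N"] by (simp add: mult_right_mono)
 also have "\<bar>\<Sum>d=1..N. S d * (v d - v (Suc d))\<bar> \<le> (\<Sum>d=1..N. (e * real d + K) * (v d - v (Suc d)))"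
 proof (rule order_trans[OF sum_abs sum_mono])
  fix d
  show "\<bar>S d * (v d - v (Suc d))\<bar> \<le> (e * real d + K) * (v d - v (Suc d))"
   unfolding abs_mult S_def using C[of d] v(1)[of d] by (simp add: mult_right_mono)
 qed
 finally show ?thesis unfolding Suc 2[symmetric] by simp
qed

lemma log_series_summable: "0 \<le> u ==> u < 1 ==> summable (%d. u ^ d / real d :: real)"
proof (rule summable_comparison_test'[where g = "%d. u ^ d" and N = 0])
 assume u: "0 \<le> u" "u < 1"
 then show "summable (%d. u ^ d)" by (intro summable_geometric) simp
 fix d :: nat
 show "norm (u ^ d / real d) \<le> u ^ d"
 proof (cases "d = 0")
  case False
  then have "u ^ d / real d \<le> u ^ d / 1" using u by (intro divide_left_mono) auto
  then show ?thesis using u by simp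
 qed (use u in simp)
qed

text \<open>A partial sum of the harmonic series exceeds any bound, and the corresponding partial
  sum of the logarithmic series tends to it as \<open>u\<close> approaches 1.\<close>

lemma log_series_at_top: "filterlim (%u::real. suminf (%d. u ^ d / real d)) at_top (at_left 1)"
 unfolding filterlim_at_top
proof
 fix Z :: real
 have "\<not> (\<forall>N. (\<Sum>d<N. inverse (real d)) \<le> Z)"
 proof
  assume "\<forall>N. (\<Sum>d<N. inverse (real d)) \<le> Z"
  then have "summable (%d. inverse (real d))" by (intro summableI_nonneg_bounded[where x = Z]) auto
  then show False using not_summable_harmonic[where 'a = real] by simp
 qed
 then obtain N where N: "Z < (\<Sum>d<N. inverse (real d))" by (auto simp: not_le)
 have "((%u::real. \<Sum>d<N. u ^ d / real d) \<longlongrightarrow> (\<Sum>d<N. 1 ^ d / real d)) (at_left 1)"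
  unfolding divide_inverse by (intro tendsto_sum tendsto_mult tendsto_power tendsto_ident_at tendsto_const)
 then have "\<forall>\<^sub>F u in at_left 1. Z < (\<Sum>d<N. u ^ d / real d)"
  by (rule order_tendstoD(1)) (use N in \<open>simp add: inverse_eq_divide\<close>)
 moreover have "\<forall>\<^sub>F u in at_left (1::real). u < 1" by (simp add: eventually_at_filter)
 moreover have "\<forall>\<^sub>F u in at_left (1::real). 0 < u" by (rule order_tendstoD(1)[OF tendsto_ident_at]) simp
 ultimately show "\<forall>\<^sub>F u in at_left 1. Z \<le> (suminf (%d. u ^ d / real d))"
 proof eventually_elim
  case (elim u)
  have "(\<Sum>d<N. u ^ d / real d) \<le> (suminf (%d. u ^ d / real d))"
   by (rule sum_le_suminf[OF log_series_summable]) (use elim in auto)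
  then show ?case using elim by simp
 qed
qed

text \<open>An Abelian theorem: the assumption bounds the partial sums of \<open>b d - 1\<close> by
  \<open>e * M + K\<close>, so the two series differ by at most \<open>e\<close> times the logarithm
  plus a constant, and the logarithm is unbounded.\<close>

lemma log_series_transfer:
 fixes b :: "nat => real"
 assumes b: "!!d. b d \<ge> 0" and lim: "(%M. (\<Sum>d=1..M. b d) / real M) \<longlonglongrightarrow> 1"
 shows "((%u. (suminf (%d. b d * (u ^ d / real d))) / (suminf (%d. u ^ d / real d))) \<longlongrightarrow> 1) (at_left 1)"
proof (rule tendstoI)
 fix e' :: real assume e': "e' > 0"
 define e where "e = e' / 2"
 have e: "e > 0" unfolding e_def using e' by simp
 have "\<forall>\<^sub>F M in sequentially. dist ((\<Sum>d=1..M. b d) / real M) 1 < e" using tendstoD[OF lim e] .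
 then obtain M0 where M0: "!!M. M \<ge> M0 ==> \<bar>(\<Sum>d=1..M. b d) / real M - 1\<bar> < e"
  unfolding eventually_sequentially dist_real_def by blast
 define K where "K = (\<Sum>M\<le>M0. \<bar>\<Sum>d=1..M. b d - 1\<bar>)"
 have K0: "K \<ge> 0" unfolding K_def by simp
 have C: "\<bar>\<Sum>d=1..M. b d - 1\<bar> \<le> e * real M + K" for M
 proof (cases "M \<le> M0")
  case True
  then have "\<bar>\<Sum>d=1..M. b d - 1\<bar> \<le> K" unfolding K_def by (intro member_le_sum) auto
  moreover have "e * real M \<ge> 0" using e by simp
  ultimately show ?thesis by linarith
 next
  case False
  then have M: "real M > 0" by simp
  have "(\<Sum>d=1..M. b d - 1) = ((\<Sum>d=1..M. b d) / real M - 1) * real M"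
  by (auto simp: sum_subtractf left_diff_distrib)
  then have "\<bar>\<Sum>d=1..M. b d - 1\<bar> = \<bar>(\<Sum>d=1..M. b d) / real M - 1\<bar> * real M" by (simp add: abs_mult)
  also have "\<dots> \<le> e * real M" using M0[of M] False M by (intro mult_right_mono) auto
  finally show ?thesis using K0 by simp
 qed
 let ?l = "%u::real. suminf (%d. u ^ d / real d)" let ?m = "%u. suminf (%d. b d * (u ^ d / real d))"
 have main: "\<bar>?m u - ?l u\<bar> \<le> e * ?l u + K"
  if u: "0 < u" "u < 1" for u :: real
 proof -
  \<comment> \<open>Division by \<open>real 0\<close> gives 0, which would spoil monotonicity
    between 0 and 1. The sums start at 1, so the value at 0 can be changed.\<close>
  define v where "v d = (if d = 0 then 1 else u ^ d / real d)" for d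
  have v0: "v d \<ge> 0" for d unfolding v_def using u by simp
  have v1: "v (Suc d) \<le> v d" for d
  proof (cases "d = 0")
   case False
   have "u ^ Suc d / real (Suc d) \<le> u ^ d / real d"
    by (rule frac_le) (use u False in \<open>auto simp: mult_left_le_one_le\<close>)
   then show ?thesis unfolding v_def using False by simp
  qed (use u in \<open>simp add: v_def\<close>)
  have S: "summable (%d. u ^ d / real d)" using log_series_summable u by simp
  have eq: "(\<Sum>d<Suc M. f d * (u ^ d / real d)) = (\<Sum>d=1..M. f d * v d)" for f M
   by (rule sum.mono_neutral_cong_right) (auto simp: v_def)
  have eq1: "(\<Sum>d<Suc M. u ^ d / real d) = (\<Sum>d=1..M. v d)" for M
   using eq[of "%_. 1" M] by simp
  have est: "\<bar>(\<Sum>d=1..M. b d * v d) - (\<Sum>d=1..M. v d)\<bar> \<le> e * (\<Sum>d=1..M. v d) + K" for M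
  proof -
   have "\<bar>\<Sum>d=1..M. (b d - 1) * v d\<bar> \<le> e * (\<Sum>d=1..M. v d) + K * v 1"
    by (rule abel_estimate[of v "%d. b d - 1" e K, OF v1 v0 C])
   moreover have "K * v 1 \<le> K" using K0 u unfolding v_def by (simp add: mult_left_le)
   ultimately show ?thesis by (simp add: algebra_simps sum_subtractf)
  qed
  have lead: "(\<Sum>d=1..M. v d) \<le> ?l u" for M
   unfolding eq1[symmetric] by (rule sum_le_suminf[OF S]) (use u in auto)
  have Sb: "summable (%d. b d * (u ^ d / real d))"
  proof (rule summableI_nonneg_bounded)
   show "b d * (u ^ d / real d) \<ge> 0" for d using b u by simp
   fix M
   have "(\<Sum>d<M. b d * (u ^ d / real d)) \<le> (\<Sum>d<Suc M. b d * (u ^ d / real d))"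
    using b u by simp
   also have "\<dots> = (\<Sum>d=1..M. b d * v d)" by (rule eq)
   also have "\<dots> \<le> (1 + e) * (\<Sum>d=1..M. v d) + K" using est[of M] by (simp add: algebra_simps)
   also have "\<dots> \<le> (1 + e) * ?l u + K" using lead[of M] e by (intro add_right_mono mult_left_mono) auto
   finally show "(\<Sum>d<M. b d * (u ^ d / real d)) \<le> (1 + e) * ?l u + K" .
  qed
  have l1: "(%M. \<Sum>d<Suc M. b d * (u ^ d / real d)) \<longlonglongrightarrow> ?m u"
   by (rule LIMSEQ_Suc[OF summable_LIMSEQ[OF Sb]])
  have l2: "(%M. \<Sum>d<Suc M. u ^ d / real d) \<longlonglongrightarrow> ?l u"
   by (rule LIMSEQ_Suc[OF summable_LIMSEQ[OF S]])
  show ?thesis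
  proof (rule LIMSEQ_le)
   show "(%M. \<bar>(\<Sum>d<Suc M. b d * (u ^ d / real d)) - (\<Sum>d<Suc M. u ^ d / real d)\<bar>) \<longlonglongrightarrow> \<bar>?m u - ?l u\<bar>"
    by (intro tendsto_intros l1 l2)
   show "(%M. e * (\<Sum>d<Suc M. u ^ d / real d) + K) \<longlonglongrightarrow> e * ?l u + K"
    by (intro tendsto_intros l2)
   show "\<exists>N. \<forall>M\<ge>N. \<bar>(\<Sum>d<Suc M. b d * (u ^ d / real d)) - (\<Sum>d<Suc M. u ^ d / real d)\<bar> \<le> e * (\<Sum>d<Suc M. u ^ d / real d) + K"
    unfolding eq eq1 using est by blast
  qed
 qed
 have "\<forall>\<^sub>F u in at_left (1::real). 2 * K / e' + 1 \<le> ?l u"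
  using log_series_at_top unfolding filterlim_at_top by blast
 moreover have "\<forall>\<^sub>F u in at_left (1::real). u < 1" by (simp add: eventually_at_filter)
 moreover have "\<forall>\<^sub>F u in at_left (1::real). 0 < u" by (rule order_tendstoD(1)[OF tendsto_ident_at]) simp
 ultimately show "\<forall>\<^sub>F u in at_left 1. dist (?m u / ?l u) 1 < e'"
 proof eventually_elim
  case (elim u)
  define L where "L = ?l u"
  define B where "B = ?m u"
  have m: "\<bar>B - L\<bar> \<le> e * L + K" unfolding B_def L_def using main elim by blast
  have "2 * K / e' \<ge> 0" using K0 e' by simp
  then have L: "L > 0" "2 * K / e' < L" using elim(1) unfolding L_def[symmetric] by auto
  then have "\<bar>B - L\<bar> < e' * L" using e' m unfolding e_def by (simp add: field_simps)
  moreover have "\<bar>B / L - 1\<bar> = \<bar>B - L\<bar> / L" using L by (simp add: field_simps)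
  ultimately show ?case unfolding dist_real_def B_def[symmetric] L_def[symmetric] using L by (simp add: divide_less_eq)
 qed
qed

lemma infsum_finite_sum:
 fixes g :: "'i => 'b => real"
 assumes "finite I" "!!i. i \<in> I ==> g i summable_on B"
 shows "(%x. \<Sum>i\<in>I. g i x) summable_on B" "infsum (%x. \<Sum>i\<in>I. g i x) B = (\<Sum>i\<in>I. infsum (g i) B)"
proof -
 have "(%x. \<Sum>i\<in>I. g i x) summable_on B \<and> infsum (%x. \<Sum>i\<in>I. g i x) B = (\<Sum>i\<in>I. infsum (g i) B)"
  using assms by (induction I rule: finite_induct) (auto simp: infsum_add intro: summable_on_add)
 then show "(%x. \<Sum>i\<in>I. g i x) summable_on B" "infsum (%x. \<Sum>i\<in>I. g i x) B = (\<Sum>i\<in>I. infsum (g i) B)" by auto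
qed

section \<open>Averages over the primes of the polynomial ring\<close>

context fq_poly
begin

definition PR where "PR = {p. prm A p \<and> p ~= {\<zero>}}"
definition ZZ :: "('a set => real) => real => real"
 where "ZZ f s = (\<Sum>\<^sub>\<infinity>p\<in>PR. f p * real (q ^ dgi p) powr (-s))"
text \<open>For \<open>s > 1\<close> this is \<open>- log (1 - q powr (1 - s))\<close>, the
  logarithm of the zeta function of \<open>A\<close>: an explicit normalization in place of the sum
  over all primes.\<close>

definition Lam :: "real => real"
 where "Lam s = (suminf (%d. (real q powr (1 - s)) ^ d / real d))"

lemma q_powr: "real (q ^ d) powr (-s) = (real q powr (1 - s)) ^ d / real q ^ d"
proof -
 have q0: "real q > 0" using q_gt by simp
 have "real (q ^ d) powr (-s) = (real q powr real d) powr (-s)" using q0 by (simp add: powr_realpow)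
 also have "\<dots> = real q powr ((1 - s) * real d - real d)" by (simp add: powr_powr algebra_simps)
 also have "\<dots> = real q powr ((1 - s) * real d) / real q powr (real d)" by (rule powr_diff)
 also have "real q powr ((1 - s) * real d) = (real q powr (1 - s)) ^ d"
  using q0 by (simp add: powr_powr flip: powr_realpow)
 finally show ?thesis using q0 by (simp add: powr_realpow)
qed

lemma u_bounds: "s > 1 ==> 0 < real q powr (1 - s)" "s > 1 ==> real q powr (1 - s) < 1"
 using q_gt by (auto simp: powr_less_one)

lemma PR_fin: "finite {p \<in> PR. dgi p = d}" "card {p \<in> PR. dgi p = d} \<le> q ^ Suc d"
proof -
 have e: "{p \<in> PR. dgi p = d} = {p. prm A p \<and> p ~= {\<zero>} \<and> dgi p = d}" unfolding PR_def by blast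
 show "finite {p \<in> PR. dgi p = d}" "card {p \<in> PR. dgi p = d} \<le> q ^ Suc d" unfolding e using card_primes_le by auto
qed

lemma PR_dgi_pos: "p \<in> PR ==> dgi p > 0" unfolding PR_def using dgi_pos by blast

lemma ZZ_summable:
 assumes s: "s > 1" and f: "!!p. p \<in> PR ==> 0 \<le> f p" "!!p. p \<in> PR ==> f p \<le> K"
 shows "(%p. f p * real (q ^ dgi p) powr (-s)) summable_on PR"
proof (rule nonneg_bdd_above_summable_on)
 show "0 \<le> f p * real (q ^ dgi p) powr (-s)" if "p \<in> PR" for p using f(1)[OF that] by simp
 define u where "u = real q powr (1 - s)"
 have u: "0 < u" "u < 1" unfolding u_def using u_bounds[OF s] by auto
 define K' where "K' = \<bar>K\<bar>"
 have K': "f p \<le> K'" "K' \<ge> 0" if "p \<in> PR" for p using f(2)[OF that] unfolding K'_def by auto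
 have "sum (%p. f p * real (q ^ dgi p) powr (-s)) F \<le> K' * real q / (1 - u)" if F: "F \<subseteq> PR" "finite F" for F
 proof -
  obtain N where N: "!!p. p \<in> F ==> dgi p < N"
   using finite_nat_set_iff_bounded[of "dgi ` F"] F(2) by auto
  have "sum (%p. f p * real (q ^ dgi p) powr (-s)) F \<le> sum (%p. K' * real (q ^ dgi p) powr (-s)) F"
   by (intro sum_mono mult_right_mono) (use F K' in auto)
  also have "\<dots> \<le> (\<Sum>p\<in>(\<Union>d\<in>{..<N}. {p \<in> PR. dgi p = d}). K' * real (q ^ dgi p) powr (-s))"
   by (rule sum_mono2) (use F N PR_fin in \<open>auto simp: K'_def\<close>)
  also have "\<dots> = (\<Sum>d<N. \<Sum>p\<in>{p \<in> PR. dgi p = d}. K' * real (q ^ dgi p) powr (-s))"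
   by (rule sum.UNION_disjoint) (use PR_fin in auto)
  also have "\<dots> = (\<Sum>d<N. real (card {p \<in> PR. dgi p = d}) * (K' * real (q ^ d) powr (-s)))"
   by (intro sum.cong refl) simp
  also have "\<dots> \<le> (\<Sum>d<N. K' * real q * u ^ d)"
  proof (rule sum_mono)
   fix d
   have "real (card {p \<in> PR. dgi p = d}) * (K' * real (q ^ d) powr (-s)) \<le> real (q ^ Suc d) * (K' * real (q ^ d) powr (-s))"
    using PR_fin(2)[of d] by (intro mult_right_mono) (auto simp: K'_def simp del: of_nat_power power_Suc)
   also have "\<dots> = K' * real q * u ^ d"
    unfolding q_powr u_def[symmetric] by simp
   finally show "real (card {p \<in> PR. dgi p = d}) * (K' * real (q ^ d) powr (-s)) \<le> K' * real q * u ^ d" .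
  qed
  also have "\<dots> = K' * real q * (\<Sum>d<N. u ^ d)" by (simp add: sum_distrib_left)
  also have "\<dots> \<le> K' * real q * (1 / (1 - u))"
  proof (intro mult_left_mono)
   have "(\<Sum>d<N. u ^ d) \<le> (suminf (%d. u ^ d))" by (rule sum_le_suminf) (use u in auto)
   then show "(\<Sum>d<N. u ^ d) \<le> 1 / (1 - u)" using suminf_geometric[of u] u by simp
  qed (simp add: K'_def)
  finally show ?thesis by simp
 qed
 then show "bdd_above (sum (%p. f p * real (q ^ dgi p) powr (-s)) ` {F. F \<subseteq> PR \<and> finite F})"
  by (intro bdd_aboveI2[where M = "K' * real q / (1 - u)"]) auto
qed

text \<open>Grouping by degree. The factor \<open>d * h d / q ^ d\<close> is the summand of the
  Mertens sum, so that \<open>log_series_transfer\<close> becomes applicable.\<close>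

lemma ZZ_series:
 assumes s: "s > 1" and f: "!!p. p \<in> PR ==> 0 \<le> f p" "!!p. p \<in> PR ==> f p \<le> K"
  and h: "!!d. (\<Sum>p\<in>{p \<in> PR. dgi p = d}. f p) = h d"
 shows "ZZ f s = (suminf (%d. (real d * h d / real q ^ d) * ((real q powr (1 - s)) ^ d / real d)))"
proof -
 define g where "g p = f p * real (q ^ dgi p) powr (-s)" for p
 have sm: "g summable_on PR" unfolding g_def by (rule ZZ_summable[OF s f])
 define D where "D d = {p \<in> PR. dgi p = d}" for d
 have bij: "bij_betw snd (SIGMA d:UNIV. D d) PR"
  by (rule bij_betwI[where g = "%p. (dgi p, p)"]) (auto simp: D_def)
 have sm2: "(%x. g (snd x)) summable_on (SIGMA d:UNIV. D d)"
  using summable_on_reindex_bij_betw[OF bij, of g] sm by simp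
 have "ZZ f s = infsum (%x. g (snd x)) (SIGMA d:UNIV. D d)"
  unfolding ZZ_def g_def[symmetric] using infsum_reindex_bij_betw[OF bij, of g] by simp
 also have "\<dots> = infsum (%d. infsum g (D d)) UNIV"
  using infsum_Sigma'_banach[of "%d p. g p" UNIV D] sm2 by (simp add: case_prod_beta')
 finally have 1: "ZZ f s = infsum (%d. infsum g (D d)) UNIV" .
 have in1: "infsum g (D d) = (real d * h d / real q ^ d) * ((real q powr (1 - s)) ^ d / real d)" for d
 proof (cases "d = 0")
  case True
  then have "D d = {}" unfolding D_def using PR_dgi_pos by auto
  then show ?thesis using True by simp
 next
  case False
  have "infsum g (D d) = (\<Sum>p\<in>D d. f p * real (q ^ d) powr (-s))"
   unfolding g_def using PR_fin(1)[of d] by (auto simp: D_def intro!: sum.cong)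
  also have "\<dots> = h d * real (q ^ d) powr (-s)" unfolding h[symmetric] D_def sum_distrib_right ..
  finally show ?thesis unfolding q_powr using False by simp
 qed
 have "((%d. infsum g (D d)) has_sum ZZ f s) UNIV" using summable_on_Sigma_banach[of "%d p. g p" UNIV D] sm2 unfolding 1 by (simp add: case_prod_beta')
 then have "(%d. infsum g (D d)) sums ZZ f s" by (rule has_sum_imp_sums)
 then show ?thesis unfolding in1 by (rule sums_unique)
qed

lemma u_filterlim: "filterlim (%s. real q powr (1 - s)) (at_left 1) (at_right 1)"
 unfolding filterlim_at
proof
 show "\<forall>\<^sub>F s in at_right 1. real q powr (1 - s) \<in> {..<1} \<and> real q powr (1 - s) ~= 1"
  using eventually_at_right_less[of "1::real"] by eventually_elim (use u_bounds in fastforce)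
 have "((%s. real q powr (1 - s)) \<longlongrightarrow> real q powr (1 - 1)) (at_right 1)"
  using q_gt by (intro tendsto_intros) auto
 then show "((%s. real q powr (1 - s)) \<longlongrightarrow> 1) (at_right 1)" using q_gt by simp
qed

lemma Lam_at_top: "filterlim Lam at_top (at_right 1)"
 unfolding Lam_def using filterlim_compose[OF log_series_at_top u_filterlim] .

text \<open>\<open>avg f a\<close>: the values \<open>f p\<close> have average \<open>a\<close> in the sense of Dirichlet density.\<close>

definition avg where "avg f a \<longleftrightarrow> ((%s. ZZ f s / Lam s) \<longlongrightarrow> a) (at_right 1)"

lemma avg_of_mertens:
 assumes f: "!!p. p \<in> PR ==> 0 \<le> f p" "!!p. p \<in> PR ==> f p \<le> K"
  and h: "!!d. (\<Sum>p\<in>{p \<in> PR. dgi p = d}. f p) = h d"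
  and lim: "(%M. (\<Sum>d=1..M. real d * h d / real q ^ d) / real M) \<longlonglongrightarrow> 1"
 shows "avg f 1"
proof -
 have hp: "h d \<ge> 0" for d unfolding h[symmetric] by (rule sum_nonneg) (use f in auto)
 have "((%u. (suminf (%d. (real d * h d / real q ^ d) * (u ^ d / real d))) / (suminf (%d. u ^ d / real d))) \<longlongrightarrow> 1) (at_left 1)"
  by (rule log_series_transfer[OF _ lim]) (use hp in auto)
 then have l: "((%s. (suminf (%d. (real d * h d / real q ^ d) * ((real q powr (1 - s)) ^ d / real d))) / (suminf (%d. (real q powr (1 - s)) ^ d / real d))) \<longlongrightarrow> 1) (at_right 1)"
  by (rule filterlim_compose[OF _ u_filterlim])
 show ?thesis unfolding avg_def
 proof (rule Lim_transform_eventually[OF l])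
  show "\<forall>\<^sub>F s in at_right 1. (suminf (%d. (real d * h d / real q ^ d) * ((real q powr (1 - s)) ^ d / real d))) / (suminf (%d. (real q powr (1 - s)) ^ d / real d)) = ZZ f s / Lam s"
   using eventually_at_right_less[of "1::real"] by eventually_elim (simp add: ZZ_series[OF _ f h] Lam_def)
 qed
qed

lemma avg_unique: "avg f a ==> avg f b ==> a = b"
 unfolding avg_def by (rule tendsto_unique) auto

lemma avg_sum:
 assumes "finite I" "!!i. i \<in> I ==> avg (f i) (a i)"
  and b: "!!i p. i \<in> I ==> p \<in> PR ==> 0 \<le> f i p" "!!i p. i \<in> I ==> p \<in> PR ==> f i p \<le> K"
 shows "avg (%p. \<Sum>i\<in>I. f i p) (\<Sum>i\<in>I. a i)"
proof -
 have l: "((%s. \<Sum>i\<in>I. ZZ (f i) s / Lam s) \<longlongrightarrow> (\<Sum>i\<in>I. a i)) (at_right 1)"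
  using assms(2) unfolding avg_def by (intro tendsto_sum) auto
 show ?thesis unfolding avg_def
 proof (rule Lim_transform_eventually[OF l])
  show "\<forall>\<^sub>F s in at_right 1. (\<Sum>i\<in>I. ZZ (f i) s / Lam s) = ZZ (%p. \<Sum>i\<in>I. f i p) s / Lam s"
   using eventually_at_right_less[of "1::real"]
  proof eventually_elim
   case (elim s)
   have "ZZ (%p. \<Sum>i\<in>I. f i p) s = (\<Sum>i\<in>I. ZZ (f i) s)"
    unfolding ZZ_def sum_distrib_right
    by (rule infsum_finite_sum(2)[OF assms(1)]) (rule ZZ_summable[OF elim b])
   then show ?case by (simp add: sum_divide_distrib)
  qed
 qed
qed

text \<open>Values in \<open>[0, K]\<close> differ by at most \<open>K\<close>. On \<open>S\<close>
  the total change is negligible by assumption, on the finite set \<open>E\<close> because it is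
  bounded while \<open>Lam\<close> tends to infinity.\<close>

lemma avg_negligible:
 assumes f: "!!p. p \<in> PR ==> 0 \<le> f p" "!!p. p \<in> PR ==> f p \<le> K"
  and g: "!!p. p \<in> PR ==> 0 \<le> g p" "!!p. p \<in> PR ==> g p \<le> K"
  and fin: "finite E" and S: "avg (%p. if p \<in> S then 1 else 0) 0"
  and eq: "!!p. p \<in> PR ==> p \<notin> S ==> p \<notin> E ==> f p = g p"
  and a: "avg f a"
 shows "avg g a"
proof -
 define Z where "Z s = \<bar>K\<bar> * (ZZ (%p. if p \<in> S then 1 else 0) s / Lam s) + \<bar>K\<bar> * real (card E) / Lam s" for s
 have "(Z \<longlongrightarrow> \<bar>K\<bar> * 0 + 0) (at_right 1)"
  unfolding Z_def using S unfolding avg_def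
  by (intro tendsto_intros tendsto_divide_0[OF tendsto_const] filterlim_at_top_imp_at_infinity[OF Lam_at_top])
 then have Z: "(Z \<longlongrightarrow> 0) (at_right 1)" by simp
 have ev: "\<forall>\<^sub>F s in at_right 1. norm (ZZ g s / Lam s - ZZ f s / Lam s) \<le> Z s"
  using eventually_at_right_less[of "1::real"] Lam_at_top[unfolded filterlim_at_top, rule_format, of 1]
 proof eventually_elim
  case (elim s)
  define w where "w p = real (q ^ dgi p) powr (-s)" for p
  have w: "0 \<le> w p" "w p \<le> 1" for p
  proof -
   show "0 \<le> w p" unfolding w_def by simp
   have "1 \<le> real (q ^ dgi p)" using q_gt by (simp del: of_nat_power)
   then have "1 \<le> real (q ^ dgi p) powr s" using elim(1) by (intro ge_one_powr_ge_zero) auto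
   then show "w p \<le> 1" unfolding w_def powr_minus_divide by (intro divide_le_eq_1[THEN iffD2]) auto
  qed
  have sf: "(%p. f p * w p) summable_on PR" "(%p. g p * w p) summable_on PR"
   unfolding w_def using ZZ_summable[OF elim(1)] f g by blast+
  have sS: "(%p. (if p \<in> S then 1 else 0) * w p) summable_on PR"
   unfolding w_def by (rule ZZ_summable[OF elim(1), where K = 1]) auto
  have sE: "(%p. (if p \<in> E then 1 else 0) * w p) summable_on PR"
   unfolding w_def by (rule ZZ_summable[OF elim(1), where K = 1]) auto
  have iE: "infsum (%p. (if p \<in> E then 1 else 0) * w p) PR \<le> real (card E)"
  proof (rule infsum_le_finite_sums[OF sE])
   fix F assume F: "finite F" "F \<subseteq> PR"
   have "(\<Sum>p\<in>F. (if p \<in> E then 1 else 0) * w p) \<le> (\<Sum>p\<in>F. if p \<in> E then 1 else 0)"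
    by (intro sum_mono) (use w in auto)
   also have "\<dots> = real (card (F \<inter> E))" using F by (simp add: sum.If_cases)
   also have "\<dots> \<le> real (card E)" using card_mono[OF fin, of "F \<inter> E"] by simp
   finally show "(\<Sum>p\<in>F. (if p \<in> E then 1 else 0) * w p) \<le> real (card E)" .
  qed
  define dlt where "dlt p = \<bar>K\<bar> * ((if p \<in> S then 1 else 0) * w p) + \<bar>K\<bar> * ((if p \<in> E then 1 else 0) * w p)" for p
  have sd: "dlt summable_on PR" unfolding dlt_def by (intro summable_on_add summable_on_cmult_right sS sE)
  have id: "infsum dlt PR = \<bar>K\<bar> * ZZ (%p. if p \<in> S then 1 else 0) s + \<bar>K\<bar> * infsum (%p. (if p \<in> E then 1 else 0) * w p) PR"
   unfolding dlt_def ZZ_def w_def[symmetric]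
   using sS sE by (simp add: infsum_add infsum_cmult_right summable_on_cmult_right)
  have pt: "g p * w p \<le> f p * w p + dlt p" "f p * w p \<le> g p * w p + dlt p" if p: "p \<in> PR" for p
  proof -
   have "g p * w p \<le> f p * w p + dlt p \<and> f p * w p \<le> g p * w p + dlt p"
   proof (cases "p \<in> S \<or> p \<in> E")
    case True
    have "g p * w p \<le> \<bar>K\<bar> * w p" "f p * w p \<le> \<bar>K\<bar> * w p"
     using f(2)[OF p] g(2)[OF p] w(1)[of p] by (auto intro!: mult_right_mono)
    moreover have "0 \<le> g p * w p" "0 \<le> f p * w p" using f(1)[OF p] g(1)[OF p] w(1)[of p] by auto
    ultimately show ?thesis using True w(1)[of p] by (auto simp: dlt_def)
   next
    case False
    then show ?thesis using eq[OF p] by (auto simp: dlt_def)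
   qed
   then show "g p * w p \<le> f p * w p + dlt p" "f p * w p \<le> g p * w p + dlt p" by auto
  qed
  have "infsum (%p. g p * w p) PR \<le> infsum (%p. f p * w p + dlt p) PR"
   by (rule infsum_mono[OF sf(2) summable_on_add[OF sf(1) sd] pt(1)])
  then have 1: "ZZ g s \<le> ZZ f s + infsum dlt PR"
   unfolding ZZ_def w_def[symmetric] infsum_add[OF sf(1) sd] .
  have "infsum (%p. f p * w p) PR \<le> infsum (%p. g p * w p + dlt p) PR"
   by (rule infsum_mono[OF sf(1) summable_on_add[OF sf(2) sd] pt(2)])
  then have 2: "ZZ f s \<le> ZZ g s + infsum dlt PR"
   unfolding ZZ_def w_def[symmetric] infsum_add[OF sf(2) sd] .
  have "infsum dlt PR \<le> \<bar>K\<bar> * ZZ (%p. if p \<in> S then 1 else 0) s + \<bar>K\<bar> * real (card E)"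
   unfolding id using iE by (intro add_left_mono mult_left_mono) auto
  then have "\<bar>ZZ g s - ZZ f s\<bar> \<le> \<bar>K\<bar> * ZZ (%p. if p \<in> S then 1 else 0) s + \<bar>K\<bar> * real (card E)" using 1 2 by linarith
  then have "\<bar>ZZ g s - ZZ f s\<bar> / Lam s \<le> (\<bar>K\<bar> * ZZ (%p. if p \<in> S then 1 else 0) s + \<bar>K\<bar> * real (card E)) / Lam s"
   using elim(2) by (intro divide_right_mono) auto
  moreover have "norm (ZZ g s / Lam s - ZZ f s / Lam s) = \<bar>ZZ g s - ZZ f s\<bar> / Lam s"
   using elim(2) by (simp add: flip: diff_divide_distrib)
  ultimately show ?case unfolding Z_def by (simp add: add_divide_distrib)
 qed
 have d: "((%s. ZZ g s / Lam s - ZZ f s / Lam s) \<longlongrightarrow> 0) (at_right 1)"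
  by (rule Lim_null_comparison[OF ev Z])
 have "((%s. (ZZ g s / Lam s - ZZ f s / Lam s) + ZZ f s / Lam s) \<longlongrightarrow> 0 + a) (at_right 1)"
  by (rule tendsto_add[OF d a[unfolded avg_def]])
 then show ?thesis unfolding avg_def by simp
qed

lemma nonzero_primes_PR: "nonzero_primes A = PR"
 unfolding nonzero_primes_def PR_def prm_iff[OF A_subring] by blast

lemma prime_norm_eq: "p \<in> PR ==> prime_norm A p = q ^ dgi p"
 unfolding prime_norm_def PR_def using card_Quot_A(2) prmD(1) by blast

text \<open>Density is normalized by the sum over all primes, \<open>avg\<close> by
  \<open>Lam\<close>; the third assumption says that their quotient tends to 1.\<close>

lemma density_zero_avg:
 assumes "S \<subseteq> PR" "has_dirichlet_density A S 0" and 1: "avg (%_. 1) 1"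
 shows "avg (%p. if p \<in> S then 1 else 0) 0"
proof -
 have a: "(\<Sum>\<^sub>\<infinity>p\<in>S. real (prime_norm A p) powr (-s)) = ZZ (%p. if p \<in> S then 1 else 0) s" for s
  unfolding ZZ_def by (rule infsum_cong_neutral) (use assms(1) prime_norm_eq in auto)
 have b: "(\<Sum>\<^sub>\<infinity>p\<in>nonzero_primes A. real (prime_norm A p) powr (-s)) = ZZ (%_. 1) s" for s
  unfolding ZZ_def nonzero_primes_PR by (rule infsum_cong) (use prime_norm_eq in auto)
 have l: "((%s. ZZ (%p. if p \<in> S then 1 else 0) s / ZZ (%_. 1) s * (ZZ (%_. 1) s / Lam s)) \<longlongrightarrow> 0 * 1) (at_right 1)"
  using assms(2) 1 unfolding has_dirichlet_density_def a b avg_def by (intro tendsto_mult)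
 have "\<forall>\<^sub>F s in at_right 1. ZZ (%_. 1) s / Lam s > 1 / 2"
  using order_tendstoD(1)[OF 1[unfolded avg_def], of "1/2"] by simp
 then have "\<forall>\<^sub>F s in at_right 1. ZZ (%p. if p \<in> S then 1 else 0) s / ZZ (%_. 1) s * (ZZ (%_. 1) s / Lam s) = ZZ (%p. if p \<in> S then 1 else 0) s / Lam s"
  by eventually_elim auto
 then show ?thesis unfolding avg_def using Lim_transform_eventually[OF l] by simp
qed

end

section \<open>The number of primes of residue degree one above a prime\<close>

context fq_order
begin

definition Hn where "Hn p = card {P. H1 P \<and> P \<inter> A = p}"

text \<open>A generator of \<open>p\<close> has degree \<open>dgi p\<close>, and every prime above
  contributes \<open>dgi p\<close> to \<open>sum_dP_le\<close>; the quotient is bounded uniformly in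
  \<open>p\<close>.\<close>

lemma over_fin:
 assumes "p \<in> PR" shows "finite {P. np P \<and> P \<inter> A = p}" "card {P. np P \<and> P \<inter> A = p} \<le> n * (2 + c0)"
proof -
 have p: "prm A p" "p ~= {\<zero>}" using assms unfolding PR_def by auto
 have d: "dgi p > 0" using PR_dgi_pos[OF assms] .
 obtain \<pi> where pi: "\<pi> \<in> p" "dege (dgi p) \<pi>" by (rule idl_gen[OF prmD(1)[OF p(1)] p(2)])
 show f: "finite {P. np P \<and> P \<inter> A = p}"
  by (rule finite_subset[OF _ np_finite[OF d]]) (auto simp: dP_def)
 have pB: "\<pi> \<in> Box (Suc (dgi p))" using At_Box pi(2) unfolding dege_def by blast
 have "(\<Sum>P\<in>{P. np P \<and> P \<inter> A = p}. dP P) \<le> n * (Suc (dgi p) + c0)"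
  by (rule sum_dP_le[OF pB dege_nonzero[OF pi(2)] f]) (use pi(1) in auto)
 moreover have "(\<Sum>P\<in>{P. np P \<and> P \<inter> A = p}. dP P) = card {P. np P \<and> P \<inter> A = p} * dgi p"
  by (simp add: dP_def)
 moreover have "n * (Suc (dgi p) + c0) \<le> n * (2 + c0) * dgi p"
 proof -
  have "Suc (dgi p) + c0 \<le> (2 + c0) * dgi p" using d by (cases "dgi p") (auto simp: algebra_simps)
  then have "n * (Suc (dgi p) + c0) \<le> n * ((2 + c0) * dgi p)" by (rule mult_le_mono2)
  then show ?thesis by (simp only:)
 qed
 ultimately have "card {P. np P \<and> P \<inter> A = p} * dgi p \<le> n * (2 + c0) * dgi p" by linarith
 then show "card {P. np P \<and> P \<inter> A = p} \<le> n * (2 + c0)" using d by simp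
qed

lemma Hn_le: assumes "p \<in> PR" shows "Hn p \<le> n * (2 + c0)"
proof -
 have "Hn p \<le> card {P. np P \<and> P \<inter> A = p}"
  unfolding Hn_def by (rule card_mono[OF over_fin(1)[OF assms]]) (auto simp: H1_np)
 then show ?thesis using over_fin(2)[OF assms] by linarith
qed

lemma H1_PR: "H1 P ==> P \<inter> A \<in> PR"
 unfolding PR_def using npD(3,5)[OF H1_np] by blast

lemma sum_Hn: "(\<Sum>p\<in>{p \<in> PR. dgi p = d}. real (Hn p)) = real (h d)"
proof -
 have e: "HH d = (\<Union>p\<in>{p \<in> PR. dgi p = d}. {P. H1 P \<and> P \<inter> A = p})"
  unfolding HH_def dP_def using H1_PR by blast
 have "card (HH d) = (\<Sum>p\<in>{p \<in> PR. dgi p = d}. card {P. H1 P \<and> P \<inter> A = p})"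
  unfolding e
 proof (rule card_UN_disjoint)
  show "finite {p \<in> PR. dgi p = d}" by (rule PR_fin)
  show "\<forall>p\<in>{p \<in> PR. dgi p = d}. finite {P. H1 P \<and> P \<inter> A = p}"
  proof
   fix p assume "p \<in> {p \<in> PR. dgi p = d}"
   then have "finite {P. np P \<and> P \<inter> A = p}" using over_fin(1) by blast
   then show "finite {P. H1 P \<and> P \<inter> A = p}" by (rule rev_finite_subset) (auto simp: H1_np)
  qed
 qed auto
 then show ?thesis unfolding h_def Hn_def by simp
qed

end

lemma (in fq_order_red) avg_Hn: "avg (%p. real (Hn p)) 1"
proof (rule avg_of_mertens)
 show "0 \<le> real (Hn p)" for p by simp
 show "real (Hn p) \<le> real (n * (2 + c0))" if "p \<in> PR" for p using Hn_le[OF that] by (simp only:)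
 show "(\<Sum>p\<in>{p \<in> PR. dgi p = d}. real (Hn p)) = real (h d)" for d by (rule sum_Hn)
 show "(%M. (\<Sum>d=1..M. real d * real (h d) / real q ^ d) / real M) \<longlonglongrightarrow> 1"
  using U_asymp unfolding U_def .
qed

context fq_poly
begin

text \<open>The prime number theorem for \<open>A\<close>, in averaged form, is the case of the
  order \<open>A\<close> itself, given by \<open>\<gamma> = 0\<close> and rank 1: every prime has
  residue degree one and lies above itself.\<close>

lemma avg_const_1: "avg (%_. 1) 1"
proof -
 have BA: "Bx A \<zero> 1 = A"
 proof -
  have "Bx A \<zero> (Suc 0) = A" unfolding Bx_Suc using A_carrier by force
  then show ?thesis by simp
 qed
 interpret I: fq_order R k T q \<zero> 1
 proof
  show "\<zero> \<in> CR" by simp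
  show "(1::nat) > 0" by simp
  show "indep A \<zero> 1" unfolding indep_def using A_carrier by (auto simp: length_Suc_conv)
  show "\<zero> [^] (1::nat) \<in> Bx A \<zero> 1" unfolding BA using subringE(2)[OF A_subring] by simp
 qed
 have O: "I.Od = A" unfolding I.Od_def using BA by simp
 interpret I: fq_order_red R k T q \<zero> 1 \<one>
 proof
  show "\<one> \<in> A" "\<one> ~= \<zero>" using subringE(3)[OF A_subring] by auto
  fix p w j assume p: "prm A p" "p ~= {\<zero>}" and w: "w \<in> I.Od" "w [^] (j::nat) \<in> I.pO p"
  have "I.pO p \<subseteq> p"
  proof
   fix x assume "x \<in> I.pO p"
   then obtain a u where x: "x = a ** u" "a \<in> p" "u \<in> A" unfolding I.pO_def O by blast
   show "x \<in> p" using x idlD(6)[OF prmD(1)[OF p(1)]] A_carrier m_comm idlD(3)[OF prmD(1)[OF p(1)] x(3,2)] by auto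
  qed
  then have "w \<in> p" using prm_pow[OF p(1) A_subring] w unfolding O by blast
  moreover have "w = w ** \<one>" using w A_carrier unfolding O by auto
  ultimately show "w \<in> I.pO p" unfolding I.pO_def O using subringE(3)[OF A_subring] by blast
 qed
 have H: "I.H1 P \<longleftrightarrow> P \<in> PR" for P
 proof
  assume "P \<in> PR"
  then have P: "prm A P" "P ~= {\<zero>}" unfolding PR_def by auto
  have PA: "P \<inter> A = P" using idlD(2)[OF prmD(1)[OF P(1)]] by blast
  have "\<exists>a\<in>A. y \<ominus> a \<in> P" if "y \<in> A" for y
  proof -
   have "y \<ominus> y = \<zero>" using that A_carrier minus_zero_iff by blast
   then show ?thesis using idlD(4)[OF prmD(1)[OF P(1)]] that by force
  qed
  then show "I.H1 P" unfolding I.H1_def I.np_def O PA using P by blast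
 next
  assume "I.H1 P"
  then have P: "prm A P" "P \<inter> A ~= {\<zero>}" unfolding I.H1_def I.np_def O by auto
  then show "P \<in> PR" unfolding PR_def using idlD(2)[OF prmD(1)[OF P(1)]] by auto
 qed
 have Hn: "I.Hn p = 1" if "p \<in> PR" for p
 proof -
  have "{P. I.H1 P \<and> P \<inter> A = p} = {p}"
   using that H idlD(2)[OF prmD(1)] unfolding PR_def by blast
  then show ?thesis unfolding I.Hn_def by simp
 qed
 have ZE: "ZZ (%p. real (I.Hn p)) s = ZZ (%_. 1) s" for s
  unfolding ZZ_def by (rule infsum_cong) (simp only: Hn of_nat_1)
 show ?thesis using I.avg_Hn unfolding avg_def ZE .
qed

end

section \<open>Embeddings of algebraic extensions\<close>

locale galois = algebraic_closure R F for R (structure) and F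
begin

lemma F_sf: "subfield F R" by (rule subfield_axioms)
lemma F_sr: "subring F R" using subfieldE(1)[OF F_sf] .
lemma F_carrier: "F \<subseteq> CR" using subfieldE(3)[OF F_sf] .

definition fld :: "'a set => bool" where "fld E \<longleftrightarrow> subfield E R \<and> F \<subseteq> E"

text \<open>Values outside \<open>E\<close> are arbitrary, so embeddings are compared on their
  domain and never as functions.\<close>

definition emb :: "'a set => ('a => 'a) => bool"
 where "emb E \<tau> \<longleftrightarrow> fld E \<and> \<tau> \<in> ring_hom (sub E) R \<and> (\<forall>x\<in>F. \<tau> x = x)"

lemma fldD:
 assumes "fld E" shows "subfield E R" "subring E R" "F \<subseteq> E" "E \<subseteq> CR" "!!x. x \<in> E ==> x \<in> CR"
  "!!x y. x \<in> E ==> y \<in> E ==> x \<oplus> y \<in> E" "!!x y. x \<in> E ==> y \<in> E ==> x \<ominus> y \<in> E"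
  "!!x y. x \<in> E ==> y \<in> E ==> x ** y \<in> E" "!!x. x \<in> E ==> x ~= \<zero> ==> inv x \<in> E"
  "!!x. x \<in> E ==> \<ominus> x \<in> E"
proof -
 show 1: "subfield E R" "F \<subseteq> E" using assms unfolding fld_def by auto
 show 2: "subring E R" using subfieldE(1)[OF 1(1)] .
 show "E \<subseteq> CR" "!!x. x \<in> E ==> x \<in> CR" using subringE(1)[OF 2] by auto
 show "!!x y. x \<in> E ==> y \<in> E ==> x \<oplus> y \<in> E" "!!x y. x \<in> E ==> y \<in> E ==> x ** y \<in> E" "!!x. x \<in> E ==> \<ominus> x \<in> E"
  using subringE[OF 2] by auto
 show "!!x y. x \<in> E ==> y \<in> E ==> x \<ominus> y \<in> E" using subring_minus[OF 2] .
 show "!!x. x \<in> E ==> x ~= \<zero> ==> inv x \<in> E" using subfield_m_inv(1)[OF 1(1)] by auto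
qed

lemma fld_F: "fld F" unfolding fld_def using F_sf by blast

lemma alg: assumes "fld E" "x \<in> CR" shows "(algebraic over E) x"
 using algebraic_mono[OF fldD(3)[OF assms(1)]] algebraic_extension[OF assms(2)] by blast

lemma fld_ext: assumes "fld E" "x \<in> CR" shows "fld (ext E x)"
 unfolding fld_def
 using simple_extension_is_subfield[OF fldD(1)[OF assms(1)] assms(2)] alg[OF assms]
  simple_extension_incl[OF fldD(4)[OF assms(1)] assms(2)] fldD(3)[OF assms(1)] by blast

lemma ext_mem: assumes "fld E" "x \<in> CR" shows "x \<in> ext E x"
 using simple_extension_mem[OF fldD(2)[OF assms(1)] assms(2)] .

lemma ext_incl: assumes "fld E" "x \<in> CR" shows "E \<subseteq> ext E x"
 using simple_extension_incl[OF fldD(4)[OF assms(1)] assms(2)] .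

lemma ext_min: assumes "subring E' R" "E \<subseteq> E'" "x \<in> E'" shows "ext E x \<subseteq> E'"
 using simple_extension_subring_incl[OF assms] .

lemma embD:
 assumes "emb E \<tau>"
 shows "fld E" "!!x. x \<in> E ==> \<tau> x \<in> CR" "!!x y. x \<in> E ==> y \<in> E ==> \<tau> (x \<oplus> y) = \<tau> x \<oplus> \<tau> y"
  "!!x y. x \<in> E ==> y \<in> E ==> \<tau> (x ** y) = \<tau> x ** \<tau> y" "\<tau> \<one> = \<one>" "!!x. x \<in> F ==> \<tau> x = x"
  "ring_hom_ring (sub E) R \<tau>" "inj_on \<tau> E" "\<tau> \<zero> = \<zero>"
  "!!x. x \<in> E ==> \<tau> (\<ominus> x) = \<ominus> \<tau> x" "!!x y. x \<in> E ==> y \<in> E ==> \<tau> (x \<ominus> y) = \<tau> x \<ominus> \<tau> y"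
proof -
 have h: "\<tau> \<in> ring_hom (sub E) R" using assms unfolding emb_def by blast
 show E: "fld E" and 1: "!!x. x \<in> F ==> \<tau> x = x" using assms unfolding emb_def by auto
 show c: "!!x. x \<in> E ==> \<tau> x \<in> CR" and a: "!!x y. x \<in> E ==> y \<in> E ==> \<tau> (x \<oplus> y) = \<tau> x \<oplus> \<tau> y"
  "!!x y. x \<in> E ==> y \<in> E ==> \<tau> (x ** y) = \<tau> x ** \<tau> y" "\<tau> \<one> = \<one>"
  using ring_hom_memE[OF h] by auto
 show "ring_hom_ring (sub E) R \<tau>"
  using ring_hom_ringI2[OF subring_is_ring[OF fldD(2)[OF E]] ring_axioms h] .
 show "inj_on \<tau> E" using non_trivial_field_hom_is_inj[OF h subfield_iff(2)[OF fldD(1)[OF E]] field_axioms] by simp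
 show z: "\<tau> \<zero> = \<zero>" using 1 subringE(2)[OF F_sr] by blast
 show m: "\<tau> (\<ominus> x) = \<ominus> \<tau> x" if x: "x \<in> E" for x
 using a(1)[OF fldD(10)[OF E x] x] z x fldD(5)[OF E] c[OF x] c[OF fldD(10)[OF E x]] minus_equality by (simp add: l_neg)
 show "\<tau> (x \<ominus> y) = \<tau> x \<ominus> \<tau> y" if "x \<in> E" "y \<in> E" for x y
  using a(1)[OF that(1) fldD(10)[OF E that(2)]] m[OF that(2)] by (simp add: minus_eq)
qed

lemma emb_pow: "emb E \<tau> ==> x \<in> E ==> \<tau> (x [^] (m::nat)) = \<tau> x [^] m"
 by (induction m) (auto simp: embD(4,5) subring_pow[OF fldD(2)[OF embD(1)]])

lemma emb_id: "fld E ==> emb E (%x. x)"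
 unfolding emb_def by (auto intro!: ring_hom_memI dest: fldD(5))

lemma emb_eval:
 assumes "emb E \<tau>" "x \<in> E" "set p \<subseteq> E" shows "\<tau> (eval p x) = eval (map \<tau> p) (\<tau> x)"
proof -
 interpret h: ring_hom_ring "sub E" R \<tau> using embD(7)[OF assms(1)] .
 show ?thesis using h.eval_hom'[of x p] assms(2,3) eval_consistent[OF fldD(2)[OF embD(1)[OF assms(1)]]] by simp
qed

lemma polyD: "p \<in> carrier (E[X]) ==> set p \<subseteq> E"
 using polynomial_incl univ_poly_carrier by blast

lemma root_exists:
 assumes "p \<in> carrier (poly_ring R)" "degree p \<ge> 1" shows "\<exists>y. is_root p y"
proof -
 have "size (roots p) = degree p" using roots_over_carrier[OF assms(1)] unfolding splitted_def .
 then have "roots p ~= {#}" using assms(2) by auto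
 then show ?thesis using roots_mem_iff_is_root[OF assms(1)] by blast
qed

lemma IrrD:
 assumes "fld E" "b \<in> CR"
 shows "Irr E b \<in> carrier (E[X])" "pirreducible E (Irr E b)" "lead_coeff (Irr E b) = \<one>" "eval (Irr E b) b = \<zero>"
  "degree (Irr E b) \<ge> 1" "Irr E b \<in> carrier (poly_ring R)" "Irr E b ~= []" "set (Irr E b) \<subseteq> E"
proof -
 show a: "Irr E b \<in> carrier (E[X])" "pirreducible E (Irr E b)" "lead_coeff (Irr E b) = \<one>" "eval (Irr E b) b = \<zero>"
  using IrrE[OF fldD(1)[OF assms(1)] assms(2) alg[OF assms]] by auto
 show d: "degree (Irr E b) \<ge> 1" using pirreducible_degree[OF fldD(1)[OF assms(1)] a(1,2)] .
 show "Irr E b \<in> carrier (poly_ring R)" using carrier_polynomial_shell[OF fldD(2)[OF assms(1)] a(1)] .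
 show "Irr E b ~= []" using d by auto
 show "set (Irr E b) \<subseteq> E" using polyD[OF a(1)] .
qed

lemma ext_elem:
 assumes "fld E" "b \<in> CR" "y \<in> ext E b"
 obtains p where "p \<in> carrier (E[X])" "y = eval p b"
 using assms simple_extension_as_eval_img[OF fldD(4)[OF assms(1)] assms(2)] by auto

text \<open>Applying \<open>\<tau>\<close> to the coefficients and evaluating at \<open>b'\<close>
  kills the minimal polynomial of \<open>b\<close>, hence every polynomial vanishing at
  \<open>b\<close>; so this homomorphism factors through \<open>ext E b\<close>.\<close>

lemma emb_ext:
 assumes \<tau>: "emb E \<tau>" and b: "b \<in> CR" and b': "b' \<in> CR" "eval (map \<tau> (Irr E b)) b' = \<zero>"
 shows "\<exists>\<tau>'. emb (ext E b) \<tau>' \<and> (\<forall>x\<in>E. \<tau>' x = \<tau> x) \<and> \<tau>' b = b'"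
proof -
 note E = embD(1)[OF \<tau>]
 interpret h: ring_hom_ring "sub E" R \<tau> using embD(7)[OF \<tau>] .
 interpret UP: domain "E[X]" using univ_poly_is_domain[OF fldD(2)[OF E]] .
 define \<psi> where "\<psi> p = eval (map \<tau> p) b'" for p
 have sc: "set (map \<tau> p) \<subseteq> CR" if "set p \<subseteq> E" for p using that by auto
 have en: "eval (normalize p) b' = eval p b'" if "set p \<subseteq> CR" for p using eval_normalize[OF that b'(1)] .
 have hom: "\<psi> \<in> ring_hom (E[X]) R"
 proof (rule ring_hom_memI)
  fix p assume p: "p \<in> carrier (E[X])"
  show "\<psi> p \<in> CR" unfolding \<psi>_def using eval_in_carrier[OF sc[OF polyD[OF p]] b'(1)] .
  fix r assume r: "r \<in> carrier (E[X])"
  have pr: "set p \<subseteq> E" "set r \<subseteq> E" using polyD p r by auto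
  have m: "set (poly_mult p r) \<subseteq> E" "set (poly_add p r) \<subseteq> E"
   using UP.m_closed[OF p r] UP.a_closed[OF p r] polyD univ_poly_mult univ_poly_add by metis+
  show "\<psi> (p \<otimes>\<^bsub>E[X]\<^esub> r) = \<psi> p ** \<psi> r"
   using h.poly_mult_hom'[of p r] pr poly_mult_consistent[OF fldD(2)[OF E]] en[OF sc[OF m(1)]] eval_poly_mult[OF sc[OF pr(1)] sc[OF pr(2)] b'(1)] unfolding \<psi>_def univ_poly_mult by simp
  show "\<psi> (p \<oplus>\<^bsub>E[X]\<^esub> r) = \<psi> p \<oplus> \<psi> r"
   using h.poly_add_hom'[of p r] pr poly_add_consistent[OF fldD(2)[OF E]] en[OF sc[OF m(2)]] eval_poly_add[OF sc[OF pr(1)] sc[OF pr(2)] b'(1)] unfolding \<psi>_def univ_poly_add by simp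
 next
  show "\<psi> \<one>\<^bsub>E[X]\<^esub> = \<one>" unfolding \<psi>_def univ_poly_one using embD(5)[OF \<tau>] by simp
 qed
 interpret ps: ring_hom_ring "E[X]" R \<psi> using ring_hom_ringI2[OF UP.ring_axioms ring_axioms hom] .
 interpret ev: ring_hom_ring "E[X]" R "%p. eval p b" using eval_ring_hom[OF fldD(2)[OF E] b] .
 note Ir = IrrD[OF E b]
 have ker: "\<psi> p = \<zero>" if p: "p \<in> carrier (E[X])" "eval p b = \<zero>" for p
 proof -
  have "Irr E b pdivides p" using Irr_minimal[OF fldD(1)[OF E] b alg[OF E b] p] .
  then obtain r where r: "r \<in> carrier (E[X])" "p = Irr E b \<otimes>\<^bsub>E[X]\<^esub> r" using pdivides_iff_shell[OF fldD(1)[OF E] Ir(1) p(1)] by blast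
  have "\<psi> p = \<psi> (Irr E b) ** \<psi> r" unfolding r(2) using ps.hom_mult[OF Ir(1) r(1)] .
  also have "\<psi> (Irr E b) = \<zero>" unfolding \<psi>_def by (rule b'(2))
  finally show ?thesis using ps.hom_closed[OF r(1)] by simp
 qed
 have wd: "\<psi> p = \<psi> r" if "p \<in> carrier (E[X])" "r \<in> carrier (E[X])" "eval p b = eval r b" for p r
 proof -
  have "\<psi> (p \<ominus>\<^bsub>E[X]\<^esub> r) = \<zero>" using that ker by (simp add: a_minus_def r_neg)
  then have "\<psi> p \<ominus> \<psi> r = \<zero>" using that by (simp add: a_minus_def)
  then show ?thesis using that by simp
 qed
 define \<tau>' where "\<tau>' y = \<psi> (SOME p. p \<in> carrier (E[X]) \<and> y = eval p b)" for y
 have t: "\<tau>' (eval p b) = \<psi> p" if p: "p \<in> carrier (E[X])" for p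
 proof -
  have "(SOME r. r \<in> carrier (E[X]) \<and> eval p b = eval r b) \<in> carrier (E[X]) \<and> eval p b = eval (SOME r. r \<in> carrier (E[X]) \<and> eval p b = eval r b) b"
   by (rule someI[where P = "%r. r \<in> carrier (E[X]) \<and> eval p b = eval r b" and x = p]) (use p in simp)
  then show ?thesis unfolding \<tau>'_def using wd[OF p] by metis
 qed
 have const: "\<tau>' x = \<tau> x" if x: "x \<in> E" for x
 proof (cases "x = \<zero>")
  case True
  then show ?thesis using t[OF UP.zero_closed] by (simp add: univ_poly_zero \<psi>_def embD(9)[OF \<tau>])
 next
  case False
  show ?thesis using x False t[of "[x]"] fldD(5)[OF E] by (auto simp: univ_poly_carrier[symmetric] \<psi>_def)
 qed
 have "[\<one>, \<zero>] \<in> carrier (E[X])" using subringE(2,3)[OF fldD(2)[OF E]] by (auto simp: univ_poly_carrier[symmetric])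
 then have tb: "\<tau>' b = b'" using t[of "[\<one>, \<zero>]"] b b' by (simp add: \<psi>_def embD(5,9)[OF \<tau>])
 have "\<tau>' \<in> ring_hom (sub (ext E b)) R"
 proof (rule ring_hom_memI)
  fix x assume "x \<in> carrier (sub (ext E b))"
  then obtain p where p: "p \<in> carrier (E[X])" "x = eval p b" using ext_elem[OF E b] by auto
  show "\<tau>' x \<in> CR" unfolding p(2) t[OF p(1)] using ps.hom_closed[OF p(1)] .
  fix y assume "y \<in> carrier (sub (ext E b))"
  then obtain r where r: "r \<in> carrier (E[X])" "y = eval r b" using ext_elem[OF E b] by auto
  have "x ** y = eval (p \<otimes>\<^bsub>E[X]\<^esub> r) b" "x \<oplus> y = eval (p \<oplus>\<^bsub>E[X]\<^esub> r) b" using p r by auto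
  then show "\<tau>' (x \<otimes>\<^bsub>sub (ext E b)\<^esub> y) = \<tau>' x ** \<tau>' y"
   "\<tau>' (x \<oplus>\<^bsub>sub (ext E b)\<^esub> y) = \<tau>' x \<oplus> \<tau>' y"
   using t[OF UP.m_closed[OF p(1) r(1)]] t[OF UP.a_closed[OF p(1) r(1)]] t[OF p(1)] t[OF r(1)] p r by auto
 next
  show "\<tau>' \<one>\<^bsub>sub (ext E b)\<^esub> = \<one>"
   using const[OF subringE(3)[OF fldD(2)[OF E]]] embD(5)[OF \<tau>] by simp
 qed
 then show ?thesis using fld_ext[OF E b] const fldD(3)[OF E] embD(6)[OF \<tau>] tb unfolding emb_def by force
qed

lemma emb_ext_exists:
 assumes \<tau>: "emb E \<tau>" and b: "b \<in> CR"
 shows "\<exists>\<tau>'. emb (ext E b) \<tau>' \<and> (\<forall>x\<in>E. \<tau>' x = \<tau> x)"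
proof -
 note E = embD(1)[OF \<tau>]
 obtain b' where "is_root (map \<tau> (Irr E b)) b'" using IrrD(1)[OF E b] univ_poly_consistent[OF fldD(2)[OF E]] polynomial_hom[of \<tau> "sub E" R] \<tau> subfield_iff(2)[OF fldD(1)[OF E]] field_axioms root_exists IrrD(5)[OF E b] unfolding emb_def by force
 then show ?thesis using emb_ext[OF \<tau> b] unfolding is_root_def by blast
qed

definition Cj where "Cj x = {y. is_root (Irr F x) y}"

lemma Cj_finite: "x \<in> CR ==> finite (Cj x)"
 unfolding Cj_def using finite_number_of_roots[OF IrrD(6)[OF fld_F]] .

lemma Cj_self: "x \<in> CR ==> x \<in> Cj x"
 unfolding Cj_def is_root_def using IrrD(4,7)[OF fld_F] by auto

lemma Cj_carrier: "y \<in> Cj x ==> y \<in> CR"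
 unfolding Cj_def is_root_def by auto

lemma Irr_eqI:
 assumes "fld E" "x \<in> CR" "y \<in> CR" "eval (Irr E x) y = \<zero>"
 shows "Irr E y = Irr E x"
 using minimal_polynomial_is_unique[OF fldD(1)[OF assms(1)] assms(3) alg[OF assms(1,3)]]
  IrrD[OF assms(1,3)] IrrD[OF assms(1,2)] assms(4) by blast

lemma Cj_eq: "x \<in> CR ==> y \<in> Cj x ==> Cj y = Cj x"
 using Irr_eqI[OF fld_F, of x y] unfolding Cj_def is_root_def by auto

lemma Cj_Irr: "x \<in> CR ==> y \<in> Cj x ==> Irr F y = Irr F x"
 using Irr_eqI[OF fld_F, of x y] unfolding Cj_def is_root_def by auto

lemma map_F_id: "emb E \<tau> ==> set p \<subseteq> F ==> map \<tau> p = p"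
 by (induct p) (auto simp: embD(6))

lemma emb_Cj: assumes "emb E \<tau>" "x \<in> E" shows "\<tau> x \<in> Cj x"
proof -
 have E: "fld E" using embD(1)[OF assms(1)] .
 have x: "x \<in> CR" using fldD(5)[OF E assms(2)] .
 have s: "set (Irr F x) \<subseteq> F" using IrrD(8)[OF fld_F x] .
 show ?thesis using emb_eval[OF assms, of "Irr F x"] s fldD(3)[OF E] map_F_id[OF assms(1) s] IrrD(4)[OF fld_F x] embD(9)[OF assms(1)] embD(2)[OF assms] IrrD(7)[OF fld_F x] unfolding Cj_def is_root_def by simp
qed

lemma emb_root:
 assumes E: "fld E" and b: "b \<in> CR" and b': "is_root (Irr E b) b'"
 shows "\<exists>\<tau>. emb (ext E b) \<tau> \<and> (\<forall>x\<in>E. \<tau> x = x) \<and> \<tau> b = b'"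
 using emb_ext[OF emb_id[OF E] b, of b'] b' unfolding is_root_def by simp

lemma emb_Cj_exists:
 assumes "x \<in> CR" "y \<in> Cj x" shows "\<exists>\<tau>. emb (ext F x) \<tau> \<and> \<tau> x = y"
 using emb_root[OF fld_F assms(1)] assms(2) unfolding Cj_def by blast

definition sep where "sep x \<longleftrightarrow> x \<in> CR \<and> (\<forall>y\<in>CR. alg_mult (Irr F x) y \<le> 1)"

lemma sep_carrier: "sep x ==> x \<in> CR" unfolding sep_def by blast

lemma sep_Cj: "sep x ==> y \<in> Cj x ==> sep y"
 using Cj_Irr Cj_carrier unfolding sep_def by auto

lemma Irr_mono_pdivides:
 assumes E: "fld E" and b: "b \<in> CR" shows "Irr E b pdivides Irr F b"
proof (rule Irr_minimal[OF fldD(1)[OF E] b alg[OF E b]])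
 have "set (Irr F b) \<subseteq> E" using IrrD(8)[OF fld_F b] fldD(3)[OF E] by blast
 then show "Irr F b \<in> carrier (E[X])"
  using IrrD(3,7)[OF fld_F b] by (auto simp: univ_poly_carrier[symmetric])
 show "eval (Irr F b) b = \<zero>" using IrrD(4)[OF fld_F b] .
qed

lemma degree_one_mem:
 assumes E: "fld E" and b: "b \<in> CR" and d: "degree (Irr E b) = 1" shows "b \<in> E"
proof -
 have "length (Irr E b) = 2" using d by simp
 then obtain a c where p: "Irr E b = [a, c]" by (auto simp: length_Suc_conv numeral_2_eq_2)
 have a: "a = \<one>" using IrrD(3)[OF E b] p by simp
 have c: "c \<in> E" using IrrD(8)[OF E b] p by auto
 have cc: "c \<in> CR" using fldD(5)[OF E c] .
 show ?thesis using IrrD(4)[OF E b] b cc minus_equality[of b c] fldD(10)[OF E c] unfolding p a by simp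
qed

text \<open>The minimal polynomial over \<open>E\<close> divides the one over \<open>F\<close>, so
  \<open>b\<close> is a simple root of it. If there were no other root, the degree would be 1 and
  \<open>b\<close> would lie in \<open>E\<close>.\<close>

lemma sep_descent:
 assumes E: "fld E" and b: "sep b" "b \<notin> E" shows "\<exists>b'. is_root (Irr E b) b' \<and> b' ~= b"
proof (rule ccontr)
 assume n: "\<not> (\<exists>b'. is_root (Irr E b) b' \<and> b' ~= b)"
 have bc: "b \<in> CR" using sep_carrier[OF b(1)] .
 note Ir = IrrD[OF E bc]
 have sz: "size (roots (Irr E b)) = degree (Irr E b)" using roots_over_carrier[OF Ir(6)] unfolding splitted_def .
 have only: "y = b" if "y \<in># roots (Irr E b)" for y using n roots_mem_iff_is_root[OF Ir(6)] that by blast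
 have "roots (Irr E b) \<subseteq># roots (Irr F b)"
  using pdivides_imp_roots_incl[OF Ir(6) IrrD(6,7)[OF fld_F bc] Irr_mono_pdivides[OF E bc]] .
 then have "count (roots (Irr E b)) b \<le> count (roots (Irr F b)) b" by (rule mset_subset_eq_count)
 also have "\<dots> \<le> 1" using b(1) alg_mult_eq_count_roots[OF IrrD(6)[OF fld_F bc]] unfolding sep_def by metis
 finally have c1: "count (roots (Irr E b)) b \<le> 1" .
 have "set_mset (roots (Irr E b)) \<subseteq> {b}" using only by blast
 then have "roots (Irr E b) = replicate_mset (size (roots (Irr E b))) b" by (rule set_mset_subset_singletonD)
 then have "degree (Irr E b) = 1" using sz c1 Ir(5) by auto
 then show False using degree_one_mem[OF E bc] b(2) by blast
qed

lemma sep_card_Cj: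
 assumes "sep b" shows "card (Cj b) = degree (Irr F b)"
proof -
 have bc: "b \<in> CR" using sep_carrier[OF assms] .
 note Ir = IrrD[OF fld_F bc]
 have sz: "size (roots (Irr F b)) = degree (Irr F b)" using roots_over_carrier[OF Ir(6)] unfolding splitted_def .
 have s: "set_mset (roots (Irr F b)) = Cj b" unfolding Cj_def using roots_mem_iff_is_root[OF Ir(6)] by blast
 have "count (roots (Irr F b)) y = 1" if y: "y \<in> Cj b" for y
 proof -
  have "count (roots (Irr F b)) y \<le> 1"
   using assms Cj_carrier[OF y] alg_mult_eq_count_roots[OF Ir(6)] unfolding sep_def by metis
  moreover have "y \<in># roots (Irr F b)" using y s by blast
  then have "count (roots (Irr F b)) y \<ge> 1" by simp
  ultimately show ?thesis by linarith
 qed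
 then have "size (roots (Irr F b)) = (\<Sum>y\<in>Cj b. 1)" unfolding size_multiset_overloaded_eq s by (intro sum.cong) auto
 then show ?thesis using sz by simp
qed

end

section \<open>Frobenius and primitive elements\<close>

lemma card_image_kernel:
 assumes "!!x y. x \<in> S ==> y \<in> S ==> f x = f y \<longleftrightarrow> g x = g y" shows "card (f ` S) = card (g ` S)"
proof -
 have i: "inv_into S f (f x) \<in> S \<and> f (inv_into S f (f x)) = f x" if "x \<in> S" for x
  using that by (simp add: f_inv_into_f inv_into_into)
 have "bij_betw (%u. g (inv_into S f u)) (f ` S) (g ` S)"
 proof (rule bij_betw_imageI)
  show "inj_on (%u. g (inv_into S f u)) (f ` S)"
  proof (rule inj_onI, clarify)
   fix x y assume "x \<in> S" "y \<in> S" "g (inv_into S f (f x)) = g (inv_into S f (f y))"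
   then show "f x = f y" using i[of x] i[of y] assms[of "inv_into S f (f x)" "inv_into S f (f y)"] by simp
  qed
  have "g (inv_into S f (f x)) = g x" if "x \<in> S" for x
   using i[OF that] assms[of "inv_into S f (f x)" x] that by simp
  then show "(%u. g (inv_into S f u)) ` (f ` S) = g ` S" by (simp add: image_image)
 qed
 then show ?thesis by (rule bij_betw_same_card)
qed

context cring
begin

definition bterm where "bterm x y n k = [(n choose k)] \<cdot> (x [^] k ** y [^] (n - k))"

lemma bterm_closed: "x \<in> CR ==> y \<in> CR ==> bterm x y n k \<in> CR"
 unfolding bterm_def by simp

lemma bterm_Suc:
 assumes "x \<in> CR" "y \<in> CR" "k \<le> n"
 shows "bterm x y (Suc n) (Suc k) = x ** bterm x y n k \<oplus> y ** bterm x y n (Suc k)"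
proof -
 have a: "x ** bterm x y n k = [(n choose k)] \<cdot> (x [^] Suc k ** y [^] (n - k))"
 using assms unfolding bterm_def by (auto simp: m_ac add_pow_rdistr)
 have b: "y ** bterm x y n (Suc k) = [(n choose Suc k)] \<cdot> (x [^] Suc k ** y [^] (n - k))"
 proof (cases "k = n")
  case False
  then have "n - k = Suc (n - Suc k)" using assms(3) by simp
  then show ?thesis
   using assms unfolding bterm_def by (simp add: add_pow_rdistr m_ac)
 qed (use assms in \<open>simp add: bterm_def binomial_eq_0\<close>)
 show ?thesis unfolding a b using assms by (simp add: bterm_def add.nat_pow_mult)
qed

lemma binomial_cring:
 assumes "x \<in> CR" "y \<in> CR"
 shows "(x \<oplus> y) [^] n = (\<Oplus>k\<in>{..n}. bterm x y n k)"
proof (induction n)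
 case 0
 then show ?case by (simp add: bterm_def)
next
 case (Suc n)
 let ?S = "\<Oplus>k\<in>{..n}. bterm x y n k"
 note c = bterm_closed[OF assms]
 have S: "?S \<in> CR" using c by simp
 have "(\<Oplus>k\<in>{..Suc n}. bterm x y (Suc n) k) = (\<Oplus>k\<in>{..n}. bterm x y (Suc n) (Suc k)) \<oplus> bterm x y (Suc n) 0"
  using c by (intro finsum_Suc2) auto
 also have "(\<Oplus>k\<in>{..n}. bterm x y (Suc n) (Suc k)) = (\<Oplus>k\<in>{..n}. x ** bterm x y n k \<oplus> y ** bterm x y n (Suc k))"
  by (rule finsum_cong') (use c assms bterm_Suc[OF assms] in auto)
 also have "\<dots> = (\<Oplus>k\<in>{..n}. x ** bterm x y n k) \<oplus> (\<Oplus>k\<in>{..n}. y ** bterm x y n (Suc k))"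
  using c assms by (intro finsum_addf) auto
 also have "(\<Oplus>k\<in>{..n}. x ** bterm x y n k) = x ** ?S" using c assms by (intro finsum_rdistr[symmetric]) auto
 also have "(\<Oplus>k\<in>{..n}. y ** bterm x y n (Suc k)) = y ** (\<Oplus>k\<in>{..n}. bterm x y n (Suc k))"
  using c assms by (intro finsum_rdistr[symmetric]) auto
 also have "bterm x y (Suc n) 0 = y ** bterm x y n 0" using assms by (simp add: bterm_def m_comm)
 also have "x ** ?S \<oplus> y ** (\<Oplus>k\<in>{..n}. bterm x y n (Suc k)) \<oplus> y ** bterm x y n 0
   = x ** ?S \<oplus> y ** ((\<Oplus>k\<in>{..n}. bterm x y n (Suc k)) \<oplus> bterm x y n 0)"
  using c assms by (simp add: r_distr a_assoc)
 also have "(\<Oplus>k\<in>{..n}. bterm x y n (Suc k)) \<oplus> bterm x y n 0 = (\<Oplus>k\<in>{..Suc n}. bterm x y n k)"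
  using c by (intro finsum_Suc2[symmetric]) auto
 also have "\<dots> = bterm x y n (Suc n) \<oplus> ?S" using c by (intro finsum_Suc) auto
 also have "bterm x y n (Suc n) = \<zero>" by (simp add: bterm_def binomial_eq_0)
 also have "x ** ?S \<oplus> y ** (\<zero> \<oplus> ?S) = (x \<oplus> y) [^] Suc n" using S assms Suc.IH by (simp add: l_distr m_comm)
 finally show ?case by simp
qed

lemma frobenius_add:
 assumes p: "normalization_semidom_class.prime (p::nat)" "[p] \<cdot> \<one> = \<zero>" and x: "x \<in> CR" "y \<in> CR"
 shows "(x \<oplus> y) [^] p = x [^] p \<oplus> y [^] p"
proof -
 have pz: "[p] \<cdot> z = \<zero>" if "z \<in> CR" for z
  using add_pow_ldistr[of \<one> z p] that p(2) by simp
 have z: "bterm x y p k = \<zero>" if k: "0 < k" "k < p" for k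
 proof -
  obtain m where "p choose k = p * m" using dvd_choose_prime[OF k(2) _ _ p(1)] k by auto
  then show ?thesis unfolding bterm_def using pz x by (simp add: add.nat_pow_pow[symmetric])
 qed
 have "p = Suc (Suc (p - 2))" using prime_ge_2_nat[OF p(1)] by simp
 then obtain m where m: "p = Suc (Suc m)" by blast
 note c = bterm_closed[OF x]
 have "(x \<oplus> y) [^] p = (\<Oplus>k\<in>{..Suc (Suc m)}. bterm x y p k)" using binomial_cring[OF x, of p] m by simp
 also have "\<dots> = bterm x y p p \<oplus> (\<Oplus>k\<in>{..Suc m}. bterm x y p k)" unfolding m by (rule finsum_Suc) (use c in auto)
 also have "(\<Oplus>k\<in>{..Suc m}. bterm x y p k) = (\<Oplus>k\<in>{..m}. bterm x y p (Suc k)) \<oplus> bterm x y p 0"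
  by (rule finsum_Suc2) (use c in auto)
 also have "(\<Oplus>k\<in>{..m}. bterm x y p (Suc k)) = \<zero>" by (rule add.finprod_one_eqI) (use z m in auto)
 finally show ?thesis using x by (simp add: bterm_def)
qed

end

text \<open>\<open>C\<close> supplies the coefficients \<open>c\<close> of primitive elements
  \<open>a + c b\<close>. It will be \<open>A\<close>, so that such combinations do not leave an
  order.\<close>

locale galois_p = galois R F for R (structure) and F +
 fixes p :: nat and C :: "'a set"
 assumes p: "normalization_semidom_class.prime p" "[p] \<cdot> \<one> = \<zero>" and C: "C \<subseteq> F" "infinite C"
begin

lemma frob_minus: "x \<in> CR ==> y \<in> CR ==> (x \<ominus> y) [^] p = x [^] p \<ominus> y [^] p"
proof -
 assume x: "x \<in> CR" "y \<in> CR"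
 have "(x \<ominus> y) [^] p \<oplus> y [^] p = (x \<ominus> y \<oplus> y) [^] p" using frobenius_add[OF p, of "x \<ominus> y" y] x by simp
 also have "x \<ominus> y \<oplus> y = x" using x by algebra
 finally have e: "(x \<ominus> y) [^] p \<oplus> y [^] p = x [^] p" .
 have c: "(x \<ominus> y) [^] p \<in> CR" "y [^] p \<in> CR" using x by auto
 have "(x \<ominus> y) [^] p = (x \<ominus> y) [^] p \<oplus> y [^] p \<ominus> y [^] p" using c by algebra
 then show ?thesis unfolding e .
qed

lemma frob_inj: "x \<in> CR ==> y \<in> CR ==> x [^] p = y [^] p ==> x = y"
proof -
 assume x: "x \<in> CR" "y \<in> CR" "x [^] p = y [^] p"
 have "(x \<ominus> y) [^] p = \<zero>" using frob_minus[OF x(1,2)] x by (simp add: r_neg)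
 moreover have "(x \<ominus> y) [^] m ~= \<zero>" if "x \<ominus> y ~= \<zero>" for m :: nat
  by (induction m) (use that x in \<open>auto simp: integral_iff\<close>)
 ultimately show "x = y" using minus_zero_iff[OF x(1,2)] by blast
qed

lemma frob_eval:
 assumes "set g \<subseteq> CR" "x \<in> CR"
 shows "eval g x [^] p = eval (map (%a. a [^] p) g) (x [^] p)"
 using assms(1)
proof (induction g)
 case Nil
 have "\<zero> [^] p = \<zero>" using prime_gt_0_nat[OF p(1)] by (cases p) auto
 then show ?case by simp
next
 case (Cons a g)
 have "eval (a # g) x [^] p = (a ** x [^] length g) [^] p \<oplus> eval g x [^] p"
  using eval_in_carrier Cons.prems assms(2) frobenius_add[OF p, of "a ** x [^] length g" "eval g x"] by simp
 also have "(a ** x [^] length g) [^] p = a [^] p ** (x [^] p) [^] length g"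
  using Cons.prems assms(2) by (simp add: nat_pow_distrib nat_pow_pow mult.commute)
 finally show ?case using Cons by simp
qed

lemma fld_eval: "fld E ==> set g \<subseteq> E ==> x \<in> E ==> eval g x \<in> E"
proof (induction g)
 case Nil
 then show ?case using subringE(2)[OF fldD(2)] by simp
next
 case (Cons a g)
 then show ?case using fldD(6,8)[OF Cons.prems(1)] subring_pow[OF fldD(2)[OF Cons.prems(1)] Cons.prems(3)] by simp
qed

lemma F_ext: "x \<in> CR ==> fld (ext F x)" by (rule fld_ext[OF fld_F])

lemma F_ext_sub: "fld E ==> x \<in> E ==> ext F x \<subseteq> E"
 using ext_min fldD(2,3) by blast

text \<open>This property of \<open>\<gamma>\<close> stands in for separability: it holds for separable elements and passes to the
  combinations \<open>a + c b\<close> of the primitive element theorem, without a proof that sums of separable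
  elements are separable.\<close>

definition Gd where "Gd \<gamma> \<longleftrightarrow> \<gamma> \<in> CR \<and> \<gamma> \<in> ext F (\<gamma> [^] p)"

lemma Gd_carrier: "Gd \<gamma> ==> \<gamma> \<in> CR" unfolding Gd_def by blast

lemma ext_frob:
 assumes "\<gamma> \<in> CR" "x \<in> ext F \<gamma>" shows "x [^] p \<in> ext F (\<gamma> [^] p)"
proof -
 obtain g where g: "g \<in> carrier (F[X])" "x = eval g \<gamma>" by (rule ext_elem[OF fld_F assms])
 have s: "set g \<subseteq> F" using polyD[OF g(1)] .
 have gp: "\<gamma> [^] p \<in> CR" using assms by simp
 have "set (map (%a. a [^] p) g) \<subseteq> ext F (\<gamma> [^] p)"
  using s subring_pow[OF F_sr] ext_incl[OF fld_F gp] by auto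
 then have "eval (map (%a. a [^] p) g) (\<gamma> [^] p) \<in> ext F (\<gamma> [^] p)"
  using fld_eval[OF F_ext[OF gp]] ext_mem[OF fld_F gp] by blast
 moreover have "set g \<subseteq> CR" using s F_carrier by blast
 ultimately show ?thesis unfolding g(2) using frob_eval[OF _ assms(1)] by simp
qed

text \<open>Another conjugate of \<open>b\<close> over the field generated by its
  \<open>p\<close>-th power would have the same \<open>p\<close>-th power, but Frobenius is
  injective.\<close>

lemma Gd_sep: assumes "sep b" shows "Gd b"
proof -
 have b: "b \<in> CR" "b [^] p \<in> CR" using sep_carrier[OF assms] by auto
 let ?E = "ext F (b [^] p)"
 have E: "fld ?E" using F_ext[OF b(2)] .
 show ?thesis unfolding Gd_def
 proof (rule conjI[OF b(1)], rule ccontr)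
  assume "b \<notin> ?E"
  then obtain b' where b': "is_root (Irr ?E b) b'" "b' ~= b" using sep_descent[OF E assms] by blast
  obtain \<tau> where t: "emb (ext ?E b) \<tau>" "\<forall>x\<in>?E. \<tau> x = x" "\<tau> b = b'"
   using emb_root[OF E b(1) b'(1)] by blast
  have "b' [^] p = b [^] p" using emb_pow[OF t(1) ext_mem[OF E b(1)], of p] t(2,3) ext_mem[OF fld_F b(2)] by simp
  then show False using frob_inj[of b' b] b(1) b' unfolding is_root_def by simp
 qed
qed

lemma emb_agree:
 assumes "emb E \<rho>" "emb E' \<tau>" "g \<in> E" "g \<in> E'" "\<rho> g = \<tau> g" "x \<in> ext F g" shows "\<rho> x = \<tau> x"
proof -
 have g: "g \<in> CR" using fldD(5)[OF embD(1)[OF assms(1)] assms(3)] .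
 obtain f where f: "f \<in> carrier (F[X])" "x = eval f g" by (rule ext_elem[OF fld_F g assms(6)])
 have s: "set f \<subseteq> F" using polyD[OF f(1)] .
 show ?thesis using emb_eval[OF assms(1,3), of f] emb_eval[OF assms(2,4), of f] s fldD(3)[OF embD(1)[OF assms(1)]] fldD(3)[OF embD(1)[OF assms(2)]] map_F_id[OF assms(1) s] map_F_id[OF assms(2) s] f(2) assms(5) by simp
qed

lemma emb_ext_img:
 assumes "emb E \<tau>" "g \<in> E" "x \<in> ext F g" shows "\<tau> x \<in> ext F (\<tau> g)"
proof -
 have g: "g \<in> CR" using fldD(5)[OF embD(1)[OF assms(1)] assms(2)] .
 obtain f where f: "f \<in> carrier (F[X])" "x = eval f g" by (rule ext_elem[OF fld_F g assms(3)])
 have s: "set f \<subseteq> F" using polyD[OF f(1)] .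
 have tg: "\<tau> g \<in> CR" using embD(2)[OF assms(1,2)] .
 show ?thesis using emb_eval[OF assms(1,2), of f] s fldD(3)[OF embD(1)[OF assms(1)]] map_F_id[OF assms(1) s] f(2) fld_eval[OF F_ext[OF tg], of f "\<tau> g"] ext_incl[OF fld_F tg] ext_mem[OF fld_F tg] by auto
qed

lemma Gd_Cj: assumes "Gd \<gamma>" "y \<in> Cj \<gamma>" shows "Gd y"
proof -
 have g: "\<gamma> \<in> CR" "\<gamma> [^] p \<in> CR" using Gd_carrier[OF assms(1)] by auto
 obtain \<tau> where t: "emb (ext F \<gamma>) \<tau>" "\<tau> \<gamma> = y" using emb_Cj_exists[OF g(1) assms(2)] by blast
 have m: "\<gamma> \<in> ext F \<gamma>" using ext_mem[OF fld_F g(1)] .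
 have "\<gamma> [^] p \<in> ext F \<gamma>" using subring_pow[OF fldD(2)[OF F_ext[OF g(1)]] m] .
 then show ?thesis using emb_ext_img[OF t(1)] assms(1) emb_pow[OF t(1) m, of p] t(2) Cj_carrier[OF assms(2)] unfolding Gd_def by force
qed

lemma ext_scale:
 assumes "a \<in> F" "a ~= \<zero>" "g \<in> CR" shows "g \<in> ext F (a ** g)"
proof -
 have a: "a \<in> CR" using assms(1) F_carrier by blast
 have ag: "a ** g \<in> CR" using assms by simp
 have "inv a ** (a ** g) = g" using assms field_Units by (simp add: m_assoc[symmetric])
 then show ?thesis using fldD(8)[OF F_ext[OF ag]] fldD(9)[OF fld_F assms(1,2)] ext_incl[OF fld_F ag] ext_mem[OF fld_F ag] by force
qed

lemma Gd_scale: assumes "a \<in> F" "a ~= \<zero>" "Gd g" shows "Gd (a ** g)"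
proof -
 have a: "a \<in> CR" "g \<in> CR" using assms Gd_carrier by auto
 have ag: "a ** g \<in> CR" using a by simp
 have ap: "a [^] p \<in> F" "a [^] p ~= \<zero>" using subring_pow[OF F_sr assms(1)] frob_inj[of a \<zero>] a assms(2) prime_gt_0_nat[OF p(1)]
  by (auto simp: nat_pow_zero)
 have e: "(a ** g) [^] p = a [^] p ** g [^] p" using a by (simp add: nat_pow_distrib)
 have agp: "(a ** g) [^] p \<in> CR" using ag by simp
 show ?thesis using ext_scale[OF ap, of "g [^] p"] a F_ext_sub[OF F_ext[OF agp]] assms(3) fldD(8)[OF F_ext[OF agp]] ext_incl[OF fld_F agp] assms(1) ag unfolding e Gd_def by blast
qed

lemma Cj_scale: assumes "a \<in> F" "a ~= \<zero>" "g \<in> CR" shows "Cj (a ** g) = (%y. a ** y) ` Cj g"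
proof -
 have a: "a \<in> CR" using assms(1) F_carrier by blast
 have ag: "a ** g \<in> CR" using assms by simp
 show ?thesis
 proof (intro equalityI subsetI)
  fix w assume "w \<in> Cj (a ** g)"
  then obtain \<tau> where t: "emb (ext F (a ** g)) \<tau>" "\<tau> (a ** g) = w" using emb_Cj_exists[OF ag] by blast
  have g: "g \<in> ext F (a ** g)" using ext_scale[OF assms] .
  show "w \<in> (%y. a ** y) ` Cj g" using embD(4)[OF t(1) _ g, of a] embD(6)[OF t(1) assms(1)] t(2) ext_incl[OF fld_F ag] assms(1) emb_Cj[OF t(1) g] by auto
 next
  fix w assume "w \<in> (%y. a ** y) ` Cj g"
  then obtain y where y: "y \<in> Cj g" "w = a ** y" by blast
  obtain \<tau> where t: "emb (ext F g) \<tau>" "\<tau> g = y" using emb_Cj_exists[OF assms(3) y(1)] by blast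
  have m: "a \<in> ext F g" "g \<in> ext F g" using ext_incl[OF fld_F assms(3)] ext_mem[OF fld_F assms(3)] assms(1) by auto
  show "w \<in> Cj (a ** g)" using embD(4)[OF t(1) m] embD(6)[OF t(1) assms(1)] t(2) y(2) emb_Cj[OF t(1) fldD(8)[OF F_ext[OF assms(3)] m]] by simp
 qed
qed

text \<open>Any conjugate combination \<open>y + c z\<close> determines both \<open>y\<close> and
  \<open>z\<close>. Stated for all conjugates, the condition is stable under conjugation and also
  lets \<open>y + c z\<close> label the pair in \<open>orb_cmb\<close>.\<close>

definition gen where "gen c a b \<longleftrightarrow> c \<in> F \<and>
 (\<forall>y\<in>Cj a. \<forall>y'\<in>Cj a. \<forall>z\<in>Cj b. \<forall>z'\<in>Cj b. y \<oplus> c ** z = y' \<oplus> c ** z' --> z = z')"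

lemma gen_F: "gen c a b ==> c \<in> F" unfolding gen_def by blast

lemma genD:
 assumes "gen c a b" "y \<in> Cj a" "y' \<in> Cj a" "z \<in> Cj b" "z' \<in> Cj b" "y \<oplus> c ** z = y' \<oplus> c ** z'"
 shows "y = y'" "z = z'"
proof -
 show z: "z = z'" using assms unfolding gen_def by blast
 show "y = y'" using gen_F[OF assms(1)] Cj_carrier[OF assms(5)] assms(6) Cj_carrier[OF assms(2)] Cj_carrier[OF assms(3)] unfolding z by simp
qed

lemma gen_exists: assumes "a \<in> CR" "b \<in> CR" obtains c where "c \<in> C" "gen c a b"
proof -
 let ?f = "%(y, y', z, z'). (y' \<ominus> y) ** inv (z \<ominus> z')"
 let ?B = "?f ` (Cj a \<times> Cj a \<times> Cj b \<times> Cj b)"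
 have "finite ?B" using Cj_finite assms by simp
 then have "\<not> C \<subseteq> ?B" using C(2) finite_subset by blast
 then obtain c where c: "c \<in> C" "c \<notin> ?B" by blast
 have cF: "c \<in> F" "c \<in> CR" using c(1) C(1) by auto
 have "z = z'" if h: "y \<in> Cj a" "y' \<in> Cj a" "z \<in> Cj b" "z' \<in> Cj b" "y \<oplus> c ** z = y' \<oplus> c ** z'" for y y' z z'
 proof (rule ccontr)
  assume n: "z ~= z'"
  have car: "y \<in> CR" "y' \<in> CR" "z \<in> CR" "z' \<in> CR" using h Cj_carrier by auto
  have nz: "z \<ominus> z' \<in> Units R" using n car field_Units by simp
  have "c ** (z \<ominus> z') = y \<oplus> c ** z \<ominus> y \<ominus> c ** z'" using car cF(2) by algebra
  also have "\<dots> = y' \<ominus> y" unfolding h(5) using car cF(2) by algebra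
  finally have e: "c ** (z \<ominus> z') = y' \<ominus> y" .
  have "c = c ** (z \<ominus> z') ** inv (z \<ominus> z')" using nz cF(2) Units_closed[OF nz] by (simp add: m_assoc)
  then have "c = (y' \<ominus> y) ** inv (z \<ominus> z')" unfolding e .
  then have "c \<in> ?B" using h(1-4) by force
  then show False using c(2) by blast
 qed
 then show ?thesis using cF(1) that c(1) unfolding gen_def by blast
qed

lemma gen_Cj: "a \<in> CR ==> b \<in> CR ==> gen c a b ==> y \<in> Cj a ==> z \<in> Cj b ==> gen c y z"
 using Cj_eq[of a y] Cj_eq[of b z] by (simp add: gen_def)

text \<open>If \<open>b\<close> were not in the field, an embedding over that field would move
  \<open>b\<close> and fix \<open>a + c b\<close>, against \<open>gen\<close>. Separability is asked
  of \<open>b\<close> alone, so that the step can be iterated with \<open>a\<close> merely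
  satisfying \<open>Gd\<close>.\<close>

lemma pet:
 assumes a: "a \<in> CR" and b: "sep b" and g: "gen c a b"
 shows "a \<in> ext F (a \<oplus> c ** b)" "b \<in> ext F (a \<oplus> c ** b)"
proof -
 let ?w = "a \<oplus> c ** b" let ?E = "ext F ?w"
 have bc: "b \<in> CR" "c \<in> CR" using sep_carrier[OF b] gen_F[OF g] by auto
 have w: "?w \<in> CR" using a bc by simp
 have E: "fld ?E" using F_ext[OF w] .
 have wE: "?w \<in> ?E" using ext_mem[OF fld_F w] .
 have cE: "c \<in> ?E" using ext_incl[OF fld_F w] gen_F[OF g] by blast
 have aw: "a = ?w \<ominus> c ** b" using a bc by algebra
 show bE: "b \<in> ?E"
 proof (rule ccontr)
  assume "b \<notin> ?E"
  then obtain b' where b': "is_root (Irr ?E b) b'" "b' ~= b" using sep_descent[OF E b] by blast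
  obtain \<tau> where t: "emb (ext ?E b) \<tau>" "\<forall>x\<in>?E. \<tau> x = x" "\<tau> b = b'"
   using emb_root[OF E bc(1) b'(1)] by blast
  let ?D = "ext ?E b"
  have D: "fld ?D" "?E \<subseteq> ?D" "b \<in> ?D" using fld_ext[OF E bc(1)] ext_incl[OF E bc(1)] ext_mem[OF E bc(1)] by auto
  have m: "c \<in> ?D" "?w \<in> ?D" using D cE wE by auto
  have aD: "a \<in> ?D" using aw fldD(7)[OF D(1) m(2) fldD(8)[OF D(1) m(1) D(3)]] by simp
  have "?w = \<tau> ?w" using t(2) wE by simp
  also have "\<dots> = \<tau> a \<oplus> c ** b'"
   using embD(3)[OF t(1) aD fldD(8)[OF D(1) m(1) D(3)]] embD(4)[OF t(1) m(1) D(3)] t(2,3) cE by simp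
  finally have "b = b'"
   using genD(2)[OF g Cj_self[OF a] emb_Cj[OF t(1) aD] Cj_self[OF bc(1)]] emb_Cj[OF t(1) D(3)] t(3) by simp
  then show False using b'(2) by simp
 qed
 show "a \<in> ?E" using aw fldD(7)[OF E wE fldD(8)[OF E cE bE]] by simp
qed

text \<open>With \<open>w = a + c b\<close>: since \<open>a\<close> lies in \<open>ext F w\<close>,
  its power \<open>a^p\<close> lies in \<open>ext F (w^p)\<close>, and then so does \<open>a\<close>
  by \<open>Gd a\<close>. The same holds for \<open>b\<close>, hence for \<open>w\<close>.\<close>

lemma Gd_pet: assumes a: "Gd a" and b: "sep b" and g: "gen c a b" shows "Gd (a \<oplus> c ** b)"
proof -
 let ?w = "a \<oplus> c ** b"
 have car: "a \<in> CR" "b \<in> CR" "c \<in> CR" using Gd_carrier[OF a] sep_carrier[OF b] gen_F[OF g] by auto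
 have w: "?w \<in> CR" "?w [^] p \<in> CR" using car by auto
 note E = F_ext[OF w(2)]
 have "x \<in> ext F (?w [^] p)" if "Gd x" "x \<in> ext F ?w" for x
  using that(1) F_ext_sub[OF E ext_frob[OF w(1) that(2)]] unfolding Gd_def by blast
 then show ?thesis using pet[OF car(1) b g] a Gd_sep[OF b] fldD(6,8)[OF E] ext_incl[OF fld_F w(2)] gen_F[OF g] w unfolding Gd_def by auto
qed

text \<open>The last clause makes \<open>ext F \<theta>\<close> the smallest field containing
  \<open>W\<close>; it gets applied to fixed fields of embeddings and to fields of elements mapped
  into a given field.\<close>

lemma prim_elem:
 assumes "finite W" "!!w. w \<in> W ==> sep w"
 shows "\<exists>\<theta>. Gd \<theta> \<and> W \<subseteq> ext F \<theta> \<and> (\<forall>E. fld E --> W \<subseteq> E --> \<theta> \<in> E)"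
 using assms
proof (induction W rule: finite_induct)
 case empty
 have z: "\<zero> [^] p = \<zero>" using prime_gt_0_nat[OF p(1)] by (cases p) auto
 show ?case using subringE(2)[OF fldD(2)] unfolding Gd_def by blast
next
 case (insert w W)
 obtain \<theta> where t: "Gd \<theta>" "W \<subseteq> ext F \<theta>" "\<forall>E. fld E --> W \<subseteq> E --> \<theta> \<in> E"
  using insert.IH[OF insert.prems[OF insertI2]] by blast
 have w: "sep w" using insert.prems by simp
 note car = Gd_carrier[OF t(1)] sep_carrier[OF w]
 obtain c where c: "c \<in> C" "gen c \<theta> w" by (rule gen_exists[OF car])
 let ?t = "\<theta> \<oplus> c ** w"
 have "insert w W \<subseteq> ext F ?t" using gen_F[OF c(2)] F_carrier car F_ext_sub[OF F_ext pet(1)[OF car(1) w c(2)]] t(2) pet(2)[OF car(1) w c(2)] by blast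
 moreover have "?t \<in> E" if E: "fld E" "insert w W \<subseteq> E" for E
 using t(3) E fldD(3)[OF E(1)] gen_F[OF c(2)] fldD(6)[OF E(1)] fldD(8)[OF E(1)] by auto
 ultimately show ?case using Gd_pet[OF t(1) w c(2)] by blast
qed

end

section \<open>Normal extensions and orbits\<close>

text \<open>The second assumption is normality of the field \<open>M\<close> generated by
  \<open>\<theta>\<close>; the embeddings of \<open>M\<close> then act as its automorphisms over
  \<open>F\<close>.\<close>

locale galois_normal = galois_p R F p C for R (structure) and F p C +
 fixes \<theta> assumes \<theta>: "\<theta> \<in> CR" "Cj \<theta> \<subseteq> ext F \<theta>"
begin

definition M where "M = ext F \<theta>"

lemma M_fld: "fld M" unfolding M_def by (rule F_ext[OF \<theta>(1)])
lemma th_M: "\<theta> \<in> M" unfolding M_def by (rule ext_mem[OF fld_F \<theta>(1)])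
lemma M_carrier: "x \<in> M ==> x \<in> CR" using fldD(5)[OF M_fld] .
lemma ext_M: "x \<in> M ==> ext F x \<subseteq> M" by (rule F_ext_sub[OF M_fld])

lemma emb_M_ext:
 assumes "emb E \<tau>" "E \<subseteq> M" obtains \<rho> where "emb M \<rho>" "!!x. x \<in> E ==> \<rho> x = \<tau> x"
proof -
 have E: "fld E" using embD(1)[OF assms(1)] .
 obtain \<rho> where r: "emb (ext E \<theta>) \<rho>" "\<forall>x\<in>E. \<rho> x = \<tau> x" using emb_ext_exists[OF assms(1) \<theta>(1)] by blast
 have "ext E \<theta> = M"
 proof
  show "ext E \<theta> \<subseteq> M" by (rule ext_min[OF fldD(2)[OF M_fld] assms(2) th_M])
  show "M \<subseteq> ext E \<theta>" unfolding M_def by (rule F_ext_sub[OF fld_ext[OF E \<theta>(1)] ext_mem[OF E \<theta>(1)]])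
 qed
 then show ?thesis using that r by simp
qed

lemma emb_M: assumes "emb M \<rho>" "x \<in> M" shows "\<rho> x \<in> M"
using emb_Cj[OF assms(1) th_M] \<theta>(2) emb_ext_img[OF assms(1) th_M, of x] assms(2) ext_M unfolding M_def by blast

lemma emb_comp: assumes "emb M \<rho>" "emb M \<tau>" shows "emb M (%x. \<rho> (\<tau> x))"
proof -
 note i = emb_M[OF assms(2)]
 have "(%x. \<rho> (\<tau> x)) \<in> ring_hom (sub M) R"
  by (rule ring_hom_memI) (simp_all add: embD(2-5)[OF assms(1)] embD(2-5)[OF assms(2)] i)
 then show ?thesis unfolding emb_def using M_fld embD(6)[OF assms(1)] embD(6)[OF assms(2)] by simp
qed

lemma Cj_M: assumes "x \<in> M" shows "Cj x \<subseteq> M"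
proof
 fix y assume y: "y \<in> Cj x"
 obtain \<tau> where t: "emb (ext F x) \<tau>" "\<tau> x = y" using emb_Cj_exists[OF M_carrier[OF assms] y] by blast
 obtain \<rho> where r: "emb M \<rho>" "!!z. z \<in> ext F x ==> \<rho> z = \<tau> z" using emb_M_ext[OF t(1) ext_M[OF assms]] by blast
 show "y \<in> M" using emb_M[OF r(1) assms] r(2) t(2) ext_mem[OF fld_F M_carrier[OF assms]] by simp
qed

lemma emb_trans: assumes "x \<in> M" "y \<in> Cj x" obtains \<rho> where "emb M \<rho>" "\<rho> x = y"
proof -
 obtain \<tau> where t: "emb (ext F x) \<tau>" "\<tau> x = y" using emb_Cj_exists[OF M_carrier[OF assms(1)] assms(2)] by blast
 obtain \<rho> where r: "emb M \<rho>" "!!z. z \<in> ext F x ==> \<rho> z = \<tau> z" using emb_M_ext[OF t(1) ext_M[OF assms(1)]] by blast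
 show ?thesis using that r t(2) ext_mem[OF fld_F M_carrier[OF assms(1)]] by simp
qed

lemma emb_inv:
 assumes "emb M \<rho>" shows "\<exists>\<tau>. emb M \<tau> \<and> (\<forall>x\<in>M. \<tau> (\<rho> x) = x) \<and> (\<forall>x\<in>M. \<rho> (\<tau> x) = x)"
proof -
 have y: "\<rho> \<theta> \<in> Cj \<theta>" "\<rho> \<theta> \<in> M" using emb_Cj[OF assms th_M] emb_M[OF assms th_M] by auto
 obtain \<tau> where t: "emb M \<tau>" "\<tau> (\<rho> \<theta>) = \<theta>" using Cj_eq[OF \<theta>(1) y(1)] Cj_self[OF \<theta>(1)] emb_trans[OF y(2)] by blast
 have a: "\<tau> (\<rho> x) = x" if "x \<in> M" for x
  using emb_agree[OF emb_comp[OF t(1) assms] emb_id[OF M_fld] th_M th_M t(2)] that unfolding M_def by blast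
 have "\<rho> (\<tau> x) = x" if x: "x \<in> M" for x
  using inj_onD[OF embD(8)[OF t(1)] a[OF emb_M[OF t(1) x]] emb_M[OF assms emb_M[OF t(1) x]] x] .
 then show ?thesis using t(1) a by blast
qed

text \<open>The part of the Galois correspondence in use: if \<open>z\<close> were not in
  \<open>ext F g\<close>, an embedding over this field moving \<open>z\<close> would extend to
  \<open>M\<close>, and it fixes \<open>g\<close>.\<close>

lemma fixed_mem:
 assumes z: "sep z" "z \<in> M" and g: "g \<in> M" and f: "!!\<rho>. emb M \<rho> ==> \<rho> g = g ==> \<rho> z = z"
 shows "z \<in> ext F g"
proof (rule ccontr)
 let ?E = "ext F g"
 have gc: "g \<in> CR" "z \<in> CR" using M_carrier g z by auto
 have E: "fld ?E" using F_ext[OF gc(1)] .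
 assume "z \<notin> ?E"
 then obtain z' where z': "is_root (Irr ?E z) z'" "z' ~= z" using sep_descent[OF E z(1)] by blast
 obtain \<tau> where t: "emb (ext ?E z) \<tau>" "\<forall>x\<in>?E. \<tau> x = x" "\<tau> z = z'" using emb_root[OF E gc(2) z'(1)] by blast
 have "ext ?E z \<subseteq> M" by (rule ext_min[OF fldD(2)[OF M_fld] ext_M[OF g] z(2)])
 then obtain \<rho> where r: "emb M \<rho>" "!!x. x \<in> ext ?E z ==> \<rho> x = \<tau> x" using emb_M_ext[OF t(1)] by blast
 have "\<rho> g = g" using r(2) t(2) ext_incl[OF E gc(2)] ext_mem[OF fld_F gc(1)] by auto
 moreover have "\<rho> z = z'" using r(2)[OF ext_mem[OF E gc(2)]] t(3) by simp
 ultimately show False using f[OF r(1)] z'(2) by simp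
qed

text \<open>The orbit of \<open>z\<close> under the stabilizer of \<open>g\<close>. Distinct orbits
  are distinct sets, so \<open>orb\<close> counts the orbits that meet \<open>Z\<close>.\<close>

definition st where "st g z = {\<rho> z | \<rho>. emb M \<rho> \<and> \<rho> g = g}"
definition orb where "orb g Z = card (st g ` Z)"

lemma st_self: "z \<in> st g z"
proof -
 have "emb M (%x. x)" using emb_id[OF M_fld] .
 then show ?thesis unfolding st_def by (intro CollectI exI[of _ "%x. x"]) simp
qed

lemma st_eq_iff:
 assumes g: "g \<in> M" and z: "z \<in> M" "z' \<in> M"
 shows "st g z = st g z' \<longleftrightarrow> (\<exists>\<rho>. emb M \<rho> \<and> \<rho> g = g \<and> \<rho> z = z')"
proof
 assume "st g z = st g z'"
 then have "z' \<in> st g z" using st_self[of z' g] by simp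
 then show "\<exists>\<rho>. emb M \<rho> \<and> \<rho> g = g \<and> \<rho> z = z'" unfolding st_def by auto
next
 have sub: "st g y' \<subseteq> st g y" if h: "emb M \<rho>" "\<rho> g = g" "\<rho> y = y'" for \<rho> y y'
 proof
  fix u assume "u \<in> st g y'"
  then obtain \<tau> where t: "emb M \<tau>" "\<tau> g = g" "u = \<tau> y'" unfolding st_def by auto
  show "u \<in> st g y" unfolding st_def
   by (intro CollectI exI[of _ "%x. \<tau> (\<rho> x)"]) (use emb_comp[OF t(1) h(1)] h t in simp)
 qed
 assume "\<exists>\<rho>. emb M \<rho> \<and> \<rho> g = g \<and> \<rho> z = z'"
 then obtain \<rho> where r: "emb M \<rho>" "\<rho> g = g" "\<rho> z = z'" by blast
 obtain \<tau> where t: "emb M \<tau>" "\<forall>x\<in>M. \<tau> (\<rho> x) = x" using emb_inv[OF r(1)] by blast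
 show "st g z = st g z'" using bspec[OF t(2) g] bspec[OF t(2) z(1)] r sub[OF r] sub[OF t(1), of z' z] by auto
qed

definition pst where "pst y z = {(\<rho> y, \<rho> z) | \<rho>. emb M \<rho>}"

lemma pst_eq_iff:
 assumes y: "y \<in> M" "y' \<in> M" and z: "z \<in> M" "z' \<in> M"
 shows "pst y z = pst y' z' \<longleftrightarrow> (\<exists>\<rho>. emb M \<rho> \<and> \<rho> y = y' \<and> \<rho> z = z')"
proof
 have "(y', z') \<in> pst y' z'" unfolding pst_def
  by (intro CollectI exI[of _ "%x. x"]) (use emb_id[OF M_fld] in simp)
 moreover assume "pst y z = pst y' z'"
 ultimately have "(y', z') \<in> pst y z" by simp
 then show "\<exists>\<rho>. emb M \<rho> \<and> \<rho> y = y' \<and> \<rho> z = z'" unfolding pst_def by auto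
next
 have sub: "pst (\<rho> u) (\<rho> v) \<subseteq> pst u v" if h: "emb M \<rho>" for \<rho> u v
 proof
  fix w assume "w \<in> pst (\<rho> u) (\<rho> v)"
  then obtain \<tau> where t: "emb M \<tau>" "w = (\<tau> (\<rho> u), \<tau> (\<rho> v))" unfolding pst_def by auto
  show "w \<in> pst u v" unfolding pst_def
   by (intro CollectI exI[of _ "%x. \<tau> (\<rho> x)"]) (use emb_comp[OF t(1) h] t in simp)
 qed
 assume "\<exists>\<rho>. emb M \<rho> \<and> \<rho> y = y' \<and> \<rho> z = z'"
 then obtain \<rho> where r: "emb M \<rho>" "\<rho> y = y'" "\<rho> z = z'" by blast
 obtain \<tau> where t: "emb M \<tau>" "\<forall>x\<in>M. \<tau> (\<rho> x) = x" using emb_inv[OF r(1)] by blast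
 show "pst y z = pst y' z'" using sub[OF r(1), of y z] sub[OF t(1), of y' z'] bspec[OF t(2) y(1)] bspec[OF t(2) z(1)] r by auto
qed

text \<open>As the group is transitive on \<open>Cj g\<close>, the orbits of the stabilizer of
  \<open>g\<close> on \<open>Cj a\<close> correspond to the orbits of the whole group on pairs, and
  pairs are symmetric in \<open>g\<close> and \<open>a\<close>.\<close>

lemma orb_pst:
 assumes g: "g \<in> M" and a: "a \<in> M"
 shows "orb g (Cj a) = card ((%(y, z). pst y z) ` (Cj g \<times> Cj a))"
  "orb a (Cj g) = card ((%(y, z). pst y z) ` (Cj g \<times> Cj a))"
proof -
 note c = M_carrier[OF g] M_carrier[OF a]
 have 1: "(%(y, z). pst y z) ` (Cj g \<times> Cj a) = (%z. pst g z) ` Cj a"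
 proof (intro equalityI subsetI)
  fix w assume "w \<in> (%(y, z). pst y z) ` (Cj g \<times> Cj a)"
  then obtain y z where y: "y \<in> Cj g" "z \<in> Cj a" "w = pst y z" by auto
  have yM: "y \<in> M" "z \<in> M" using Cj_M g a y by auto
  obtain \<rho> where r: "emb M \<rho>" "\<rho> y = g" using Cj_eq[OF c(1) y(1)] Cj_self[OF c(1)] emb_trans[OF yM(1)] by blast
  show "w \<in> (%z. pst g z) ` Cj a" using emb_Cj[OF r(1) yM(2)] Cj_eq[OF c(2) y(2)] pst_eq_iff[OF yM(1) g yM(2) emb_M[OF r(1) yM(2)]] r unfolding y(3) by blast
 next
  fix w assume "w \<in> (%z. pst g z) ` Cj a"
  then obtain z where "z \<in> Cj a" "w = pst g z" by blast
  then show "w \<in> (%(y, z). pst y z) ` (Cj g \<times> Cj a)" using Cj_self[OF c(1)] by (intro image_eqI[of _ _ "(g, z)"]) auto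
 qed
 have 2: "(%(y, z). pst y z) ` (Cj g \<times> Cj a) = (%y. pst y a) ` Cj g"
 proof (intro equalityI subsetI)
  fix w assume "w \<in> (%(y, z). pst y z) ` (Cj g \<times> Cj a)"
  then obtain y z where y: "y \<in> Cj g" "z \<in> Cj a" "w = pst y z" by auto
  have yM: "y \<in> M" "z \<in> M" using Cj_M g a y by auto
  obtain \<rho> where r: "emb M \<rho>" "\<rho> z = a" using Cj_eq[OF c(2) y(2)] Cj_self[OF c(2)] emb_trans[OF yM(2)] by blast
  show "w \<in> (%y. pst y a) ` Cj g" using emb_Cj[OF r(1) yM(1)] Cj_eq[OF c(1) y(1)] pst_eq_iff[OF yM(1) emb_M[OF r(1) yM(1)] yM(2) a] r unfolding y(3) by blast
 next
  fix w assume "w \<in> (%y. pst y a) ` Cj g"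
  then obtain y where "y \<in> Cj g" "w = pst y a" by blast
  then show "w \<in> (%(y, z). pst y z) ` (Cj g \<times> Cj a)" using Cj_self[OF c(2)] by (intro image_eqI[of _ _ "(y, a)"]) auto
 qed
 show "orb g (Cj a) = card ((%(y, z). pst y z) ` (Cj g \<times> Cj a))"
  unfolding orb_def 1
 proof (rule card_image_kernel)
  fix z z' assume "z \<in> Cj a" "z' \<in> Cj a"
  then have m: "z \<in> M" "z' \<in> M" using Cj_M[OF a] by auto
  show "st g z = st g z' \<longleftrightarrow> pst g z = pst g z'" unfolding st_eq_iff[OF g m] pst_eq_iff[OF g g m] ..
 qed
 show "orb a (Cj g) = card ((%(y, z). pst y z) ` (Cj g \<times> Cj a))"
  unfolding orb_def 2
 proof (rule card_image_kernel)
  fix z z' assume "z \<in> Cj g" "z' \<in> Cj g"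
  then have m: "z \<in> M" "z' \<in> M" using Cj_M[OF g] by auto
  show "st a z = st a z' \<longleftrightarrow> pst z a = pst z' a" unfolding st_eq_iff[OF a m] pst_eq_iff[OF m a a] by blast
 qed
qed

lemma orb_sym: "g \<in> M ==> a \<in> M ==> orb g (Cj a) = orb a (Cj g)"
 using orb_pst by simp

definition cmb where "cmb c g a = (%(y, z). y \<oplus> c ** z) ` (Cj g \<times> Cj a)"

lemma cmb_M: assumes "c \<in> F" "g \<in> M" "a \<in> M" shows "cmb c g a \<subseteq> M"
proof
 fix w assume "w \<in> cmb c g a"
 then obtain y z where y: "y \<in> Cj g" "z \<in> Cj a" "w = y \<oplus> c ** z" unfolding cmb_def by auto
 then show "w \<in> M" using Cj_M[OF assms(2)] Cj_M[OF assms(3)] fldD(3)[OF M_fld] assms(1) fldD(6)[OF M_fld _ fldD(8)[OF M_fld]] unfolding y(3) by blast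
qed

text \<open>By \<open>gen\<close> a pair can be recovered from \<open>y + c z\<close>, also after
  conjugation; so orbits of pairs become classes of conjugate elements, which have minimal
  polynomials and can be counted by primes.\<close>

lemma orb_cmb:
 assumes g: "g \<in> M" and a: "sep a" "a \<in> M" and c: "gen c g a"
 shows "orb g (Cj a) = card (Cj ` cmb c g a)"
proof -
 note car = M_carrier[OF g] M_carrier[OF a(2)]
 have cF: "c \<in> F" "c \<in> M" using gen_F[OF c] fldD(3)[OF M_fld] by auto
 have iff: "pst y z = pst y' z' \<longleftrightarrow> Cj (y \<oplus> c ** z) = Cj (y' \<oplus> c ** z')"
  if h: "y \<in> Cj g" "z \<in> Cj a" "y' \<in> Cj g" "z' \<in> Cj a" for y z y' z'
 proof -
  have m: "y \<in> M" "y' \<in> M" "z \<in> M" "z' \<in> M" using h Cj_M[OF g] Cj_M[OF a(2)] by auto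
  have w: "y \<oplus> c ** z \<in> M" "y' \<oplus> c ** z' \<in> M" using cmb_M[OF cF(1) g a(2)] h unfolding cmb_def by auto
  have e: "\<rho> (y \<oplus> c ** z) = \<rho> y \<oplus> c ** \<rho> z" if r: "emb M \<rho>" for \<rho>
   using embD(3)[OF r m(1) fldD(8)[OF M_fld cF(2) m(3)]] embD(4)[OF r cF(2) m(3)] embD(6)[OF r cF(1)] by simp
  show ?thesis
  proof
   assume "pst y z = pst y' z'"
   then obtain \<rho> where r: "emb M \<rho>" "\<rho> y = y'" "\<rho> z = z'" using pst_eq_iff[OF m] by blast
   then have "y' \<oplus> c ** z' \<in> Cj (y \<oplus> c ** z)" using emb_Cj[OF r(1) w(1)] e[OF r(1)] by simp
   then show "Cj (y \<oplus> c ** z) = Cj (y' \<oplus> c ** z')" by (rule Cj_eq[OF M_carrier[OF w(1)], symmetric])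
  next
   assume "Cj (y \<oplus> c ** z) = Cj (y' \<oplus> c ** z')"
   then have "y' \<oplus> c ** z' \<in> Cj (y \<oplus> c ** z)" using Cj_self[OF M_carrier[OF w(2)]] by simp
   then obtain \<rho> where r: "emb M \<rho>" "\<rho> (y \<oplus> c ** z) = y' \<oplus> c ** z'" by (rule emb_trans[OF w(1)])
   have i: "\<rho> y \<in> Cj g" "\<rho> z \<in> Cj a"
    using emb_Cj[OF r(1) m(1)] emb_Cj[OF r(1) m(3)] Cj_eq[OF car(1) h(1)] Cj_eq[OF car(2) h(2)] by auto
   show "pst y z = pst y' z'" using r e genD[OF c i(1) h(3) i(2) h(4)] pst_eq_iff[OF m] r(1) by auto
  qed
 qed
 have "card ((%(y, z). pst y z) ` (Cj g \<times> Cj a)) = card ((%(y, z). Cj (y \<oplus> c ** z)) ` (Cj g \<times> Cj a))"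
  by (rule card_image_kernel, clarsimp simp: iff)
 then show ?thesis using orb_pst(1)[OF g a(2)] unfolding cmb_def image_image by (simp add: case_prod_unfold)
qed

lemma cmb_Cj:
 assumes g: "g \<in> M" and a: "sep a" "a \<in> M" and c: "gen c g a" and w: "w \<in> cmb c g a"
 shows "Cj w \<subseteq> cmb c g a"
proof
 note car = M_carrier[OF g] M_carrier[OF a(2)]
 have cF: "c \<in> F" "c \<in> M" using gen_F[OF c] fldD(3)[OF M_fld] by auto
 obtain y z where y: "y \<in> Cj g" "z \<in> Cj a" "w = y \<oplus> c ** z" using w unfolding cmb_def by auto
 have m: "y \<in> M" "z \<in> M" using Cj_M[OF g] Cj_M[OF a(2)] y by auto
 have wM: "w \<in> M" using cmb_M[OF cF(1) g a(2)] w by blast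
 fix w' assume "w' \<in> Cj w"
 then obtain \<rho> where r: "emb M \<rho>" "\<rho> w = w'" by (rule emb_trans[OF wM])
 show "w' \<in> cmb c g a" using emb_Cj[OF r(1) m(1)] emb_Cj[OF r(1) m(2)] Cj_eq[OF car(1) y(1)] Cj_eq[OF car(2) y(2)] embD(3)[OF r(1) m(1) fldD(8)[OF M_fld cF(2) m(2)]] embD(4)[OF r(1) cF(2) m(2)] embD(6)[OF r(1) cF(1)] r(2) y(3) unfolding cmb_def by force
qed

end

text \<open>An embedding of \<open>ext F \<theta>\<close> maps \<open>W\<close> into itself. The
  elements that it sends back into \<open>ext F \<theta>\<close> form a field containing
  \<open>W\<close>, hence containing \<open>\<theta>\<close>.\<close>

lemma (in galois_p) normal_gen:
 assumes W: "finite W" "!!w. w \<in> W ==> sep w" "!!w. w \<in> W ==> Cj w \<subseteq> W"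
 obtains \<theta> where "Gd \<theta>" "W \<subseteq> ext F \<theta>" "Cj \<theta> \<subseteq> ext F \<theta>" "!!E. fld E ==> W \<subseteq> E ==> \<theta> \<in> E"
proof -
 obtain \<theta> where t: "Gd \<theta>" "W \<subseteq> ext F \<theta>" "\<forall>E. fld E --> W \<subseteq> E --> \<theta> \<in> E" using prim_elem[OF W(1,2)] by blast
 let ?M = "ext F \<theta>"
 have tc: "\<theta> \<in> CR" using Gd_carrier[OF t(1)] .
 note M = F_ext[OF tc]
 have "y \<in> ?M" if y: "y \<in> Cj \<theta>" for y
 proof -
  obtain \<tau> where \<tau>: "emb ?M \<tau>" "\<tau> \<theta> = y" using emb_Cj_exists[OF tc y] by blast
  let ?E = "{x \<in> ?M. \<tau> x \<in> ?M}"
  have F: "F \<subseteq> ?E" by (intro subsetI CollectI conjI) (simp_all add: embD(6)[OF \<tau>(1)] subsetD[OF fldD(3)[OF M]])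
  have sr: "subring ?E R"
   by (rule subringI) (use fldD(5)[OF M] subsetD[OF F subringE(3)[OF F_sr]] in
     \<open>auto simp: embD[OF \<tau>(1)] fldD[OF M]\<close>)
  have "subfield ?E R"
  proof (rule subfieldI'[OF sr])
   fix x assume x: "x \<in> ?E - {\<zero>}"
   then have xm: "x \<in> ?M" "x ~= \<zero>" "\<tau> x \<in> ?M" by auto
   have xi: "inv x \<in> ?M" using fldD(9)[OF M xm(1,2)] .
   have nz: "\<tau> x ~= \<zero>" using inj_onD[OF embD(8)[OF \<tau>(1)], of x \<zero>] embD(9)[OF \<tau>(1)] xm by auto
   show "inv x \<in> ?E" using embD(4)[OF \<tau>(1) xm(1) xi] xm fldD(5)[OF M] field_Units embD(5)[OF \<tau>(1)] comm_inv_char[of "\<tau> x" "\<tau> (inv x)"] embD(2)[OF \<tau>(1)] xi fldD(9)[OF M xm(3) nz] by simp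
  qed
  then have E: "fld ?E" unfolding fld_def using F by blast
  have "W \<subseteq> ?E" using t(2) W(3) emb_Cj[OF \<tau>(1)] by blast
  then show "y \<in> ?M" using t(3) E \<tau>(2) by blast
 qed
 then show ?thesis using that t by blast
qed

section \<open>Orders in finite extensions\<close>

lemma (in ring) indep_mono: "indep S x n ==> S' \<subseteq> S ==> indep S' x n"
 unfolding indep_def by blast

locale ff = fq_poly R k T q + galois R F for R (structure) and k T q F +
 fixes pc :: nat
 assumes F_gen: "F = generate_field R (insert T k)"
  and pc: "normalization_semidom_class.prime pc" "[pc] \<cdot> \<one> = \<zero>"
begin

lemma A_F: "A \<subseteq> F"
proof -
 have s: "insert T k \<subseteq> F" unfolding F_gen by (rule subsetI, rule generate_field.incl)
 show ?thesis unfolding A_def by (rule ext_min[OF F_sr]) (rule subset_trans[OF subset_insertI s], rule subsetD[OF s insertI1])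
qed

lemma A_inf: "infinite A"
proof
 assume f: "finite A"
 have "q ^ card A \<le> card A" using card_mono[OF f At_A, of "card A"] card_At by simp
 moreover have "card A < q ^ card A" using less_exp[of "card A"] power_mono[of 2 q "card A"] q_gt by linarith
 ultimately show False by simp
qed

end

sublocale ff \<subseteq> galois_p R F pc A
 by unfold_locales (use pc A_F A_inf in auto)

context ff
begin

lemma A_mult: "a \<in> A ==> b \<in> A ==> a ** b \<in> A" using subringE(6)[OF A_subring] .
lemma A_nz: "a \<in> A ==> b \<in> A ==> a ~= \<zero> ==> b ~= \<zero> ==> a ** b ~= \<zero>"
 using integral_iff A_carrier by auto

lemma frac: assumes "x \<in> F" shows "\<exists>d\<in>A. d ~= \<zero> \<and> d ** x \<in> A"
proof -
 let ?E = "{x \<in> CR. \<exists>d\<in>A. d ~= \<zero> \<and> d ** x \<in> A}"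
 have AE: "A \<subseteq> ?E"
 proof
  fix a assume "a \<in> A"
  then show "a \<in> ?E" using A_carrier subringE(3)[OF A_subring] one_not_zero by (intro CollectI conjI bexI[of _ \<one>]) auto
 qed
 have sr: "subring ?E R"
 proof (rule subringI)
  show "\<one> \<in> ?E" using AE subringE(3)[OF A_subring] by blast
  fix x assume x: "x \<in> ?E"
  then obtain d where d: "x \<in> CR" "d \<in> A" "d ~= \<zero>" "d ** x \<in> A" by blast
  have dc: "d \<in> CR" using d A_carrier by blast
  have "d ** \<ominus> x = \<ominus> (d ** x)" using d(1) dc by algebra
  then show "\<ominus> x \<in> ?E" using d subringE(5)[OF A_subring d(4)] by auto
  fix y assume y: "y \<in> ?E"
  then obtain e where e: "y \<in> CR" "e \<in> A" "e ~= \<zero>" "e ** y \<in> A" by blast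
  have ec: "e \<in> CR" using e A_carrier by blast
  have de: "d ** e \<in> A" "d ** e ~= \<zero>" using A_mult[OF d(2) e(2)] A_nz[OF d(2) e(2) d(3) e(3)] by auto
  have "d ** e ** (x ** y) = (d ** x) ** (e ** y)" using d(1) e(1) dc ec by algebra
  then show "x ** y \<in> ?E" using de d(1) e(1) A_mult[OF d(4) e(4)] by auto
  have "d ** e ** (x \<oplus> y) = e ** (d ** x) \<oplus> d ** (e ** y)" using d(1) e(1) dc ec by algebra
  then show "x \<oplus> y \<in> ?E" using de d(1) e(1) subringE(7)[OF A_subring A_mult[OF e(2) d(4)] A_mult[OF d(2) e(4)]] by auto
 qed blast
 have "subfield ?E R"
 proof (rule subfieldI'[OF sr])
  fix x assume "x \<in> ?E - {\<zero>}"
  then obtain d where d: "x \<in> CR" "x ~= \<zero>" "d \<in> A" "d ~= \<zero>" "d ** x \<in> A" by blast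
  have dc: "d \<in> CR" using d A_carrier by blast
  have u: "x \<in> Units R" using d field_Units by simp
  have "d ** x ~= \<zero>" using integral_iff d dc by simp
  then show "inv x \<in> ?E" using u d(1) dc d by (auto simp: m_assoc)
 qed
 then show ?thesis using AE T_A k_A generate_field_min_subfield1[of "insert T k" ?E] k_carrier assms unfolding F_gen by blast
qed

abbreviation dg where "dg g \<equiv> degree (Irr F g)"

lemma dg_pos: "g \<in> CR ==> dg g > 0" using IrrD(5)[OF fld_F, of g] by linarith

lemma Bx_ext: assumes g: "g \<in> CR" shows "Bx F g (dg g) = ext F g"
proof -
 have e: "ext F g = (%f. eval f g) ` {f \<in> carrier (F[X]). length f \<le> dg g}"
  using Span_exp_base[OF F_sf g alg[OF fld_F g]] Span_eq_eval_img[OF F_sf g] by simp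
 show ?thesis
 proof
  have "eval f g \<in> ext F g" if "set f \<subseteq> F" for f
   using fld_eval[OF F_ext[OF g] _ ext_mem[OF fld_F g]] that ext_incl[OF fld_F g] by blast
  then show "Bx F g (dg g) \<subseteq> ext F g" unfolding Bx_def by blast
  show "ext F g \<subseteq> Bx F g (dg g)"
  proof
   fix x assume "x \<in> ext F g"
   then obtain f where f: "f \<in> carrier (F[X])" "length f \<le> dg g" "x = eval f g" unfolding e by blast
   have s: "set f \<subseteq> F" using polyD[OF f(1)] .
   have "eval (replicate (dg g - length f) \<zero> @ f) g = eval f g" by (rule eval_replicate) (use s F_carrier g in auto)
   moreover have "set (replicate (dg g - length f) \<zero> @ f) \<subseteq> F" using s subringE(2)[OF F_sr] by auto
   ultimately show "x \<in> Bx F g (dg g)" unfolding Bx_def f(3)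
    by (intro image_eqI[of _ _ "replicate (dg g - length f) \<zero> @ f"]) (use f(2) in auto)
  qed
 qed
qed

lemma indep_F: assumes "g \<in> CR" shows "indep F g (dg g)"
 unfolding indep_def
proof (intro allI impI)
 fix f assume f: "set f \<subseteq> F \<and> length f = dg g \<and> eval f g = \<zero>"
 then have l: "length f = dg g" by blast
 have c: "combine f (exp_base g (dg g)) = \<zero>" using combine_eq_eval[of f g] f by simp
 show "set f \<subseteq> {\<zero>}" using independent_imp_trivial_combine[OF F_sf exp_base_independent[OF F_sf assms alg[OF fld_F assms]] _ c] f l by (simp add: exp_base_def)
qed

lemma dg_eq: assumes "g \<in> CR" "h \<in> CR" "ext F g = ext F h" shows "dg g = dg h"
 using dimI[OF F_sf dimension_simple_extension[OF F_sf assms(1) alg[OF fld_F assms(1)]]]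
  dimI[OF F_sf dimension_simple_extension[OF F_sf assms(2) alg[OF fld_F assms(2)]]] assms(3) by simp

text \<open>\<open>P\<close> is any property inherited by multiples. Besides denominators this
  covers elements of \<open>A\<close> off which a statement about primes holds, as in
  \<open>ae_ball\<close>.\<close>

lemma common_denom:
 assumes "finite W" "!!w. w \<in> W ==> \<exists>d\<in>A. d ~= \<zero> \<and> P d w" "!!d e w. d \<in> A ==> e \<in> A ==> w \<in> W ==> P d w ==> P (e ** d) w"
 shows "\<exists>d\<in>A. d ~= \<zero> \<and> (\<forall>w\<in>W. P d w)"
 using assms
proof (induction W rule: finite_induct)
 case empty
 then show ?case using subringE(3)[OF A_subring] one_not_zero by blast
next
 case (insert w W)
 obtain d where d: "d \<in> A" "d ~= \<zero>" "\<forall>w\<in>W. P d w"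
  using insert.IH[OF insert.prems(1)[OF insertI2] insert.prems(2)[OF _ _ insertI2]] by blast
 obtain e where e: "e \<in> A" "e ~= \<zero>" "P e w" using insert.prems(1)[OF insertI1] by blast
 have dc: "d \<in> CR" "e \<in> CR" using d e A_carrier by auto
 have "P (d ** e) w" by (rule insert.prems(2)[OF e(1) d(1) insertI1 e(3)])
 moreover have "P (d ** e) w'" if "w' \<in> W" for w'
  using insert.prems(2)[OF d(1) e(1) insertI2[OF that]] d(3) that dc by (simp add: m_comm)
 ultimately show ?case using A_mult[OF d(1) e(1)] A_nz[OF d(1) e(1) d(2) e(2)] by blast
qed

lemma clear_F: assumes "finite W" "W \<subseteq> F" shows "\<exists>d\<in>A. d ~= \<zero> \<and> (\<forall>w\<in>W. d ** w \<in> A)"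
proof (rule common_denom[OF assms(1)])
 show "\<exists>d\<in>A. d ~= \<zero> \<and> d ** w \<in> A" if "w \<in> W" for w using frac that assms(2) by blast
 show "e ** d ** w \<in> A" if "d \<in> A" "e \<in> A" "w \<in> W" "d ** w \<in> A" for d e w
 proof -
  have "e ** d ** w = e ** (d ** w)" using that A_carrier F_carrier assms(2) by (intro m_assoc) auto
  then show ?thesis using A_mult[OF that(2,4)] by simp
 qed
qed

lemma clear_Bx:
 assumes g: "g \<in> CR" and W: "finite W" "W \<subseteq> Bx F g n"
 shows "\<exists>d\<in>A. d ~= \<zero> \<and> (\<forall>w\<in>W. d ** w \<in> Bx A g n)"
proof (rule common_denom[OF W(1)])
 show "\<exists>d\<in>A. d ~= \<zero> \<and> d ** w \<in> Bx A g n" if w: "w \<in> W" for w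
 proof -
  obtain f where f: "set f \<subseteq> F" "length f = n" "w = eval f g" using w W(2) unfolding Bx_def by auto
  obtain d where d: "d \<in> A" "d ~= \<zero>" "\<forall>a\<in>set f. d ** a \<in> A" using clear_F[of "set f"] f(1) by auto
  have "d ** w = eval (map ((\<otimes>) d) f) g" unfolding f(3) using eval_scale[of d g f] d(1) f(1) g A_carrier F_carrier by auto
  then have "d ** w \<in> Bx A g n" unfolding Bx_def using d(3) f(2) by (intro image_eqI[of _ _ "map ((\<otimes>) d) f"]) auto
  then show ?thesis using d by blast
 qed
 show "e ** d ** w \<in> Bx A g n" if h: "d \<in> A" "e \<in> A" "w \<in> W" "d ** w \<in> Bx A g n" for d e w
 proof -
  have "w \<in> CR" using h(3) W(2) Bx_carrier[OF F_carrier g] by blast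
  then have "e ** d ** w = e ** (d ** w)" using h A_carrier by (intro m_assoc) auto
  also have "\<dots> \<in> Bx A g n" by (rule Bx_scale[OF A_carrier g _ _ h(4)]) (use A_mult[OF h(2)] h(2) A_carrier in auto)
  finally show ?thesis .
 qed
qed

text \<open>The minimal polynomial of \<open>g\<close> over \<open>F\<close> has its coefficients in
  \<open>A\<close>, see \<open>Irr_A\<close>; this is what makes the powers of \<open>g\<close> span
  an order.\<close>

definition pbs where "pbs g \<longleftrightarrow> g \<in> CR \<and> g [^] (dg g) \<in> Bx A g (dg g)"

lemma pbs_order: assumes "pbs g" shows "fq_order R k T q g (dg g)"
proof -
 have g: "g \<in> CR" "g [^] (dg g) \<in> Bx A g (dg g)" using assms unfolding pbs_def by auto
 show ?thesis by unfold_locales (use g dg_pos[OF g(1)] indep_mono[OF indep_F[OF g(1)] A_F] in auto)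
qed

lemma ext_scale_eq:
 assumes "a \<in> F" "a ~= \<zero>" "g \<in> CR" shows "ext F (a ** g) = ext F g"
proof
 have a: "a \<in> CR" using assms(1) F_carrier by blast
 have ag: "a ** g \<in> CR" using a assms(3) by simp
 show "ext F g \<subseteq> ext F (a ** g)" by (rule F_ext_sub[OF F_ext[OF ag] ext_scale[OF assms]])
 have "a ** g \<in> ext F g"
  using fldD(8)[OF F_ext[OF assms(3)]] ext_incl[OF fld_F assms(3)] ext_mem[OF fld_F assms(3)] assms(1) by blast
 then show "ext F (a ** g) \<subseteq> ext F g" by (rule F_ext_sub[OF F_ext[OF assms(3)]])
qed

text \<open>In the relation for \<open>e g\<close> every coefficient acquires a positive power of
  \<open>e\<close>, so a common denominator suffices. All nonzero multiples of \<open>d\<close> are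
  included, so that one factor can serve several elements.\<close>

lemma pbs_exists:
 assumes g: "g \<in> CR" shows "\<exists>d\<in>A. d ~= \<zero> \<and> (\<forall>a\<in>A. a ~= \<zero> --> pbs (a ** d ** g))"
proof -
 let ?n = "dg g"
 have "g [^] ?n \<in> ext F g" using subring_pow[OF fldD(2)[OF F_ext[OF g]] ext_mem[OF fld_F g]] .
 then obtain f where f: "set f \<subseteq> F" "length f = ?n" "g [^] ?n = eval f g" using Bx_ext[OF g] unfolding Bx_def by auto
 obtain d where d: "d \<in> A" "d ~= \<zero>" "\<forall>w\<in>set f. d ** w \<in> A" using clear_F[of "set f"] f(1) by auto
 have "pbs (e ** g)" if e: "e \<in> A" "e ~= \<zero>" "\<forall>w\<in>set f. e ** w \<in> A" for e
 proof -
  have ec: "e \<in> CR" "e \<in> F" using e A_F by auto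
  have "e [^] m ** eval h g \<in> Bx A (e ** g) (length h)" if "set h \<subseteq> set f" "length h \<le> m" for h m
   using that
  proof (induction h)
   case (Cons a h)
   have a: "a \<in> CR" "e ** a \<in> A" using Cons.prems(1) e(3) f(1) by auto
   have h: "eval h g \<in> CR" using eval_in_carrier[OF _ g] Cons.prems(1) f(1) F_carrier by auto
   obtain l where l: "m = length h + Suc l" using Cons.prems(2) by (metis add_Suc_right less_iff_Suc_add Suc_le_eq length_Cons)
   have em: "e [^] m = e [^] length h ** (e [^] l ** e)" using ec unfolding l by (simp add: nat_pow_mult[symmetric] m_assoc)
   have "e [^] m ** (a ** g [^] length h) = (e [^] l ** (e ** a)) ** (e [^] length h ** g [^] length h)"
    unfolding em using ec a(1) g by (simp add: m_ac)
   also have "e [^] length h ** g [^] length h = (e ** g) [^] length h" using ec g by (simp add: nat_pow_distrib)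
   finally have e1: "e [^] m ** (a ** g [^] length h) = (e [^] l ** (e ** a)) ** (e ** g) [^] length h" .
   have "e [^] m ** eval (a # h) g = e [^] m ** (a ** g [^] length h) \<oplus> e [^] m ** eval h g"
    using ec a(1) g h by (simp add: r_distr)
   then have e2: "e [^] m ** eval (a # h) g = (e [^] l ** (e ** a)) ** (e ** g) [^] length h \<oplus> e [^] m ** eval h g"
    unfolding e1 .
   have "e [^] l ** (e ** a) \<in> A" using A_mult[OF subring_pow[OF A_subring e(1)] a(2)] .
   then show ?case unfolding e2 length_Cons Bx_Suc using Cons.IH Cons.prems by auto
  qed (use ec in simp)
  from this[OF order_refl, of ?n] have m: "e [^] ?n ** eval f g \<in> Bx A (e ** g) ?n" using f(2) by simp
  have eg: "e ** g \<in> CR" using ec g by simp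
  have "dg (e ** g) = ?n" by (rule dg_eq[OF eg g ext_scale_eq[OF ec(2) e(2) g]])
  then show ?thesis using ec g m eg unfolding pbs_def by (simp add: nat_pow_distrib f(3)[symmetric])
 qed
 moreover have "a ** d ** w \<in> A" if "a \<in> A" "w \<in> set f" for a w
 proof -
  have "a ** d ** w = a ** (d ** w)" using that d(1) A_carrier F_carrier f(1) by (intro m_assoc) auto
  then show ?thesis using A_mult[OF that(1)] d(3) that(2) by simp
 qed
 ultimately show ?thesis using A_mult[OF _ d(1)] A_nz[OF _ d(1) _ d(2)] d by blast
qed

text \<open>By \<open>Gd g\<close> the powers of \<open>g^pc\<close> are again a basis of
  \<open>ext F g\<close>; let \<open>D\<close> clear denominators of the powers of \<open>g\<close>
  in it. If \<open>w\<close> has coordinates \<open>b\<close>, then \<open>w^pc\<close> has the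
  coordinates \<open>b^pc\<close> in the new basis. So if \<open>w^pc\<close> lies in the extension
  of a prime, the elements \<open>D b^pc\<close> lie in the prime, and so do the \<open>b\<close>
  unless \<open>D\<close> does.\<close>

lemma order_red:
 assumes g: "pbs g" and G: "Gd g"
 shows "\<exists>D. fq_order_red R k T q g (dg g) D"
proof -
 interpret o: fq_order R k T q g "dg g" using pbs_order[OF g] .
 let ?n = "dg g" let ?g = "g [^] pc"
 have gc: "g \<in> CR" "?g \<in> CR" using Gd_carrier[OF G] by auto
 have "ext F ?g = ext F g"
 proof
  show "ext F ?g \<subseteq> ext F g"
   by (rule F_ext_sub[OF F_ext[OF gc(1)] subring_pow[OF fldD(2)[OF F_ext[OF gc(1)]] ext_mem[OF fld_F gc(1)]]])
  show "ext F g \<subseteq> ext F ?g" using F_ext_sub[OF F_ext[OF gc(2)]] G unfolding Gd_def by blast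
 qed
 then have n: "dg ?g = ?n" and ext: "Bx F ?g ?n = ext F g" using dg_eq[OF gc(2,1)] Bx_ext[OF gc(2)] by auto
 have ind: "indep A ?g ?n" using indep_mono[OF indep_F[OF gc(2)] A_F] n by simp
 obtain D where D: "D \<in> A" "D ~= \<zero>" "!!i. i < ?n ==> D ** g [^] i \<in> Bx A ?g ?n"
  using subring_pow[OF fldD(2)[OF F_ext[OF gc(1)]] ext_mem[OF fld_F gc(1)]] clear_Bx[OF gc(2), of "(%i. g [^] i) ` {..<?n}" ?n] unfolding ext by auto
 have Dc: "D \<in> CR" using D(1) A_carrier by blast
 note Bas = Bx_asub[OF A_asub gc(2), of ?n]
 have lat: "D ** eval f g \<in> Bx A ?g ?n" if "set f \<subseteq> A" "length f \<le> ?n" for f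
  using that
 proof (induction f)
  case Nil
  then show ?case using asubD(2)[OF Bas] Dc by simp
 next
  case (Cons a f)
  have a: "a \<in> A" "a \<in> CR" using Cons.prems A_carrier by auto
  have f: "eval f g \<in> CR" using eval_in_carrier[OF _ gc(1)] Cons.prems A_carrier by auto
  have "a ** (D ** g [^] length f) \<in> Bx A ?g ?n"
   by (rule Bx_scale[OF A_carrier gc(2) a(2) A_mult[OF a(1)] D(3)]) (use Cons.prems in auto)
  then show ?case using a(2) f Dc gc(1) asubD(6)[OF Bas] Cons by (simp add: r_distr m_lcomm)
 qed
 have step: "w \<in> o.pO P" if P: "prm A P" "P ~= {\<zero>}" "D \<notin> P" and w: "w \<in> o.Od" "w [^] pc \<in> o.pO P" for P w
 proof -
  obtain \<pi> where pi: "\<pi> \<in> P" "P = {\<pi> ** b | b. b \<in> A}" by (rule idl_gen[OF prmD(1)[OF P(1)] P(2)])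
  have piA: "\<pi> \<in> A" using idlD(5)[OF prmD(1)[OF P(1)] pi(1)] .
  have pic: "\<pi> \<in> CR" using piA A_carrier by blast
  obtain b where b: "set b \<subseteq> A" "length b = ?n" "w = eval b g" using w(1) unfolding o.Od_def Bx_def by auto
  obtain u where u: "u \<in> o.Od" "w [^] pc = \<pi> ** u" using w(2) o.pO_gen[OF pi(2,1) piA] by blast
  obtain v where v: "set v \<subseteq> A" "length v = ?n" "u = eval v g" using u(1) unfolding o.Od_def Bx_def by auto
  obtain e where e: "set e \<subseteq> A" "length e = ?n" "D ** u = eval e ?g" using lat[OF v(1)] v(2,3) unfolding Bx_def by auto
  have bc: "set b \<subseteq> CR" "set e \<subseteq> CR" using b(1) e(1) A_carrier by auto
  let ?bp = "map (%a. a [^] pc) b"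
  have bpA: "set ?bp \<subseteq> A" using b(1) subring_pow[OF A_subring] by auto
  have "eval (map ((\<otimes>) D) ?bp) ?g = D ** w [^] pc"
   using eval_scale[OF Dc gc(2), of ?bp] bpA A_carrier frob_eval[OF bc(1) gc(1)] b(3) by auto
  also have "\<dots> = \<pi> ** (D ** u)" using u(1) o.Od_carrier Dc pic unfolding u(2) by (auto simp: m_lcomm)
  also have "\<dots> = eval (map ((\<otimes>) \<pi>) e) ?g" unfolding e(3) using eval_scale[OF pic gc(2) bc(2)] by simp
  finally have eq: "eval (map ((\<otimes>) D) ?bp) ?g = eval (map ((\<otimes>) \<pi>) e) ?g" .
  have "map ((\<otimes>) D) ?bp = map ((\<otimes>) \<pi>) e"
   by (rule Bx_coords_unique[OF A_asub gc(2) ind _ _ _ _ eq]) (use bpA e(1,2) b(2) A_mult[OF D(1)] A_mult[OF piA] in auto)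
  then have "set (map ((\<otimes>) D) ?bp) = set (map ((\<otimes>) \<pi>) e)" by simp
  then have "D ** a [^] pc \<in> P" if "a \<in> set b" for a using that e(1) pi(2) by auto
  then have bP: "a \<in> P" if "a \<in> set b" for a
   using that prmD(3)[OF P(1) D(1) subring_pow[OF A_subring]] P(3) b(1) prm_pow[OF P(1) A_subring] by blast
  have "eval f g \<in> o.pO P" if "set f \<subseteq> set b" "length f \<le> ?n" for f
   using that
  proof (induction f)
   case Nil
   then show ?case using idlD(4)[OF o.pO_idl[OF prmD(1)[OF P(1)] P(2)]] by simp
  next
   case (Cons a f)
   have "g [^] length f \<in> o.Od" using subring_pow[OF o.Od_subring o.gamma_Od] .
   then have "a ** g [^] length f \<in> o.pO P" unfolding o.pO_def using bP Cons.prems by auto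
   then show ?case using idlD(7)[OF o.pO_idl[OF prmD(1)[OF P(1)] P(2)]] Cons by simp
  qed
  then show "w \<in> o.pO P" using b by simp
 qed
 have "fq_order_red R k T q g ?n D"
 proof (unfold_locales)
  show "D \<in> A" "D ~= \<zero>" using D by auto
  fix P w and j :: nat
  assume P: "prm A P" "P ~= {\<zero>}" "D \<notin> P" and w: "w \<in> o.Od" "w [^] j \<in> o.pO P"
  have wc: "w \<in> CR" using w(1) o.Od_carrier by blast
  have it: "w \<in> o.pO P" if "w [^] (pc ^ i) \<in> o.pO P" for i
   using that
  proof (induction i)
   case (Suc i)
   show ?case using Suc.prems wc Suc.IH step[OF P subring_pow[OF o.Od_subring w(1)]] by (simp add: nat_pow_pow mult.commute)
  qed (use wc in simp)
  \<comment> \<open>As \<open>pc ^ j\<close> is at least \<open>j\<close>, the Frobenius step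
    iterated \<open>j\<close> times covers an arbitrary exponent.\<close>
  have "w [^] (pc ^ j) = w [^] (pc ^ j - j) ** w [^] j" using prime_ge_2_nat[OF pc(1)] wc by (simp add: nat_pow_mult)
  then have "w [^] (pc ^ j) \<in> o.pO P"
   using idlD(3)[OF o.pO_idl[OF prmD(1)[OF P(1)] P(2)] subring_pow[OF o.Od_subring w(1)] w(2)] by simp
  then show "w \<in> o.pO P" by (rule it)
 qed
 then show ?thesis by blast
qed

lemma avg_Hn:
 assumes "pbs g" "Gd g" shows "avg (%P. real (fq_order.Hn R k T g (dg g) P)) 1"
proof -
 obtain D where "fq_order_red R k T q g (dg g) D" using order_red[OF assms] by blast
 then show ?thesis by (rule fq_order_red.avg_Hn)
qed

lemma PR_bad: assumes "d \<in> A" "d ~= \<zero>" shows "finite {P \<in> PR. d \<in> P}"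
proof -
 obtain e where e: "dege e d" by (rule dege_exists[OF assms])
 have "{P \<in> PR. d \<in> P} \<subseteq> (\<Union>i\<le>e. {P \<in> PR. dgi P = i})"
 proof
  fix P assume P: "P \<in> {P \<in> PR. d \<in> P}"
  then have p: "idl A P" "P ~= {\<zero>}" "P \<in> PR" "d \<in> P" using prmD(1) unfolding PR_def by auto
  have "P \<inter> At (dgi P) = {\<zero>}" by (rule idl_gen[OF p(1,2)])
  then show "P \<in> (\<Union>i\<le>e. {P \<in> PR. dgi P = i})" using p(4) assms(2) e At_mono[of "Suc e" "dgi P"] p(3) unfolding dege_def by force
 qed
 then show ?thesis by (rule finite_subset) (use PR_fin(1) in auto)
qed

end

section \<open>Residues of conjugates\<close>

lemma (in ring) subring_eval:
 assumes "subring E R" "set g \<subseteq> E" "x \<in> E" shows "eval g x \<in> E"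
 using assms(2)
proof (induction g)
 case (Cons a g)
 have "x [^] length g \<in> E" by (induction g) (use assms subringE[OF assms(1)] in auto)
 then show ?case using Cons subringE(6,7)[OF assms(1)] by simp
qed (use subringE(2)[OF assms(1)] in simp)

lemma (in domain) eval_cong_idl:
 assumes B: "subring B R" and I: "idl B I" and g: "set g \<subseteq> B" and x: "x \<in> B" "y \<in> B" "x \<ominus> y \<in> I"
 shows "eval g x \<ominus> eval g y \<in> I"
 using g
proof (induction g rule: rev_induct)
 case Nil
 then show ?case using idlD(4)[OF I] by (simp add: minus_eq)
next
 case (snoc b g)
 have Bc: "B \<subseteq> CR" using subringE(1)[OF B] .
 have g: "set g \<subseteq> CR" "b \<in> CR" "x \<in> CR" "y \<in> CR" using snoc.prems Bc x by auto
 have e: "eval g x \<in> B" "eval g y \<in> B" using subring_eval[OF B] snoc.prems x by auto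
 have ec: "eval g x \<in> CR" "eval g y \<in> CR" using e Bc by auto
 have "eval (g @ [b]) x \<ominus> eval (g @ [b]) y = (x ** (eval g x \<ominus> eval g y)) \<oplus> (eval g y ** (x \<ominus> y))"
  unfolding eval_append_aux[OF g(1,2,3)] eval_append_aux[OF g(1,2,4)] using ec g(2-4) by algebra
 also have "\<dots> \<in> I" using idlD(3,7)[OF I] snoc e x by simp
 finally show ?case .
qed

lemma (in galois) split_eval:
 assumes "f \<in> carrier (poly_ring R)" "f ~= []"
 shows "\<exists>ys. set ys \<subseteq> {y. is_root f y} \<and>
  (\<forall>x\<in>CR. eval f x = lead_coeff f ** foldr (%y a. (x \<ominus> y) ** a) ys \<one>)"
 using assms
proof (induction "degree f" arbitrary: f)
 case 0
 obtain c where "f = [c]" using 0 by (cases f) auto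
 moreover have "c \<in> CR" using polyD[OF 0(2)] calculation by simp
 ultimately show ?case by (intro exI[of _ "[]"]) auto
next
 case (Suc d)
 obtain y where y: "is_root f y" using root_exists[OF Suc.prems(1)] Suc.hyps(2) by auto
 have yc: "y \<in> CR" using y unfolding is_root_def by blast
 have "[\<one>, \<ominus> y] pdivides f" using is_root_imp_pdivides[OF Suc.prems(1) y] .
 then obtain g where g: "g \<in> carrier (poly_ring R)" "f = poly_mult [\<one>, \<ominus> y] g"
  unfolding pdivides_def factor_def univ_poly_mult by auto
 have l: "[\<one>, \<ominus> y] \<in> carrier (poly_ring R)" using yc by (auto simp: univ_poly_carrier[symmetric] polynomial_def)
 have gn: "g ~= []" using Suc.prems(2) g(2) by auto
 have p: "polynomial (CR) g" "polynomial (CR) [\<one>, \<ominus> y]" using g(1) l univ_poly_carrier by blast+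
 have "d = degree g" using poly_mult_degree_eq[OF carrier_is_subring p(2,1)] gn Suc.hyps(2) unfolding g(2) by simp
 from Suc.hyps(1)[OF this g(1) gn] obtain ys where ys: "set ys \<subseteq> {y. is_root g y}"
  "!!x. x \<in> CR ==> eval g x = lead_coeff g ** foldr (%y a. (x \<ominus> y) ** a) ys \<one>"
  by blast
 have lg: "lead_coeff g \<in> CR" using gn polyD[OF g(1)] by (cases g) auto
 have lf: "lead_coeff f = lead_coeff g" unfolding g(2) using poly_mult_lead_coeff[OF carrier_is_subring p(2,1)] gn lg by simp
 have ev: "eval f x = (x \<ominus> y) ** eval g x" if "x \<in> CR" for x
  unfolding g(2) using eval_poly_mult[OF polyD[OF l] polyD[OF g(1)] that] that yc by (simp add: minus_eq)
 have fc: "foldr (%y a. (x \<ominus> y) ** a) zs \<one> \<in> CR" if "x \<in> CR" "set zs \<subseteq> CR" for x zs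
  using that by (induction zs) auto
 have yss: "set ys \<subseteq> CR" using ys(1) unfolding is_root_def by auto
 have "eval f x = lead_coeff f ** foldr (%y a. (x \<ominus> y) ** a) (y # ys) \<one>" if x: "x \<in> CR" for x
  unfolding ev[OF x] ys(2)[OF x] lf using lg fc[OF x yss] x yc by (simp add: m_lcomm)
 moreover have "set (y # ys) \<subseteq> {y. is_root f y}"
 proof
  fix z assume z: "z \<in> set (y # ys)"
  show "z \<in> {y. is_root f y}"
  proof (cases "z = y")
   case False
   then have "is_root g z" using z ys(1) by auto
   then show ?thesis using ev[of z] Suc.prems(2) yc unfolding is_root_def by auto
  qed (use y in simp)
 qed
 ultimately show ?case by blast
qed

locale ffn = ff R k T q F pc for R (structure) and k T q F pc +
 fixes \<theta>
 assumes th: "\<theta> \<in> CR" "Cj \<theta> \<subseteq> ext F \<theta>" and th_pbs: "pbs \<theta>"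

sublocale ffn \<subseteq> galois_normal R F pc A \<theta>
 by unfold_locales (use th in auto)

sublocale ffn \<subseteq> B: fq_order R k T q \<theta> "dg \<theta>"
 by (rule pbs_order[OF th_pbs])

context ffn
begin

text \<open>Instead of a Frobenius element fixing \<open>w\<close>: the residue of \<open>w\<close>
  at \<open>P\<close> comes from \<open>A\<close>. Such elements form a ring, see
  \<open>rd_subring\<close>.\<close>

definition rd where "rd P w \<longleftrightarrow> w \<in> B.Od \<and> (\<exists>a\<in>A. w \<ominus> a \<in> P)"
definition nrd where "nrd P Z = card {w \<in> Z. rd P w}"

lemma rd_subring: assumes P: "B.np P" shows "subring {w. rd P w} R"
proof (rule subringI)
 note i = idlD[OF B.npD(2)[OF P]]
 note Oc = subsetD[OF B.Od_carrier]
 show "{w. rd P w} \<subseteq> CR" unfolding rd_def using Oc by blast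
 have A: "rd P a" if "a \<in> A" for a
  unfolding rd_def using that B.A_Od A_carrier i(4) by (intro conjI bexI[of _ a]) (auto simp: minus_eq r_neg)
 show "\<one> \<in> {w. rd P w}" using A subringE(3)[OF A_subring] by blast
 fix x assume "x \<in> {w. rd P w}"
 then obtain a where a: "x \<in> B.Od" "a \<in> A" "x \<ominus> a \<in> P" unfolding rd_def by blast
 have c: "x \<in> CR" "a \<in> CR" using a Oc A_carrier by auto
 have "\<ominus> x \<ominus> (\<ominus> a) \<in> P" using c i(9)[OF a(3)] by algebra
 then show "\<ominus> x \<in> {w. rd P w}" unfolding rd_def using subringE(5)[OF B.Od_subring a(1)] subringE(5)[OF A_subring a(2)] by blast
 fix y assume "y \<in> {w. rd P w}"
 then obtain b where b: "y \<in> B.Od" "b \<in> A" "y \<ominus> b \<in> P" unfolding rd_def by blast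
 have d: "y \<in> CR" "b \<in> CR" using b Oc A_carrier by auto
 have "x ** y \<ominus> a ** b = y ** (x \<ominus> a) \<oplus> a ** (y \<ominus> b)" using c d by algebra
 then show "x ** y \<in> {w. rd P w}" using i(7)[OF i(3)[OF b(1) a(3)] i(3)[OF _ b(3), of a]] a(2) B.A_Od B.Od_mult[OF a(1) b(1)] A_mult[OF a(2) b(2)] unfolding rd_def by force
 have "x \<oplus> y \<ominus> (a \<oplus> b) \<in> P" using c d i(7)[OF a(3) b(3)] by algebra
 then show "x \<oplus> y \<in> {w. rd P w}"
  unfolding rd_def using subringE(7)[OF B.Od_subring a(1) b(1)] subringE(7)[OF A_subring a(2) b(2)] by blast
qed

lemma rd_A: "B.np P ==> a \<in> A ==> rd P a"
 unfolding rd_def using B.A_Od A_carrier idlD(4)[OF B.npD(2)]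
 by (intro conjI bexI[of _ a]) (auto simp: minus_eq r_neg)

text \<open>Exceptions are given by a nonzero element of \<open>A\<close>, so that denominators can
  be used as they come; \<open>ae_PR\<close> turns this into finitely many exceptional primes of
  \<open>A\<close>.\<close>

definition ae where "ae Q \<longleftrightarrow> (\<exists>d\<in>A. d ~= \<zero> \<and> (\<forall>P. B.np P --> d \<notin> P --> Q P))"

lemma not_in_mult: "B.np P ==> e ** d \<notin> P ==> e \<in> A ==> d \<in> A ==> d \<notin> P"
 using idlD(3)[OF B.npD(2)] B.A_Od by blast

lemma ae_ball: assumes "finite W" "!!w. w \<in> W ==> ae (Q w)" shows "ae (%P. \<forall>w\<in>W. Q w P)"
proof -
 have "\<exists>d\<in>A. d ~= \<zero> \<and> (\<forall>w\<in>W. \<forall>P. B.np P --> d \<notin> P --> Q w P)"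
  by (rule common_denom[OF assms(1)]) (use assms(2) not_in_mult in \<open>unfold ae_def, blast+\<close>)
 then show ?thesis unfolding ae_def by blast
qed

lemma ae_conj: assumes "ae Q" "ae Q'" shows "ae (%P. Q P \<and> Q' P)"
proof -
 obtain d e where d: "d \<in> A" "d ~= \<zero>" "\<forall>P. B.np P --> d \<notin> P --> Q P" "e \<in> A" "e ~= \<zero>" "\<forall>P. B.np P --> e \<notin> P --> Q' P"
  using assms unfolding ae_def by blast
 have "d ** e = e ** d" using d(1,4) A_carrier by (intro m_comm) auto
 then have "Q P \<and> Q' P" if "B.np P" "d ** e \<notin> P" for P
  using not_in_mult[OF that(1), of d e] not_in_mult[OF that(1), of e d] that d by simp
 then show ?thesis unfolding ae_def using A_mult[OF d(1,4)] A_nz[OF d(1,4,2,5)] by blast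
qed

lemma ae_mono: "ae Q ==> (!!P. B.np P ==> Q P ==> Q' P) ==> ae Q'"
 unfolding ae_def by blast

lemma ae_notin: assumes "x \<in> B.Od" "x ~= \<zero>" shows "ae (%P. x \<notin> P)"
proof -
 obtain d u where d: "d \<in> A" "d ~= \<zero>" "u \<in> B.Od" "d = x ** u" by (rule B.A_inter_multiples[OF assms])
 have "x \<notin> P" if P: "B.np P" "d \<notin> P" for P
 proof
  assume "x \<in> P"
  then have "u ** x \<in> P" using idlD(3)[OF B.npD(2)[OF P(1)] d(3)] by blast
  moreover have "u ** x = d" unfolding d(4) using d(3) assms(1) B.Od_carrier by (intro m_comm) auto
  ultimately show False using P(2) by simp
 qed
 then show ?thesis unfolding ae_def using d by blast
qed

lemma Irr_A: assumes "pbs g" shows "set (Irr F g) \<subseteq> A"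
proof -
 have g: "g \<in> CR" "g [^] (dg g) \<in> Bx A g (dg g)" using assms unfolding pbs_def by auto
 obtain h where h: "set h \<subseteq> A" "length h = dg g" "g [^] (dg g) = eval h g" using g(2) unfolding Bx_def by auto
 note Ir = IrrD[OF fld_F g(1)]
 obtain f where f: "Irr F g = \<one> # f" using Ir(3,7) by (cases "Irr F g") auto
 have fF: "set f \<subseteq> F" "length f = dg g" using Ir(8) f by auto
 have "g [^] length f \<oplus> eval f g = \<zero>" using Ir(4) f g(1) by simp
 then have e: "eval f g = \<ominus> \<one> ** eval h g" using fF(2) h(3) eval_in_carrier[OF _ g(1)] fF h(1) F_carrier A_carrier minus_equality[of "eval f g" "eval h g"] by (simp add: a_comm l_minus)
 have mA: "\<ominus> \<one> \<in> A" using subringE(3,5)[OF A_subring] by blast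
 have "eval f g = eval (map ((\<otimes>) (\<ominus> \<one>)) h) g" unfolding e using eval_scale[of "\<ominus> \<one>" g h] h(1) A_carrier g(1) by auto
 then have "f = map ((\<otimes>) (\<ominus> \<one>)) h"
  by (intro Bx_coords_unique[OF subring_asub[OF F_sr] g(1) indep_F[OF g(1)]])
   (use fF h A_mult[OF mA] A_F in auto)
 then show ?thesis using f h(1) A_mult[OF mA] subringE(3)[OF A_subring] by auto
qed

text \<open>Away from finitely many primes, the primes of residue degree one of \<open>A[g]\<close> correspond to the
  conjugates of \<open>g\<close> with residue in \<open>A / (P \<inter> A)\<close>.\<close>

lemma Hn_nrd:
 assumes g: "g \<in> M" "pbs g" "Cj g \<subseteq> B.Od"
 shows "ae (%P. fq_order.Hn R k T g (dg g) (P \<inter> A) = nrd P (Cj g))"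
proof -
 interpret o: fq_order R k T q g "dg g" using pbs_order[OF g(2)] .
 have gc: "g \<in> CR" using M_carrier[OF g(1)] .
 note Oc = subsetD[OF B.Od_carrier]
 have "\<forall>y\<in>Cj g. \<exists>\<rho>. emb M \<rho> \<and> \<rho> g = y" using emb_trans[OF g(1)] by metis
 then obtain \<rho> where r: "!!y. y \<in> Cj g ==> emb M (\<rho> y)" "!!y. y \<in> Cj g ==> \<rho> y g = y" by metis
 have oM: "o.Od \<subseteq> M"
  unfolding o.Od_def using Bx_mono[OF A_F, of g "dg g"] Bx_ext[OF gc] ext_M[OF g(1)] by blast
 have ro: "\<rho> y (eval h g) = eval h y" if y: "y \<in> Cj g" and h: "set h \<subseteq> A" for y h
 proof -
  have hF: "set h \<subseteq> F" using h A_F by blast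
  then show ?thesis using fldD(3)[OF M_fld] emb_eval[OF r(1)[OF y] g(1), of h] map_F_id[OF r(1)[OF y] hF] r(2)[OF y] by simp
 qed
 \<comment> \<open>The preimage of \<open>P\<close> under the conjugation taking \<open>g\<close> to
   \<open>y\<close>. It is a prime of \<open>A[g]\<close> with the same contraction to
   \<open>A\<close>.\<close>
 define Q where "Q P y = {v \<in> o.Od. \<rho> y v \<in> P}" for P y
 have key: "o.Hn (P \<inter> A) = nrd P (Cj g)"
  if P: "B.np P" and ne: "\<forall>w\<in>{(y, y') \<in> Cj g \<times> Cj g. y ~= y'}. fst w \<ominus> snd w \<notin> P" for P
 proof -
  note Pi = idlD[OF B.npD(2)[OF P]]
  let ?Y = "{w \<in> Cj g. rd P w}"
  have vr: "\<rho> y v \<in> B.Od" if "y \<in> Cj g" "v \<in> o.Od" for y v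
  proof -
   obtain h where h: "set h \<subseteq> A" "v = eval h g" using \<open>v \<in> o.Od\<close> unfolding o.Od_def Bx_def by auto
   show ?thesis using h(1) B.A_Od subring_eval[OF B.Od_subring] g(3) that(1) unfolding h(2) ro[OF that(1) h(1)] by blast
  qed
  have QA: "Q P y \<inter> A = P \<inter> A" if y: "y \<in> Cj g" for y
   unfolding Q_def using embD(6)[OF r(1)[OF y]] A_F o.A_Od by auto
  have Qnp: "o.np (Q P y)" if y: "y \<in> Cj g" for y
  proof -
   note e = embD[OF r(1)[OF y]]
   have oM': "v \<in> o.Od ==> v \<in> M" for v using oM by blast
   have "idl o.Od (Q P y)" unfolding idl_def asub_def
   proof (intro conjI ballI)
    show "Q P y \<subseteq> CR" unfolding Q_def using o.Od_carrier by blast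
    show "\<zero> \<in> Q P y" unfolding Q_def using e(9) Pi(4) o.OdD(2) by simp
    show "v \<ominus> w \<in> Q P y" if "v \<in> Q P y" "w \<in> Q P y" for v w
     using that o.OdD(3)[of v w] e(11)[OF oM' oM'] Pi(8) unfolding Q_def by simp
    show "Q P y \<subseteq> o.Od" unfolding Q_def by blast
    show "v ** w \<in> Q P y" if "v \<in> o.Od" "w \<in> Q P y" for v w
     using that o.Od_mult[of v w] e(4)[OF oM' oM'] Pi(3)[OF vr[OF y]] unfolding Q_def by simp
   qed
   moreover have "\<one> \<notin> Q P y" unfolding Q_def using e(5) prmD(2)[OF B.npD(1)[OF P]] by simp
   moreover have "v \<in> Q P y \<or> w \<in> Q P y" if "v \<in> o.Od" "w \<in> o.Od" "v ** w \<in> Q P y" for v w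
    using that e(4)[OF oM' oM'] prmD(3)[OF B.npD(1)[OF P] vr[OF y] vr[OF y]] unfolding Q_def by simp
   ultimately show ?thesis using QA[OF y] B.npD(5)[OF P] unfolding prm_def o.np_def by simp
  qed
  have QH: "o.H1 (Q P y)" if y: "y \<in> ?Y" for y
  proof -
   have yC: "y \<in> Cj g" "rd P y" using y by auto
   have "\<exists>a\<in>A. v \<ominus> a \<in> Q P y" if v: "v \<in> o.Od" for v
   proof -
    obtain h where h: "set h \<subseteq> A" "v = eval h g" using v unfolding o.Od_def Bx_def by auto
    have "eval h y \<in> {w. rd P w}" by (rule subring_eval[OF rd_subring[OF P]]) (use h(1) rd_A[OF P] yC in auto)
    then obtain a where a: "a \<in> A" "\<rho> y v \<ominus> a \<in> P" unfolding rd_def h(2) ro[OF yC(1) h(1)] by blast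
    have aM: "a \<in> M" "a \<in> F" "a \<in> o.Od" using a(1) A_F fldD(3)[OF M_fld] o.A_Od by auto
    show ?thesis using o.OdD(3)[OF v aM(3)] embD(11)[OF r(1)[OF yC(1)] _ aM(1), of v] embD(6)[OF r(1)[OF yC(1)] aM(2)] v oM a(2) a(1) unfolding Q_def by force
   qed
   then show ?thesis unfolding o.H1_def using Qnp[OF yC(1)] by blast
  qed
  have gO: "g \<in> o.Od" by (rule o.gamma_Od)
  have inj: "inj_on (Q P) ?Y"
  proof (rule inj_onI, rule ccontr)
   fix y y' assume y: "y \<in> ?Y" "y' \<in> ?Y" "Q P y = Q P y'" "y ~= y'"
   have yC: "y \<in> Cj g" "y' \<in> Cj g" using y by auto
   obtain a where a: "a \<in> A" "y \<ominus> a \<in> P" using y(1) unfolding rd_def by auto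
   have aM: "a \<in> M" "a \<in> F" "a \<in> o.Od" "a \<in> CR" using a(1) A_F fldD(3)[OF M_fld] o.A_Od by auto
   have e: "\<rho> z (g \<ominus> a) = z \<ominus> a" if "z \<in> Cj g" for z
    using embD(11)[OF r(1)[OF that] g(1) aM(1)] r(2)[OF that] embD(6)[OF r(1)[OF that] aM(2)] by simp
   have "(y \<ominus> a) \<ominus> (y' \<ominus> a) \<in> P" using o.OdD(3)[OF gO aM(3)] e[OF yC(1)] a(2) y(3) e[OF yC(2)] Pi(8)[OF a(2)] unfolding Q_def by force
   moreover have "(y \<ominus> a) \<ominus> (y' \<ominus> a) = y \<ominus> y'" using Cj_carrier[OF yC(1)] Cj_carrier[OF yC(2)] aM(4) by algebra
   ultimately show False using ne yC y(4) by auto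
  qed
  \<comment> \<open>For surjectivity: residue degree one gives \<open>a\<close> in \<open>A\<close>
    with \<open>g - a\<close> in the prime, so the minimal polynomial of \<open>g\<close> takes at
    \<open>a\<close> a value in \<open>P\<close>. This value is a product of differences
    \<open>a - y\<close>; a conjugate \<open>y\<close> congruent to \<open>a\<close> modulo
    \<open>P\<close> induces the prime.\<close>
  have "Q P ` ?Y = {P'. o.H1 P' \<and> P' \<inter> A = P \<inter> A}"
  proof (intro equalityI subsetI)
   fix P' assume "P' \<in> Q P ` ?Y"
   then show "P' \<in> {P'. o.H1 P' \<and> P' \<inter> A = P \<inter> A}" using QH QA by auto
  next
   fix P' assume "P' \<in> {P'. o.H1 P' \<and> P' \<inter> A = P \<inter> A}"
   then have P': "o.H1 P'" "o.np P'" "P' \<inter> A = P \<inter> A" unfolding o.H1_def by auto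
   note P'i = o.npD(2)[OF P'(2)]
   obtain a where a: "a \<in> A" "g \<ominus> a \<in> P'" using P'(1) gO unfolding o.H1_def by blast
   have ac: "a \<in> CR" using a(1) A_carrier by blast
   have cong: "eval h g \<ominus> eval h a \<in> P'" if "set h \<subseteq> A" for h
    by (rule eval_cong_idl[OF o.Od_subring P'i _ gO _ a(2)]) (use that o.A_Od a(1) in auto)
   let ?f = "Irr F g"
   note Ir = IrrD[OF fld_F gc]
   have fa: "eval ?f a \<in> A" using subring_eval[OF A_subring Irr_A[OF g(2)] a(1)] .
   have "eval ?f g \<ominus> eval ?f a \<in> P'" using cong[OF Irr_A[OF g(2)]] .
   then have "\<ominus> (\<zero> \<ominus> eval ?f a) \<in> P'" using idlD(9)[OF P'i] Ir(4) by simp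
   then have "eval ?f a \<in> P'" using fa A_carrier by (auto simp: minus_eq)
   then have fP: "eval ?f a \<in> P" using fa P'(3) by blast
   obtain ys where ys: "set ys \<subseteq> Cj g" "eval ?f a = lead_coeff ?f ** foldr (%y b. (a \<ominus> y) ** b) ys \<one>"
    using split_eval[OF Ir(6,7)] ac unfolding Cj_def by blast
   have aO: "a \<in> B.Od" using a(1) B.A_Od by blast
   have fO: "foldr (%y b. (a \<ominus> y) ** b) zs \<one> \<in> B.Od" if "set zs \<subseteq> Cj g" for zs
    using that
   proof (induction zs)
    case (Cons y zs)
    then show ?case using B.Od_mult[OF B.OdD(3)[OF aO, of y]] g(3) by auto
   qed (use subringE(3)[OF B.Od_subring] in simp)
   have "foldr (%y b. (a \<ominus> y) ** b) ys \<one> \<in> P" using fP ys Oc[OF fO[OF ys(1)]] Ir(3) by simp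
   then have "\<exists>y\<in>set ys. a \<ominus> y \<in> P" using ys(1)
   proof (induction ys)
    case (Cons y ys)
    then show ?case using prmD(3)[OF B.npD(1)[OF P] B.OdD(3)[OF aO, of y] fO[of ys]] g(3) by auto
   qed (use prmD(2)[OF B.npD(1)[OF P]] in simp)
   then obtain y where y: "y \<in> Cj g" "a \<ominus> y \<in> P" using ys(1) by blast
   have yO: "y \<in> B.Od" "y \<in> CR" using y(1) g(3) Cj_carrier by auto
   have ya: "y \<ominus> a \<in> P" using ac yO(2) Pi(9)[OF y(2)] by algebra
   then have yY: "y \<in> ?Y" using y(1) yO(1) a(1) unfolding rd_def by blast
   have "P' \<subseteq> Q P y"
   proof
    fix v assume v: "v \<in> P'"
    have vO: "v \<in> o.Od" using idlD(5)[OF P'i v] .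
    then obtain h where h: "set h \<subseteq> A" "v = eval h g" unfolding o.Od_def Bx_def by auto
    have ha: "eval h a \<in> A" "eval h a \<in> CR" using subring_eval[OF A_subring h(1) a(1)] A_carrier by auto
    have vc: "v \<in> CR" using vO o.Od_carrier by blast
    have "v \<ominus> (v \<ominus> eval h a) = eval h a" using vc ha(2) by algebra
    then have 1: "eval h a \<in> P" using idlD(8)[OF P'i v] cong[OF h(1)] h(2) ha(1) P'(3) by force
    have "eval h y \<ominus> eval h a \<in> P"
     by (rule eval_cong_idl[OF B.Od_subring B.npD(2)[OF P] _ yO(1) aO ya]) (use h(1) B.A_Od in auto)
    then have "(eval h y \<ominus> eval h a) \<oplus> eval h a \<in> P" using Pi(7) 1 by blast
    moreover have "eval h y \<in> CR" using eval_in_carrier[OF _ yO(2)] h(1) A_carrier by auto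
    then have "(eval h y \<ominus> eval h a) \<oplus> eval h a = eval h y" using ha(2) by algebra
    ultimately show "v \<in> Q P y" unfolding Q_def using vO ro[OF y(1) h(1)] h(2) by simp
   qed
   then show "P' \<in> Q P ` ?Y" using o.np_maximal[OF P'(2) Qnp[OF y(1)]] yY by blast
  qed
  then show ?thesis unfolding o.Hn_def nrd_def using card_image[OF inj] by simp
 qed
 have fin: "finite {(y, y') \<in> Cj g \<times> Cj g. y ~= y'}"
  by (rule finite_subset[of _ "Cj g \<times> Cj g"]) (use Cj_finite[OF gc] in auto)
 have "ae (%P. \<forall>w\<in>{(y, y') \<in> Cj g \<times> Cj g. y ~= y'}. fst w \<ominus> snd w \<notin> P)"
 proof (rule ae_ball[OF fin])
  fix w assume "w \<in> {(y, y') \<in> Cj g \<times> Cj g. y ~= y'}"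
  then have w: "fst w \<in> Cj g" "snd w \<in> Cj g" "fst w ~= snd w" by auto
  then show "ae (%P. fst w \<ominus> snd w \<notin> P)"
   using ae_notin[OF B.OdD(3)] g(3) minus_zero_iff Cj_carrier by blast
 qed
 then show ?thesis by (rule ae_mono) (rule key)
qed

end

section \<open>Averages of products of two residue counts\<close>

context ffn
begin

abbreviation Hg where "Hg g \<equiv> fq_order.Hn R k T g (dg g)"

text \<open>Lying over: 1 belongs to the basis of the order, so it is no multiple of a generator of
  \<open>p\<close>, and some prime contains the extension of \<open>p\<close>. Its contraction is
  \<open>p\<close> since \<open>p\<close> is maximal.\<close>

lemma np_over: assumes p: "p \<in> PR" shows "\<exists>P. B.np P \<and> P \<inter> A = p"
proof -
 have pp: "prm A p" "p ~= {\<zero>}" using p unfolding PR_def by auto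
 note i = prmD(1)[OF pp(1)]
 obtain \<pi> where pi: "\<pi> \<in> p" "p = {\<pi> ** b | b. b \<in> A}" by (rule idl_gen[OF i pp(2)])
 have piA: "\<pi> \<in> A" using idlD(5)[OF i pi(1)] .
 have pic: "\<pi> \<in> CR" using piA A_carrier by blast
 have "\<one> \<notin> B.pO p"
 proof
  assume "\<one> \<in> B.pO p"
  then obtain u where u: "u \<in> B.Od" "\<one> = \<pi> ** u" using B.pO_gen[OF pi(2,1) piA] by blast
  then obtain v where v: "set v \<subseteq> A" "length v = dg \<theta>" "u = eval v \<theta>" unfolding B.Od_def Bx_def by auto
  obtain m where m: "dg \<theta> = Suc m" using B.n_pos by (cases "dg \<theta>") auto
  let ?o = "replicate m \<zero> @ [\<one>]"
  have "eval ?o \<theta> = \<one>" using eval_replicate[of "[\<one>]" \<theta> m] th(1) by simp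
  also have "\<dots> = eval (map ((\<otimes>) \<pi>) v) \<theta>" using eval_scale[OF pic th(1), of v] v A_carrier u(2) by auto
  finally have e: "eval ?o \<theta> = eval (map ((\<otimes>) \<pi>) v) \<theta>" .
  have "?o = map ((\<otimes>) \<pi>) v"
   by (rule Bx_coords_unique[OF A_asub th(1) B.indep_A _ _ _ _ e])
    (use v A_mult[OF piA] m subringE(2,3)[OF A_subring] in auto)
  then have "\<one> \<in> set (map ((\<otimes>) \<pi>) v)" by (metis in_set_conv_decomp)
  then have "\<one> \<in> p" using v(1) pi(2) by auto
  then show False using prmD(2)[OF pp(1)] by blast
 qed
 moreover have pO: "a \<in> B.pO p" if "a \<in> p" for a
  unfolding B.pO_def using that idlD(6)[OF i that] subringE(3)[OF B.Od_subring]
  by (intro CollectI exI[of _ a] exI[of _ \<one>]) simp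
 ultimately obtain P where P: "B.np P" "B.pO p \<subseteq> P"
  using pp(2) pi A_carrier B.exists_np[OF B.pO_idl[OF i pp(2)]] pi(1) by blast
 have "P \<inter> A \<subseteq> p"
 proof (rule ccontr)
  assume "\<not> P \<inter> A \<subseteq> p"
  then obtain y where y: "y \<in> P" "y \<in> A" "y \<notin> p" by blast
  obtain z where z: "z \<in> A" "z ** y \<ominus> \<one> \<in> p" using prm_A_inv[OF pp y(2,3)] by blast
  note Pi = idlD[OF B.npD(2)[OF P(1)]]
  have zy: "z ** y \<in> P" using Pi(3)[OF _ y(1), of z] z(1) B.A_Od by blast
  have "z ** y \<ominus> (z ** y \<ominus> \<one>) \<in> P" using Pi(8)[OF zy] pO[OF z(2)] P(2) by blast
  moreover have "z ** y \<ominus> (z ** y \<ominus> \<one>) = \<one>" using Pi(6)[OF zy] by algebra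
  ultimately show False using prmD(2)[OF B.npD(1)[OF P(1)]] by simp
 qed
 then show ?thesis using P pO idlD(5)[OF i] by blast
qed

lemma ae_PR:
 assumes "ae Q" shows "\<exists>E. finite E \<and> (\<forall>p\<in>PR - E. \<exists>P. B.np P \<and> P \<inter> A = p \<and> Q P)"
proof -
 obtain d where d: "d \<in> A" "d ~= \<zero>" "\<forall>P. B.np P --> d \<notin> P --> Q P" using assms unfolding ae_def by blast
 have "\<exists>P. B.np P \<and> P \<inter> A = p \<and> Q P" if p: "p \<in> PR - {p \<in> PR. d \<in> p}" for p
 proof -
  obtain P where "B.np P" "P \<inter> A = p" using np_over p by blast
  moreover have "d \<notin> p" using p by blast
  ultimately show ?thesis using d by blast
 qed
 then show ?thesis using PR_bad[OF d(1,2)] by blast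
qed

lemma rd_inv:
 assumes P: "B.np P" and d: "d \<in> A" "d \<notin> P" and w: "w \<in> B.Od" "rd P (d ** w)" shows "rd P w"
proof -
 obtain t where t: "t \<in> A" "t ** d \<ominus> \<one> \<in> P" using prm_A_inv[OF B.npD(3,5)[OF P] d(1)] d(2) by blast
 have c: "t \<in> CR" "d \<in> CR" "w \<in> CR" using t d w A_carrier B.Od_carrier by auto
 have a: "t ** (d ** w) \<in> {w. rd P w}" using subringE(6)[OF rd_subring[OF P]] rd_A[OF P t(1)] w(2) by blast
 have iP: "w ** (t ** d \<ominus> \<one>) \<in> P" using idlD(3)[OF B.npD(2)[OF P] w(1) t(2)] .
 have "w ** (t ** d \<ominus> \<one>) \<ominus> \<zero> \<in> P" using iP idlD(6)[OF B.npD(2)[OF P] iP] by (simp add: minus_eq)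
 then have b: "w ** (t ** d \<ominus> \<one>) \<in> {w. rd P w}"
  unfolding rd_def using subringE(2)[OF A_subring] idlD(5)[OF B.npD(2)[OF P] iP] by blast
 have "t ** (d ** w) \<ominus> w ** (t ** d \<ominus> \<one>) = w" using c by algebra
 then show ?thesis using subring_minus[OF rd_subring[OF P] a b] by simp
qed

lemma nrd_scale:
 assumes "b \<in> A" "b ~= \<zero>" "Z \<subseteq> CR" shows "nrd P ((\<otimes>) b ` Z) = card {z \<in> Z. rd P (b ** z)}"
proof -
 have b: "b \<in> CR" using assms(1) A_carrier by blast
 have "inj_on ((\<otimes>) b) {z \<in> Z. rd P (b ** z)}"
  by (rule inj_onI) (use assms(3) m_lcancel[OF assms(2) b] in \<open>auto simp: subset_iff\<close>)
 moreover have "{w \<in> (\<otimes>) b ` Z. rd P w} = (\<otimes>) b ` {z \<in> Z. rd P (b ** z)}" by blast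
 ultimately show ?thesis unfolding nrd_def using card_image by simp
qed

text \<open>By \<open>pet\<close> both \<open>y\<close> and \<open>z\<close> are polynomials in
  \<open>y + c z\<close> over \<open>F\<close>. Off the denominators of these polynomials, a residue
  of the combination in that of \<open>A\<close> forces the same for \<open>y\<close> and
  \<open>z\<close>; the converse is clear.\<close>

lemma nrd_cmb:
 assumes e: "e \<in> M" and a: "sep a" "a \<in> M" and c: "gen c e a" "c \<in> A" and b: "b \<in> A" "b ~= \<zero>"
  and O: "Cj (b ** e) \<subseteq> B.Od" "Cj (b ** a) \<subseteq> B.Od"
 shows "ae (%P. nrd P (Cj (b ** e)) * nrd P (Cj (b ** a)) = nrd P ((\<otimes>) b ` cmb c e a))"
proof -
 note ec = M_carrier[OF e] M_carrier[OF a(2)]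
 have bF: "b \<in> F" "b \<in> CR" "c \<in> CR" using b c A_F by auto
 note Ce = Cj_scale[OF bF(1) b(2) ec(1)] and Ca = Cj_scale[OF bF(1) b(2) ec(2)]
 have yO: "b ** y \<in> B.Od" if "y \<in> Cj e" for y using O(1) that Ce by auto
 have zO: "b ** z \<in> B.Od" if "z \<in> Cj a" for z using O(2) that Ca by auto
 have dist: "b ** (y \<oplus> c ** z) = b ** y \<oplus> c ** (b ** z)" if "y \<in> Cj e" "z \<in> Cj a" for y z
  using bF Cj_carrier[OF that(1)] Cj_carrier[OF that(2)] by algebra
 have "ae (%P. \<forall>w\<in>Cj e \<times> Cj a. rd P (b ** (fst w \<oplus> c ** snd w)) --> rd P (b ** fst w) \<and> rd P (b ** snd w))"
 proof (rule ae_ball)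
  show "finite (Cj e \<times> Cj a)" using Cj_finite ec by blast
  fix w assume "w \<in> Cj e \<times> Cj a"
  then obtain y z where w: "w = (y, z)" "y \<in> Cj e" "z \<in> Cj a" by auto
  have yc: "y \<in> CR" "z \<in> CR" using Cj_carrier w by auto
  let ?u = "y \<oplus> c ** z" let ?v = "b ** ?u"
  have uc: "?u \<in> CR" "?v \<in> CR" using yc bF by auto
  note V = F_ext[OF uc(2)]
  have "{b ** y, b ** z} \<subseteq> Bx F ?v (dg ?v)" using pet[OF yc(1) sep_Cj[OF a(1) w(3)] gen_Cj[OF ec c(1) w(2,3)]] ext_scale_eq[OF bF(1) b(2) uc(1)] fldD(8)[OF V] subsetD[OF ext_incl[OF fld_F uc(2)] bF(1)] Bx_ext[OF uc(2)] by simp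
  then obtain d where d: "d \<in> A" "d ~= \<zero>" "d ** (b ** y) \<in> Bx A ?v (dg ?v)" "d ** (b ** z) \<in> Bx A ?v (dg ?v)"
   using clear_Bx[OF uc(2), of "{b ** y, b ** z}" "dg ?v"] by auto
  have "rd P (b ** y) \<and> rd P (b ** z)" if P: "B.np P" "d \<notin> P" "rd P ?v" for P
  proof -
   have "x \<in> {w. rd P w}" if x: "x \<in> Bx A ?v (dg ?v)" for x
   proof -
    obtain h where h: "set h \<subseteq> A" "x = eval h ?v" using x unfolding Bx_def by auto
    show ?thesis unfolding h(2) by (rule subring_eval[OF rd_subring[OF P(1)]]) (use h(1) rd_A[OF P(1)] P(3) in auto)
   qed
   then show ?thesis using rd_inv[OF P(1) d(1) P(2)] d(3,4) yO[OF w(2)] zO[OF w(3)] by blast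
  qed
  then show "ae (%P. rd P (b ** (fst w \<oplus> c ** snd w)) --> rd P (b ** fst w) \<and> rd P (b ** snd w))"
   using d(1,2) unfolding ae_def w(1) by auto
 qed
 then show ?thesis
 proof (rule ae_mono)
  fix P assume P: "B.np P" and h: "\<forall>w\<in>Cj e \<times> Cj a. rd P (b ** (fst w \<oplus> c ** snd w)) --> rd P (b ** fst w) \<and> rd P (b ** snd w)"
  let ?Y = "{y \<in> Cj e. rd P (b ** y)}" let ?Z = "{z \<in> Cj a. rd P (b ** z)}"
  let ?f = "%(y, z). y \<oplus> c ** z"
  have "inj_on ?f (?Y \<times> ?Z)"
  proof (rule inj_onI, clarsimp)
   fix y z y' z' assume h: "y \<in> Cj e" "z \<in> Cj a" "y' \<in> Cj e" "z' \<in> Cj a" "y \<oplus> c ** z = y' \<oplus> c ** z'"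
   then show "y = y' \<and> z = z'" using genD[OF c(1) h(1,3,2,4)] by blast
  qed
  moreover have "?f ` (?Y \<times> ?Z) = {u \<in> cmb c e a. rd P (b ** u)}"
  proof (intro equalityI subsetI)
   fix u assume "u \<in> ?f ` (?Y \<times> ?Z)"
   then obtain y z where u: "u = y \<oplus> c ** z" "y \<in> Cj e" "z \<in> Cj a" "rd P (b ** y)" "rd P (b ** z)" by auto
   have "b ** u \<in> {w. rd P w}" using subringE(6)[OF rd_subring[OF P]] rd_A[OF P c(2)] u(5) subringE(7)[OF rd_subring[OF P]] u(4) unfolding u(1) dist[OF u(2,3)] by blast
   then show "u \<in> {u \<in> cmb c e a. rd P (b ** u)}" unfolding cmb_def using u by auto
  next
   fix u assume "u \<in> {u \<in> cmb c e a. rd P (b ** u)}"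
   then obtain y z where u: "u = y \<oplus> c ** z" "y \<in> Cj e" "z \<in> Cj a" "rd P (b ** u)" unfolding cmb_def by auto
   have "rd P (b ** y)" "rd P (b ** z)" using bspec[OF h, of "(y, z)"] u by auto
   then show "u \<in> ?f ` (?Y \<times> ?Z)" using u by (intro image_eqI[of _ _ "(y, z)"]) auto
  qed
  ultimately have "card ?Y * card ?Z = card {u \<in> cmb c e a. rd P (b ** u)}"
   using card_image[of ?f "?Y \<times> ?Z"] by (simp add: card_cartesian_product)
  moreover have "cmb c e a \<subseteq> CR" using cmb_M[OF gen_F[OF c(1)] e a(2)] M_carrier by blast
  moreover have "Cj e \<subseteq> CR" "Cj a \<subseteq> CR" using Cj_carrier by auto
  ultimately show "nrd P (Cj (b ** e)) * nrd P (Cj (b ** a)) = nrd P ((\<otimes>) b ` cmb c e a)"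
   unfolding Ce Ca using nrd_scale[OF b] by simp
 qed
qed

lemma Hg_bdd: assumes "finite W" "!!w. w \<in> W ==> pbs w" obtains K where "K \<ge> 0" "!!w p. w \<in> W ==> p \<in> PR ==> real (Hg w p) \<le> K"
proof -
 have "\<exists>K\<ge>0. \<forall>w\<in>W. \<forall>p\<in>PR. real (Hg w p) \<le> K"
  using assms
 proof (induction W rule: finite_induct)
  case (insert w W)
  obtain K where K: "K \<ge> 0" "\<forall>w\<in>W. \<forall>p\<in>PR. real (Hg w p) \<le> K" using insert by auto
  interpret o: fq_order R k T q w "dg w" using pbs_order insert.prems by blast
  let ?K = "max K (real (dg w * (2 + o.c0)))"
  have "\<forall>x\<in>insert w W. \<forall>p\<in>PR. real (Hg x p) \<le> ?K"
  proof (intro ballI)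
   fix x p assume x: "x \<in> insert w W" "p \<in> PR"
   show "real (Hg x p) \<le> ?K"
   proof (cases "x = w")
    case True
    have "real (Hg w p) \<le> real (dg w * (2 + o.c0))" using o.Hn_le[OF x(2)] by (rule of_nat_mono)
    then show ?thesis unfolding True by (rule order_trans) (rule max.cobounded2)
   next
    case False
    then show ?thesis using K(2) x by force
   qed
  qed
  moreover have "?K \<ge> 0" by linarith
  ultimately show ?case by blast
 qed auto
 then show ?thesis using that by blast
qed

text \<open>\<open>g C\<close> represents the class \<open>C\<close> of conjugates in
  \<open>cmb c e a\<close>. Each of their counts has average 1 by \<open>avg_Hn\<close>, and
  \<open>orb_cmb\<close> gives the number of classes. The factor \<open>b\<close> makes all elements
  involved integral.\<close>

lemma avg_orb:
 assumes e: "e \<in> M" "Gd e" and a: "sep a" "a \<in> M" and c: "gen c e a" "c \<in> A" and b: "b \<in> A" "b ~= \<zero>"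
  and O: "Cj (b ** e) \<subseteq> B.Od" "Cj (b ** a) \<subseteq> B.Od"
  and pb: "!!w. w \<in> insert e (insert a (cmb c e a)) ==> pbs (b ** w)"
 shows "avg (%p. real (Hg (b ** e) p) * real (Hg (b ** a) p)) (real (orb e (Cj a)))"
proof -
 let ?V = "cmb c e a"
 note ec = M_carrier[OF e(1)] M_carrier[OF a(2)]
 have bF: "b \<in> F" "b \<in> CR" "b \<in> M" "c \<in> F" "c \<in> B.Od" "c \<in> CR"
  using b c A_F fldD(3)[OF M_fld] B.A_Od by auto
 have VM: "?V \<subseteq> M" using cmb_M[OF bF(4) e(1) a(2)] .
 have VG: "Gd w" if wV: "w \<in> ?V" for w
 proof -
  obtain y z where w: "w = y \<oplus> c ** z" "y \<in> Cj e" "z \<in> Cj a" using wV unfolding cmb_def by auto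
  show ?thesis unfolding w(1) by (rule Gd_pet[OF Gd_Cj[OF e(2) w(2)] sep_Cj[OF a(1) w(3)] gen_Cj[OF ec c(1) w(2,3)]])
 qed
 have VO: "b ** w \<in> B.Od" if wV: "w \<in> ?V" for w
 proof -
  obtain y z where w: "w = y \<oplus> c ** z" "y \<in> Cj e" "z \<in> Cj a" using wV unfolding cmb_def by auto
  have "b ** w = b ** y \<oplus> c ** (b ** z)" unfolding w(1) using bF(2,6) Cj_carrier[OF w(2)] Cj_carrier[OF w(3)] by algebra
  moreover have "b ** y \<in> B.Od" "b ** z \<in> B.Od"
   using O w(2,3) Cj_scale[OF bF(1) b(2) ec(1)] Cj_scale[OF bF(1) b(2) ec(2)] by auto
  ultimately show ?thesis using B.OdD(6) B.Od_mult[OF bF(5)] by simp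
 qed
 have VC: "Cj w \<subseteq> ?V" if "w \<in> ?V" for w using cmb_Cj[OF e(1) a c(1) that] .
 have Cb: "Cj (b ** w) = (\<otimes>) b ` Cj w" if "w \<in> M" for w using Cj_scale[OF bF(1) b(2) M_carrier[OF that]] .
 have finV: "finite ?V" unfolding cmb_def using Cj_finite ec by blast
 let ?I = "Cj ` ?V"
 have "\<forall>C\<in>?I. \<exists>w\<in>?V. Cj w = C" by blast
 then obtain g where g: "!!C. C \<in> ?I ==> g C \<in> ?V" "!!C. C \<in> ?I ==> Cj (g C) = C" by metis
 have bM: "b ** w \<in> M" if "w \<in> M" for w using fldD(8)[OF M_fld bF(3) that] .
 have gC: "Cj (b ** g C) = (\<otimes>) b ` C" if "C \<in> ?I" for C using Cb[of "g C"] g[OF that] VM by auto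
 let ?W = "insert e (insert a ?V)"
 obtain K where K: "K \<ge> 0" "!!w p. w \<in> (\<otimes>) b ` ?W ==> p \<in> PR ==> real (Hg w p) \<le> K"
  using finV Hg_bdd[of "(\<otimes>) b ` ?W"] pb by blast
 have gb: "real (Hg (b ** g C) p) \<le> K" if "C \<in> ?I" "p \<in> PR" for C p using K(2)[OF _ that(2), of "b ** g C"] g(1)[OF that(1)] by blast
 have finI: "finite ?I" using finV by blast
 have avs: "avg (%p. \<Sum>C\<in>?I. real (Hg (b ** g C) p)) (\<Sum>C\<in>?I. 1)"
 proof (rule avg_sum[OF finI, where K = K])
  fix C assume C: "C \<in> ?I"
  show "avg (%p. real (Hg (b ** g C) p)) 1"
   using avg_Hn[OF pb Gd_scale[OF bF(1) b(2) VG]] g(1)[OF C] by blast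
 qed (use gb in auto)
 have ae1: "ae (%P. Hg (b ** w) (P \<inter> A) = nrd P (Cj (b ** w)))" if w: "w \<in> M" "pbs (b ** w)" "Cj (b ** w) \<subseteq> B.Od" for w
  by (rule Hn_nrd[OF bM[OF w(1)] w(2,3)])
 have "ae (%P. \<forall>C\<in>?I. Hg (b ** g C) (P \<inter> A) = nrd P ((\<otimes>) b ` C))"
 proof (rule ae_ball[OF finI])
  fix C assume C: "C \<in> ?I"
  have "C \<subseteq> ?V" using VC[OF g(1)[OF C]] g(2)[OF C] by simp
  then show "ae (%P. Hg (b ** g C) (P \<inter> A) = nrd P ((\<otimes>) b ` C))"
   using VO ae1[of "g C"] g(1)[OF C] VM pb unfolding gC[OF C] by blast
 qed
 note aeg = this
 have "pbs (b ** e)" "pbs (b ** a)" using pb by auto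
 note ae_PR[OF ae_conj[OF ae_conj[OF ae1[OF e(1) this(1) O(1)] ae1[OF a(2) this(2) O(2)]]
  ae_conj[OF aeg nrd_cmb[OF e(1) a c b O]]]]
 then obtain E where E: "finite E" "\<forall>p\<in>PR - E. \<exists>P. B.np P \<and> P \<inter> A = p \<and>
   ((Hg (b ** e) (P \<inter> A) = nrd P (Cj (b ** e)) \<and> Hg (b ** a) (P \<inter> A) = nrd P (Cj (b ** a))) \<and>
   (\<forall>C\<in>?I. Hg (b ** g C) (P \<inter> A) = nrd P ((\<otimes>) b ` C)) \<and>
   nrd P (Cj (b ** e)) * nrd P (Cj (b ** a)) = nrd P ((\<otimes>) b ` cmb c e a))"
  by (elim exE conjE) (rule that)
 have "avg (%p. real (Hg (b ** e) p) * real (Hg (b ** a) p)) (\<Sum>C\<in>?I. 1)"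
 proof (rule avg_negligible[where S = "{}" and K = "max (real (card ?I) * K) (K * K)", OF _ _ _ _ E(1) _ _ avs])
  show "avg (%p. if p \<in> {} then 1 else 0) 0" unfolding avg_def ZZ_def by simp
  fix p assume p: "p \<in> PR"
  have "(\<Sum>C\<in>?I. real (Hg (b ** g C) p)) \<le> real (card ?I) * K" using sum_bounded_above[of ?I _ K] gb p by simp
  then show "(\<Sum>C\<in>?I. real (Hg (b ** g C) p)) \<le> max (real (card ?I) * K) (K * K)" by linarith
  have "real (Hg (b ** e) p) * real (Hg (b ** a) p) \<le> K * K" by (rule mult_mono) (use K p in auto)
  then show "real (Hg (b ** e) p) * real (Hg (b ** a) p) \<le> max (real (card ?I) * K) (K * K)" by linarith
  assume "p \<notin> E"
  then have "p \<in> PR - E" using p by blast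
  from bspec[OF E(2) this] obtain P where P: "B.np P" "P \<inter> A = p" "Hg (b ** e) p = nrd P (Cj (b ** e))" "Hg (b ** a) p = nrd P (Cj (b ** a))"
   "\<forall>C\<in>?I. Hg (b ** g C) p = nrd P ((\<otimes>) b ` C)" "nrd P (Cj (b ** e)) * nrd P (Cj (b ** a)) = nrd P ((\<otimes>) b ` ?V)"
   by blast
  have carV: "?V \<subseteq> CR" using VM M_carrier by blast
  have CV: "C \<subseteq> ?V" if "C \<in> ?I" for C using VC that by blast
  have "{u \<in> ?V. rd P (b ** u)} = (\<Union>C\<in>?I. {u \<in> C. rd P (b ** u)})"
   using CV Cj_self carV by blast
  moreover have "card (\<Union>C\<in>?I. {u \<in> C. rd P (b ** u)}) = (\<Sum>C\<in>?I. card {u \<in> C. rd P (b ** u)})"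
  proof (rule card_UN_disjoint[OF finI])
   show "\<forall>C\<in>?I. finite {u \<in> C. rd P (b ** u)}" using CV finite_subset[OF _ finV] by fastforce
   have "C = C'" if "C \<in> ?I" "C' \<in> ?I" "u \<in> C" "u \<in> C'" for C C' u
    using that Cj_eq[of _ u] carV by blast
   then show "\<forall>C\<in>?I. \<forall>C'\<in>?I. C ~= C' --> {u \<in> C. rd P (b ** u)} \<inter> {u \<in> C'. rd P (b ** u)} = {}" by blast
  qed
  moreover have "card {u \<in> C. rd P (b ** u)} = Hg (b ** g C) p" if "C \<in> ?I" for C
   using P(5) that nrd_scale[OF b, of C P] CV[OF that] carV by auto
  ultimately have "nrd P ((\<otimes>) b ` ?V) = (\<Sum>C\<in>?I. Hg (b ** g C) p)" using nrd_scale[OF b carV, of P] by simp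
  then have eq: "Hg (b ** e) p * Hg (b ** a) p = (\<Sum>C\<in>?I. Hg (b ** g C) p)" unfolding P(3,4) P(6) .
  show "(\<Sum>C\<in>?I. real (Hg (b ** g C) p)) = real (Hg (b ** e) p) * real (Hg (b ** a) p)"
   unfolding of_nat_sum[symmetric] of_nat_mult[symmetric] eq ..
 qed (auto intro: sum_nonneg)
 then show ?thesis using orb_cmb[OF e(1) a c(1)] by simp
qed

text \<open>Asserted for all nonzero multiples of \<open>d\<close>, so that a common multiple can
  later scale \<open>e\<close> in the same way for two different \<open>a\<close>.\<close>

lemma avg_orb_scaled:
 assumes e: "e \<in> M" "Gd e" and a: "sep a" "a \<in> M"
 shows "\<exists>d\<in>A. d ~= \<zero> \<and> (\<forall>b\<in>A. b ** d ~= \<zero> --> pbs (b ** d ** e) \<and> pbs (b ** d ** a) \<and>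
   avg (%p. real (Hg (b ** d ** e) p) * real (Hg (b ** d ** a) p)) (real (orb e (Cj a))))"
proof -
 note ec = M_carrier[OF e(1)] M_carrier[OF a(2)]
 obtain c where c: "c \<in> A" "gen c e a" by (rule gen_exists[OF ec])
 have cF: "c \<in> F" using c(1) A_F by blast
 let ?W = "insert e (insert a (cmb c e a)) \<union> (Cj e \<union> Cj a)"
 have fin: "finite ?W" unfolding cmb_def using Cj_finite ec by blast
 have WM: "?W \<subseteq> M" using e a cmb_M[OF cF e(1) a(2)] Cj_M by blast
 have ass: "b ** (x ** d) ** w = b ** x ** d ** w" if "b \<in> A" "x \<in> A" "d \<in> A" for b x d w
  using that A_carrier by (metis m_assoc subsetD)
 obtain d1 where d1: "d1 \<in> A" "d1 ~= \<zero>" "\<forall>w\<in>?W. \<forall>b\<in>A. b ** d1 ~= \<zero> --> pbs (b ** d1 ** w)"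
 proof -
  have "\<exists>d\<in>A. d ~= \<zero> \<and> (\<forall>w\<in>?W. \<forall>b\<in>A. b ** d ~= \<zero> --> pbs (b ** d ** w))"
  proof (rule common_denom[OF fin])
   fix w assume "w \<in> ?W"
   then obtain d where d: "d \<in> A" "d ~= \<zero>" "\<forall>b\<in>A. b ~= \<zero> --> pbs (b ** d ** w)" using WM M_carrier pbs_exists by blast
   have dc: "d \<in> CR" using d(1) A_carrier by blast
   show "\<exists>d\<in>A. d ~= \<zero> \<and> (\<forall>b\<in>A. b ** d ~= \<zero> --> pbs (b ** d ** w))" using d(3) dc d(1,2) by force
  next
   fix d x w assume h: "d \<in> A" "x \<in> A" "w \<in> ?W" "\<forall>b\<in>A. b ** d ~= \<zero> --> pbs (b ** d ** w)"
   show "\<forall>b\<in>A. b ** (x ** d) ~= \<zero> --> pbs (b ** (x ** d) ** w)"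
   proof (intro ballI impI)
    fix b assume b: "b \<in> A" "b ** (x ** d) ~= \<zero>"
    have "b ** (x ** d) = b ** x ** d" using b(1) h(1,2) A_carrier by (intro m_assoc[symmetric]) auto
    then show "pbs (b ** (x ** d) ** w)" using h(4) A_mult[OF b(1) h(2)] b(2) by simp
   qed
  qed
  then show ?thesis using that by blast
 qed
 have "?W \<subseteq> Bx F \<theta> (dg \<theta>)" using WM unfolding M_def Bx_ext[OF th(1), symmetric] .
 then obtain d2 where d2: "d2 \<in> A" "d2 ~= \<zero>" "\<forall>w\<in>?W. d2 ** w \<in> B.Od"
  using clear_Bx[OF th(1) fin] unfolding B.Od_def by blast
 have dc: "d1 \<in> CR" "d2 \<in> CR" using d1 d2 A_carrier by auto
 show ?thesis
 proof (rule bexI[of _ "d1 ** d2"], rule conjI[rotated], rule ballI, rule impI)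
  show "d1 ** d2 \<in> A" "d1 ** d2 ~= \<zero>" using A_mult[OF d1(1) d2(1)] A_nz[OF d1(1) d2(1) d1(2) d2(2)] by auto
  fix b assume b: "b \<in> A" "b ** (d1 ** d2) ~= \<zero>"
  have bc: "b \<in> CR" using b(1) A_carrier by blast
  let ?b = "b ** (d1 ** d2)"
  have bA: "?b \<in> A" "?b \<in> F" "?b \<in> CR" using A_mult[OF b(1) A_mult[OF d1(1) d2(1)]] A_F by auto
  have e1: "?b = (b ** d2) ** d1" "?b = (b ** d1) ** d2" using bc dc by (simp_all add: m_ac)
  have pb: "pbs (?b ** w)" if w: "w \<in> ?W" for w using d1(3) w A_mult[OF b(1) d2(1)] b(2) unfolding e1(1) by blast
  have od: "?b ** w \<in> B.Od" if w: "w \<in> ?W" for w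
  proof -
   have eq: "?b ** w = (b ** d1) ** (d2 ** w)" using w WM M_carrier bc dc by (auto simp: m_assoc)
   show ?thesis unfolding eq by (rule B.A_Od_mult[OF A_mult[OF b(1) d1(1)]]) (use d2(3) w in blast)
  qed
  have "Cj (?b ** e) \<subseteq> B.Od" "Cj (?b ** a) \<subseteq> B.Od"
   unfolding Cj_scale[OF bA(2) b(2) ec(1)] Cj_scale[OF bA(2) b(2) ec(2)] using od by auto
  then have "avg (%p. real (Hg (?b ** e) p) * real (Hg (?b ** a) p)) (real (orb e (Cj a)))"
   by (rule avg_orb[OF e a c(2,1) bA(1) b(2)]) (rule pb, blast)
  then show "pbs (?b ** e) \<and> pbs (?b ** a) \<and> avg (%p. real (Hg (?b ** e) p) * real (Hg (?b ** a) p)) (real (orb e (Cj a)))"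
   using pb by simp
 qed
qed

end

section \<open>Integral closures and splitting types\<close>

text \<open>Finiteness of the field provides a finite spanning set, so that \<open>dim\<close> is
  the dimension and not an unspecified value.\<close>

lemma (in field) dim_one_iff:
 assumes K: "subfield K R" and fin: "finite (CR)"
 shows "dim K (CR) = 1 \<longleftrightarrow> K = CR"
proof
 assume "K = CR"
 then show "dim K (CR) = 1" using dimension_one[OF K] dimI[OF K, of 1 "CR"] unfolding over_def by simp
next
 assume d: "dim K (CR) = 1"
 obtain Us where Us: "set Us = CR" using finite_list[OF fin] by blast
 have 1: "dimension 1 K (CR)" using Span_base_incl[OF K, of Us] Span_in_carrier[OF subfieldE(3)[OF K], of Us] Us Span_finite_dimension[OF K, of Us] finite_dimensionE[OF K] d unfolding over_def by force
 obtain Vs where Vs: "independent K Vs" "length Vs = 1" "Span K Vs = K" "set Vs \<subseteq> CR"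
  using exists_base[OF K dimension_one[OF K]] by blast
 then show "K = CR" using independent_length_eq_dimension[OF K 1 Vs(1,4)] Vs(3) by simp
qed

locale ffk = ff R k T q F pc for R (structure) and k T q F pc +
 fixes g D
 assumes gred: "fq_order_red R k T q g (dg g) D"

sublocale ffk \<subseteq> o: fq_order_red R k T q g "dg g" D
 by (rule gred)

context ffk
begin

definition Kg where "Kg = ext F g"

lemma Kg_fld: "fld Kg" unfolding Kg_def by (rule F_ext[OF o.\<gamma>])
lemma Od_Kg: "o.Od \<subseteq> Kg" unfolding o.Od_def Kg_def Bx_ext[OF o.\<gamma>, symmetric] by (rule Bx_mono[OF A_F])
text \<open>The ascending chain condition for submodules of a free module of rank \<open>l\<close>.
  The leading coefficients occurring in the union form a principal ideal \<open>I\<close>, whose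
  generator occurs at some stage; the parts without leading coefficient stabilize by
  induction.\<close>

lemma chain_stab:
 fixes N :: "nat => 'a set"
 assumes N: "!!m. asub (N m)" "!!m a x. a \<in> A ==> x \<in> N m ==> a ** x \<in> N m" "!!m m'. m \<le> m' ==> N m \<subseteq> N m'"
  and B: "!!m. N m \<subseteq> Bx A g l"
 shows "\<exists>m0. \<forall>m. N m \<subseteq> N m0"
 using assms
proof (induction l arbitrary: N)
 case 0
 then show ?case by (metis Bx_0 subset_singletonD subset_refl empty_subsetI singletonD subsetI)
next
 case (Suc l)
 note As = A_asub
 have bx: "Bx A g l \<subseteq> CR" using Bx_carrier[OF A_carrier o.\<gamma>] .
 define I where "I = {s \<in> A. \<exists>m. \<exists>u\<in>Bx A g l. s ** g [^] l \<oplus> u \<in> N m}"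
 have gl: "g [^] l \<in> CR" using o.\<gamma> by simp
 note bl = asubD[OF Bx_asub[OF A_asub o.\<gamma>, of l]]
 have sc: "a ** u \<in> Bx A g l" if "a \<in> A" "u \<in> Bx A g l" for a u
  by (rule Bx_scale[OF A_carrier o.\<gamma> _ _ that(2)]) (use that(1) A_mult A_carrier in auto)
 have I: "idl A I" unfolding idl_def asub_def
 proof (intro conjI ballI)
  show "I \<subseteq> CR" "I \<subseteq> A" unfolding I_def using A_carrier by auto
  show "\<zero> \<in> I" unfolding I_def using asubD(2)[OF Suc.prems(1)] subringE(2)[OF A_subring] bl(2) gl
   by (intro CollectI conjI exI[where x = 0]) (auto intro!: bexI[where x = \<zero>])
  fix s s' assume s: "s \<in> I" "s' \<in> I"
  obtain m u where u: "s \<in> A" "u \<in> Bx A g l" "s ** g [^] l \<oplus> u \<in> N m" using s(1) unfolding I_def by blast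
  obtain m' u' where u': "s' \<in> A" "u' \<in> Bx A g l" "s' ** g [^] l \<oplus> u' \<in> N m'" using s(2) unfolding I_def by blast
  have c: "s \<in> CR" "s' \<in> CR" "u \<in> CR" "u' \<in> CR" using u u' A_carrier bx by auto
  let ?m = "max m m'"
  have i: "s ** g [^] l \<oplus> u \<in> N ?m" "s' ** g [^] l \<oplus> u' \<in> N ?m"
   using subsetD[OF Suc.prems(3)[OF max.cobounded1] u(3)] subsetD[OF Suc.prems(3)[OF max.cobounded2] u'(3)] by auto
  have "(s \<ominus> s') ** g [^] l \<oplus> (u \<ominus> u') \<in> N ?m" using c gl asubD(3)[OF Suc.prems(1) i] by algebra
  then show "s \<ominus> s' \<in> I" unfolding I_def using asubD(3)[OF A_asub u(1) u'(1)] bl(3)[OF u(2) u'(2)] by blast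
 next
  fix a s assume a: "a \<in> A" "s \<in> I"
  obtain m u where u: "s \<in> A" "u \<in> Bx A g l" "s ** g [^] l \<oplus> u \<in> N m" using a(2) unfolding I_def by blast
  have c: "s \<in> CR" "a \<in> CR" "u \<in> CR" using u a A_carrier bx by auto
  have "(a ** s) ** g [^] l \<oplus> a ** u \<in> N m" using c gl Suc.prems(2)[OF a(1) u(3)] by algebra
  then show "a ** s \<in> I" unfolding I_def using A_mult[OF a(1) u(1)] sc[OF a(1) u(2)] by blast
 qed
 obtain \<pi> where pi: "\<pi> \<in> I" "!!s. s \<in> I ==> \<exists>b\<in>A. s = \<pi> ** b"
 proof (cases "I = {\<zero>}")
  case True
  then show ?thesis using that[of \<zero>] subringE(2)[OF A_subring] bexI[of "%b. \<zero> = \<zero> ** b" \<zero> A] by auto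
 next
  case False
  obtain \<pi> where "\<pi> \<in> I" "I = {\<pi> ** b | b. b \<in> A}" by (rule idl_gen[OF I False])
  then show ?thesis using that by blast
 qed
 obtain m1 v where v: "\<pi> \<in> A" "v \<in> Bx A g l" "\<pi> ** g [^] l \<oplus> v \<in> N m1" using pi(1) unfolding I_def by blast
 have "\<exists>m0. \<forall>m. N m \<inter> Bx A g l \<subseteq> N m0 \<inter> Bx A g l"
  by (rule Suc.IH) (use Suc.prems(2,3) asub_Int[OF Suc.prems(1) Bx_asub[OF A_asub o.\<gamma>]] sc in blast)+
 then obtain m2 where m2: "!!m. N m \<inter> Bx A g l \<subseteq> N m2" by blast
 let ?m0 = "max m1 m2"
 have "x \<in> N ?m0" if x: "x \<in> N m" for m x
 proof -
  obtain s u where s: "x = s ** g [^] l \<oplus> u" "s \<in> A" "u \<in> Bx A g l" using x Suc.prems(4) unfolding Bx_Suc by blast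
  obtain b where b: "b \<in> A" "s = \<pi> ** b" using s x pi(2) unfolding I_def by blast
  have c: "b \<in> CR" "\<pi> \<in> CR" "u \<in> CR" "v \<in> CR" using b v s A_carrier bx by auto
  let ?M = "max m ?m0"
  have y: "b ** (\<pi> ** g [^] l \<oplus> v) \<in> N ?m0" using subsetD[OF Suc.prems(3)[OF max.cobounded1] Suc.prems(2)[OF b(1) v(3)]] .
  have "x \<ominus> b ** (\<pi> ** g [^] l \<oplus> v) \<in> N ?M"
   using asubD(3)[OF Suc.prems(1) subsetD[OF Suc.prems(3)[OF max.cobounded1] x] subsetD[OF Suc.prems(3)[OF max.cobounded2] y]] .
  moreover have e: "x \<ominus> b ** (\<pi> ** g [^] l \<oplus> v) = u \<ominus> b ** v" unfolding s(1) b(2) using c gl by algebra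
  ultimately have "(u \<ominus> b ** v) \<oplus> b ** (\<pi> ** g [^] l \<oplus> v) \<in> N ?m0"
   using m2[of ?M] bl(3)[OF s(3) sc[OF b(1) v(2)]] asubD(6)[OF Suc.prems(1) subsetD[OF Suc.prems(3)[OF max.cobounded2]] y] by auto
  moreover have "(u \<ominus> b ** v) \<oplus> b ** (\<pi> ** g [^] l \<oplus> v) = x" unfolding s(1) b(2) using c gl by algebra
  ultimately show ?thesis by simp
 qed
 then show ?case by blast
qed

text \<open>Integrality is replaced by almost integrality, which is evidently inherited by sums and products;
  the two agree because \<open>A\<close> is Noetherian.\<close>

definition alm where "alm x \<longleftrightarrow> x \<in> Kg \<and> (\<exists>d\<in>A. d ~= \<zero> \<and> (\<forall>m::nat. d ** x [^] m \<in> o.Od))"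

lemma Kg_carrier: "x \<in> Kg ==> x \<in> CR" using fldD(5)[OF Kg_fld] .

text \<open>\<open>d\<close> clears the denominators of the finitely many powers below the degree of
  the monic relation, and the relation reduces all higher powers to these.\<close>

lemma integral_alm:
 assumes x: "x \<in> Kg" and f: "f \<in> carrier (A[X])" "f ~= []" "lead_coeff f = \<one>" "eval f x = \<zero>" shows "alm x"
proof -
 have xc: "x \<in> CR" using Kg_carrier[OF x] .
 obtain h where h: "f = \<one> # h" using f(2,3) by (cases f) auto
 have hA: "set h \<subseteq> A" using polyD[OF f(1)] h by auto
 have hc: "eval h x \<in> CR" using eval_in_carrier[OF _ xc] hA A_carrier by blast
 have rel: "x [^] length h = \<ominus> eval h x" using f(4) h xc minus_equality[of "x [^] length h" "eval h x"] hc by simp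
 obtain d where d: "d \<in> A" "d ~= \<zero>" "!!i. i < length h ==> d ** x [^] i \<in> o.Od"
  using subring_pow[OF fldD(2)[OF Kg_fld] x] clear_Bx[OF o.\<gamma>, of "(%i::nat. x [^] i) ` {..<length h}" "dg g"] unfolding Bx_ext[OF o.\<gamma>] Kg_def o.Od_def by auto
 have dc: "d \<in> CR" using d(1) A_carrier by blast
 have lin: "d ** (x [^] e ** eval h' x) \<in> o.Od" if "set h' \<subseteq> A" "!!i. i < length h' ==> d ** x [^] (e + i) \<in> o.Od" for h' e
  using that
 proof (induction h')
  case Nil
  then show ?case using o.OdD(2) dc xc by simp
 next
  case (Cons a h')
  have a: "a \<in> A" "a \<in> CR" using Cons.prems A_carrier by auto
  have "a ** (d ** x [^] (e + length h')) \<in> o.Od" using o.A_Od_mult[OF a(1)] Cons.prems(2)[of "length h'"] by simp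
  then show ?case using eval_in_carrier[OF _ xc] Cons.prems A_carrier a(2) dc xc o.OdD(6) Cons by (auto simp: nat_pow_mult[symmetric] r_distr m_ac)
 qed
 have "d ** x [^] m \<in> o.Od" for m :: nat
 proof (induction m rule: less_induct)
  case (less m)
  show ?case
  proof (cases "m < length h")
   case False
   define e where "e = m - length h"
   have m: "m = e + length h" using False unfolding e_def by simp
   have "x [^] m = x [^] e ** x [^] length h" unfolding m using xc by (simp add: nat_pow_mult)
   then have "d ** x [^] m = \<ominus> (d ** (x [^] e ** eval h x))" unfolding rel using dc xc hc by (simp add: r_minus)
   moreover have "d ** (x [^] e ** eval h x) \<in> o.Od" by (rule lin[OF hA]) (use less m in auto)
   ultimately show ?thesis using o.OdD(5) by simp
  qed (use d(3) in blast)
 qed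
 then show ?thesis unfolding alm_def using x d(1,2) by blast
qed

text \<open>\<open>d\<close> times the modules spanned by the first \<open>m\<close> powers of
  \<open>x\<close> form a chain inside the order. Where it stops growing, cancelling
  \<open>d\<close> leaves a monic relation.\<close>

lemma alm_integral:
 assumes "alm x" shows "x \<in> integral_closure A Kg"
proof -
 obtain d where d: "x \<in> Kg" "d \<in> A" "d ~= \<zero>" "!!m::nat. d ** x [^] m \<in> o.Od" using assms unfolding alm_def by blast
 have xc: "x \<in> CR" "d \<in> CR" using Kg_carrier[OF d(1)] d(2) A_carrier by auto
 define N where "N m = (\<otimes>) d ` Bx A x m" for m
 have bc: "Bx A x m \<subseteq> CR" for m using Bx_carrier[OF A_carrier xc(1)] .
 have "\<exists>m0. \<forall>m. N m \<subseteq> N m0"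
 proof (rule chain_stab)
  show "asub (N m)" for m unfolding N_def by (rule o.asub_mult[OF Bx_asub[OF A_asub xc(1)] xc(2)])
  show "a ** y \<in> N m" if ay: "a \<in> A" "y \<in> N m" for m a y
  proof -
   obtain u where u: "u \<in> Bx A x m" "y = d ** u" using ay(2) unfolding N_def by blast
   have "a ** u \<in> Bx A x m" by (rule Bx_scale[OF A_carrier xc(1) _ _ u(1)]) (use ay(1) A_mult A_carrier in auto)
   moreover have "a ** y = d ** (a ** u)" unfolding u(2) using ay(1) A_carrier u(1) bc xc by (intro m_lcomm) auto
   ultimately show ?thesis unfolding N_def by blast
  qed
  show "N m \<subseteq> N m'" if "m \<le> m'" for m m'
   unfolding N_def using Bx_incr[OF subringE(2)[OF A_subring] A_carrier xc(1) that] by blast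
  show "N m \<subseteq> Bx A g (dg g)" for m unfolding o.Od_def[symmetric]
  proof (induction m)
   case 0
   then show ?case unfolding N_def using o.OdD(2) xc by simp
  next
   case (Suc m)
   show ?case
   proof
    fix y assume "y \<in> N (Suc m)"
    then obtain s u where u: "s \<in> A" "u \<in> Bx A x m" "y = d ** (s ** x [^] m \<oplus> u)" unfolding N_def Bx_Suc by blast
    have c: "s \<in> CR" "u \<in> CR" "x [^] m \<in> CR" using u A_carrier bc xc by auto
    have "y = s ** (d ** x [^] m) \<oplus> d ** u" unfolding u(3) using c xc by algebra
    then show "y \<in> o.Od" using Suc u(2) o.OdD(6) o.A_Od_mult[OF u(1) d(4)] unfolding N_def by blast
   qed
  qed
 qed
 then obtain m0 where m0: "N (Suc m0) \<subseteq> N m0" by blast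
 have "x [^] m0 \<in> Bx A x (Suc m0)"
  unfolding Bx_Suc using subringE(3)[OF A_subring] asubD(2)[OF Bx_asub[OF A_asub xc(1)]] xc(1)
  by (intro CollectI exI[of _ \<one>] exI[of _ \<zero>]) simp
 then obtain w where w: "w \<in> Bx A x m0" "d ** x [^] m0 = d ** w" using m0 unfolding N_def by blast
 obtain v where v: "set v \<subseteq> A" "length v = m0" "x [^] m0 = eval v x" using w(2) m_lcancel[OF d(3) xc(2), of "x [^] m0" w] xc(1) bc w(1) unfolding Bx_def by auto
 let ?f = "\<one> # map ((\<otimes>) (\<ominus> \<one>)) v"
 have vc: "set v \<subseteq> CR" "eval v x \<in> CR" using v(1) A_carrier eval_in_carrier[OF _ xc(1)] by auto
 have m1: "\<ominus> \<one> \<in> A" using subringE(3,5)[OF A_subring] by blast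
 have "eval ?f x = x [^] m0 \<oplus> \<ominus> \<one> ** eval v x" using eval_scale[of "\<ominus> \<one>" x v] xc(1) vc(1) v(2) by simp
 also have "\<dots> = \<zero>" unfolding v(3) using vc(2) by (simp add: l_minus r_neg)
 finally have "eval ?f x = \<zero>" .
 moreover have "?f \<in> carrier (A[X])"
  using v(1) A_mult[OF m1] subringE(3)[OF A_subring] by (auto simp: univ_poly_carrier[symmetric] polynomial_def)
 ultimately show ?thesis unfolding integral_closure_def using d(1) by (intro CollectI conjI bexI[of _ ?f]) auto
qed

definition OK where "OK = integral_closure A Kg"

lemma OK_alm: "x \<in> OK \<longleftrightarrow> alm x"
 unfolding OK_def using alm_integral integral_alm unfolding integral_closure_def by blast

lemma Od_OK: "o.Od \<subseteq> OK"
proof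
 fix x assume x: "x \<in> o.Od"
 have "\<one> ** x [^] m \<in> o.Od" for m :: nat using subring_pow[OF o.Od_subring x, of m] o.Od_carrier by auto
 then show "x \<in> OK" using x Od_Kg subringE(3)[OF A_subring] one_not_zero OK_alm unfolding alm_def by blast
qed

lemma OK_subring: "subring OK R"
proof (rule subringI)
 show "OK \<subseteq> CR" using OK_alm Kg_carrier unfolding alm_def by blast
 show "\<one> \<in> OK" using Od_OK subringE(3)[OF o.Od_subring] by blast
 fix x assume "x \<in> OK"
 then obtain d where d: "x \<in> Kg" "d \<in> A" "d ~= \<zero>" "!!m::nat. d ** x [^] m \<in> o.Od" using OK_alm unfolding alm_def by blast
 have c: "x \<in> CR" "d \<in> CR" using d Kg_carrier A_carrier by auto
 have mul: "x ** y \<in> OK" "x \<oplus> y \<in> OK" if yO: "y \<in> OK" for y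
 proof -
  obtain e where e: "y \<in> Kg" "e \<in> A" "e ~= \<zero>" "!!m::nat. e ** y [^] m \<in> o.Od" using yO OK_alm unfolding alm_def by blast
  have c': "y \<in> CR" "e \<in> CR" using e Kg_carrier A_carrier by auto
  have de: "d ** e \<in> A" "d ** e ~= \<zero>" using A_mult[OF d(2) e(2)] A_nz[OF d(2) e(2) d(3) e(3)] by auto
  have ij: "d ** e ** (x [^] i ** y [^] j) \<in> o.Od" for i j :: nat
  using c c' o.Od_mult[OF d(4) e(4)] by (simp add: m_ac)
  have "d ** e ** (x ** y) [^] m \<in> o.Od" for m :: nat using ij[of m m] c c' by (simp add: nat_pow_distrib)
  then show "x ** y \<in> OK" unfolding OK_alm alm_def using fldD(8)[OF Kg_fld d(1) e(1)] de by blast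
  have "d ** e ** (x [^] i ** y [^] j ** (x \<oplus> y) [^] m) \<in> o.Od" for i j m :: nat
  proof (induction m arbitrary: i j)
   case 0
   then show ?case using ij[of i j] c c' by simp
  next
   case (Suc m)
   have p: "(x \<oplus> y) [^] m \<in> CR" "x [^] i \<in> CR" "y [^] j \<in> CR" using c c' by auto
   show ?case using c c' p o.OdD(6)[OF Suc[of "Suc i" j] Suc[of i "Suc j"]] unfolding nat_pow_Suc by algebra
  qed
  from this[of 0 0] have "d ** e ** (x \<oplus> y) [^] m \<in> o.Od" for m :: nat using c c' by simp
  then show "x \<oplus> y \<in> OK" unfolding OK_alm alm_def using fldD(6)[OF Kg_fld d(1) e(1)] de by blast
 qed
 show "x ** y \<in> OK" "x \<oplus> y \<in> OK" if "y \<in> OK" for y using mul[OF that] by auto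
 have "\<ominus> \<one> \<in> OK" using Od_OK subringE(3,5)[OF o.Od_subring] by blast
 then show "\<ominus> x \<in> OK" using c mul(1)[of "\<ominus> \<one>"] by (simp add: r_minus)
qed

end

section \<open>Comparison of the integral closure with the order\<close>

context ffk
begin

lemma factor_power:
 assumes p: "prm A p" "p = {\<pi> ** b | b. b \<in> A}" "\<pi> \<in> p" "p ~= {\<zero>}" and d: "d \<in> A" "d ~= \<zero>"
 shows "\<exists>a s. s \<in> A \<and> s \<notin> p \<and> d = \<pi> [^] (a::nat) ** s"
proof -
 note i = idlD[OF prmD(1)[OF p(1)]]
 have piA: "\<pi> \<in> A" "\<pi> \<in> CR" using i(5,6)[OF p(3)] by auto
 have pi0: "\<pi> ~= \<zero>"
 proof
  assume "\<pi> = \<zero>"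
  then have "x = \<zero>" if "x \<in> p" for x using that p(2) A_carrier by auto
  then show False using p(4) i(4) by blast
 qed
 obtain e where e: "dege e \<pi>" by (rule dege_exists[OF piA(1) pi0])
 have e0: "e > 0"
 proof (rule ccontr)
  assume "\<not> e > 0"
  then have "\<pi> \<in> k" using e At_Suc[of 0] k_carrier unfolding dege_def by auto
  then have "inv \<pi> ** \<pi> \<in> p" using subfield_m_inv(1)[OF k] pi0 k_A i(3)[OF _ p(3)] by blast
  moreover have "inv \<pi> ** \<pi> = \<one>" using pi0 piA(2) field_Units by simp
  ultimately show False using prmD(2)[OF p(1)] by simp
 qed
 obtain m where "dege m d" by (rule dege_exists[OF d])
 then show ?thesis using d
 proof (induction m arbitrary: d rule: less_induct)
  case (less m d)
  show ?case
  proof (cases "d \<in> p")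
   case False
   have "d = \<pi> [^] (0::nat) ** d" using less.prems(2) A_carrier by auto
   then show ?thesis using False less.prems(2) by blast
  next
   case True
   then obtain b where b: "b \<in> A" "d = \<pi> ** b" using p(2) by blast
   have bc: "b \<in> CR" using b(1) A_carrier by blast
   have b0: "b ~= \<zero>" using less.prems(3) b(2) piA(2) by auto
   obtain l where l: "dege l b" by (rule dege_exists[OF b(1) b0])
   have "dege (e + l) d" unfolding b(2) by (rule dege_mult[OF e l])
   then obtain a s where s: "s \<in> A" "s \<notin> p" "b = \<pi> [^] (a::nat) ** s" using dege_At[of "e + l" d "Suc m"] dege_At[of m d "Suc (e + l)"] less.prems(1) e0 less.IH[OF _ l b(1) b0] unfolding dege_def by auto
   have "d = \<pi> [^] Suc a ** s" unfolding b(2) s(3) using piA(2) s(1) A_carrier by (simp add: m_ac subset_iff)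
   then show ?thesis using s by blast
  qed
 qed
qed

text \<open>Off \<open>D\<close> the order and the integral closure have the same localization.
  Write \<open>d = \<pi>^a s0\<close>. If \<open>w = s \<pi>^(j+1) x\<close> lies in the order, then
  \<open>s0 w^(a+1)\<close> is a multiple of \<open>\<pi>\<close>; by reducedness so is
  \<open>s0 w\<close>, and one factor \<open>\<pi>\<close> can be cancelled. After finitely many
  rounds none is left.\<close>

lemma OK_local:
 assumes p: "p \<in> PR" "D \<notin> p" and x: "x \<in> OK" shows "\<exists>s\<in>A. s \<notin> p \<and> s ** x \<in> o.Od"
proof -
 have pp: "prm A p" "p ~= {\<zero>}" using p(1) unfolding PR_def by auto
 note i = prmD(1)[OF pp(1)]
 obtain \<pi> where pi: "\<pi> \<in> p" "p = {\<pi> ** b | b. b \<in> A}" by (rule idl_gen[OF i pp(2)])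
 have piA: "\<pi> \<in> A" "\<pi> \<in> CR" using idlD(5,6)[OF i pi(1)] by auto
 have pi0: "\<pi> ~= \<zero>"
 proof
  assume "\<pi> = \<zero>"
  then have "x = \<zero>" if "x \<in> p" for x using that pi(2) A_carrier by auto
  then show False using pp(2) idlD(4)[OF i] by blast
 qed
 note pO = idlD[OF o.pO_idl[OF i pp(2)]]
 note gen = o.pO_gen[OF pi(2,1) piA(1)]
 obtain d where d: "x \<in> Kg" "d \<in> A" "d ~= \<zero>" "!!m::nat. d ** x [^] m \<in> o.Od" using x OK_alm unfolding alm_def by blast
 have c: "x \<in> CR" "d \<in> CR" using d Kg_carrier A_carrier by auto
 obtain a s0 where s0: "s0 \<in> A" "s0 \<notin> p" "d = \<pi> [^] (a::nat) ** s0" using factor_power[OF pp(1) pi(2,1) pp(2) d(2,3)] by blast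
 have s0c: "s0 \<in> CR" using s0(1) A_carrier by blast
 have pia: "\<pi> [^] l \<in> CR" "\<pi> [^] l \<in> A" "\<pi> [^] l ~= \<zero>" for l :: nat
 proof -
  show "\<pi> [^] l \<in> CR" "\<pi> [^] l \<in> A" using piA subring_pow[OF A_subring piA(1)] by auto
  show "\<pi> [^] l ~= \<zero>" by (induction l) (use piA pi0 integral_iff in auto)
 qed
 have "\<exists>s\<in>A. s \<notin> p \<and> s ** x \<in> o.Od" if "\<exists>s\<in>A. s \<notin> p \<and> s ** (\<pi> [^] j ** x) \<in> o.Od" for j :: nat
  using that
 proof (induction j)
  case 0
  then show ?case using c by simp
 next
  case (Suc j)
  then obtain s where s: "s \<in> A" "s \<notin> p" "s ** (\<pi> [^] Suc j ** x) \<in> o.Od" by blast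
  have sc: "s \<in> CR" using s(1) A_carrier by blast
  let ?w = "s ** (\<pi> [^] Suc j ** x)" let ?m = "Suc a"
  define z where "z = s [^] ?m ** \<pi> [^] (j * ?m) ** (d ** x [^] ?m)"
  have zO: "z \<in> o.Od" unfolding z_def
   by (rule o.A_Od_mult[OF A_mult[OF subring_pow[OF A_subring s(1)] pia(2)] d(4)])
  have zc: "z \<in> CR" using zO o.Od_carrier by blast
  have wc: "?w \<in> CR" using s(3) o.Od_carrier by blast
  have pw: "(s ** (\<pi> [^] i ** x)) [^] m = s [^] m ** (\<pi> [^] (i * m) ** x [^] m)" for i m :: nat
   using sc piA(2) c(1) by (simp add: nat_pow_distrib nat_pow_pow)
  have e1: "?w [^] ?m = s [^] ?m ** ((\<pi> [^] (j * ?m) ** \<pi> [^] ?m) ** x [^] ?m)"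
   unfolding nat_pow_mult[OF piA(2)] pw by (simp only: mult_Suc add.commute)
  have "\<pi> [^] a ** (s0 ** ?w [^] ?m) = d ** ?w [^] ?m" unfolding s0(3) using pia(1) s0c wc by (simp add: m_assoc)
  also have "\<dots> = \<pi> [^] ?m ** z"
  proof -
   have al: "d ** (S ** ((B ** E) ** Z)) = E ** (S ** B ** (d ** Z))"
    if "S \<in> CR" "B \<in> CR" "E \<in> CR" "Z \<in> CR" for S B E Z using that c(2) by algebra
   show ?thesis unfolding e1 z_def by (rule al) (use sc c(1) pia(1) piA(2) in auto)
  qed
  also have "\<dots> = \<pi> [^] a ** (\<pi> ** z)" using piA(2) zc by (simp add: m_assoc)
  finally have "s0 ** ?w [^] ?m \<in> o.pO p" using m_lcancel[OF pia(3)[of a] pia(1)] s0c wc piA(2) zc zO unfolding gen by auto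
  then have "s0 [^] a ** (s0 ** ?w [^] ?m) \<in> o.pO p" using pO(3) subring_pow[OF A_subring s0(1)] o.A_Od by blast
  moreover have "(s0 ** ?w) [^] ?m = s0 [^] a ** (s0 ** ?w [^] ?m)"
   using s0c wc nat_pow_distrib[OF s0c wc, of ?m] by (simp add: m_assoc)
  ultimately have "s0 ** ?w \<in> o.pO p" using o.red[OF pp p(2) o.A_Od_mult[OF s0(1) s(3)], of ?m] by simp
  then obtain u where u: "u \<in> o.Od" "s0 ** ?w = \<pi> ** u" unfolding gen by blast
  have "\<pi> ** (s0 ** s ** (\<pi> [^] j ** x)) = \<pi> ** u"
   unfolding u(2)[symmetric] using s0c sc piA(2) c(1) by (simp add: m_ac)
  then have "s0 ** s ** (\<pi> [^] j ** x) = u" using u(1) o.Od_carrier m_lcancel[OF pi0 piA(2)] s0c sc pia(1) c(1) by auto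
  moreover have "s0 ** s \<notin> p" using prmD(3)[OF pp(1) s0(1) s(1)] s0(2) s(2) by blast
  ultimately show ?case using Suc.IH A_mult[OF s0(1) s(1)] u(1) by blast
 qed
 then show ?thesis using s0c pia(1) c(1) d(4)[of 1] s0(1,2) unfolding s0(3) by (auto simp: m_ac)
qed

definition abv where "abv p = {P. prm OK P \<and> P \<inter> A = p}"

lemma abvD:
 assumes p: "p \<in> PR" "D \<notin> p" and P: "P \<in> abv p"
 shows "prm OK P" "P \<inter> A = p" "o.np (P \<inter> o.Od)" "P \<inter> o.Od \<inter> A = p"
  "!!s x. s \<in> A ==> s \<notin> p ==> x \<in> OK ==> s ** x \<in> P ==> x \<in> P"
proof -
 show 1: "prm OK P" "P \<inter> A = p" using P unfolding abv_def by auto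
 have pr: "prm o.Od (P \<inter> o.Od)" using prm_restrict[OF 1(1) Od_OK o.Od_subring] .
 show 2: "P \<inter> o.Od \<inter> A = p" using 1(2) o.A_Od by blast
 then show "o.np (P \<inter> o.Od)" unfolding o.np_def using pr p(1) unfolding PR_def by simp
 show "x \<in> P" if "s \<in> A" "s \<notin> p" "x \<in> OK" "s ** x \<in> P" for s x
  using prmD(3)[OF 1(1) _ that(3,4)] that(1,2) 1(2) o.A_Od Od_OK by blast
qed

text \<open>With \<open>abv_exists\<close> this identifies the primes of the integral closure above
  \<open>p\<close> with those of the order, as \<open>OK_local\<close> makes the localizations
  agree.\<close>

lemma abv_inj: assumes p: "p \<in> PR" "D \<notin> p" shows "inj_on (%P. P \<inter> o.Od) (abv p)"
proof (rule inj_onI)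
 have sub: "P \<subseteq> P'" if h: "P \<in> abv p" "P' \<in> abv p" "P \<inter> o.Od = P' \<inter> o.Od" for P P'
 proof
  fix x assume x: "x \<in> P"
  have xO: "x \<in> OK" using idlD(5)[OF prmD(1)[OF abvD(1)[OF p h(1)]] x] .
  obtain s where s: "s \<in> A" "s \<notin> p" "s ** x \<in> o.Od" using OK_local[OF p xO] by blast
  have "s ** x \<in> P'" using idlD(3)[OF prmD(1)[OF abvD(1)[OF p h(1)]] _ x] s(1) o.A_Od Od_OK s(3) h(3) by blast
  then show "x \<in> P'" by (rule abvD(5)[OF p h(2) s(1,2) xO])
 qed
 fix P P' assume h: "P \<in> abv p" "P' \<in> abv p" "P \<inter> o.Od = P' \<inter> o.Od"
 show "P = P'" using sub[OF h] sub[OF h(2,1) h(3)[symmetric]] by blast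
qed

lemma abv_finite: assumes p: "p \<in> PR" "D \<notin> p" shows "finite (abv p)"
using abvD(3,4)[OF p] inj_on_finite[OF abv_inj[OF p] _ o.over_fin(1)[OF p(1)]] by blast

definition dg1 where "dg1 P \<longleftrightarrow> (\<forall>x\<in>OK. \<exists>a\<in>A. x \<ominus> a \<in> P)"

lemma abv_reduce:
 assumes p: "p \<in> PR" "D \<notin> p" and P: "P \<in> abv p" and x: "x \<in> OK"
 shows "\<exists>t\<in>A. \<exists>s\<in>A. s \<notin> p \<and> s ** x \<in> o.Od \<and> x \<ominus> t ** (s ** x) \<in> P"
proof -
 have pp: "prm A p" "p ~= {\<zero>}" using p(1) unfolding PR_def by auto
 obtain s where s: "s \<in> A" "s \<notin> p" "s ** x \<in> o.Od" using OK_local[OF p x] by blast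
 obtain t where t: "t \<in> A" "t ** s \<ominus> \<one> \<in> p" using prm_A_inv[OF pp s(1,2)] by blast
 note Pi = idlD[OF prmD(1)[OF abvD(1)[OF p P]]]
 have c: "x \<in> CR" "s \<in> CR" "t \<in> CR" using x s t A_carrier subringE(1)[OF OK_subring] by auto
 have "\<ominus> (x ** (t ** s \<ominus> \<one>)) = x \<ominus> t ** (s ** x)" using c by algebra
 then show ?thesis using Pi(3)[OF x] t(2) abvD(2)[OF p P] Pi(9) s t by force
qed

lemma dg1_iff: assumes p: "p \<in> PR" "D \<notin> p" and P: "P \<in> abv p" shows "dg1 P \<longleftrightarrow> o.H1 (P \<inter> o.Od)"
proof
 assume d: "dg1 P"
 have "\<exists>a\<in>A. y \<ominus> a \<in> P \<inter> o.Od" if y: "y \<in> o.Od" for y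
 proof -
  obtain a where "a \<in> A" "y \<ominus> a \<in> P" using d y Od_OK unfolding dg1_def by blast
  then show ?thesis using o.OdD(3)[OF y] o.A_Od by blast
 qed
 then show "o.H1 (P \<inter> o.Od)" unfolding o.H1_def using abvD(3)[OF p P] by blast
next
 assume h: "o.H1 (P \<inter> o.Od)"
 note Pi = idlD[OF prmD(1)[OF abvD(1)[OF p P]]]
 have "\<exists>a\<in>A. x \<ominus> a \<in> P" if x: "x \<in> OK" for x
 proof -
  obtain t s where s: "t \<in> A" "s \<in> A" "s ** x \<in> o.Od" "x \<ominus> t ** (s ** x) \<in> P" using abv_reduce[OF p P x] by blast
  obtain a where a: "a \<in> A" "s ** x \<ominus> a \<in> P" using h s(3) unfolding o.H1_def by blast
  have c: "x \<in> CR" "s \<in> CR" "t \<in> CR" "a \<in> CR" using x s a A_carrier subringE(1)[OF OK_subring] by auto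
  have "(x \<ominus> t ** (s ** x)) \<oplus> t ** (s ** x \<ominus> a) = x \<ominus> t ** a" using c by algebra
  then show ?thesis using Pi(3)[OF _ a(2)] s(1) o.A_Od Od_OK Pi(7)[OF s(4)] A_mult[OF s(1) a(1)] by force
 qed
 then show "dg1 P" unfolding dg1_def by blast
qed

lemma abv_exists:
 assumes p: "p \<in> PR" "D \<notin> p" and P: "o.np P" "P \<inter> A = p" shows "\<exists>P'\<in>abv p. P' \<inter> o.Od = P"
proof -
 have pp: "prm A p" "p ~= {\<zero>}" using p(1) unfolding PR_def by auto
 note Pp = o.npD(1)[OF P(1)] and Pi = idlD[OF o.npD(2)[OF P(1)]]
 let ?Q = "{x \<in> OK. \<exists>s\<in>A. s \<notin> p \<and> s ** x \<in> P}"
 note Oc = subsetD[OF subringE(1)[OF OK_subring]] and Ac = subsetD[OF A_carrier]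
 have ss: "s ** s' \<in> A \<and> s ** s' \<notin> p" if "s \<in> A" "s \<notin> p" "s' \<in> A" "s' \<notin> p" for s s'
  using prmD(3)[OF pp(1) that(1,3)] A_mult[OF that(1,3)] that by blast
 have AP: "a ** y \<in> P" if "a \<in> A" "y \<in> P" for a y using Pi(3)[OF _ that(2)] that(1) o.A_Od by blast
 have "idl OK ?Q" unfolding idl_def asub_def
 proof (intro conjI ballI)
  show "?Q \<subseteq> CR" "?Q \<subseteq> OK" using Oc by auto
  show "\<zero> \<in> ?Q" using subringE(2)[OF OK_subring] subringE(3)[OF A_subring] prmD(2)[OF pp(1)] Pi(4)
   by (intro CollectI conjI bexI[of _ \<one>]) auto
  fix x y assume "x \<in> ?Q" "y \<in> ?Q"
  then obtain s s' where s: "x \<in> OK" "s \<in> A" "s \<notin> p" "s ** x \<in> P" "y \<in> OK" "s' \<in> A" "s' \<notin> p" "s' ** y \<in> P" by blast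
  have c: "x \<in> CR" "y \<in> CR" "s \<in> CR" "s' \<in> CR" using s Oc Ac by auto
  have "s ** s' ** (x \<ominus> y) = s' ** (s ** x) \<ominus> s ** (s' ** y)" using c by algebra
  also have "\<dots> \<in> P" by (rule Pi(8)[OF AP[OF s(6,4)] AP[OF s(2,8)]])
  finally show "x \<ominus> y \<in> ?Q" using ss[OF s(2,3,6,7)] subring_minus[OF OK_subring s(1,5)] by blast
 next
  fix x y assume x: "x \<in> OK" "y \<in> ?Q"
  then obtain s where s: "y \<in> OK" "s \<in> A" "s \<notin> p" "s ** y \<in> P" by blast
  obtain s' where s': "s' \<in> A" "s' \<notin> p" "s' ** x \<in> o.Od" using OK_local[OF p x(1)] by blast
  have "s ** s' ** (x ** y) = (s' ** x) ** (s ** y)" using s s' x Oc Ac by algebra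
  also have "\<dots> \<in> P" by (rule Pi(3)[OF s'(3) s(4)])
  finally show "x ** y \<in> ?Q" using ss[OF s(2,3) s'(1,2)] subringE(6)[OF OK_subring x(1) s(1)] by blast
 qed
 moreover have "\<one> \<notin> ?Q"
 proof
  assume "\<one> \<in> ?Q"
  then obtain s where s: "s \<in> A" "s \<notin> p" "s ** \<one> \<in> P" by blast
  then show False using Ac P(2) by auto
 qed
 moreover have "x \<in> ?Q \<or> y \<in> ?Q" if xy: "x \<in> OK" "y \<in> OK" "x ** y \<in> ?Q" for x y
 proof -
  obtain s where s: "s \<in> A" "s \<notin> p" "s ** (x ** y) \<in> P" using xy(3) by blast
  obtain s1 where s1: "s1 \<in> A" "s1 \<notin> p" "s1 ** x \<in> o.Od" using OK_local[OF p xy(1)] by blast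
  obtain s2 where s2: "s2 \<in> A" "s2 \<notin> p" "s2 ** y \<in> o.Od" using OK_local[OF p xy(2)] by blast
  have "s ** ((s1 ** x) ** (s2 ** y)) = (s1 ** s2) ** (s ** (x ** y))" using xy s s1 s2 Oc Ac by algebra
  also have "\<dots> \<in> P" by (rule AP[OF A_mult[OF s1(1) s2(1)] s(3)])
  finally have "s \<in> P \<or> (s1 ** x) ** (s2 ** y) \<in> P"
   using prmD(3)[OF Pp _ o.Od_mult[OF s1(3) s2(3)]] s(1) o.A_Od by blast
  moreover have "s \<notin> P" using s P(2) by blast
  ultimately show ?thesis using prmD(3)[OF Pp s1(3) s2(3)] xy(1,2) s1 s2 by blast
 qed
 ultimately have Q: "prm OK ?Q" unfolding prm_def by blast
 have QO: "?Q \<inter> o.Od = P"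
 proof (intro equalityI subsetI)
  fix x assume "x \<in> ?Q \<inter> o.Od"
  then obtain s where s: "x \<in> o.Od" "s \<in> A" "s \<notin> p" "s ** x \<in> P" by blast
  then show "x \<in> P" using prmD(3)[OF Pp _ s(1,4)] o.A_Od P(2) by blast
 next
  fix x assume x: "x \<in> P"
  then show "x \<in> ?Q \<inter> o.Od" using Pi(5)[OF x] Pi(6)[OF x] Od_OK subringE(3)[OF A_subring] prmD(2)[OF pp(1)]
   by (intro IntI CollectI conjI bexI[of _ \<one>]) auto
 qed
 then show ?thesis using P(2) o.A_Od Q QO unfolding abv_def by blast
qed

lemma Hn_abv: assumes p: "p \<in> PR" "D \<notin> p" shows "o.Hn p = card {P \<in> abv p. dg1 P}"
proof -
 have "(%P. P \<inter> o.Od) ` {P \<in> abv p. dg1 P} = {P. o.H1 P \<and> P \<inter> A = p}"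
 proof (intro equalityI subsetI)
  fix P assume "P \<in> (%P. P \<inter> o.Od) ` {P \<in> abv p. dg1 P}"
  then show "P \<in> {P. o.H1 P \<and> P \<inter> A = p}" using dg1_iff[OF p] abvD(4)[OF p] by blast
 next
  fix P assume P: "P \<in> {P. o.H1 P \<and> P \<inter> A = p}"
  then obtain P' where P': "P' \<in> abv p" "P' \<inter> o.Od = P" using abv_exists[OF p, of P] unfolding o.H1_def by blast
  then show "P \<in> (%P. P \<inter> o.Od) ` {P \<in> abv p. dg1 P}" using dg1_iff[OF p P'(1)] P P' by blast
 qed
 moreover have "inj_on (%P. P \<inter> o.Od) {P \<in> abv p. dg1 P}" by (rule inj_on_subset[OF abv_inj[OF p]]) blast
 ultimately show ?thesis unfolding o.Hn_def using card_image by fastforce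
qed

lemma inertia_one:
 assumes p: "p \<in> PR" "D \<notin> p" and P: "P \<in> abv p" shows "inertia_degree A Kg P = 1 \<longleftrightarrow> dg1 P"
proof -
 have pp: "prm A p" "p ~= {\<zero>}" using p(1) unfolding PR_def by auto
 note PO = abvD(1)[OF p P] and Pi = idlD[OF prmD(1)[OF abvD(1)[OF p P]]]
 note Oc = subsetD[OF subringE(1)[OF OK_subring]] and Ac = subsetD[OF A_carrier]
 let ?O = "sub OK" let ?Q = "?O Quot P" let ?c = "%x. P +>\<^bsub>?O\<^esub> x"
 have AO: "A \<subseteq> OK" using o.A_Od Od_OK by blast
 note ceq = coset_sub_eq_iff[OF OK_subring prmD(1)[OF PO]]
 have inv: "\<exists>z\<in>OK. z ** y \<ominus> \<one> \<in> P" if y: "y \<in> OK" "y \<notin> P" for y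
 proof -
  obtain s where s: "s \<in> A" "s \<notin> p" "s ** y \<in> o.Od" using OK_local[OF p y(1)] by blast
  obtain z where z: "z \<in> o.Od" "z ** (s ** y) \<ominus> \<one> \<in> P" using abvD(5)[OF p P s(1,2) y(1)] y(2) o.np_inv[OF abvD(3)[OF p P] s(3)] by blast
  have "z ** (s ** y) = (z ** s) ** y" using z(1) o.Od_carrier s(1) Ac Oc[OF y(1)] by (intro m_assoc[symmetric]) auto
  then show ?thesis using o.Od_mult[OF z(1)] s(1) o.A_Od Od_OK z(2) by auto
 qed
 interpret Q: field ?Q by (rule Quot_field[OF OK_subring PO inv])
 interpret Pr: primeideal P ?O using prm_iff[OF OK_subring] PO by blast
 interpret h: ring_hom_ring ?O ?Q ?c by (rule Pr.rcos_ring_hom_ring)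
 have car: "carrier ?Q = ?c ` OK" by (rule carrier_Quot_sub)
 have sA: "subring A ?O" using A_subring AO subringE[OF A_subring] a_minus_sub[OF OK_subring]
  by (intro Pr.subringI) auto
 have sf: "subfield (?c ` A) ?Q"
 proof (rule Q.subfieldI'[OF h.img_is_subring[OF sA]])
  fix x assume x: "x \<in> ?c ` A - {\<zero>\<^bsub>?Q\<^esub>}"
  then obtain a where a: "a \<in> A" "x = ?c a" "?c a ~= \<zero>\<^bsub>?Q\<^esub>" by blast
  have aO: "a \<in> OK" using a(1) AO by blast
  have "a \<notin> p"
  proof
   assume "a \<in> p"
   then have "?c a = ?c \<zero>" using abvD(2)[OF p P] Ac[OF a(1)] ceq[OF aO subringE(2)[OF OK_subring]] by (auto simp: minus_eq)
   then show False using a(3) h.hom_zero by simp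
  qed
  then obtain t where t: "t \<in> A" "t ** a \<ominus> \<one> \<in> p" using prm_A_inv[OF pp a(1)] by blast
  have tO: "t \<in> OK" using t(1) AO by blast
  have "?c (t ** a) = ?c \<one>"
   using ceq[OF subringE(6)[OF OK_subring tO aO] subringE(3)[OF OK_subring]] t(2) abvD(2)[OF p P] by blast
  then have "?c t \<otimes>\<^bsub>?Q\<^esub> ?c a = \<one>\<^bsub>?Q\<^esub>" using h.hom_mult[of t a] h.hom_one tO aO by simp
  then have "?c a \<otimes>\<^bsub>?Q\<^esub> ?c t = \<one>\<^bsub>?Q\<^esub>" using Q.m_comm[of "?c a" "?c t"] tO aO by simp
  then have "inv\<^bsub>?Q\<^esub> x = ?c t" unfolding a(2) using Q.comm_inv_char tO aO by simp
  then show "inv\<^bsub>?Q\<^esub> x \<in> ?c ` A" using t(1) by blast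
 qed
 \<comment> \<open>Every class contains some \<open>t v\<close> from a finite set:
   \<open>abv_reduce\<close> expresses the element through the order, and both factors can then be
   reduced modulo \<open>\<pi>\<close>.\<close>
 have fin: "finite (carrier ?Q)"
 proof -
  obtain \<pi> where pi: "\<pi> \<in> p" "dege (dgi p) \<pi>" by (rule idl_gen[OF prmD(1)[OF pp(1)] pp(2)])
  have "carrier ?Q \<subseteq> (%(t, v). ?c (t ** v)) ` (At (dgi p) \<times> o.Box (dgi p))"
  proof
   fix y assume "y \<in> carrier ?Q"
   then obtain x where x: "x \<in> OK" "y = ?c x" unfolding car by blast
   obtain t s where s: "t \<in> A" "s \<in> A" "s ** x \<in> o.Od" "x \<ominus> t ** (s ** x) \<in> P" using abv_reduce[OF p P x(1)] by blast
   obtain b r where t: "b \<in> A" "r \<in> At (dgi p)" "t = \<pi> ** b \<oplus> r" using A_div[OF pi(2) s(1)] by blast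
   obtain u v where v: "u \<in> o.Od" "v \<in> o.Box (dgi p)" "s ** x = \<pi> ** u \<oplus> v" using o.Od_div[OF pi(2) s(3)] by blast
   have rA: "r \<in> A" using t(2) At_A by blast
   have vO: "v \<in> o.Od" using v(2) o.Box_Od by blast
   have c: "x \<in> CR" "s \<in> CR" "t \<in> CR" "b \<in> CR" "r \<in> CR" "u \<in> CR" "v \<in> CR" "\<pi> \<in> CR"
    using x s t(1) rA v(1) vO Oc Ac o.Od_carrier idlD(6)[OF prmD(1)[OF pp(1)] pi(1)] by auto
   have piP: "\<pi> \<in> P" using pi(1) abvD(2)[OF p P] by blast
   have O: "b ** (s ** x) \<in> OK" "r ** u \<in> OK" using o.A_Od_mult[OF t(1) s(3)] o.A_Od_mult[OF rA v(1)] Od_OK by auto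
   have "(x \<ominus> t ** (s ** x)) \<oplus> ((b ** (s ** x)) ** \<pi> \<oplus> (r ** u) ** \<pi>) \<in> P"
    by (intro Pi(7) s(4) Pi(3)[OF O(1) piP] Pi(3)[OF O(2) piP])
   moreover have "(x \<ominus> t ** (s ** x)) \<oplus> ((b ** (s ** x)) ** \<pi> \<oplus> (r ** u) ** \<pi>) = x \<ominus> r ** v"
   proof -
    have "(x \<ominus> t ** (s ** x)) \<oplus> ((b ** (s ** x)) ** \<pi> \<oplus> (r ** u) ** \<pi>) = x \<ominus> (t \<ominus> \<pi> ** b) ** (s ** x) \<oplus> r ** (\<pi> ** u)"
     using c by algebra
    also have "t \<ominus> \<pi> ** b = r" unfolding t(3) using c by algebra
    also have "x \<ominus> r ** (s ** x) \<oplus> r ** (\<pi> ** u) = x \<ominus> r ** v" unfolding v(3) using c by algebra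
    finally show ?thesis .
   qed
   ultimately have "y = ?c (r ** v)" using ceq[OF x(1)] o.A_Od_mult[OF rA vO] Od_OK unfolding x(2) by auto
   then show "y \<in> (%(t, v). ?c (t ** v)) ` (At (dgi p) \<times> o.Box (dgi p))" using t(2) v(2) by auto
  qed
  moreover have "finite (At (dgi p) \<times> o.Box (dgi p))" using At_finite o.Box_finite by blast
  ultimately show ?thesis using finite_surj by blast
 qed
 have "inertia_degree A Kg P = 1 \<longleftrightarrow> ?c ` A = ?c ` OK"
  unfolding inertia_degree_def Let_def OK_def[symmetric] using Q.dim_one_iff[OF sf fin] car by simp
 also have "\<dots> \<longleftrightarrow> dg1 P"
 proof
  assume e: "?c ` A = ?c ` OK"
  have "\<exists>a\<in>A. x \<ominus> a \<in> P" if x: "x \<in> OK" for x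
  proof -
   obtain a where "a \<in> A" "?c x = ?c a" using e x by blast
   then show ?thesis using ceq[OF x, of a] AO by blast
  qed
  then show "dg1 P" unfolding dg1_def by blast
 next
  assume d: "dg1 P"
  have "?c x \<in> ?c ` A" if x: "x \<in> OK" for x
  proof -
   obtain a where a: "a \<in> A" "x \<ominus> a \<in> P" using d x unfolding dg1_def by blast
   then show ?thesis using ceq[OF x, of a] AO a(1) by blast
  qed
  then show "?c ` A = ?c ` OK" using AO by blast
 qed
 finally show ?thesis .
qed

text \<open>The link with the definition of arithmetic equivalence: only the number of entries 1 of
  a splitting type is ever used.\<close>

theorem Hn_splitting:
 assumes p: "p \<in> PR" "D \<notin> p" shows "o.Hn p = count (mset (splitting_type A Kg p)) 1"
proof -
 have pa: "primes_above A Kg p = abv p"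
  unfolding primes_above_def abv_def OK_def[symmetric] using prm_iff[OF OK_subring] by blast
 have i1: "1 = inertia_degree A Kg P \<longleftrightarrow> dg1 P" if "P \<in> abv p" for P
  unfolding inertia_one[OF p that, symmetric] by (rule eq_commute)
 have "count (mset (splitting_type A Kg p)) 1 = count (image_mset (inertia_degree A Kg) (mset_set (abv p))) 1"
  unfolding splitting_type_def pa by simp
 also have "\<dots> = (\<Sum>P | P \<in># mset_set (abv p) \<and> 1 = inertia_degree A Kg P. count (mset_set (abv p)) P)"
  by (rule count_image_mset')
 also have "\<dots> = (\<Sum>P\<in>{P \<in> abv p. dg1 P}. 1)"
 proof (rule sum.cong)
  show "{P. P \<in># mset_set (abv p) \<and> 1 = inertia_degree A Kg P} = {P \<in> abv p. dg1 P}"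
   using abv_finite[OF p] i1 by auto
  show "count (mset_set (abv p)) P = 1" if "P \<in> {P \<in> abv p. dg1 P}" for P using that abv_finite[OF p] by simp
 qed
 also have "\<dots> = o.Hn p" using Hn_abv[OF p] by simp
 finally show ?thesis by simp
qed

end

section \<open>Arithmetically equivalent fields\<close>

lemma (in ffk) Hn_splitting_ae:
 "\<exists>D\<in>A. D ~= \<zero> \<and> (\<forall>p\<in>PR. D \<notin> p --> o.Hn p = count (mset (splitting_type A (ext F g) p)) 1)"
 using Hn_splitting o.D1 unfolding Kg_def by blast

lemma (in ff) Hn_splitting:
 assumes "pbs g" "Gd g"
 shows "\<exists>D\<in>A. D ~= \<zero> \<and> (\<forall>p\<in>PR. D \<notin> p -->
  fq_order.Hn R k T g (dg g) p = count (mset (splitting_type A (ext F g) p)) 1)"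
proof -
 obtain D where D: "fq_order_red R k T q g (dg g) D" using order_red[OF assms] by blast
 show ?thesis by (rule ffk.Hn_splitting_ae[OF ffk.intro[OF ff_axioms ffk_axioms.intro[OF D]]])
qed

text \<open>Off a set of density zero and finitely many primes the counts for \<open>a\<close> and
  \<open>b\<close> agree, so their products with the count for \<open>e\<close> have the same
  average.\<close>

lemma (in ffn) orb_equal:
 assumes a: "sep a" "a \<in> M" and b: "sep b" "b \<in> M" and e: "e \<in> M" "Gd e"
  and eq: "arithmetically_equivalent A (ext F a) (ext F b)"
 shows "orb e (Cj a) = orb e (Cj b)"
proof -
 note ac = M_carrier[OF a(2)] and bc = M_carrier[OF b(2)]
 obtain d1 where d1: "d1 \<in> A" "d1 ~= \<zero>" "\<forall>c\<in>A. c ** d1 ~= \<zero> --> pbs (c ** d1 ** e) \<and> pbs (c ** d1 ** a) \<and>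
   avg (%p. real (Hg (c ** d1 ** e) p) * real (Hg (c ** d1 ** a) p)) (real (orb e (Cj a)))"
  using avg_orb_scaled[OF e a] by blast
 obtain d2 where d2: "d2 \<in> A" "d2 ~= \<zero>" "\<forall>c\<in>A. c ** d2 ~= \<zero> --> pbs (c ** d2 ** e) \<and> pbs (c ** d2 ** b) \<and>
   avg (%p. real (Hg (c ** d2 ** e) p) * real (Hg (c ** d2 ** b) p)) (real (orb e (Cj b)))"
  using avg_orb_scaled[OF e b] by blast
 \<comment> \<open>A common multiple of both scaling factors, so that the scaled \<open>e\<close> is
   literally the same in the two averages.\<close>
 let ?d = "d2 ** d1"
 have dc: "d1 ** d2 = ?d" using d1(1) d2(1) A_carrier by (intro m_comm) auto
 have d: "?d \<in> A" "?d ~= \<zero>" "?d \<in> F" using A_mult[OF d2(1) d1(1)] A_nz[OF d2(1) d1(1) d2(2) d1(2)] A_F by auto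
 note h1 = mp[OF bspec[OF d1(3) d2(1)] d(2)] and h2 = mp[OF bspec[OF d2(3) d1(1), unfolded dc] d(2)]
 let ?e = "?d ** e" let ?a = "?d ** a" let ?b = "?d ** b"
 have pa: "pbs ?a" "pbs ?e" "avg (%p. real (Hg ?e p) * real (Hg ?a p)) (real (orb e (Cj a)))" using h1 by auto
 have pb: "pbs ?b" "avg (%p. real (Hg ?e p) * real (Hg ?b p)) (real (orb e (Cj b)))" using h2 by auto
 have xa: "ext F ?a = ext F a" "ext F ?b = ext F b"
  using ext_scale_eq[OF d(3,2) ac] ext_scale_eq[OF d(3,2) bc] by auto
 obtain Da where Da: "Da \<in> A" "Da ~= \<zero>" "!!p. p \<in> PR ==> Da \<notin> p ==> Hg ?a p = count (mset (splitting_type A (ext F a) p)) 1"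
  using Hn_splitting[OF pa(1) Gd_scale[OF d(3,2) Gd_sep[OF a(1)]]] unfolding xa by blast
 obtain Db where Db: "Db \<in> A" "Db ~= \<zero>" "!!p. p \<in> PR ==> Db \<notin> p ==> Hg ?b p = count (mset (splitting_type A (ext F b) p)) 1"
  using Hn_splitting[OF pb(1) Gd_scale[OF d(3,2) Gd_sep[OF b(1)]]] unfolding xa by blast
 obtain S where S: "S \<subseteq> PR" "has_dirichlet_density A S 0"
  "!!p. p \<in> PR - S ==> splitting_type A (ext F a) p = splitting_type A (ext F b) p"
  using eq unfolding arithmetically_equivalent_def nonzero_primes_PR by blast
 have fin: "finite ({p \<in> PR. Da \<in> p} \<union> {p \<in> PR. Db \<in> p})" using PR_bad Da(1,2) Db(1,2) by blast
 obtain N where N: "N \<ge> 0" "!!w p. w \<in> {?e, ?a, ?b} ==> p \<in> PR ==> real (Hg w p) \<le> N"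
  using Hg_bdd[of "{?e, ?a, ?b}"] pa(1,2) pb(1) by blast
 have "avg (%p. real (Hg ?e p) * real (Hg ?b p)) (real (orb e (Cj a)))"
 proof (rule avg_negligible[where K = "N * N", OF _ _ _ _ fin density_zero_avg[OF S(1,2) avg_const_1] _ pa(3)])
  fix p assume p: "p \<in> PR"
  show "real (Hg ?e p) * real (Hg ?a p) \<le> N * N" "real (Hg ?e p) * real (Hg ?b p) \<le> N * N"
   by (rule mult_mono; use N p in simp)+
  assume "p \<notin> S" "p \<notin> {p \<in> PR. Da \<in> p} \<union> {p \<in> PR. Db \<in> p}"
  then have "Hg ?a p = Hg ?b p" using Da(3)[OF p] Db(3)[OF p] S(3)[of p] p by simp
  then show "real (Hg ?e p) * real (Hg ?a p) = real (Hg ?e p) * real (Hg ?b p)" by simp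
 qed auto
 from avg_unique[OF this pb(2)] show ?thesis by simp
qed

section \<open>Orbit numbers and inclusions of fields\<close>

context galois_normal
begin

lemma orb_fix:
 assumes g: "g \<in> M" and Z: "Z \<subseteq> ext F g" shows "orb g Z = card Z"
proof -
 have "st g z = {z}" if z: "z \<in> Z" for z
 proof -
  have "\<rho> z = z" if r: "emb M \<rho>" "\<rho> g = g" for \<rho>
   using emb_agree[OF r(1) emb_id[OF M_fld] g g r(2)] Z z by blast
  then show ?thesis using st_self unfolding st_def by blast
 qed
 then have "inj_on (st g) Z" by (intro inj_onI) auto
 then show ?thesis unfolding orb_def by (rule card_image)
qed

text \<open>As many orbits as elements means that the stabilizer of \<open>g\<close> fixes every
  conjugate of \<open>a\<close>; then \<open>fixed_mem\<close> applies. This is the converse of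
  \<open>orb_fix\<close>.\<close>

lemma orb_full:
 assumes g: "g \<in> M" and a: "sep a" "a \<in> M" and o: "orb g (Cj a) = card (Cj a)"
 shows "Cj a \<subseteq> ext F g"
proof
 note ac = M_carrier[OF a(2)]
 have inj: "inj_on (st g) (Cj a)" using o eq_card_imp_inj_on[OF Cj_finite[OF ac]] unfolding orb_def by blast
 fix z assume z: "z \<in> Cj a"
 have zM: "z \<in> M" using z Cj_M[OF a(2)] by blast
 show "z \<in> ext F g"
 proof (rule fixed_mem[OF sep_Cj[OF a(1) z] zM g])
  fix \<rho> assume r: "emb M \<rho>" "\<rho> g = g"
  show "\<rho> z = z" using emb_Cj[OF r(1) zM] Cj_eq[OF ac z] st_eq_iff[OF g zM emb_M[OF r(1) zM]] r inj_onD[OF inj, of z "\<rho> z"] z by force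
 qed
qed

text \<open>Conjugating \<open>a\<close> to \<open>x\<close> and then \<open>y\<close> to
  \<open>b\<close> takes \<open>ext F a\<close> to \<open>ext F x\<close>, which is
  \<open>ext F y\<close>, and on to \<open>ext F b\<close>.\<close>

lemma ext_iso:
 assumes a: "a \<in> M" and b: "b \<in> M" and x: "x \<in> Cj a" "y \<in> Cj b" and e: "ext F x = ext F y"
 shows "isomorphic_over F (ext F a) (ext F b)"
proof -
 note ac = M_carrier[OF a] and bc = M_carrier[OF b]
 have m: "x \<in> M" "y \<in> M" using x Cj_M[OF a] Cj_M[OF b] by auto
 note xc = M_carrier[OF m(1)] M_carrier[OF m(2)]
 obtain \<rho> where r: "emb M \<rho>" "\<rho> a = x" by (rule emb_trans[OF a x(1)])
 have "b \<in> Cj y" using Cj_eq[OF bc x(2)] Cj_self[OF bc] by simp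
 then obtain \<tau> where t: "emb M \<tau>" "\<tau> y = b" by (rule emb_trans[OF m(2)])
 define \<phi> where "\<phi> u = \<tau> (\<rho> u)" for u
 have p: "emb M \<phi>" unfolding \<phi>_def by (rule emb_comp[OF t(1) r(1)])
 have pa: "\<phi> a = \<tau> x" unfolding \<phi>_def r(2) ..
 have xm: "x \<in> ext F y" "y \<in> ext F x" using e ext_mem[OF fld_F xc(1)] ext_mem[OF fld_F xc(2)] by auto
 have 1: "\<tau> x \<in> ext F b" using emb_ext_img[OF t(1) m(2) xm(1)] t(2) by simp
 have tc: "\<tau> x \<in> CR" using embD(2)[OF t(1) m(1)] .
 have 2: "b \<in> ext F (\<tau> x)" using emb_ext_img[OF t(1) m(1) xm(2)] t(2) by simp
 have L: "ext F (\<tau> x) = ext F b"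
  using F_ext_sub[OF F_ext[OF bc] 1] F_ext_sub[OF F_ext[OF tc] 2] by blast
 let ?K = "ext F a" let ?L = "ext F b"
 have KM: "?K \<subseteq> M" by (rule ext_M[OF a])
 have img: "\<phi> ` ?K = ?L"
 proof
  show "\<phi> ` ?K \<subseteq> ?L" using emb_ext_img[OF p a] unfolding pa L by blast
  show "?L \<subseteq> \<phi> ` ?K"
  proof
   fix v assume "v \<in> ?L"
   then obtain f where f: "f \<in> carrier (F[X])" "v = eval f (\<tau> x)" using ext_elem[OF fld_F tc, of v] L by metis
   have s: "set f \<subseteq> F" using polyD[OF f(1)] .
   have "eval f a \<in> ?K" using fld_eval[OF F_ext[OF ac] _ ext_mem[OF fld_F ac]] s ext_incl[OF fld_F ac] by blast
   then show "v \<in> \<phi> ` ?K" using emb_eval[OF p a, of f] s fldD(3)[OF M_fld] map_F_id[OF p s] pa unfolding f(2) by force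
  qed
 qed
 have "\<phi> \<in> ring_hom (sub ?K) (sub ?L)"
  by (rule ring_hom_memI) (use img KM in \<open>auto simp: embD(3,4,5)[OF p] subset_iff\<close>)
 moreover have "bij_betw \<phi> ?K ?L" unfolding bij_betw_def using img inj_on_subset[OF embD(8)[OF p] KM] by blast
 ultimately show ?thesis using embD(6)[OF p] unfolding ring_iso_def isomorphic_over_def by auto
qed

end

lemma (in galois) sep_iff: "x \<in> CR ==> separable_over F x \<longleftrightarrow> sep x"
 unfolding separable_over_def sep_def using alg[OF fld_F] by blast

lemma (in galois_p) fin_sep_generator:
 assumes "finite_separable_extension F K" obtains a where "sep a" "K = ext F a"
proof -
 have K: "fld K" "finite_dimension F K" "!!x. x \<in> K ==> sep x"
 proof -
  show "fld K" "finite_dimension F K" using assms unfolding finite_separable_extension_def fld_def over_def by auto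
  then show "sep x" if "x \<in> K" for x
   using assms that sep_iff fldD(5) unfolding finite_separable_extension_def by blast
 qed
 obtain n where "dimension n F K" using K(2) by (rule finite_dimensionE')
 then obtain Us where Us: "set Us \<subseteq> CR" "Span F Us = K" using exists_base[OF F_sf] by blast
 have UK: "set Us \<subseteq> K" using Span_base_incl[OF F_sf Us(1)] Us(2) by simp
 obtain a where a: "Gd a" "set Us \<subseteq> ext F a" "\<forall>E. fld E --> set Us \<subseteq> E --> a \<in> E"
  using prim_elem[of "set Us"] K(3) UK by blast
 note E = F_ext[OF Gd_carrier[OF a(1)]]
 have aK: "a \<in> K" using a(3) K(1) UK by blast
 have "Span F Vs \<subseteq> ext F a" if "set Vs \<subseteq> ext F a" for Vs
  using that
 proof (induction Vs)
  case Nil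
  then show ?case by simp
 next
  case (Cons v Vs)
  have "u \<in> ext F a" if u: "u \<in> line_extension F v (Span F Vs)" for u
  proof -
   obtain s w where "s \<in> F" "w \<in> Span F Vs" "u = s ** v \<oplus> w" using u unfolding line_extension_mem_iff by blast
   moreover have "Span F Vs \<subseteq> ext F a" "v \<in> ext F a" using Cons by auto
   ultimately show ?thesis using fldD(6)[OF E fldD(8)[OF E]] fldD(3)[OF E] by blast
  qed
  then show ?case by auto
 qed
 then show ?thesis using a(2) Us(2) F_ext_sub[OF K(1) aK] that K(3)[OF aK] by blast
qed

lemma (in field) finite_subfield_pow:
 assumes E: "subfield E R" "finite E" and x: "x \<in> E" shows "x [^] card E = x"
proof (cases "x = \<zero>")
 case True
 have "card E > 0" using E by (auto simp: card_gt_0_iff)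
 then show ?thesis unfolding True by (cases "card E") auto
next
 case False
 interpret Q: field "sub E" using subfield_iff(2)[OF E(1)] .
 interpret G: group "Multiplicative_Group.mult_of (sub E)" by (rule Q.field_mult_group)
 have "x \<in> carrier (Multiplicative_Group.mult_of (sub E))" using x False by simp
 from G.pow_order_eq_1[OF this] have 1: "x [^] (card E - 1) = \<one>" using subringE(2)[OF subfieldE(1)[OF E(1)]] unfolding order_def by (simp add: nat_pow_def)
 have "card E = Suc (card E - 1)" using E by (auto simp: card_gt_0_iff)
 then have "x [^] card E = x [^] (card E - 1) ** x" by (metis nat_pow_Suc)
 then show ?thesis using x subfieldE(3)[OF E(1)] 1 by auto
qed

text \<open>The field \<open>ext k x\<close> is finite and so consists of all roots of
  \<open>X^Q - X\<close>, with \<open>Q\<close> its number of elements; a conjugate of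
  \<open>x\<close> is such a root. Hence constants are subject to the comparison of Galois
  cores.\<close>

lemma (in ff) constant_Cj:
 assumes x: "x \<in> CR" "(algebraic over k) x" shows "Cj x \<subseteq> ext k x"
proof
 let ?E = "ext k x"
 have E: "subfield ?E R" using simple_extension_is_subfield[OF k x(1)] x(2) by simp
 have "?E = (%f. eval f x) ` {f \<in> carrier (k[X]). length f \<le> degree (Irr k x)}"
  using Span_exp_base[OF k x] Span_eq_eval_img[OF k x(1)] by simp
 moreover have "{f \<in> carrier (k[X]). length f \<le> degree (Irr k x)} \<subseteq> {f. set f \<subseteq> k \<and> length f \<le> degree (Irr k x)}"
  using polyD by blast
 ultimately have fin: "finite ?E" using finite_imageI[OF finite_subset[OF _ finite_lists_length_le[OF fin_k]]] by simp
 have xE: "x \<in> ?E" using simple_extension_mem[OF subring_k x(1)] .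
 let ?Q = "card ?E"
 have "{\<zero>, \<one>} \<subseteq> ?E" using subringE(2,3)[OF subfieldE(1)[OF E]] by simp
 then have "card {\<zero>, \<one>} \<le> ?Q" using card_mono[OF fin] by blast
 then have "?Q = Suc (Suc (?Q - 2))" by simp
 then obtain m where Q: "?Q = Suc (Suc m)" by blast
 \<comment> \<open>The polynomial \<open>X^Q - X\<close>, as \<open>Q = m + 2\<close>.\<close>
 let ?f = "\<one> # replicate m \<zero> @ [\<ominus> \<one>, \<zero>]"
 have "set (replicate m \<zero>) \<subseteq> CR" by (induction m) auto
 then have f: "?f \<in> carrier (poly_ring R)" unfolding univ_poly_carrier[symmetric] polynomial_def by simp
 have ev: "eval ?f y = y [^] ?Q \<ominus> y" if y: "y \<in> CR" for y
 using eval_replicate[of "[\<ominus> \<one>, \<zero>]" y m] y unfolding Q by (auto simp: l_minus minus_eq)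
 have root: "y \<in># roots ?f \<longleftrightarrow> y \<in> CR \<and> y [^] ?Q = y" for y
 proof -
  have "is_root ?f y \<longleftrightarrow> y \<in> CR \<and> eval ?f y = \<zero>" unfolding is_root_def by simp
  also have "\<dots> \<longleftrightarrow> y \<in> CR \<and> y [^] ?Q = y"
   using ev[of y] minus_zero_iff[OF nat_pow_closed, of y y ?Q] by (metis (no_types))
  finally show ?thesis unfolding roots_mem_iff_is_root[OF f] .
 qed
 have sub: "?E \<subseteq> set_mset (roots ?f)" using root finite_subfield_pow[OF E fin] subfieldE(3)[OF E] by blast
 have "(\<Sum>y\<in>set_mset (roots ?f). 1) \<le> (\<Sum>y\<in>set_mset (roots ?f). count (roots ?f) y)"
  by (rule sum_mono) (simp add: Suc_le_eq)
 then have "card (set_mset (roots ?f)) \<le> size (roots ?f)" by (simp add: size_multiset_overloaded_eq)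
 also have "\<dots> \<le> ?Q" using size_roots_le_degree[OF f] Q by simp
 finally have eq: "?E = set_mset (roots ?f)" using card_seteq[OF _ sub] by simp
 fix y assume y: "y \<in> Cj x"
 obtain \<tau> where t: "emb (ext F x) \<tau>" "\<tau> x = y" using emb_Cj_exists[OF x(1) y] by blast
 have "y \<in># roots ?f" using emb_pow[OF t(1) ext_mem[OF fld_F x(1)], of ?Q] finite_subfield_pow[OF E fin xE] t(2) Cj_carrier[OF y] unfolding root by simp
 then show "y \<in> ?E" by (rule iffD2[OF eqset_imp_iff[OF eq]])
qed

text \<open>\<open>OE\<close> is all that is retained of arithmetic equivalence. The assumptions are
  symmetric in \<open>\<alpha>\<close> and \<open>\<beta>\<close>, so one inclusion in each
  statement is enough.\<close>

locale ffab = ffn R k T q F pc \<theta> for R (structure) and k T q F pc \<theta> +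
 fixes \<alpha> \<beta>
 assumes th_Gd: "Gd \<theta>" and al: "sep \<alpha>" "\<alpha> \<in> M" and be: "sep \<beta>" "\<beta> \<in> M"
  and OE: "!!e. e \<in> M ==> Gd e ==> orb e (Cj \<alpha>) = orb e (Cj \<beta>)"
begin

text \<open>For \<open>e = \<theta>\<close> the stabilizer acts trivially on \<open>M\<close>, so
  that \<open>orb\<close> counts elements.\<close>

lemma card_eq: "card (Cj \<alpha>) = card (Cj \<beta>)"
 using OE[OF th_M th_Gd] orb_fix[OF th_M, of "Cj \<alpha>"] orb_fix[OF th_M, of "Cj \<beta>"] Cj_M[OF al(2)] Cj_M[OF be(2)]
 unfolding M_def by simp

text \<open>The number of orbits is maximal exactly when all conjugates lie in
  \<open>ext F e\<close>, and by \<open>card_eq\<close> the two maxima agree.\<close>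

lemma closure_incl:
 assumes e: "e \<in> M" "Gd e" and X: "Cj \<alpha> \<subseteq> ext F e" shows "Cj \<beta> \<subseteq> ext F e"
 by (rule orb_full[OF e(1) be]) (use OE[OF e] orb_fix[OF e(1) X] card_eq in simp)

text \<open>\<open>OE\<close> is used with \<open>e = z\<close> and then reversed by
  \<open>orb_sym\<close>, so that the stabilizers of \<open>\<alpha>\<close> and
  \<open>\<beta>\<close> act on the conjugates of \<open>z\<close>.\<close>

lemma core_incl:
 assumes z: "sep z" and Z: "Cj z \<subseteq> ext F \<alpha>" shows "z \<in> ext F \<beta>"
proof -
 have zc: "z \<in> CR" using sep_carrier[OF z] .
 have zM: "z \<in> M" using Z ext_M[OF al(2)] Cj_self[OF zc] by blast
 have "orb \<beta> (Cj z) = orb \<alpha> (Cj z)" using OE[OF zM Gd_sep[OF z]] orb_sym[OF zM al(2)] orb_sym[OF zM be(2)] by simp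
 also have "\<dots> = card (Cj z)" by (rule orb_fix[OF al(2) Z])
 finally show ?thesis using orb_full[OF be(2) z zM] Cj_self[OF zc] by blast
qed

lemma galois_ext_closure:
 assumes G: "galois_extension F E" and K: "ext F \<alpha> \<subseteq> E" shows "ext F \<beta> \<subseteq> E"
proof -
 have E: "fld E" using G unfolding galois_extension_def fld_def by blast
 have X: "Cj \<alpha> \<subseteq> E" using K ext_mem[OF fld_F sep_carrier[OF al(1)]] G unfolding galois_extension_def Cj_def by blast
 obtain e where e: "Gd e" "Cj \<alpha> \<subseteq> ext F e" "\<forall>E. fld E --> Cj \<alpha> \<subseteq> E --> e \<in> E"
  using prim_elem[OF Cj_finite[OF sep_carrier[OF al(1)]] sep_Cj[OF al(1)]] by blast
 have "e \<in> M" "e \<in> E" using e(3) M_fld Cj_M[OF al(2)] E X by auto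
 then show ?thesis using closure_incl[OF _ e(1,2)] F_ext_sub[OF E] Cj_self[OF sep_carrier[OF be(1)]] by blast
qed

lemma galois_ext_core:
 assumes G: "galois_extension F E" and K: "E \<subseteq> ext F \<alpha>" shows "E \<subseteq> ext F \<beta>"
proof
 fix z assume z: "z \<in> E"
 have E: "fld E" using G unfolding galois_extension_def fld_def by blast
 have "sep z" using G z sep_iff[OF fldD(5)[OF E z]] unfolding galois_extension_def by blast
 then show "z \<in> ext F \<beta>" using G z core_incl K unfolding galois_extension_def Cj_def by blast
qed

lemma constants_incl:
 assumes s: "!!x. x \<in> ext F \<alpha> ==> sep x"
 shows "field_of_constants k (ext F \<alpha>) \<subseteq> field_of_constants k (ext F \<beta>)"
proof
 fix x assume "x \<in> field_of_constants k (ext F \<alpha>)"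
 then have x: "x \<in> ext F \<alpha>" "(algebraic over k) x" unfolding field_of_constants_def by auto
 have xc: "x \<in> CR" using sep_carrier[OF s[OF x(1)]] .
 note K = F_ext[OF sep_carrier[OF al(1)]]
 have "ext k x \<subseteq> ext F \<alpha>"
  by (rule ext_min[OF fldD(2)[OF K] _ x(1)]) (use k_A A_F fldD(3)[OF K] in blast)
 then show "x \<in> field_of_constants k (ext F \<beta>)" using core_incl[OF s[OF x(1)]] constant_Cj[OF xc x(2)] x(2) unfolding field_of_constants_def by blast
qed

end

section \<open>Pairs of permutation representations of small degree\<close>

definition fixer :: "('z => 'z) set => 'z set => ('z => 'z) set"
 where "fixer G W = {g \<in> G. \<forall>w\<in>W. g w = w}"

definition ob :: "('z => 'z) set => 'z set => 'z => 'z set"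
 where "ob G W z = (%g. g z) ` fixer G W"

text \<open>Orbit numbers are compared for pointwise stabilizers only, since these are the
  stabilizers of single field elements (\<open>fixing_generator\<close>). \<open>W\<close> may mix
  points of both sets, which is used in degree 5.\<close>

locale perm_pair =
 fixes G :: "('z => 'z) set" and U V :: "'z set"
 assumes fin: "finite U" "finite V" and perm: "!!g. g \<in> G ==> g permutes (U \<union> V)"
  and act: "!!g u. g \<in> G ==> u \<in> U ==> g u \<in> U" "!!g v. g \<in> G ==> v \<in> V ==> g v \<in> V"
  and G_id: "id \<in> G" and G_comp: "!!g h. g \<in> G ==> h \<in> G ==> g \<circ> h \<in> G"
  and G_inv: "!!g. g \<in> G ==> \<exists>h\<in>G. h \<circ> g = id \<and> g \<circ> h = id"
  and trans: "!!u u'. u \<in> U ==> u' \<in> U ==> \<exists>g\<in>G. g u = u'" "!!v v'. v \<in> V ==> v' \<in> V ==> \<exists>g\<in>G. g v = v'"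
  and faithful: "!!g. g \<in> G ==> (!!u. u \<in> U ==> g u = u) ==> g = id" "!!g. g \<in> G ==> (!!v. v \<in> V ==> g v = v) ==> g = id"
  and card_UV: "card U = card V" and U_ne: "U ~= {}"
  and orb_eq: "!!W. W \<subseteq> U \<union> V ==> card (ob G W ` U) = card (ob G W ` V)"
begin

lemma swap: "perm_pair G V U"
 by unfold_locales
  (use fin perm act G_id G_comp G_inv trans faithful card_UV U_ne orb_eq in \<open>auto simp: Un_commute card_gt_0_iff[symmetric]\<close>)

lemma finG: "finite G"
 by (rule finite_subset[OF _ finite_permutations[of "U \<union> V"]]) (use perm fin in auto)

abbreviation "S \<equiv> fixer G"
abbreviation "O1 \<equiv> ob G"

lemma SD: "g \<in> S W ==> g \<in> G" "g \<in> S W ==> w \<in> W ==> g w = w" unfolding fixer_def by auto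
lemma SI: "g \<in> G ==> (!!w. w \<in> W ==> g w = w) ==> g \<in> S W" unfolding fixer_def by auto
lemma S_fin: "finite (S W)" unfolding fixer_def using finG by simp
lemma S_id: "id \<in> S W" unfolding fixer_def using G_id by simp
lemma S_comp: "g \<in> S W ==> h \<in> S W ==> g \<circ> h \<in> S W" unfolding fixer_def using G_comp by auto
lemma S_inv: assumes "g \<in> S W" shows "\<exists>h\<in>S W. h \<circ> g = id \<and> g \<circ> h = id"
proof -
 obtain h where h: "h \<in> G" "h \<circ> g = id" "g \<circ> h = id" using G_inv[OF SD(1)[OF assms]] by blast
 have "h w = w" if "w \<in> W" for w using fun_cong[OF h(2), of w] SD(2)[OF assms that] by simp
 then show ?thesis using h SI by blast
qed
lemma S_mono: "W \<subseteq> W' ==> S W' \<subseteq> S W" unfolding fixer_def by auto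
lemma S_pos: "card (S W) > 0" using S_fin S_id by (auto simp: card_gt_0_iff)
lemma G_inj: "g \<in> G ==> g x = g y ==> x = y" using permutes_inj[OF perm] by (auto dest: injD)

lemma O_self: "z \<in> O1 W z" unfolding ob_def using S_id by (intro image_eqI[of _ _ id]) auto
lemma O_fin: "finite (O1 W z)" unfolding ob_def using S_fin by simp
lemma O_pos: "card (O1 W z) > 0" using O_fin O_self[of z W] by (fastforce simp: card_gt_0_iff)
lemma O_mono: "W \<subseteq> W' ==> O1 W' z \<subseteq> O1 W z" unfolding ob_def using S_mono by blast
lemma O_sub: "z \<in> U ==> O1 W z \<subseteq> U" "z \<in> V ==> O1 W z \<subseteq> V" unfolding ob_def using act SD(1) by auto
lemma O_act: "g \<in> S W ==> g z \<in> O1 W z" unfolding ob_def by blast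

lemma O_eq: assumes "y \<in> O1 W z" shows "O1 W y = O1 W z"
proof -
 obtain g where g: "g \<in> S W" "y = g z" using assms unfolding ob_def by blast
 obtain h where h: "h \<in> S W" "h \<circ> g = id" using S_inv[OF g(1)] by blast
 have "f y \<in> O1 W z" if "f \<in> S W" for f using O_act[OF S_comp[OF that g(1)], of z] g(2) by simp
 moreover have "f z \<in> O1 W y" if "f \<in> S W" for f using fun_cong[OF h(2), of z] g(2) O_act[OF S_comp[OF that h(1)], of y] by simp
 ultimately show ?thesis unfolding ob_def by blast
qed

lemma O_stable: assumes "g \<in> S W" "y \<in> O1 W z" shows "g y \<in> O1 W z"
 using O_act[OF assms(1), of y] O_eq[OF assms(2)] by simp

lemma orbit_stab: "card (S W) = card (O1 W z) * card (S (insert z W))"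
proof -
 have "card {g \<in> S W. g z = y} = card (S (insert z W))" if yO: "y \<in> O1 W z" for y
 proof -
  obtain g where g: "g \<in> S W" "y = g z" using yO unfolding ob_def by blast
  obtain h where h: "h \<in> S W" "h \<circ> g = id" "g \<circ> h = id" using S_inv[OF g(1)] by blast
  have hz: "h y = z" using fun_cong[OF h(2), of z] g(2) by simp
  have "(%f. g \<circ> f) ` S (insert z W) = {f \<in> S W. f z = y}"
  proof (intro equalityI subsetI)
   fix f assume "f \<in> (%f. g \<circ> f) ` S (insert z W)"
   then obtain f' where f': "f' \<in> S (insert z W)" "f = g \<circ> f'" by blast
   have "f' z = z" using SD(2)[OF f'(1) insertI1] .
   then show "f \<in> {f \<in> S W. f z = y}" using f'(1) S_mono[of W "insert z W"] S_comp[OF g(1)] g(2) f'(2) by auto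
  next
   fix f assume f: "f \<in> {f \<in> S W. f z = y}"
   have "h \<circ> f \<in> S (insert z W)"
    by (rule SI) (use SD[OF S_comp[OF h(1), of f]] f hz in auto)
   moreover have "f = g \<circ> (h \<circ> f)" using h(3) by (simp add: o_assoc)
   ultimately show "f \<in> (%f. g \<circ> f) ` S (insert z W)" by blast
  qed
  moreover have "inj_on (%f. g \<circ> f) (S (insert z W))"
   by (rule inj_onI) (metis h(2) o_assoc id_o)
  ultimately show ?thesis using card_image by metis
 qed
 moreover have "(\<Sum>g\<in>S W. 1) = (\<Sum>y\<in>(%g. g z) ` S W. \<Sum>g\<in>{g \<in> S W. g z = y}. (1::nat))"
  by (rule sum.image_gen[OF S_fin])
 ultimately show ?thesis unfolding ob_def[symmetric] by simp
qed

lemma sum_orbits: assumes "Z = U \<or> Z = V" shows "(\<Sum>B\<in>O1 W ` Z. card B) = card Z"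
proof -
 have fZ: "finite Z" using assms fin by blast
 have "O1 W z \<subseteq> Z" if "z \<in> Z" for z using assms that O_sub(1)[of z W] O_sub(2)[of z W] by auto
 then have "\<Union>(O1 W ` Z) = Z" using O_self[of _ W] by blast
 moreover have "card (\<Union>(O1 W ` Z)) = (\<Sum>B\<in>O1 W ` Z. card B)"
 proof (rule card_Union_disjoint)
  have "B = B'" if "B \<in> O1 W ` Z" "B' \<in> O1 W ` Z" "y \<in> B" "y \<in> B'" for B B' y using that O_eq by blast
  then show "pairwise disjnt (O1 W ` Z)" unfolding pairwise_def disjnt_def by blast
 qed (use O_fin in blast)
 ultimately show ?thesis by simp
qed

text \<open>Fix the points of \<open>Z\<close> one after another. Each step divides the group order
  by an orbit length below \<open>p\<close>, and at the end faithfulness leaves the identity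
  alone.\<close>

lemma not_dvd:
 assumes p: "normalization_semidom_class.prime (p::nat)" and Z: "Z = U \<or> Z = V" and s: "!!y. y \<in> Z ==> card (O1 W y) < p"
 shows "\<not> p dvd card (S W)"
proof -
 have "\<exists>m. \<not> p dvd m \<and> card (S W) = m * card (S (W \<union> B))" if "finite B" "B \<subseteq> Z" for B
  using that
 proof (induction B rule: finite_induct)
  case empty
  have "\<not> p dvd 1" using p by (simp add: prime_nat_iff)
  then show ?case by (intro exI[of _ 1]) simp
 next
  case (insert b B)
  then obtain m where m: "\<not> p dvd m" "card (S W) = m * card (S (W \<union> B))" by blast
  let ?c = "card (O1 (W \<union> B) b)"
  have "?c \<le> card (O1 W b)" by (rule card_mono[OF O_fin O_mono]) blast
  then have "?c < p" using s[of b] insert.prems by auto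
  then have "\<not> p dvd m * ?c" using O_pos[of "W \<union> B" b] m(1) p by (auto simp: prime_dvd_mult_iff)
  moreover have "card (S W) = m * ?c * card (S (W \<union> insert b B))" using m(2) orbit_stab[of "W \<union> B" b] by simp
  ultimately show ?case by blast
 qed
 then obtain m where m: "\<not> p dvd m" "card (S W) = m * card (S (W \<union> Z))" using Z fin by blast
 have "g = id" if "g \<in> S (W \<union> Z)" for g using faithful[OF SD(1)[OF that]] SD(2)[OF that] Z by blast
 then have "S (W \<union> Z) = {id}" using S_id by blast
 then show ?thesis using m by simp
qed

lemma card_stab: assumes "u \<in> U" "v \<in> V" shows "card (S {u}) = card (S {v})"
proof -
 have "O1 {} u = U" "O1 {} v = V" using trans(1)[OF assms(1)] trans(2)[OF assms(2)] act(1)[OF _ assms(1)] act(2)[OF _ assms(2)] unfolding fixer_def ob_def by auto+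
 then have "card U * card (S {u}) = card V * card (S {v})" using orbit_stab[of "{}" u] orbit_stab[of "{}" v] by simp
 moreover have "card U > 0" using U_ne fin(1) by (simp add: card_gt_0_iff)
 ultimately show ?thesis using card_UV by simp
qed

lemma stab_eq: assumes "u \<in> U" "v \<in> V" "S {u} \<subseteq> S {v} \<or> S {v} \<subseteq> S {u}" shows "S {u} = S {v}"
 using assms(3) card_stab[OF assms(1,2)] card_subset_eq[OF S_fin] by metis

lemma O_single: assumes "card (O1 W z) = 1" "g \<in> S W" shows "g z = z"
proof -
 obtain a where "O1 W z = {a}" using assms(1) by (auto simp: card_1_singleton_iff)
 then show ?thesis using O_self[of z W] O_act[OF assms(2), of z] by auto
qed

end

text \<open>The contrary of the claim, as a locale, so that every intermediate result is also
  available with \<open>U\<close> and \<open>V\<close> interchanged.\<close>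

locale perm_pair_bad = perm_pair +
 assumes bad: "!!u v. u \<in> U ==> v \<in> V ==> S {u} ~= S {v}"
begin

lemma swap_bad: "perm_pair_bad G V U"
proof -
 interpret s: perm_pair G V U by (rule swap)
 show ?thesis by unfold_locales (use bad in blast)
qed

lemma O_ge2: assumes "u \<in> U" "v \<in> V" shows "card (O1 {u} v) \<ge> 2"
proof (rule ccontr)
 assume "\<not> card (O1 {u} v) \<ge> 2"
 then have "S {u} \<subseteq> S {v}" using O_pos[of "{u}" v] O_single[of "{u}" v] SD(1) by (auto intro: SI)
 then show False using stab_eq[OF assms] bad[OF assms] by blast
qed

lemma O_u: "O1 {u} u = {u}" using SD(2)[of _ "{u}" u] O_self[of u "{u}"] unfolding ob_def by auto

text \<open>By \<open>O_ge2\<close> the stabilizer of \<open>u\<close> has at most half as many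
  orbits on \<open>V\<close> as there are points, hence also on \<open>U\<close>, where
  \<open>{u}\<close> is one of its orbits.\<close>

lemma rank:
 assumes u: "u \<in> U" shows "card (O1 {u} ` U) \<ge> 2" "2 * card (O1 {u} ` U) \<le> card U"
proof -
 have "2 * card (O1 {u} ` V) = (\<Sum>B\<in>O1 {u} ` V. 2)" by simp
 also have "\<dots> \<le> (\<Sum>B\<in>O1 {u} ` V. card B)" by (rule sum_mono) (use O_ge2[OF u] in auto)
 also have "\<dots> = card U" using sum_orbits[of V] card_UV by simp
 finally show 2: "2 * card (O1 {u} ` U) \<le> card U" using orb_eq[of "{u}"] u by simp
 show "card (O1 {u} ` U) \<ge> 2"
 proof (rule ccontr)
  assume "\<not> card (O1 {u} ` U) \<ge> 2"
  moreover have "card (O1 {u} ` U) > 0" using fin u by (auto simp: card_gt_0_iff)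
  ultimately have c: "card (O1 {u} ` U) = 1" by linarith
  then obtain B where "O1 {u} ` U = {B}" by (auto simp: card_1_singleton_iff)
  then have "O1 {u} ` U = {{u}}" using O_u u by (metis imageI singletonD)
  then have "card U = 1" using sum_orbits[of U "{u}"] by simp
  then show False using 2 c by simp
 qed
qed

text \<open>Here the stabilizer of \<open>u\<close> is transitive on the other points, so
  \<open>card U - 1\<close> divides its order. It has two orbits on \<open>V\<close>, both shorter
  than that, which by \<open>not_dvd\<close> rules out prime values. What remains is degree 5 with
  orbit lengths 2 and 3 on \<open>V\<close>; there one also fixes a point \<open>y\<close> of the
  short orbit.\<close>

lemma rank2:
 assumes u: "u \<in> U" and r: "card (O1 {u} ` U) = 2" and n: "card U \<le> 6" shows False
proof -
 let ?n = "card U"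
 have n4: "?n \<ge> 4" using rank(2)[OF u] r by simp
 have big: "card (O1 {u} w) = ?n - 1" if w: "w \<in> U" "w ~= u" for w
 proof -
  have ne: "O1 {u} w ~= {u}" using O_self[of w "{u}"] w by blast
  have "{{u}, O1 {u} w} \<subseteq> O1 {u} ` U" using O_u u w by blast
  then have "O1 {u} ` U = {{u}, O1 {u} w}" using r ne fin(1) card_subset_eq[of "O1 {u} ` U" "{{u}, O1 {u} w}"] by simp
  then show ?thesis using sum_orbits[of U "{u}"] ne by auto
 qed
 have dv: "?n - 1 dvd card (S {u})"
 proof -
  have "card (U - {u}) ~= 0" using u n4 by simp
  then have "U - {u} ~= {}" by force
  then obtain w where "w \<in> U" "w ~= u" by blast
  then show ?thesis using orbit_stab[of "{u}" w] big[of w] by simp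
 qed
 have sizes: "\<exists>b. O1 {u} ` V = {O1 {u} v, b} \<and> O1 {u} v ~= b \<and> card (O1 {u} v) + card b = ?n \<and> card b \<ge> 2" if v: "v \<in> V" for v
 proof -
  obtain a b where ab: "O1 {u} ` V = {a, b}" "a ~= b" using orb_eq[of "{u}"] u r by (auto simp: card_2_iff)
  have "O1 {u} v = a \<or> O1 {u} v = b" using ab(1) v by blast
  then have "\<exists>b. O1 {u} ` V = {O1 {u} v, b} \<and> O1 {u} v ~= b" using ab by (metis insert_commute)
  then obtain b where b: "O1 {u} ` V = {O1 {u} v, b}" "O1 {u} v ~= b" by blast
  have "b \<in> O1 {u} ` V" unfolding b(1) by simp
  then have "card b \<ge> 2" using O_ge2[OF u] by blast
  moreover have "card (O1 {u} v) + card b = ?n" using sum_orbits[of V "{u}"] b card_UV by simp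
  ultimately show ?thesis using b by blast
 qed
 have small: "card (O1 {u} v) < ?n - 1" if "v \<in> V" for v using sizes[OF that] by auto
 have "\<not> normalization_semidom_class.prime (?n - 1)" using not_dvd[of "?n - 1" V "{u}"] small dv by blast
 moreover have "?n = 4 \<or> ?n = 5 \<or> ?n = 6" using n n4 by linarith
 ultimately have n5: "?n = 5" by auto
 have pr3: "normalization_semidom_class.prime (3::nat)" by simp
 obtain y where y: "y \<in> V" "card (O1 {u} y) = 2"
 proof -
  obtain v where v: "v \<in> V" using card_UV U_ne fin by fastforce
  obtain b where b: "O1 {u} ` V = {O1 {u} v, b}" "card (O1 {u} v) + card b = 5" "card b \<ge> 2" using sizes[OF v] n5 by auto
  then have "card (O1 {u} v) = 2 \<or> card b = 2" using O_ge2[OF u v] by linarith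
  moreover have "b \<in> O1 {u} ` V" using b(1) by blast
  ultimately show ?thesis using that v by blast
 qed
 let ?W = "insert y {u}"
 obtain C where C: "O1 {u} ` V = {O1 {u} y, C}" "O1 {u} y ~= C" "card C = 3" using sizes[OF y(1)] y(2) n5 by auto
 have cH: "card (S {u}) = 2 * card (S ?W)" using orbit_stab[of "{u}" y] y(2) by simp
 obtain c where c: "c \<in> V" "C = O1 {u} c" using C(1) by blast
 have d3: "3 dvd card (S ?W)" using orbit_stab[of "{u}" c] C(3) c(2) cH prime_dvd_mult_iff[OF pr3, of 2 "card (S ?W)"] by simp
 then obtain v where v: "v \<in> V" "card (O1 ?W v) \<ge> 3" using not_dvd[OF pr3, of V ?W] by (meson not_le_imp_less)
 have sub: "O1 ?W z \<subseteq> O1 {u} z" for z by (rule O_mono) blast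
 have "O1 {u} v ~= O1 {u} y" using v(2) card_mono[OF O_fin sub, of v] y(2) by auto
 then have vC: "O1 {u} v = C" using C(1) v(1) by blast
 have OC: "O1 ?W v = C" using card_seteq[OF O_fin sub, of v] v(2) vC C(3) by simp
 have Wy: "O1 ?W y = {y}" using SD(2)[of _ ?W y] O_self[of y ?W] unfolding ob_def by auto
 obtain y' where y': "O1 {u} y = {y, y'}" "y' ~= y"
 proof -
  obtain a b where "O1 {u} y = {a, b}" "a ~= b" using y(2) by (auto simp: card_2_iff)
  then show ?thesis using O_self[of y "{u}"] that[of b] that[of a] by auto
 qed
 have y'V: "y' \<in> V" using O_sub(2)[OF y(1), of "{u}"] y'(1) by blast
 have Wy': "O1 ?W y' = {y'}"
 proof -
  have "y \<notin> O1 ?W y'"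
  proof
   assume "y \<in> O1 ?W y'"
   then have "O1 ?W y' = {y}" using O_eq[of y ?W y'] Wy by simp
   then show False using O_self[of y' ?W] y'(2) by simp
  qed
  then show ?thesis using O_eq[of y' "{u}" y] y'(1) sub[of y'] O_self[of y' ?W] by auto
 qed
 have "O1 ?W ` V = {{y}, {y'}, C}"
 proof (intro equalityI subsetI)
  fix B assume "B \<in> O1 ?W ` V"
  then obtain z where z: "z \<in> V" "B = O1 ?W z" by blast
  have "z = y \<or> z = y' \<or> z \<in> C" using C(1) y'(1) z(1) O_self[of z "{u}"] by blast
  then show "B \<in> {{y}, {y'}, C}" unfolding z(2) using Wy Wy' O_eq[of z ?W v] OC by auto
 next
  fix B assume "B \<in> {{y}, {y'}, C}"
  then show "B \<in> O1 ?W ` V" using Wy Wy' OC y(1) y'V v(1) by blast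
 qed
 moreover have "{y} ~= C" "{y'} ~= C" using C(3) by auto
 \<comment> \<open>Three orbits on \<open>U\<close> as well: \<open>{u}\<close> and two of length at
   least 2 among the four other points. So no length reaches 3, contrary to
   \<open>d3\<close>.\<close>
 ultimately have c3: "card (O1 ?W ` U) = 3" using y'(2) orb_eq[of ?W] u y(1) by simp
 have ge2: "card (O1 ?W w) \<ge> 2" if w: "w \<in> U" "w ~= u" for w
 proof -
  have "S (insert w ?W) \<subseteq> S (insert w {u})" by (rule S_mono) blast
  then have le: "card (S (insert w ?W)) \<le> card (S (insert w {u}))" by (rule card_mono[OF S_fin])
  have "2 * (card (O1 ?W w) * card (S (insert w ?W))) = 4 * card (S (insert w {u}))"
   using cH orbit_stab[of ?W w] orbit_stab[of "{u}" w] big[OF w] n5 by simp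
  then have "card (O1 ?W w) * card (S (insert w ?W)) \<ge> 2 * card (S (insert w ?W))" using le by linarith
  then show ?thesis using S_pos[of "insert w ?W"] by simp
 qed
 have Wu: "O1 ?W u = {u}" using sub[of u] O_u O_self[of u ?W] by blast
 have "card (O1 ?W w) < 3" if w: "w \<in> U" for w
 proof (cases "w = u")
  case False
  let ?A = "O1 ?W ` U - {{u}, O1 ?W w}"
  have ne: "O1 ?W w ~= {u}" using O_self[of w ?W] False by blast
  have m: "{{u}, O1 ?W w} \<subseteq> O1 ?W ` U" using Wu u w by blast
  have "card ?A = 1" using card_Diff_subset[OF _ m] c3 ne by simp
  then obtain B where B: "?A = {B}" by (auto simp: card_1_singleton_iff)
  have "B \<in> ?A" using B by blast
  then obtain w' where w': "w' \<in> U" "B = O1 ?W w'" "B ~= {u}" by blast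
  have fo: "finite (O1 ?W ` U)" using fin by simp
  have "(\<Sum>B\<in>O1 ?W ` U. card B) = (\<Sum>B\<in>?A. card B) + (\<Sum>B\<in>{{u}, O1 ?W w}. card B)"
   by (rule sum.subset_diff[OF m fo])
  then show ?thesis using w' Wu ge2[OF w'(1)] w'(2) ne unfolding sum_orbits[OF disjI1[OF refl]] n5 B by force
 qed (use Wu in simp)
 then show False using not_dvd[OF pr3, of U ?W] d3 by blast
qed

text \<open>The bound in \<open>rank\<close> is attained, so every orbit on \<open>V\<close> has
  length 2. Hence 3 does not divide the order of the stabilizer, and the five points of
  \<open>U\<close> other than \<open>u\<close> can split into two orbits only as 1 and 4.\<close>

lemma rank3:
 assumes u: "u \<in> U" and r: "card (O1 {u} ` U) = 3" and n: "card U = 6"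
 shows "!!v. v \<in> V ==> card (O1 {u} v) = 2"
  "\<exists>u2\<in>U. u2 ~= u \<and> S {u} \<subseteq> S {u2} \<and> (\<forall>w\<in>U. w ~= u --> w ~= u2 --> card (O1 {u} w) = 4)"
proof -
 have fV: "finite (O1 {u} ` V)" and fU: "finite (O1 {u} ` U)" using fin by auto
 show two: "card (O1 {u} v) = 2" if v: "v \<in> V" for v
 proof (rule ccontr)
  assume "card (O1 {u} v) ~= 2"
  then have "card (O1 {u} v) > 2" using O_ge2[OF u v] by linarith
  then have "(\<Sum>B\<in>O1 {u} ` V. 2) < (\<Sum>B\<in>O1 {u} ` V. card B)"
   by (intro sum_strict_mono_ex1[OF fV]) (use v O_ge2[OF u] in auto)
  then show False using orb_eq[of "{u}"] u r sum_orbits[of V "{u}"] card_UV n by simp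
 qed
 have pr3: "normalization_semidom_class.prime (3::nat)" by simp
 have m: "{u} \<in> O1 {u} ` U" using O_u u by blast
 have "card (O1 {u} ` U - {{u}}) = 2" using r m by simp
 then obtain B C where BC: "O1 {u} ` U - {{u}} = {B, C}" "B ~= C" by (auto simp: card_2_iff)
 have "insert {u} (O1 {u} ` U - {{u}}) = O1 {u} ` U" by (rule insert_Diff[OF m])
 then have e: "O1 {u} ` U = insert {u} {B, C}" unfolding BC(1) by (rule sym)
 have ne: "{u} \<notin> {B, C}" unfolding BC(1)[symmetric] by blast
 have n3: "card D ~= 3 \<and> card D > 0" if D: "D \<in> {B, C}" for D
 proof -
  obtain w where "D = O1 {u} w" using D e by blast
  then show ?thesis using not_dvd[OF pr3, of V "{u}"] two orbit_stab[of "{u}" w] O_pos[of "{u}" w] by auto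
 qed
 have "card B = 1 \<and> card C = 4 \<or> card B = 4 \<and> card C = 1" using sum_orbits[of U "{u}"] e ne BC(2) n n3[of B] n3[of C] by force
 then have "\<exists>B C. O1 {u} ` U = insert {u} {B, C} \<and> {u} \<notin> {B, C} \<and> card B = 1 \<and> card C = 4"
 proof
  assume "card B = 4 \<and> card C = 1"
  moreover have "insert {u} {B, C} = insert {u} {C, B}" by blast
  ultimately show ?thesis using e ne by (intro exI[of _ C] exI[of _ B]) simp
 next
  assume "card B = 1 \<and> card C = 4"
  then show ?thesis using e ne by (intro exI[of _ B] exI[of _ C]) simp
 qed
 then obtain B C where BC: "O1 {u} ` U = insert {u} {B, C}" "{u} \<notin> {B, C}" "card B = 1" "card C = 4"
  by (elim exE conjE) (rule that)
 obtain u2 where u2: "u2 \<in> U" "B = O1 {u} u2" using BC(1) by blast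
 have Bu: "B = {u2}" using BC(3) O_self[of u2 "{u}"] u2(2) by (auto simp: card_1_singleton_iff)
 have "u2 ~= u" using BC(2) Bu by blast
 moreover have "S {u} \<subseteq> S {u2}" using O_single[of "{u}" u2] u2(2) BC(3) SD(1) by (auto intro: SI)
 moreover have "card (O1 {u} w) = 4" if w: "w \<in> U" "w ~= u" "w ~= u2" for w
 proof -
  have "O1 {u} w \<in> insert {u} {B, C}" using BC(1) w(1) by blast
  then show ?thesis using O_self[of w "{u}"] w(2,3) Bu BC(4) by auto
 qed
 ultimately show "\<exists>u2\<in>U. u2 ~= u \<and> S {u} \<subseteq> S {u2} \<and> (\<forall>w\<in>U. w ~= u --> w ~= u2 --> card (O1 {u} w) = 4)"
  using u2(1) by blast
qed

lemma rank_eq3: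
 assumes u: "u \<in> U" and n: "card U \<le> 6" shows "card (O1 {u} ` U) = 3" "card U = 6"
proof -
 have "card (O1 {u} ` U) ~= 2" using rank2[OF u _ n] by blast
 then show "card (O1 {u} ` U) = 3" "card U = 6" using rank[OF u] n by auto
qed

text \<open>On each orbit of length 2 in \<open>V\<close> an element is trivial or the swap, so
  commutators act trivially on \<open>V\<close> and vanish by faithfulness.\<close>

lemma stab_comm:
 assumes u: "u \<in> U" and n: "card U \<le> 6" and g: "g \<in> S {u}" and h: "h \<in> S {u}" shows "g (h x) = h (g x)"
proof -
 obtain g' where g': "g' \<in> S {u}" "g' \<circ> g = id" using S_inv[OF g] by blast
 obtain h' where h': "h' \<in> S {u}" "h' \<circ> h = id" using S_inv[OF h] by blast
 have "g (h v) = h (g v)" if v: "v \<in> V" for v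
 proof -
  have "card (O1 {u} v) = 2" using rank3(1)[OF u rank_eq3[OF u n] v] .
  then obtain a b where ab: "O1 {u} v = {a, b}" "a ~= b" by (auto simp: card_2_iff)
  have c: "f a = a \<and> f b = b \<or> f a = b \<and> f b = a" if f: "f \<in> S {u}" for f
   using O_stable[OF f, of a v] O_stable[OF f, of b v] G_inj[OF SD(1)[OF f], of a b] ab by auto
  have "v = a \<or> v = b" using O_self[of v "{u}"] ab by simp
  then show ?thesis using c[OF g] c[OF h] by fastforce
 qed
 moreover have "g' (h' (g (h v))) = v" if "v \<in> V" "g (h v) = h (g v)" for v
  using that(2) fun_cong[OF g'(2), of v] fun_cong[OF h'(2), of "g v"] by simp
 ultimately have "(g' \<circ> (h' \<circ> (g \<circ> h))) v = v" if "v \<in> V" for v using that by simp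
 then have c: "g' \<circ> (h' \<circ> (g \<circ> h)) = id"
  using faithful(2) SD(1)[OF S_comp[OF g'(1) S_comp[OF h'(1) S_comp[OF g h]]]] by blast
 have "g' (h' (g (h x))) = g' (h' (h (g x)))"
  using fun_cong[OF c, of x] fun_cong[OF g'(2), of x] fun_cong[OF h'(2), of "g x"] by simp
 then show ?thesis using G_inj[OF SD(1)[OF g'(1)]] G_inj[OF SD(1)[OF h'(1)]] by blast
qed

text \<open>An abelian group acts regularly on an orbit, up to elements that are trivial there; an
  element trivial on the orbit of length 4 also fixes the remaining points \<open>u\<close> and
  \<open>u2\<close>. So the stabilizer of \<open>u\<close> has order 4.\<close>

lemma partner:
 assumes u: "u \<in> U" and n: "card U \<le> 6"
 obtains u2 where "card (S {u}) = 4" "\<forall>w\<in>U. w ~= u --> w ~= u2 --> S {w, u} = {id} \<and> card (O1 {u} w) = 4"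
proof -
 note r = rank_eq3[OF u n]
 obtain u2 where u2: "u2 \<in> U" "u2 ~= u" "S {u} \<subseteq> S {u2}" "!!w. w \<in> U ==> w ~= u ==> w ~= u2 ==> card (O1 {u} w) = 4"
  using rank3(2)[OF u r] by blast
 have 1: "S {w, u} = {id}" if w: "w \<in> U" "w ~= u" "w ~= u2" for w
 proof -
  have "w \<notin> O1 {u} x" if "x = u \<or> x = u2" for x
  proof -
   have "f x = x" if "f \<in> S {u}" for f using SD(2)[OF that, of u] SD(2)[of f "{u2}" u2] u2(3) that \<open>x = u \<or> x = u2\<close> by auto
   then show ?thesis using w(2,3) that unfolding ob_def by auto
  qed
  then have "{u, u2} \<inter> O1 {u} w = {}" using O_eq[of _ "{u}" w] O_self[of w "{u}"] by blast
  then have "card ({u, u2} \<union> O1 {u} w) = card U" using card_Un_disjoint[of "{u, u2}" "O1 {u} w"] O_fin u2(2) u2(4)[OF w] r(2) by simp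
  moreover have "{u, u2} \<union> O1 {u} w \<subseteq> U" using u u2(1) O_sub(1)[OF w(1)] by blast
  ultimately have Ue: "U = {u, u2} \<union> O1 {u} w" using card_subset_eq[OF fin(1)] by metis
  have "g = id" if g: "g \<in> S {w, u}" for g
  proof (rule faithful(1)[OF SD(1)[OF g]])
   have gu: "g \<in> S {u}" using g S_mono[of "{u}" "{w, u}"] by blast
   fix x assume "x \<in> U"
   then consider "x = u" | "x = u2" | f where "f \<in> S {u}" "x = f w" unfolding Ue ob_def by blast
   then show "g x = x"
   proof cases
    case 3
    then show ?thesis using stab_comm[OF u n gu 3(1), of w] SD(2)[OF g, of w] by simp
   qed (use SD(2)[OF gu] u2(3) gu SD(2)[of g "{u2}" u2] in auto)
  qed
  then show ?thesis using S_id by blast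
 qed
 have "\<not> U \<subseteq> {u, u2}" using card_mono[of "{u, u2}" U] r(2) u2(2) by auto
 then obtain w where w: "w \<in> U" "w ~= u" "w ~= u2" by blast
 have "card (S {u}) = 4" using orbit_stab[of "{u}" w] 1[OF w] u2(4)[OF w] by simp
 moreover have "\<forall>w\<in>U. w ~= u --> w ~= u2 --> S {w, u} = {id} \<and> card (O1 {u} w) = 4" using 1 u2(4) by simp
 ultimately show ?thesis by (rule that)
qed

text \<open>Three points of \<open>V\<close> whose stabilizers meet pairwise trivially give three
  subgroups of order 2 of the stabilizer of \<open>u\<close>, which they exhaust since it has order
  4. By \<open>block\<close> each of them sends \<open>w\<close> to \<open>w\<close> or
  \<open>w2\<close>, contrary to its orbit of length 4.\<close>

lemma impossible: assumes n: "card U \<le> 6" shows False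
proof -
 interpret s: perm_pair_bad G V U by (rule swap_bad)
 have nV: "card V \<le> 6" using n card_UV by simp
 have V6: "card V = 6" if "v \<in> V" for v using s.rank_eq3(2)[OF that nV] .
 obtain u where u: "u \<in> U" using U_ne by blast
 obtain u2 where u2: "card (S {u}) = 4" "\<forall>w\<in>U. w ~= u --> w ~= u2 --> S {w, u} = {id} \<and> card (O1 {u} w) = 4"
  by (rule partner[OF u n]) (rule that)
 have c2: "card (S {v, u'}) = 2" if v: "v \<in> V" and u': "u' \<in> U" for v u'
  using orbit_stab[of "{u'}" v] rank3(1)[OF u' rank_eq3[OF u' n] v] card_stab[OF u v] card_stab[OF u' v] u2(1) by simp
 text \<open>A nontrivial element fixing \<open>v\<close> and \<open>w\<close> commutes with the stabilizer of \<open>v\<close>, which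
  therefore acts on its two fixed points.\<close>
 have block: "\<exists>w2. \<forall>v\<in>V. \<forall>g\<in>S {v}. g w \<in> {w, w2}" if w: "w \<in> U" for w
 proof -
  obtain w2 where w2: "\<forall>x\<in>U. x ~= w --> x ~= w2 --> S {x, w} = {id} \<and> card (O1 {w} x) = 4" by (rule partner[OF w n]) (rule that)
  have "g w \<in> {w, w2}" if v: "v \<in> V" and g: "g \<in> S {v}" for v g
  proof (rule ccontr)
   assume x: "g w \<notin> {w, w2}"
   have "S {v, w} \<subseteq> {id}"
   proof
    fix h assume h: "h \<in> S {v, w}"
    have hv: "h \<in> S {v}" using h S_mono[of "{v}" "{v, w}"] by blast
    have "h (g w) = g w" using s.stab_comm[OF v nV hv g, of w] SD(2)[OF h, of w] by simp
    then have "h \<in> S {g w, w}" using SD[OF h] by (auto intro: SI)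
    then show "h \<in> {id}" using bspec[OF w2 act(1)[OF SD(1)[OF g] w]] x by simp
   qed
   then show False using card_mono[of "{id}" "S {v, w}"] c2[OF v w] by simp
  qed
  then show ?thesis by blast
 qed
 obtain v where v: "v \<in> V" using card_UV U_ne fin by fastforce
 obtain v2 where v2: "\<forall>w\<in>V. w ~= v --> w ~= v2 --> S {w, v} = {id} \<and> card (O1 {v} w) = 4" by (rule s.partner[OF v nV]) (rule that)
 have ex: "\<exists>x. x \<in> V \<and> x \<notin> D" if "finite D" "card D < 6" for D using card_mono[OF that(1), of V] V6[OF v] that(2) by auto
 have "card {v, v2} \<le> 2" by (simp add: card_insert_if)
 then obtain v' where v': "v' \<in> V" "v' \<notin> {v, v2}" using ex[of "{v, v2}"] by auto
 obtain v2' where v2': "\<forall>w\<in>V. w ~= v' --> w ~= v2' --> S {w, v'} = {id} \<and> card (O1 {v'} w) = 4" by (rule s.partner[OF v'(1) nV]) (rule that)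
 have "card {v, v2, v', v2'} \<le> 4" by (simp add: card_insert_if)
 then obtain v'' where v'': "v'' \<in> V" "v'' \<notin> {v, v2, v', v2'}" using ex[of "{v, v2, v', v2'}"] by auto
 have int: "S {x, u} \<inter> S {y, u} = {id}" if "S {x, y} = {id}" for x y
 proof -
  have "S {x, u} \<inter> S {y, u} \<subseteq> S {x, y}" unfolding fixer_def by blast
  then show ?thesis using that S_id by blast
 qed
 let ?X = "S {v, u}" let ?Y = "S {v', u}" let ?Z = "S {v'', u}"
 have i: "?Y \<inter> ?X = {id}" "?Z \<inter> ?X = {id}" "?Z \<inter> ?Y = {id}"
  using int bspec[OF v2 v'(1)] bspec[OF v2 v''(1)] bspec[OF v2' v''(1)] v'(2) v''(2) by auto
 have "card (?X \<union> ?Y) = 3" using card_Un_Int[OF S_fin S_fin, of "{v, u}" "{v', u}"] i(1) c2[OF v u] c2[OF v'(1) u] by (simp add: Int_commute)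
 moreover have "(?X \<union> ?Y) \<inter> ?Z = {id}" using i by blast
 ultimately have "card (?X \<union> ?Y \<union> ?Z) = 4" using card_Un_Int[of "?X \<union> ?Y" ?Z] S_fin c2[OF v''(1) u] by simp
 moreover have sub: "?X \<union> ?Y \<union> ?Z \<subseteq> S {u}" using S_mono[of "{u}"] by blast
 ultimately have eq: "S {u} = ?X \<union> ?Y \<union> ?Z" using card_subset_eq[OF S_fin sub] u2(1) by simp
 have "card {u, u2} \<le> 2" by (simp add: card_insert_if)
 then have "\<not> U \<subseteq> {u, u2}" using card_mono[of "{u, u2}" U] V6[OF v] card_UV by auto
 then obtain w where w: "w \<in> U" "w ~= u" "w ~= u2" by blast
 obtain w2 where w2: "!!v g. v \<in> V ==> g \<in> S {v} ==> g w \<in> {w, w2}" using block[OF w(1)] by blast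
 have "g w \<in> {w, w2}" if "g \<in> S {u}" for g
 proof -
  obtain y where "y \<in> V" "g \<in> S {y, u}" using \<open>g \<in> S {u}\<close> eq v v'(1) v''(1) by blast
  then show ?thesis using w2[of y g] S_mono[of "{y}" "{y, u}"] by blast
 qed
 then have "O1 {u} w \<subseteq> {w, w2}" unfolding ob_def by blast
 then have "card (O1 {u} w) \<le> card {w, w2}" by (rule card_mono[rotated]) simp
 also have "\<dots> \<le> 2" by (simp add: card_insert_if)
 finally have "card (O1 {u} w) \<le> 2" .
 then show False using bspec[OF u2(2) w(1)] w(2,3) by simp
qed

end

lemma (in perm_pair) common_stabilizer:
 assumes "card U \<le> 6" shows "\<exists>u\<in>U. \<exists>v\<in>V. S {u} = S {v}"
proof (rule ccontr)
 assume a: "\<not> ?thesis"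
 interpret perm_pair_bad G U V by unfold_locales (use a in blast)
 show False by (rule impossible[OF assms])
qed

section \<open>Conclusion\<close>

context galois_normal
begin

lemma emb_fixed_fld: assumes r: "emb M \<rho>" shows "fld {x \<in> M. \<rho> x = x}"
proof -
 have "\<rho> (inv x) = inv x" if x: "x \<in> M" "x ~= \<zero>" "\<rho> x = x" for x
 proof -
  have c: "x \<in> Units R" "inv x \<in> M" using x fldD(9)[OF M_fld] M_carrier field_Units by auto
  have "x ** \<rho> (inv x) = \<rho> (x ** inv x)" using embD(4)[OF r x(1) c(2)] x(3) by simp
  also have "\<dots> = \<one>" using c(1) embD(5)[OF r] by simp
  finally show ?thesis using comm_inv_char[of x "\<rho> (inv x)"] M_carrier[OF x(1)] embD(2)[OF r c(2)] by simp
 qed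
 moreover have "F \<subseteq> {x \<in> M. \<rho> x = x}" using fldD(3)[OF M_fld] embD(6)[OF r] by blast
 moreover have "subring {x \<in> M. \<rho> x = x} R"
  by (rule subringI) (use fldD[OF M_fld] subringE[OF fldD(2)[OF M_fld]] embD[OF r] in auto)
 ultimately show ?thesis unfolding fld_def using fldD(9)[OF M_fld] by (auto intro: subfieldI')
qed

text \<open>A primitive element turns the pointwise stabilizer of a finite set into the stabilizer
  of one element, the form in which \<open>OE\<close> is available.\<close>

lemma fixing_generator:
 assumes "finite W" "!!w. w \<in> W ==> sep w" "W \<subseteq> M"
 obtains e where "e \<in> M" "Gd e" "W \<subseteq> ext F e" "\<forall>\<rho>. emb M \<rho> --> (\<rho> e = e) = (\<forall>w\<in>W. \<rho> w = w)"
proof -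
 obtain e where e: "Gd e" "W \<subseteq> ext F e" "\<forall>E. fld E --> W \<subseteq> E --> e \<in> E"
  using prim_elem[OF assms(1,2)] by blast
 have eM: "e \<in> M" using e(3) M_fld assms(3) by blast
 have "(\<rho> e = e) = (\<forall>w\<in>W. \<rho> w = w)" if r: "emb M \<rho>" for \<rho>
 proof
  assume "\<rho> e = e"
  then show "\<forall>w\<in>W. \<rho> w = w" using emb_agree[OF r emb_id[OF M_fld] eM eM] e(2) by blast
 next
  assume "\<forall>w\<in>W. \<rho> w = w"
  then show "\<rho> e = e" using e(3) emb_fixed_fld[OF r] assms(3) by blast
 qed
 then show ?thesis using that[OF eM e(1,2)] by blast
qed

end

context ffab
begin

lemma swap: "ffab R k T q F pc \<theta> \<beta> \<alpha>"
 by unfold_locales (use th_Gd al be OE in auto)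

lemma UV_finite: "finite (Cj \<alpha>)" "finite (Cj \<beta>)" using Cj_finite sep_carrier al(1) be(1) by auto

text \<open>By \<open>closure_incl\<close> the conjugates of \<open>\<beta>\<close> lie in the field
  generated by those of \<open>\<alpha>\<close>. This yields faithfulness on each side.\<close>

lemma emb_faithful:
 assumes r: "emb M \<rho>" "!!u. u \<in> Cj \<alpha> ==> \<rho> u = u" and v: "v \<in> Cj \<beta>" shows "\<rho> v = v"
proof -
 obtain e where e: "e \<in> M" "Gd e" "Cj \<alpha> \<subseteq> ext F e" "\<forall>\<rho>. emb M \<rho> --> (\<rho> e = e) = (\<forall>w\<in>Cj \<alpha>. \<rho> w = w)"
  by (rule fixing_generator[OF UV_finite(1) sep_Cj[OF al(1)] Cj_M[OF al(2)]]) (assumption, rule that)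
 have "\<rho> e = e" using e(4) r by simp
 then show ?thesis using emb_agree[OF r(1) emb_id[OF M_fld] e(1,1)] closure_incl[OF e(1-3)] v by blast
qed

text \<open>Continuing by the identity turns embeddings, which are arbitrary outside
  \<open>M\<close>, into permutations that can be compared as functions.\<close>

definition res :: "('a => 'a) => 'a => 'a"
 where "res \<rho> x = (if x \<in> Cj \<alpha> \<union> Cj \<beta> then \<rho> x else x)"

lemma UV_M: "Cj \<alpha> \<union> Cj \<beta> \<subseteq> M" using Cj_M al(2) be(2) by blast

lemma emb_UV:
 assumes "emb M \<rho>" shows "u \<in> Cj \<alpha> ==> \<rho> u \<in> Cj \<alpha>" "v \<in> Cj \<beta> ==> \<rho> v \<in> Cj \<beta>"
proof -
 have "\<rho> x \<in> Cj a" if "x \<in> Cj a" "a \<in> M" for x a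
  using emb_Cj[OF assms, of x] Cj_eq[OF M_carrier[OF that(2)] that(1)] Cj_M[OF that(2)] that(1) by blast
 then show "u \<in> Cj \<alpha> ==> \<rho> u \<in> Cj \<alpha>" "v \<in> Cj \<beta> ==> \<rho> v \<in> Cj \<beta>" using al(2) be(2) by auto
qed

lemma res_comp: assumes "emb M \<rho>" "emb M \<tau>" shows "res \<rho> \<circ> res \<tau> = res (%x. \<rho> (\<tau> x))"
 using emb_UV[OF assms(2)] unfolding res_def by (auto simp: fun_eq_iff)

lemma res_inv: assumes "emb M \<rho>" obtains \<tau> where "emb M \<tau>" "res \<tau> \<circ> res \<rho> = id" "res \<rho> \<circ> res \<tau> = id"
proof -
 obtain \<tau> where t: "emb M \<tau>" "\<forall>x\<in>M. \<tau> (\<rho> x) = x" "\<forall>x\<in>M. \<rho> (\<tau> x) = x" using emb_inv[OF assms] by blast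
 then have "res (%x. \<tau> (\<rho> x)) = id" "res (%x. \<rho> (\<tau> x)) = id" using UV_M unfolding res_def fun_eq_iff by auto
 then show ?thesis using that t(1) res_comp[OF t(1) assms] res_comp[OF assms t(1)] by simp
qed

lemma perm_pair_res: "perm_pair (res ` {\<rho>. emb M \<rho>}) (Cj \<alpha>) (Cj \<beta>)" (is "perm_pair ?G _ _")
proof
 interpret s: ffab R k T q F pc \<theta> \<beta> \<alpha> by (rule swap)
 show "finite (Cj \<alpha>)" "finite (Cj \<beta>)" by (rule UV_finite)+
 show "card (Cj \<alpha>) = card (Cj \<beta>)" by (rule card_eq)
 show "Cj \<alpha> ~= {}" using Cj_self[OF sep_carrier[OF al(1)]] by blast
 show "id \<in> ?G" by (rule image_eqI[of _ _ "%x. x"]) (use emb_id[OF M_fld] in \<open>auto simp: res_def\<close>)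
 show "g \<circ> h \<in> ?G" if "g \<in> ?G" "h \<in> ?G" for g h using that res_comp emb_comp by auto
 show inv: "\<exists>h\<in>?G. h \<circ> g = id \<and> g \<circ> h = id" if "g \<in> ?G" for g using that res_inv by blast
 show "g permutes Cj \<alpha> \<union> Cj \<beta>" if g: "g \<in> ?G" for g
 proof -
  obtain h where "h \<circ> g = id" "g \<circ> h = id" using inv[OF g] by blast
  then have "bij g" by (rule o_bij)
  moreover have "g x = x" if "x \<notin> Cj \<alpha> \<union> Cj \<beta>" for x using g that unfolding res_def by auto
  ultimately show ?thesis unfolding permutes_def bij_iff by blast
 qed
 show "g u \<in> Cj \<alpha>" if "g \<in> ?G" "u \<in> Cj \<alpha>" for g u using that emb_UV(1) unfolding res_def by auto
 show "g v \<in> Cj \<beta>" if "g \<in> ?G" "v \<in> Cj \<beta>" for g v using that emb_UV(2) unfolding res_def by auto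
 have tr: "\<exists>g\<in>?G. g x = y" if a: "a \<in> M" "Cj a \<subseteq> Cj \<alpha> \<union> Cj \<beta>" and x: "x \<in> Cj a" "y \<in> Cj a" for a x y
 proof -
  have xM: "x \<in> M" using x(1) a UV_M by blast
  have "y \<in> Cj x" using x Cj_eq[OF M_carrier[OF a(1)] x(1)] by simp
  then obtain \<rho> where "emb M \<rho>" "\<rho> x = y" by (rule emb_trans[OF xM])
  then show ?thesis using x(1) a(2) by (intro bexI[of _ "res \<rho>"]) (auto simp: res_def)
 qed
 show "\<exists>g\<in>?G. g u = u'" if "u \<in> Cj \<alpha>" "u' \<in> Cj \<alpha>" for u u' using tr[OF al(2)] that by blast
 show "\<exists>g\<in>?G. g v = v'" if "v \<in> Cj \<beta>" "v' \<in> Cj \<beta>" for v v' using tr[OF be(2)] that by blast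
 show "g = id" if "g \<in> ?G" "!!u. u \<in> Cj \<alpha> ==> g u = u" for g
  using that emb_faithful unfolding res_def fun_eq_iff by auto
 show "g = id" if "g \<in> ?G" "!!v. v \<in> Cj \<beta> ==> g v = v" for g
  using that s.emb_faithful unfolding res_def fun_eq_iff by auto
 show "card (ob ?G W ` Cj \<alpha>) = card (ob ?G W ` Cj \<beta>)" if W: "W \<subseteq> Cj \<alpha> \<union> Cj \<beta>" for W
 proof -
  have fW: "finite W" using W UV_finite by (meson finite_UnI finite_subset)
  have sW: "sep w" if "w \<in> W" for w using that W sep_Cj al(1) be(1) by blast
  obtain e where e: "e \<in> M" "Gd e" "\<forall>\<rho>. emb M \<rho> --> (\<rho> e = e) = (\<forall>w\<in>W. \<rho> w = w)"
   by (rule fixing_generator[OF fW sW subset_trans[OF W UV_M]]) (assumption, rule that)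
  have "res \<rho> w = \<rho> w" if "w \<in> W" for \<rho> w using that W unfolding res_def by auto
  then have "(\<forall>w\<in>W. res \<rho> w = w) = (\<rho> e = e)" if "emb M \<rho>" for \<rho> using e(3) that by simp
  then have "fixer ?G W = res ` {\<rho>. emb M \<rho> \<and> \<rho> e = e}" unfolding fixer_def by blast
  then have "ob ?G W z = st e z" if "z \<in> Cj \<alpha> \<union> Cj \<beta>" for z
   using that unfolding ob_def st_def by (auto simp: res_def image_iff)
  then have "ob ?G W ` Cj \<alpha> = st e ` Cj \<alpha>" "ob ?G W ` Cj \<beta> = st e ` Cj \<beta>" by (auto intro!: image_cong)
  then show ?thesis using OE[OF e(1,2)] unfolding orb_def by simp
 qed
qed

text \<open>A common stabilizer of conjugates \<open>u\<close> and \<open>v\<close> puts each of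
  them in the field generated by the other, by \<open>fixed_mem\<close>; \<open>ext_iso\<close> does
  the rest. The degree enters as the number of conjugates.\<close>

lemma isomorphic_degree_6:
 assumes "dim F (ext F \<alpha>) \<le> 6" shows "isomorphic_over F (ext F \<alpha>) (ext F \<beta>)"
proof -
 note ac = sep_carrier[OF al(1)]
 interpret pp: perm_pair "res ` {\<rho>. emb M \<rho>}" "Cj \<alpha>" "Cj \<beta>" by (rule perm_pair_res)
 have "card (Cj \<alpha>) = dg \<alpha>" by (rule sep_card_Cj[OF al(1)])
 also have "\<dots> = dim F (ext F \<alpha>)" using simple_extension_dim[OF F_sf ac alg[OF fld_F ac]] by (simp add: over_def)
 finally obtain u v where uv: "u \<in> Cj \<alpha>" "v \<in> Cj \<beta>" "pp.S {u} = pp.S {v}" using pp.common_stabilizer assms by fastforce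
 have m: "u \<in> M" "v \<in> M" using uv(1,2) UV_M by auto
 have fx: "\<rho> x = x \<longleftrightarrow> res \<rho> \<in> pp.S {x}" if "emb M \<rho>" "x \<in> Cj \<alpha> \<union> Cj \<beta>" for \<rho> x
  using that unfolding fixer_def res_def by auto
 have "u \<in> ext F v"
  by (rule fixed_mem[OF sep_Cj[OF al(1) uv(1)] m(1,2)]) (use fx uv in auto)
 moreover have "v \<in> ext F u"
  by (rule fixed_mem[OF sep_Cj[OF be(1) uv(2)] m(2,1)]) (use fx uv in auto)
 ultimately have "ext F u = ext F v"
  using F_ext_sub[OF F_ext[OF M_carrier[OF m(1)]]] F_ext_sub[OF F_ext[OF M_carrier[OF m(2)]]] by blast
 then show ?thesis by (rule ext_iso[OF al(2) be(2) uv(1,2)])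
qed

end

text \<open>\<open>\<theta>\<close> is a generator of the field of all conjugates of
  \<open>a\<close> and \<open>b\<close>, scaled by \<open>d\<close> to become integral, which
  changes neither the field nor its normality.\<close>

lemma (in ff) equivalent_pair:
 assumes a: "sep a" and b: "sep b" and eq: "arithmetically_equivalent A (ext F a) (ext F b)"
 obtains \<theta> where "ffab R k T q F pc \<theta> a b"
proof -
 note ac = sep_carrier[OF a] and bc = sep_carrier[OF b]
 have "sep w" if "w \<in> Cj a \<union> Cj b" for w using that sep_Cj a b by blast
 moreover have "Cj w \<subseteq> Cj a \<union> Cj b" if "w \<in> Cj a \<union> Cj b" for w using that Cj_eq[OF ac] Cj_eq[OF bc] by blast
 ultimately obtain t where t: "Gd t" "Cj a \<union> Cj b \<subseteq> ext F t" "Cj t \<subseteq> ext F t"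
  using normal_gen[of "Cj a \<union> Cj b"] Cj_finite[OF ac] Cj_finite[OF bc] by (metis finite_UnI)
 note tc = Gd_carrier[OF t(1)]
 obtain d where d: "d \<in> A" "d ~= \<zero>" "\<forall>a\<in>A. a ~= \<zero> --> pbs (a ** d ** t)" using pbs_exists[OF tc] by blast
 have dF: "d \<in> F" using d(1) A_F by blast
 have dc: "d \<in> CR" using dF F_carrier by blast
 have "\<one> \<in> A" using subringE(3)[OF A_subring] .
 then have p: "pbs (d ** t)" using bspec[OF d(3), of \<one>] dc by simp
 have x: "ext F (d ** t) = ext F t" by (rule ext_scale_eq[OF dF d(2) tc])
 have "Cj (d ** t) \<subseteq> ext F (d ** t)"
  unfolding x Cj_scale[OF dF d(2) tc] using t(3) fldD(8)[OF F_ext[OF tc]] fldD(3)[OF F_ext[OF tc]] dF by blast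
 then interpret n: ffn R k T q F pc "d ** t" by unfold_locales (use dc tc p in auto)
 have m: "a \<in> n.M" "b \<in> n.M" using t(2) Cj_self[OF ac] Cj_self[OF bc] unfolding n.M_def x by auto
 have "ffab R k T q F pc (d ** t) a b"
  by unfold_locales (use Gd_scale[OF dF d(2) t(1)] a b m n.orb_equal[OF a m(1) b m(2) _ _ eq] in auto)
 then show ?thesis by (rule that)
qed

text \<open>The order of the additive group of \<open>k\<close> kills 1. It is a power of
  \<open>p\<close>, so a power of the field element \<open>[p] \<cdot> \<one>\<close> vanishes, and
  hence the element itself.\<close>

lemma (in field) prime_char:
 assumes k: "subfield k R" "finite k" and pp: "primepow (card k)"
 obtains p :: nat where "normalization_semidom_class.prime p" "[p] \<cdot> \<one> = \<zero>"
proof -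
 obtain p n where p: "normalization_semidom_class.prime p" "card k = p ^ n" using pp unfolding primepow_def by blast
 interpret k: field "sub k" using subfield_iff(2)[OF k(1)] .
 have pw: "[m] \<cdot>\<^bsub>sub k\<^esub> \<one> = [m] \<cdot> \<one>" for m :: nat by (induction m) (auto simp: add_pow_def)
 have "[card k] \<cdot> \<one> = \<zero>"
  using k.add.pow_order_eq_1[of \<one>] subringE(3)[OF subfieldE(1)[OF k(1)]] pw[of "card k"] by (simp add: order_def add_pow_def)
 moreover have "add_pow R (p ^ n) \<one> = add_pow R p \<one> [^] n" for n
 proof (induction n)
  case (Suc n)
  then show ?case using add.nat_pow_pow[OF one_closed, of p "p ^ n"] by (simp add: add_pow_rdistr mult.commute)
 qed simp
 moreover have "add_pow R p \<one> [^] m = \<zero> ==> add_pow R p \<one> = \<zero>" for m :: nat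
  by (induction m) (auto simp: integral_iff)
 ultimately show ?thesis using that[OF p(1)] p(2) by simp
qed

theorem proposition1:
  fixes \<Omega> :: "('a, 'b) ring_scheme" (structure)
    and Fq F A K L :: "'a set" and T :: 'a and q :: nat
  assumes "primepow q"
    and "field \<Omega>"
    and "subfield Fq \<Omega>" and "finite Fq" and "card Fq = q"
    and "T \<in> carrier \<Omega>" and "(ring.transcendental \<Omega> over Fq) T"
    and A: "A = ring.simple_extension \<Omega> Fq T"
    and F: "F = generate_field \<Omega> (insert T Fq)"
    and "algebraic_closure \<Omega> F"
    and "ring.finite_separable_extension \<Omega> F K"
    and "ring.finite_separable_extension \<Omega> F L"
    and "ring.arithmetically_equivalent \<Omega> A K L"
  shows "(ring.galois_closure \<Omega> F K = ring.galois_closure \<Omega> F L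
        \<and> ring.galois_core \<Omega> F K = ring.galois_core \<Omega> F L
        \<and> ring.field_of_constants \<Omega> Fq K = ring.field_of_constants \<Omega> Fq L)
    \<and> (ring.galois_extension \<Omega> F K \<longrightarrow> K = L)
    \<and> ((ring.dim \<Omega> over F) K \<le> 6 \<longrightarrow> ring.isomorphic_over \<Omega> F K L)"
proof -
 interpret \<Omega>: field \<Omega> by fact
 obtain pc :: nat where pc: "normalization_semidom_class.prime pc" "[pc] \<cdot> \<one> = \<zero>"
  by (rule \<Omega>.prime_char[OF assms(3,4), unfolded assms(5), OF assms(1)]) (rule that)
 interpret algebraic_closure \<Omega> F by fact
 have fq: "fq_poly \<Omega> Fq T q" by (rule fq_poly.intro[OF assms(2) fq_poly_axioms.intro]) (fact assms)+
 have g: "galois \<Omega> F" by (rule galois.intro) fact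
 have "ff \<Omega> Fq T q F pc" by (rule ff.intro[OF fq g ff_axioms.intro]) (fact F pc)+
 have AA: "A = \<Omega>.ext Fq T" by fact
 interpret ff \<Omega> Fq T q F pc by fact
 obtain a where a: "sep a" "K = \<Omega>.ext F a" by (rule fin_sep_generator[OF assms(11)]) (rule that)
 obtain b where b: "sep b" "L = \<Omega>.ext F b" by (rule fin_sep_generator[OF assms(12)]) (rule that)
 obtain \<theta> where "ffab \<Omega> Fq T q F pc \<theta> a b"
  by (rule equivalent_pair[OF a(1) b(1) assms(13)[unfolded a(2) b(2) AA, folded A_def]]) (rule that)
 then interpret ffab \<Omega> Fq T q F pc \<theta> a b .
 interpret s: ffab \<Omega> Fq T q F pc \<theta> b a by (rule swap)
 have K: "sep x" if "x \<in> K" for x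
  using that assms(11) sep_iff \<Omega>.subring_props(1) unfolding \<Omega>.finite_separable_extension_def by (metis subfieldE(3) subsetD)
 have L: "sep x" if "x \<in> L" for x
  using that assms(12) sep_iff unfolding \<Omega>.finite_separable_extension_def by (metis subfieldE(3) subsetD)
 \<comment> \<open>Together with \<open>co\<close> this makes \<open>LEAST\<close> and
   \<open>GREATEST\<close> range over the same predicates for \<open>K\<close> and for
   \<open>L\<close>.\<close>
 have cl: "\<Omega>.galois_extension F E \<and> K \<subseteq> E \<longleftrightarrow> \<Omega>.galois_extension F E \<and> L \<subseteq> E" for E
  unfolding a(2) b(2) using galois_ext_closure s.galois_ext_closure by blast
 have co: "\<Omega>.galois_extension F E \<and> E \<subseteq> K \<longleftrightarrow> \<Omega>.galois_extension F E \<and> E \<subseteq> L" for E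
  unfolding a(2) b(2) using galois_ext_core s.galois_ext_core by blast
 have "\<Omega>.field_of_constants Fq K = \<Omega>.field_of_constants Fq L"
  using constants_incl s.constants_incl K L unfolding a(2) b(2) by blast
 \<comment> \<open>Taking \<open>E = K\<close> gives \<open>L \<subseteq> K\<close> from the first
   equivalence and \<open>K \<subseteq> L\<close> from the second.\<close>
 moreover have "\<Omega>.galois_extension F K --> K = L" using cl[of K] co[of K] by blast
 moreover have "(\<Omega>.dim over F) K \<le> 6 --> \<Omega>.isomorphic_over F K L"
  unfolding a(2) b(2) over_def using isomorphic_degree_6 by blast
 ultimately show ?thesis unfolding \<Omega>.galois_closure_def \<Omega>.galois_core_def cl co by blast
qed
end
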